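(* Let $\eta$ be a Poisson process on $\mathbb X$ with locally finite (not necessarily diffuse) intensity measure $\lambda$. Let $Z=Z^Y$ be a randomized stopping set for which there exists an increasing sequence of randomized stopping sets $Z_j=Z_j^Y$, $j\ge1$ (with the same randomization $Y$), such that $\mathbb P(\eta(Z_j(\eta))<\infty)=1$ for every $j\ge 1$ and $Z=\bigcup_{j\ge1}Z_j$. Let $k\in\mathbb N$ and let $u\in L^2(\lambda^k)$ be $\lambda^k$-a.e. symmetric. Then $$\mathbb E\big[\mathbb E[I_k(u)\mid\eta_Z]^2\big]\le k!\int u(x_1,\dots,x_k)^2\,\mathbb P\big(\{x_1,\dots,x_k\}\cap Z(\eta)\ne\emptyset\big)\,\lambda^k(d(x_1,\dots,x_k)),$$ where $\eta_Z:=\eta_{Z(\eta)}$ is the restriction of $\eta$ to $Z(\eta)$ and $I_k(u)$ is the multiple Wiener–Itô integral of order $k$ of $u$ with respect to the compensated process $\eta-\lambda$.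
   Context: $(\mathbb X,\mathcal X)$ is a Borel space (measurably isomorphic to a Borel subset of $[0,1]$). Fix an increasing sequence $B_n\in\mathcal X$ with $B_n\uparrow\mathbb X$, and let $\mathcal X_0:=\{B\cap B_n:B\in\mathcal X,n\in\mathbb N\}$. A measure on $\mathbb X$ is locally finite if it is finite on $\mathcal X_0$. $\mathbf N$ is the set of all measures on $\mathbb X$ that are $\mathbb N_0$-valued on $\mathcal X_0$, with the $\sigma$-field generated by $\mu\mapsto\mu(B)$, $B\in\mathcal X$. For a measure $\nu$ and $B\in\mathcal X$, $\nu_B:=\nu(\cdot\cap B)$. A Poisson process with intensity $\lambda$ is a random element $\eta$ of $\mathbf N$ with $\eta(B)$ Poisson of mean $\lambda(B)$ and independent values on disjoint sets. Stopping set: a map $Z:\mathbf N\to\mathcal X$ such that $(x,\mu)\mapsto\mathbf 1\{x\in Z(\mu)\}$ is measurable and $Z(\mu)=Z(\mu_{Z(\mu)}+\psi_{Z(\mu)^c})$ for all $\mu,\psi\in\mathbf N$. Randomized stopping set: $Z^Y$, where $Y$ is a random element of a measurable space $\mathbb Y$ independent of $\eta$, $Z^y$ is a stopping set for $\mathbb P(Y\in\cdot)$-a.e. $y$, and $(\mu,x,y)\mapsto\mathbf 1\{x\in Z^y(\mu)\}$ is jointly measurable; $Z(\eta)$ means $Z^Y(\eta)$. Multiple integrals satisfy $\mathbb E[I_k(u)I_m(v)]=\mathbf 1\{k=m\}k!\langle u,v\rangle_{L^2(\lambda^k)}$ for symmetric kernels $u\in L^2(\lambda^k)$, $v\in L^2(\lambda^m)$;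 for symmetric $u\in L^1(\lambda^k)\cap L^2(\lambda^k)$, $I_k(u)=\sum_{i=0}^k(-1)^{k-i}\binom ki(\eta^{(i)}\otimes\lambda^{k-i})(u)$ a.s., with $\eta^{(i)}$ the $i$-th factorial measure of $\eta$. *)

theory Defs
  imports "HOL-Probability.Probability" "HOL-Combinatorics.Permutations"
begin

section \<open>Spaces of counting measures\<close>

definition borel_isomorphic_space :: "'a measure \<Rightarrow> bool" where
  "borel_isomorphic_space X \<longleftrightarrow>
    (\<exists>(A :: real set) f g. A \<in> sets borel \<and> A \<subseteq> {0..1} \<and>
      f \<in> X \<rightarrow>\<^sub>M restrict_space borel A \<and> g \<in> restrict_space borel A \<rightarrow>\<^sub>M X \<and>
      (\<forall>x\<in>space X. g (f x) = x) \<and> (\<forall>t\<in>A. f (g t) = t))"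

definition localizing_sequence :: "'a measure \<Rightarrow> (nat \<Rightarrow> 'a set) \<Rightarrow> bool" where
  "localizing_sequence X Bn \<longleftrightarrow> range Bn \<subseteq> sets X \<and> incseq Bn \<and> (\<Union>n. Bn n) = space X"

definition local_sets :: "'a measure \<Rightarrow> (nat \<Rightarrow> 'a set) \<Rightarrow> 'a set set" where
  "local_sets X Bn = {B \<inter> Bn n |B n. B \<in> sets X}"

definition locally_finite_measure :: "'a measure \<Rightarrow> (nat \<Rightarrow> 'a set) \<Rightarrow> 'a measure \<Rightarrow> bool" where
  "locally_finite_measure X Bn L \<longleftrightarrow>
    sets L = sets X \<and> (\<forall>C\<in>local_sets X Bn. emeasure L C < \<infinity>)"

definition counting_measures :: "'a measure \<Rightarrow> (nat \<Rightarrow> 'a set) \<Rightarrow> 'a measure set" where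
  "counting_measures X Bn =
    {\<mu>. sets \<mu> = sets X \<and> (\<forall>C\<in>local_sets X Bn. \<exists>n::nat. emeasure \<mu> C = of_nat n)}"

definition counting_algebra :: "'a measure \<Rightarrow> (nat \<Rightarrow> 'a set) \<Rightarrow> 'a measure measure" where
  "counting_algebra X Bn =
    (SUP B \<in> sets X. vimage_algebra (counting_measures X Bn) (\<lambda>\<mu>. emeasure \<mu> B) borel)"

text \<open>For measurable \<open>B\<close> this is the measure \<open>A \<mapsto> \<mu> (A \<inter> B)\<close> on the whole space (see
  \<open>emeasure_restricted\<close>), unlike \<open>restrict_space\<close>, which changes the underlying space.\<close>

definition restr_measure :: "'a measure \<Rightarrow> 'a set \<Rightarrow> 'a measure" where
  "restr_measure \<mu> B = density \<mu> (indicator B)"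

definition add_measure :: "'a measure \<Rightarrow> 'a measure \<Rightarrow> 'a measure" where
  "add_measure \<mu> \<psi> = measure_of (space \<mu>) (sets \<mu>) (\<lambda>A. emeasure \<mu> A + emeasure \<psi> A)"


section \<open>Poisson processes\<close>

text \<open>The Poisson distribution with mean \<open>\<infinity>\<close> is the point mass at \<open>\<infinity>\<close>. The library's
  \<open>poisson_pmf\<close> is not used because it is only specified for a strictly positive rate.\<close>

definition poisson_distributed :: "'w measure \<Rightarrow> ('w \<Rightarrow> ennreal) \<Rightarrow> ennreal \<Rightarrow> bool" where
  "poisson_distributed P W m \<longleftrightarrow>
    W \<in> borel_measurable P \<and>
    (if m = \<infinity> then AE \<omega> in P. W \<omega> = \<infinity>
     else \<forall>n::nat. measure P {\<omega> \<in> space P. W \<omega> = of_nat n}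
            = exp (- enn2real m) * enn2real m ^ n / fact n)"

definition poisson_process ::
  "'a measure \<Rightarrow> (nat \<Rightarrow> 'a set) \<Rightarrow> 'a measure \<Rightarrow> 'w measure \<Rightarrow> ('w \<Rightarrow> 'a measure) \<Rightarrow> bool" where
  "poisson_process X Bn L P \<eta> \<longleftrightarrow>
    \<eta> \<in> P \<rightarrow>\<^sub>M counting_algebra X Bn \<and>
    (\<forall>B\<in>sets X. poisson_distributed P (\<lambda>\<omega>. emeasure (\<eta> \<omega>) B) (emeasure L B)) \<and>
    (\<forall>(m::nat) A. (\<forall>i<m. A i \<in> sets X) \<longrightarrow> disjoint_family_on A {..<m} \<longrightarrow>
      prob_space.indep_vars P (\<lambda>_. borel) (\<lambda>i \<omega>. emeasure (\<eta> \<omega>) (A i)) {..<m})"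


section \<open>Stopping sets\<close>

text \<open>Independence of random elements in possibly different spaces; \<open>prob_space.indep_var\<close> forces
  both to have the same type.\<close>

definition independent_elements ::
  "'w measure \<Rightarrow> 'b measure \<Rightarrow> ('w \<Rightarrow> 'b) \<Rightarrow> 'c measure \<Rightarrow> ('w \<Rightarrow> 'c) \<Rightarrow> bool" where
  "independent_elements P M V N W \<longleftrightarrow>
    V \<in> P \<rightarrow>\<^sub>M M \<and> W \<in> P \<rightarrow>\<^sub>M N \<and>
    prob_space.indep_set P (sets (vimage_algebra (space P) V M)) (sets (vimage_algebra (space P) W N))"

definition stopping_set ::
  "'a measure \<Rightarrow> (nat \<Rightarrow> 'a set) \<Rightarrow> ('a measure \<Rightarrow> 'a set) \<Rightarrow> bool" where
  "stopping_set X Bn Z \<longleftrightarrow>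
    (\<forall>\<mu>\<in>counting_measures X Bn. Z \<mu> \<in> sets X) \<and>
    (\<lambda>(x, \<mu>). indicator (Z \<mu>) x :: real) \<in> borel_measurable (X \<Otimes>\<^sub>M counting_algebra X Bn) \<and>
    (\<forall>\<mu>\<in>counting_measures X Bn. \<forall>\<psi>\<in>counting_measures X Bn.
      Z \<mu> = Z (add_measure (restr_measure \<mu> (Z \<mu>)) (restr_measure \<psi> (space X - Z \<mu>))))"

text \<open>Here \<open>Q\<close> is the law of the randomization variable, a measure on its state space.\<close>

definition randomized_stopping_set ::
  "'a measure \<Rightarrow> (nat \<Rightarrow> 'a set) \<Rightarrow> 'y measure \<Rightarrow> ('y \<Rightarrow> 'a measure \<Rightarrow> 'a set) \<Rightarrow> bool" where
  "randomized_stopping_set X Bn Q Z \<longleftrightarrow>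
    (\<forall>y\<in>space Q. \<forall>\<mu>\<in>counting_measures X Bn. Z y \<mu> \<in> sets X) \<and>
    (AE y in Q. stopping_set X Bn (Z y)) \<and>
    (\<lambda>(\<mu>, x, y). indicator (Z y \<mu>) x :: real)
      \<in> borel_measurable (counting_algebra X Bn \<Otimes>\<^sub>M X \<Otimes>\<^sub>M Q)"


section \<open>Multiple Wiener--Ito integrals\<close>

text \<open>Points of the \<open>k\<close>-fold product space are functions on \<open>{..<k}\<close>.\<close>

abbreviation power_measure :: "'a measure \<Rightarrow> nat \<Rightarrow> (nat \<Rightarrow> 'a) measure" where
  "power_measure L k \<equiv> PiM {..<k} (\<lambda>_. L)"

text \<open>On a Borel space every \<open>\<mu>\<close> in \<open>counting_measures X Bn\<close> is the sum of the point masses at \<open>x\<close>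
  over all labelled points \<open>(x, n)\<close> with \<open>n < \<mu> {x}\<close>, so that a point of multiplicity \<open>r\<close> is
  listed \<open>r\<close> times. The factorial measure of order \<open>m\<close> is the sum of the point masses at
  \<open>(x\<^sub>1, \<dots>, x\<^sub>m)\<close> over all \<open>m\<close>-tuples of pairwise distinct labelled points.\<close>

definition labelled_points :: "'a measure \<Rightarrow> ('a \<times> nat) set" where
  "labelled_points \<mu> = {(x, n). x \<in> space \<mu> \<and> of_nat n < emeasure \<mu> {x}}"

definition factorial_measure :: "nat \<Rightarrow> 'a measure \<Rightarrow> (nat \<Rightarrow> 'a) measure" where
  "factorial_measure m \<mu> =
    distr (count_space {p \<in> {..<m} \<rightarrow>\<^sub>E labelled_points \<mu>. inj_on p {..<m}})
      (power_measure \<mu> m) (\<lambda>p. \<lambda>i\<in>{..<m}. fst (p i))"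

definition symmetric_L2 :: "'a measure \<Rightarrow> nat \<Rightarrow> ((nat \<Rightarrow> 'a) \<Rightarrow> real) \<Rightarrow> bool" where
  "symmetric_L2 L k u \<longleftrightarrow>
    u \<in> borel_measurable (power_measure L k) \<and>
    integrable (power_measure L k) (\<lambda>x. (u x)\<^sup>2) \<and>
    (\<forall>\<pi>. \<pi> permutes {..<k} \<longrightarrow> (AE x in power_measure L k. u (x \<circ> \<pi>) = u x))"

text \<open>The pathwise formula for kernels that are also integrable; \<open>\<mu>\<close> is the realization of the
  process.\<close>

definition pathwise_integral ::
  "'a measure \<Rightarrow> nat \<Rightarrow> ((nat \<Rightarrow> 'a) \<Rightarrow> real) \<Rightarrow> 'a measure \<Rightarrow> real" where
  "pathwise_integral L k u \<mu> =
    (\<Sum>i\<le>k. (-1) ^ (k - i) * real (k choose i) *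
      (\<integral>(x, y). u (merge {..<i} {i..<k} (x, y))
        \<partial>(factorial_measure i \<mu> \<Otimes>\<^sub>M PiM {i..<k} (\<lambda>_. L))))"

text \<open>\<open>wiener_ito L P \<eta> k u J\<close> says that the random variable \<open>J\<close> is a version of \<open>I\<^sub>k(u)\<close>: this
  integral is the continuous extension of the pathwise formula from the symmetric kernels in
  \<open>L\<^sup>1 \<inter> L\<^sup>2\<close> to all symmetric kernels in \<open>L\<^sup>2\<close>, and as such is only determined almost surely.\<close>

definition wiener_ito ::
  "'a measure \<Rightarrow> 'w measure \<Rightarrow> ('w \<Rightarrow> 'a measure) \<Rightarrow> nat \<Rightarrow> ((nat \<Rightarrow> 'a) \<Rightarrow> real)
    \<Rightarrow> ('w \<Rightarrow> real) \<Rightarrow> bool" where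
  "wiener_ito L P \<eta> k u J \<longleftrightarrow>
    J \<in> borel_measurable P \<and>
    (\<exists>v :: nat \<Rightarrow> (nat \<Rightarrow> 'a) \<Rightarrow> real.
      (\<forall>n. symmetric_L2 L k (v n) \<and> integrable (power_measure L k) (v n)) \<and>
      (\<lambda>n. \<integral>\<^sup>+x. ennreal ((v n x - u x)\<^sup>2) \<partial>power_measure L k) \<longlonglongrightarrow> 0 \<and>
      (\<lambda>n. \<integral>\<^sup>+\<omega>. ennreal ((pathwise_integral L k (v n) (\<eta> \<omega>) - J \<omega>)\<^sup>2) \<partial>P) \<longlonglongrightarrow> 0)"


section \<open>The restriction of the process to a randomized stopping set\<close>

definition stopped_process ::
  "('w \<Rightarrow> 'a measure) \<Rightarrow> ('w \<Rightarrow> 'y) \<Rightarrow> ('y \<Rightarrow> 'a measure \<Rightarrow> 'a set) \<Rightarrow> 'w \<Rightarrow> 'a measure" where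
  "stopped_process \<eta> Y Z \<omega> = restr_measure (\<eta> \<omega>) (Z (Y \<omega>) (\<eta> \<omega>))"

definition stopped_sigma ::
  "'a measure \<Rightarrow> (nat \<Rightarrow> 'a set) \<Rightarrow> 'w measure \<Rightarrow> ('w \<Rightarrow> 'a measure) \<Rightarrow> ('w \<Rightarrow> 'y)
    \<Rightarrow> ('y \<Rightarrow> 'a measure \<Rightarrow> 'a set) \<Rightarrow> 'w measure" where
  "stopped_sigma X Bn P \<eta> Y Z =
    vimage_algebra (space P) (stopped_process \<eta> Y Z) (counting_algebra X Bn)"

end

(*
  Let w be a bounded symmetric kernel supported in a local box, F = I_k(w), and let H be the pathwise
  integral of w(x) 1{x avoids Z(eta)}, x in X^k. Adding points to eta which avoid Z(eta) does not
  change Z. Hence the indicator survives the shifts in the Mecke formula, and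
    E[H G(eta)] = E int w(x) 1{x avoids Z(eta)} D_x G(eta) lambda^k(dx),
  where D_x is the k-fold difference operator. If G is a function of eta_Z, then D_x G(eta) vanishes
  whenever x avoids Z(eta), so H is orthogonal to all such G and E[F | eta_Z] = E[F - H | eta_Z].
  The formula also gives E[H F] = E[H^2] = k! int w(x)^2 P(x avoids Z(eta)) lambda^k(dx), so that
  E[(F - H)^2] = k! int w(x)^2 P(x meets Z(eta)) lambda^k(dx). Conditioning is an L^2 contraction,
  and square integrable kernels are approximated by truncations.
*)

theory Submission
  imports Defs
begin

section \<open>Counting measures on a Borel space\<close>

text \<open>The kernel of H depends on \<eta>, so the isometry for multiple integrals does not apply
  to H and its moments are computed from the Mecke formula alone. The avoidance indicator must then
  be the same before and after points are added, which uses the stopping property in both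
  directions: points outside Z(\<eta>) leave Z unchanged, and so do points outside Z of the enlarged
  process. The coefficients (k choose i) count the i-subsets J of the k coordinates; by symmetry of
  w the shift by the first i points may be replaced by the shift by any such J, and the alternating
  sum over J is D_x. As the intensity may have atoms, points may coincide; hence points are indexed
  by labels, and D_x F is found by counting tuples of labels. For kernels bounded on a local box B
  every quantity is dominated by a polynomial in \<eta>(B), whose moments are finite. The
  randomization is frozen at a value y by independence. In the limit, (p + q)^2 \<le> (1 + 1/a) p^2
  + (1 + a) q^2 with a tending to 0 preserves the constant k!.\<close>

lemma nn_integral_measurable_kernel:
  fixes K :: "'b \<Rightarrow> 'c measure"
  assumes sets_K: "\<And>b. b \<in> space M \<Longrightarrow> sets (K b) = sets S"
    and K: "\<And>A. A \<in> sets S \<Longrightarrow> (\<lambda>b. emeasure (K b) A) \<in> borel_measurable M"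
    and C: "range C \<subseteq> sets S" "incseq C" "(\<Union>n::nat. C n) = space S"
    and fin: "\<And>b n. b \<in> space M \<Longrightarrow> emeasure (K b) (C n) < \<infinity>"
    and f[measurable]: "(\<lambda>(b, z). f b z) \<in> borel_measurable (M \<Otimes>\<^sub>M S)"
  shows "(\<lambda>b. \<integral>\<^sup>+z. f b z \<partial>K b) \<in> borel_measurable M"
proof (cases "space S = {}")
  case True
  have "(\<integral>\<^sup>+z. f b z \<partial>K b) = 0" if "b \<in> space M" for b
    using True sets_eq_imp_space_eq[OF sets_K[OF that]] by (simp add: nn_integral_empty)
  then show ?thesis by (simp cong: measurable_cong)
next
  case False
  note K[measurable]
  have C'[measurable]: "C n \<in> sets S" for n using C(1) by auto
  \<comment> \<open>Dividing by the finite mass of \<open>C n\<close> turns the restricted kernel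
    into a subprobability kernel, for which integrals are known to depend measurably on the
    parameter; multiplying back and letting \<open>C n\<close> increase recovers the integral
    against \<open>K\<close>.\<close>
  define m where "m n b = emeasure (K b) (C n)" for n b
  define K' where "K' n b = scale_measure (inverse (m n b)) (density (K b) (indicator (C n)))" for n b
  have em: "emeasure (K' n b) A = inverse (m n b) * emeasure (K b) (C n \<inter> A)"
    if "b \<in> space M" "A \<in> sets S" for n b A
    using that C' by (simp add: K'_def emeasure_restricted sets_K)
  \<comment> \<open>Only an inequality: if the mass is zero its inverse is \<infinity>, and 0 *
    \<infinity> = 0 in \<open>ennreal\<close>. The scaled measure is then the null measure.\<close>
  have m_inv: "m n b * inverse (m n b) \<le> 1" if "b \<in> space M" for n b
    by (cases "m n b = 0") (use fin[OF that, of n] in \<open>auto simp: m_def ennreal_mult_divide_eq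
        divide_ennreal_def[symmetric] top.not_eq_extremum\<close>)
  have K'_meas: "K' n \<in> M \<rightarrow>\<^sub>M subprob_algebra S" for n
  proof (rule measurable_subprob_algebra)
    fix b assume b: "b \<in> space M"
    show s: "sets (K' n b) = sets S" using sets_K[OF b] by (simp add: K'_def)
    have "emeasure (K' n b) (space S) = inverse (m n b) * m n b"
      using b by (subst em) (auto simp: m_def Int_absorb2 C' sets.sets_into_space)
    then show "subprob_space (K' n b)"
      using m_inv[OF b, of n] False sets_eq_imp_space_eq[OF s]
      by (intro subprob_spaceI) (auto simp: mult.commute)
  next
    fix A assume A: "A \<in> sets S"
    have "(\<lambda>b. inverse (m n b) * emeasure (K b) (C n \<inter> A)) \<in> borel_measurable M"
      unfolding m_def using A by measurable
    then show "(\<lambda>b. emeasure (K' n b) A) \<in> borel_measurable M"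
      using em A by (simp cong: measurable_cong)
  qed
  have int: "m n b * (\<integral>\<^sup>+z. f b z \<partial>K' n b) = (\<integral>\<^sup>+z. f b z * indicator (C n) z \<partial>K b)"
    if b: "b \<in> space M" for n b
  proof -
    have [measurable]: "f b \<in> borel_measurable (K b)"
      using measurable_Pair2[OF f b] sets_K[OF b] by (simp cong: measurable_cong_sets)
    have [measurable]: "C n \<in> sets (K b)" using sets_K[OF b] by auto
    have "(\<integral>\<^sup>+z. f b z \<partial>K' n b) = inverse (m n b) * (\<integral>\<^sup>+z. f b z * indicator (C n) z \<partial>K b)"
      unfolding K'_def by (subst nn_integral_scale_measure)
        (auto simp: nn_integral_density mult.commute)
    moreover have "(\<integral>\<^sup>+z. f b z * indicator (C n) z \<partial>K b) = 0" if "m n b = 0"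
    proof -
      have "AE z in K b. z \<notin> C n" using that by (subst AE_iff_null_sets[symmetric]) (auto simp: m_def null_sets_def)
      then show ?thesis by (subst nn_integral_0_iff_AE) auto
    qed
    ultimately show ?thesis using fin[OF b, of n]
      by (cases "m n b = 0") (auto simp: m_def[symmetric] mult.assoc[symmetric]
        divide_ennreal_def[symmetric] ennreal_divide_self)
  qed
  have "(\<integral>\<^sup>+z. f b z \<partial>K b) = (SUP n. m n b * (\<integral>\<^sup>+z. f b z \<partial>K' n b))" if b: "b \<in> space M" for b
  proof -
    have [measurable]: "f b \<in> borel_measurable (K b)"
      using measurable_Pair2[OF f b] sets_K[OF b] by (simp cong: measurable_cong_sets)
    have [measurable]: "C n \<in> sets (K b)" for n using sets_K[OF b] by auto
    have sp: "space (K b) = space S" using sets_eq_imp_space_eq[OF sets_K[OF b]] .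
    have "(SUP n. \<integral>\<^sup>+z. f b z * indicator (C n) z \<partial>K b) = (\<integral>\<^sup>+z. (SUP n. f b z * indicator (C n) z) \<partial>K b)"
      using C(2) by (intro nn_integral_monotone_convergence_SUP[symmetric])
        (auto simp: incseq_def le_fun_def indicator_def)
    also have "\<dots> = (\<integral>\<^sup>+z. f b z \<partial>K b)"
    proof (rule nn_integral_cong)
      fix z assume "z \<in> space (K b)"
      then obtain n where "z \<in> C n" using C(3) sp by auto
      then have "f b z \<le> (SUP n. f b z * indicator (C n) z)"
        by (intro SUP_upper2[of n]) auto
      moreover have "(SUP n. f b z * indicator (C n) z) \<le> f b z"
        by (intro SUP_least) (auto simp: indicator_def)
      ultimately show "(SUP n. f b z * indicator (C n) z) = f b z" by (rule antisym[rotated])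
    qed
    finally show ?thesis by (simp add: int[OF b])
  qed
  moreover have "(\<lambda>b. SUP n. m n b * (\<integral>\<^sup>+z. f b z \<partial>K' n b)) \<in> borel_measurable M"
    unfolding m_def using nn_integral_measurable_subprob_algebra2[OF f K'_meas] by measurable
  ultimately show ?thesis by (simp cong: measurable_cong)
qed

lemma emeasure_add_measure:
  assumes "sets \<psi> = sets \<mu>" "A \<in> sets \<mu>"
  shows "emeasure (add_measure \<mu> \<psi>) A = emeasure \<mu> A + emeasure \<psi> A"
  unfolding add_measure_def
proof (rule emeasure_measure_of_sigma)
  show "countably_additive (sets \<mu>) (\<lambda>A. emeasure \<mu> A + emeasure \<psi> A)"
    unfolding countably_additive_def
    by (auto simp: suminf_add[symmetric] suminf_emeasure assms(1))
qed (use assms in \<open>auto simp: positive_def sets.sigma_algebra_axioms\<close>)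

lemma sets_add_measure[simp]: "sets (add_measure \<mu> \<psi>) = sets \<mu>"
  by (simp add: add_measure_def)

lemma space_add_measure[simp]: "space (add_measure \<mu> \<psi>) = space \<mu>"
  by (simp add: add_measure_def)

lemma sets_restr_measure[simp]: "sets (restr_measure \<mu> B) = sets \<mu>"
  and space_restr_measure[simp]: "space (restr_measure \<mu> B) = space \<mu>"
  by (simp_all add: restr_measure_def)

lemma emeasure_restr_measure:
  "B \<in> sets \<mu> \<Longrightarrow> A \<in> sets \<mu> \<Longrightarrow> emeasure (restr_measure \<mu> B) A = emeasure \<mu> (A \<inter> B)"
  by (simp add: restr_measure_def emeasure_restricted Int_commute)

section \<open>Localized Borel spaces and the sigma-field of counting measures\<close>

locale localized_borel_space =
  fixes X :: "'a measure" and Bn :: "nat \<Rightarrow> 'a set"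
  assumes borel_iso: "borel_isomorphic_space X"
    and localizing: "localizing_sequence X Bn"
begin

abbreviation "CM \<equiv> counting_measures X Bn"
abbreviation "N \<equiv> counting_algebra X Bn"

lemma Bn_sets[measurable, simp]: "Bn n \<in> sets X"
  and Bn_mono: "m \<le> n \<Longrightarrow> Bn m \<subseteq> Bn n"
  and Bn_UN: "(\<Union>n. Bn n) = space X"
  using localizing by (auto simp: localizing_sequence_def incseq_def)

lemma incseq_Bn: "incseq Bn"
  using localizing by (auto simp: localizing_sequence_def)

lemma local_sets_sets: "C \<in> local_sets X Bn \<Longrightarrow> C \<in> sets X"
  by (auto simp: local_sets_def)

lemma Bn_local: "Bn n \<in> local_sets X Bn"
  by (auto simp: local_sets_def intro!: exI[of _ "Bn n"])

lemma local_sets_subset: "C \<in> local_sets X Bn \<Longrightarrow> D \<subseteq> C \<Longrightarrow> D \<in> sets X \<Longrightarrow> D \<in> local_sets X Bn"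
  by (auto simp: local_sets_def intro!: exI[of _ D])

text \<open>A measurable real coordinate with a left inverse makes points measurable and allows
  measures to be transported to the line.\<close>

lemma borel_embedding:
  "\<exists>(f :: 'a \<Rightarrow> real) g. f \<in> borel_measurable X \<and> (\<forall>x\<in>space X. g (f x) = x)"
proof -
  from borel_iso obtain A :: "real set" and f g where A: "A \<in> sets borel"
    and f: "f \<in> X \<rightarrow>\<^sub>M restrict_space borel A" and inv: "\<forall>x\<in>space X. g (f x) = x"
    unfolding borel_isomorphic_space_def by blast
  have "f \<in> borel_measurable X"
    using f A by (auto simp: measurable_restrict_space2_iff)
  with inv show ?thesis by blast
qed

lemma singleton_sets[measurable]: "x \<in> space X \<Longrightarrow> {x} \<in> sets X"
proof -
  assume x: "x \<in> space X"
  obtain f :: "'a \<Rightarrow> real" and g where fX[measurable]: "f \<in> borel_measurable X"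
    and inv: "\<forall>x\<in>space X. g (f x) = x"
    using borel_embedding by blast
  have "f -` {f x} \<inter> space X \<in> sets X" by measurable
  also have "f -` {f x} \<inter> space X = {x}" using x inv by (auto, metis)
  finally show ?thesis .
qed

text \<open>Every point lies in some \<open>Bn n\<close>, so a counting measure gives each point a
  finite integer mass.\<close>

lemma singleton_local: "x \<in> space X \<Longrightarrow> {x} \<in> local_sets X Bn"
  using Bn_UN local_sets_subset[OF Bn_local, of "{x}"] by (auto simp: singleton_sets)

lemma space_N: "space N = CM"
  by (auto simp: counting_algebra_def space_Sup_eq_UN)

lemma CM_sets: "\<mu> \<in> CM \<Longrightarrow> sets \<mu> = sets X"
  by (simp add: counting_measures_def)

lemma CM_space: "\<mu> \<in> CM \<Longrightarrow> space \<mu> = space X"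
  by (intro sets_eq_imp_space_eq CM_sets)

lemma CM_nat: "\<mu> \<in> CM \<Longrightarrow> C \<in> local_sets X Bn \<Longrightarrow> \<exists>n::nat. emeasure \<mu> C = of_nat n"
  by (simp add: counting_measures_def)

lemma CM_finite: "\<mu> \<in> CM \<Longrightarrow> C \<in> local_sets X Bn \<Longrightarrow> emeasure \<mu> C < \<infinity>"
  using CM_nat[of \<mu> C] by (auto simp: of_nat_less_top)

lemma measurable_emeasure_N[measurable]:
  assumes "B \<in> sets X" shows "(\<lambda>\<mu>. emeasure \<mu> B) \<in> borel_measurable N"
  unfolding counting_algebra_def
  by (rule measurable_SUP1[OF assms]) (auto intro: measurable_vimage_algebra1)

lemma measurable_N:
  assumes "\<And>w. w \<in> space M \<Longrightarrow> f w \<in> CM"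
    and "\<And>B. B \<in> sets X \<Longrightarrow> (\<lambda>w. emeasure (f w) B) \<in> borel_measurable M"
  shows "f \<in> M \<rightarrow>\<^sub>M N"
  unfolding counting_algebra_def
  by (rule measurable_SUP2) (use assms in \<open>auto intro!: measurable_vimage_algebra2\<close>)

text \<open>Counting measures may have infinite total mass but are finite on each
  \<open>Bn n\<close>, so they form a kernel that is finite along an exhaustion.\<close>

lemma nn_integral_measurable_N:
  assumes K: "K \<in> M \<rightarrow>\<^sub>M N"
    and f: "(\<lambda>(b, z). f b z) \<in> borel_measurable (M \<Otimes>\<^sub>M X)"
  shows "(\<lambda>b. \<integral>\<^sup>+z. f b z \<partial>K b) \<in> borel_measurable M"
proof (rule nn_integral_measurable_kernel[OF _ _ _ incseq_Bn Bn_UN _ f])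
  have K': "K b \<in> CM" if "b \<in> space M" for b using measurable_space[OF K that] by (simp add: space_N)
  show "sets (K b) = sets X" "emeasure (K b) (Bn n) < \<infinity>" if "b \<in> space M" for b n
    using K'[OF that] CM_sets CM_finite Bn_local by auto
  show "(\<lambda>b. emeasure (K b) A) \<in> borel_measurable M" if "A \<in> sets X" for A
    using measurable_compose[OF K measurable_emeasure_N[OF that]] .
qed auto

text \<open>A nonzero integer mass is at least 1, so a set of mass n contains at most n
  atoms.\<close>

lemma finite_atoms:
  assumes \<mu>: "\<mu> \<in> CM" and C: "C \<in> local_sets X Bn"
  shows "finite {x\<in>C. emeasure \<mu> {x} \<noteq> 0}"
proof -
  have CX: "C \<in> sets X" using local_sets_sets[OF C] .
  obtain n where n: "emeasure \<mu> C = of_nat n" using CM_nat[OF \<mu> C] by auto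
  show ?thesis
  proof (rule finite_if_finite_subsets_card_bdd[where C=n, THEN conjunct1])
    fix F assume F: "F \<subseteq> {x\<in>C. emeasure \<mu> {x} \<noteq> 0}" "finite F"
    have FX: "x \<in> space X" if "x \<in> F" for x using F that CX sets.sets_into_space by auto
    have one: "1 \<le> emeasure \<mu> {x}" if x: "x \<in> F" for x
    proof -
      obtain m where "emeasure \<mu> {x} = of_nat m" using CM_nat[OF \<mu> singleton_local[OF FX[OF x]]] by auto
      moreover have "emeasure \<mu> {x} \<noteq> 0" using F(1) x by auto
      ultimately show ?thesis by auto
    qed
    have "of_nat (card F) = (\<Sum>x\<in>F. 1::ennreal)" by simp
    also have "\<dots> \<le> (\<Sum>x\<in>F. emeasure \<mu> {x})" using one by (intro sum_mono) auto
    also have "\<dots> = emeasure \<mu> F"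
      using FX CM_sets[OF \<mu>] F by (intro emeasure_eq_sum_singleton[symmetric]) (auto simp: singleton_sets)
    also have "\<dots> \<le> emeasure \<mu> C" using F CX CM_sets[OF \<mu>] by (intro emeasure_mono) auto
    finally show "card F \<le> n" unfolding n by simp
  qed
qed

text \<open>Transported to the line, an atomless measure has a continuous distribution function,
  which cannot jump from one integer to the next.\<close>

lemma atomless_null:
  assumes \<mu>: "\<mu> \<in> CM" and D: "D \<in> local_sets X Bn" and na: "\<And>x. x \<in> D \<Longrightarrow> emeasure \<mu> {x} = 0"
  shows "emeasure \<mu> D = 0"
proof -
  obtain f :: "'a \<Rightarrow> real" and g where fX[measurable]: "f \<in> borel_measurable X"
    and inv: "\<forall>x\<in>space X. g (f x) = x"
    using borel_embedding by blast
  have DX[measurable]: "D \<in> sets X" using local_sets_sets[OF D] .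
  define \<nu> where "\<nu> = distr (restr_measure \<mu> D) borel f"
  have fm: "f \<in> borel_measurable (restr_measure \<mu> D)"
    using fX CM_sets[OF \<mu>] measurable_cong_sets[of "restr_measure \<mu> D" X borel borel] by auto
  have em: "emeasure \<nu> B = emeasure \<mu> (f -` B \<inter> D)" if B: "B \<in> sets borel" for B
  proof -
    have "f -` B \<inter> space X \<in> sets \<mu>" using measurable_sets[OF fX B] by (simp add: CM_sets[OF \<mu>])
    moreover have "f -` B \<inter> space X \<inter> D = f -` B \<inter> D" using sets.sets_into_space[OF DX] by blast
    ultimately show ?thesis unfolding \<nu>_def using fm B DX CM_sets[OF \<mu>] CM_space[OF \<mu>]
      by (subst emeasure_distr) (auto simp: emeasure_restr_measure)
  qed
  have loc: "f -` B \<inter> D \<in> local_sets X Bn" if "B \<in> sets borel" for B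
  proof (rule local_sets_subset[OF D])
    have "(f -` B \<inter> space X) \<inter> D \<in> sets X" using that by measurable
    moreover have "f -` B \<inter> space X \<inter> D = f -` B \<inter> D" using sets.sets_into_space[OF DX] by blast
    ultimately show "f -` B \<inter> D \<in> sets X" by simp
  qed auto
  have sp: "space \<nu> = UNIV" by (simp add: \<nu>_def)
  have "emeasure \<nu> (space \<nu>) \<noteq> \<infinity>"
    unfolding sp using CM_finite[OF \<mu> loc[of UNIV]] by (simp add: em)
  then interpret finite_borel_measure \<nu>
    by (intro finite_borel_measure.intro finite_measureI finite_borel_measure_axioms.intro)
      (simp_all add: \<nu>_def)
  have nat_val: "\<exists>n::nat. measure \<nu> B = real n" if "B \<in> sets borel" for B
    using CM_nat[OF \<mu> loc[OF that]] em[OF that] by (auto simp: measure_def)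
  have "measure \<nu> {t} = 0" for t
  proof (cases "\<exists>x\<in>D. f x = t")
    case True
    then obtain x where x: "x \<in> D" "f x = t" by auto
    then have "f -` {t} \<inter> D = {x}" using inv sets.sets_into_space[OF DX] by (auto, metis subsetD)
    then show ?thesis using na[OF x(1)] by (simp add: measure_def em)
  next
    case False
    then have "f -` {t} \<inter> D = {}" by auto
    then show ?thesis by (simp add: measure_def em)
  qed
  then have cont: "isCont (cdf \<nu>) t" for t by (simp add: isCont_cdf)
  have zero: "cdf \<nu> t = 0" for t
  proof (rule ccontr)
    assume "cdf \<nu> t \<noteq> 0"
    moreover obtain n where n: "cdf \<nu> t = real n" using nat_val[of "{..t}"] by (auto simp: cdf_def)
    \<comment> \<open>The threshold 1/2 lies strictly between the integers 0 and 1: the distribution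
      function tends to 0 on the left and exceeds 1/2 at t, so by continuity it would attain 1/2,
      which is not an integer.\<close>
    ultimately have ge: "cdf \<nu> t \<ge> 1/2" by simp
    have "eventually (\<lambda>s. cdf \<nu> s < 1/2) at_bot"
      using cdf_lim_at_bot by (rule order_tendstoD) simp
    then obtain s0 where s0: "\<And>s. s \<le> s0 \<Longrightarrow> cdf \<nu> s < 1/2"
      by (auto simp: eventually_at_bot_linorder)
    define s where "s = min s0 t"
    have "\<exists>r\<ge>s. r \<le> t \<and> cdf \<nu> r = 1/2"
      using s0[of s] ge cont by (intro IVT) (auto simp: s_def)
    then obtain r where "cdf \<nu> r = 1/2" by auto
    moreover obtain m where "cdf \<nu> r = real m" using nat_val[of "{..r}"] by (auto simp: cdf_def)
    ultimately have "real (2 * m) = real 1" by simp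
    then have "2 * m = 1" by linarith
    then show False by presburger
  qed
  have "measure \<nu> (space \<nu>) = 0"
    using cdf_lim_infty zero LIMSEQ_unique[OF _ tendsto_const] by simp
  then have "emeasure \<nu> UNIV = 0" using borel_UNIV by (simp add: emeasure_eq_measure)
  then show ?thesis by (simp add: em)
qed

text \<open>The set splits into its finitely many atoms and an atomless remainder, which is null by
  \<open>atomless_null\<close>; an atom x of mass n carries exactly the labels (x, 0), ..., (x, n -
  1).\<close>

lemma labelled_points_local:
  assumes \<mu>: "\<mu> \<in> CM" and C: "C \<in> local_sets X Bn"
  shows "finite {q \<in> labelled_points \<mu>. fst q \<in> C}"
    "emeasure \<mu> C = of_nat (card {q \<in> labelled_points \<mu>. fst q \<in> C})"
proof -
  define S where "S = {x\<in>C. emeasure \<mu> {x} \<noteq> 0}"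
  have finS: "finite S" using finite_atoms[OF \<mu> C] by (simp add: S_def)
  have CX: "C \<in> sets X" using local_sets_sets[OF C] .
  have SX: "x \<in> space X" if "x \<in> S" for x using that CX sets.sets_into_space by (auto simp: S_def)
  have S: "S \<in> sets X" using SX by (intro sets.countable[OF singleton_sets] countable_finite finS) auto
  have "\<forall>x\<in>S. \<exists>n::nat. emeasure \<mu> {x} = of_nat n"
    using CM_nat[OF \<mu> singleton_local] SX by auto
  then obtain n where n: "\<And>x. x \<in> S \<Longrightarrow> emeasure \<mu> {x} = of_nat (n x)" by metis
  have eq: "{q \<in> labelled_points \<mu>. fst q \<in> C} = (SIGMA x:S. {..<n x})"
    using n SX CM_space[OF \<mu>] by (auto simp: labelled_points_def S_def) force+
  show "finite {q \<in> labelled_points \<mu>. fst q \<in> C}" unfolding eq using finS by auto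
  have "emeasure \<mu> (C - S) = 0"
    by (rule atomless_null[OF \<mu> local_sets_subset[OF C]]) (use S CX in \<open>auto simp: S_def\<close>)
  moreover have "emeasure \<mu> C = emeasure \<mu> (C - S) + emeasure \<mu> S"
    using S CX CM_sets[OF \<mu>] by (subst plus_emeasure) (auto simp: S_def intro!: arg_cong[where f="emeasure \<mu>"])
  moreover have "emeasure \<mu> S = (\<Sum>x\<in>S. emeasure \<mu> {x})"
    using finS SX CM_sets[OF \<mu>] by (intro emeasure_eq_sum_singleton) (auto simp: singleton_sets)
  ultimately show "emeasure \<mu> C = of_nat (card {q \<in> labelled_points \<mu>. fst q \<in> C})"
    unfolding eq by (simp add: n finS)
qed

lemma measurable_fst_labelled_points:
  "\<mu> \<in> CM \<Longrightarrow> fst \<in> count_space (labelled_points \<mu>) \<rightarrow>\<^sub>M X"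
  using CM_space by (auto simp: labelled_points_def)

text \<open>Counting labels gives equality on local sets; continuity along the exhaustion by
  \<open>Bn\<close> extends it to sets of infinite mass.\<close>

lemma distr_labelled_points:
  assumes \<mu>: "\<mu> \<in> CM"
  shows "distr (count_space (labelled_points \<mu>)) X fst = \<mu>"
proof (rule measure_eqI)
  show "sets (distr (count_space (labelled_points \<mu>)) X fst) = sets \<mu>" using CM_sets[OF \<mu>] by simp
  fix A assume "A \<in> sets (distr (count_space (labelled_points \<mu>)) X fst)"
  then have A: "A \<in> sets X" by simp
  let ?D = "distr (count_space (labelled_points \<mu>)) X fst"
  have loc: "emeasure ?D (A \<inter> Bn n) = emeasure \<mu> (A \<inter> Bn n)" for n
  proof -
    have C: "A \<inter> Bn n \<in> local_sets X Bn" using A by (auto simp: local_sets_def)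
    have "emeasure ?D (A \<inter> Bn n) = emeasure (count_space (labelled_points \<mu>)) {q \<in> labelled_points \<mu>. fst q \<in> A \<inter> Bn n}"
      using A measurable_fst_labelled_points[OF \<mu>]
      by (subst emeasure_distr) (auto intro!: arg_cong[where f="emeasure _"])
    also have "\<dots> = emeasure \<mu> (A \<inter> Bn n)"
      using labelled_points_local[OF \<mu> C] by (subst emeasure_count_space_finite) auto
    finally show ?thesis .
  qed
  have "(SUP n. emeasure \<nu> (A \<inter> Bn n)) = emeasure \<nu> A" if "sets \<nu> = sets X" for \<nu>
  proof -
    have "(\<Union>n. A \<inter> Bn n) = A" using Bn_UN sets.sets_into_space[OF A] by auto
    moreover have "incseq (\<lambda>n. A \<inter> Bn n)" using Bn_mono by (auto simp: incseq_def subset_eq)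
    ultimately show ?thesis using that A by (subst SUP_emeasure_incseq) auto
  qed
  from this[of ?D] this[of \<mu>] loc CM_sets[OF \<mu>] show "emeasure ?D A = emeasure \<mu> A" by simp
qed

lemma nn_integral_labelled_points:
  assumes \<mu>: "\<mu> \<in> CM" and f: "f \<in> borel_measurable X"
  shows "(\<integral>\<^sup>+x. f x \<partial>\<mu>) = (\<integral>\<^sup>+q. f (fst q) \<partial>count_space (labelled_points \<mu>))"
  by (subst distr_labelled_points[OF \<mu>, symmetric],
      subst nn_integral_distr[OF measurable_fst_labelled_points[OF \<mu>]]) (use f in auto)

text \<open>This is \<mu> plus the unit masses at \<open>x j\<close> for j in \<open>J\<close>. The
  points are indexed by \<open>J\<close> and not collected in a set, so coinciding points are added
  with their multiplicity.\<close>

definition add_points :: "'a measure \<Rightarrow> 'i set \<Rightarrow> ('i \<Rightarrow> 'a) \<Rightarrow> 'a measure" where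
  "add_points \<mu> J x = add_measure \<mu> (distr (count_space J) X x)"

lemma sets_add_points[simp]: "sets (add_points \<mu> J x) = sets \<mu>"
  and space_add_points[simp]: "space (add_points \<mu> J x) = space \<mu>"
  by (simp_all add: add_points_def)

lemma sum_indicator_nat: "finite J \<Longrightarrow> (\<Sum>j\<in>J. indicator A (x j) :: ennreal) = of_nat (card {j\<in>J. x j \<in> A})"
  by (simp add: indicator_def sum.If_cases Int_def)

lemma emeasure_add_points:
  assumes \<mu>: "\<mu> \<in> CM" and J: "finite J" "x ` J \<subseteq> space X" and A: "A \<in> sets X"
  shows "emeasure (add_points \<mu> J x) A = emeasure \<mu> A + (\<Sum>j\<in>J. indicator A (x j))"
proof -
  have x: "x \<in> count_space J \<rightarrow>\<^sub>M X" using J by auto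
  have "emeasure (distr (count_space J) X x) A = of_nat (card {j\<in>J. x j \<in> A})"
    using A J(1) x
    by (subst emeasure_distr) (auto simp: emeasure_count_space_finite vimage_def Int_def conj_commute)
  also have "\<dots> = (\<Sum>j\<in>J. indicator A (x j))"
    using J(1) by (simp add: sum_indicator_nat)
  finally have "emeasure (distr (count_space J) X x) A = (\<Sum>j\<in>J. indicator A (x j))" .
  then show ?thesis using A CM_sets[OF \<mu>] by (simp add: add_points_def emeasure_add_measure)
qed

lemma add_points_CM:
  assumes \<mu>: "\<mu> \<in> CM" and J: "finite J" "x ` J \<subseteq> space X"
  shows "add_points \<mu> J x \<in> CM"
  unfolding counting_measures_def
proof (intro CollectI conjI ballI)
  fix C assume C: "C \<in> local_sets X Bn"
  obtain n where "emeasure \<mu> C = of_nat n" using CM_nat[OF \<mu> C] by auto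
  then show "\<exists>n::nat. emeasure (add_points \<mu> J x) C = of_nat n"
    using emeasure_add_points[OF \<mu> J local_sets_sets[OF C]] J
    by (intro exI[of _ "n + card {j\<in>J. x j \<in> C}"]) (simp add: sum_indicator_nat)
qed (simp add: CM_sets[OF \<mu>])

lemma CM_eqI: "\<mu> \<in> CM \<Longrightarrow> \<nu> \<in> CM \<Longrightarrow> (\<And>A. A \<in> sets X \<Longrightarrow> emeasure \<mu> A = emeasure \<nu> A) \<Longrightarrow> \<mu> = \<nu>"
  by (rule measure_eqI) (auto simp: CM_sets)

lemma restr_measure_CM:
  assumes \<mu>: "\<mu> \<in> CM" and B: "B \<in> sets X"
  shows "restr_measure \<mu> B \<in> CM"
  unfolding counting_measures_def
proof (intro CollectI conjI ballI)
  fix C assume C: "C \<in> local_sets X Bn"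
  have "C \<inter> B \<in> local_sets X Bn" using local_sets_subset[OF C] local_sets_sets[OF C] B by auto
  then show "\<exists>n::nat. emeasure (restr_measure \<mu> B) C = of_nat n"
    using CM_nat[OF \<mu>] B CM_sets[OF \<mu>] local_sets_sets[OF C] by (subst emeasure_restr_measure) auto
qed (simp add: CM_sets[OF \<mu>])

lemma measurable_add_points:
  assumes J: "finite J" and K: "K \<in> M \<rightarrow>\<^sub>M N" and x: "\<And>j. j \<in> J \<Longrightarrow> (\<lambda>w. x w j) \<in> M \<rightarrow>\<^sub>M X"
  shows "(\<lambda>w. add_points (K w) J (x w)) \<in> M \<rightarrow>\<^sub>M N"
proof (rule measurable_N)
  have K': "K w \<in> CM" if "w \<in> space M" for w using measurable_space[OF K that] by (simp add: space_N)
  have x': "x w ` J \<subseteq> space X" if "w \<in> space M" for w using measurable_space[OF x that] by auto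
  show "add_points (K w) J (x w) \<in> CM" if "w \<in> space M" for w
    using add_points_CM[OF K'[OF that] J x'[OF that]] .
  fix B assume B[measurable]: "B \<in> sets X"
  have [measurable]: "(\<lambda>w. emeasure (K w) B) \<in> borel_measurable M"
    using measurable_compose[OF K measurable_emeasure_N[OF B]] .
  have "(\<lambda>w. (\<Sum>j\<in>J. indicator B (x w j) :: ennreal)) \<in> borel_measurable M"
    using x by (intro borel_measurable_sum measurable_compose[OF _ borel_measurable_indicator[OF B]])
  then have "(\<lambda>w. emeasure (K w) B + (\<Sum>j\<in>J. indicator B (x w j))) \<in> borel_measurable M"
    by measurable
  then show "(\<lambda>w. emeasure (add_points (K w) J (x w)) B) \<in> borel_measurable M"
    using emeasure_add_points[OF K' J x' B] by (simp cong: measurable_cong)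
qed

end

section \<open>The Mecke formula\<close>

text \<open>The measure M(db) K(b, dz) on the product, for kernels that may have infinite total
  mass. It turns each side of the Mecke formula into a measure, so that the two can be compared on a
  generator.\<close>

lemma semidirect_measure:
  fixes K :: "'b \<Rightarrow> 'c measure"
  assumes sets_K: "\<And>b. b \<in> space M \<Longrightarrow> sets (K b) = sets S"
    and int_K: "\<And>f. f \<in> borel_measurable (M \<Otimes>\<^sub>M S) \<Longrightarrow> (\<lambda>b. \<integral>\<^sup>+z. f (b, z) \<partial>K b) \<in> borel_measurable M"
  obtains Q where "sets Q = sets (M \<Otimes>\<^sub>M S)"
    "\<And>f. f \<in> borel_measurable (M \<Otimes>\<^sub>M S) \<Longrightarrow> (\<integral>\<^sup>+w. f w \<partial>Q) = (\<integral>\<^sup>+b. \<integral>\<^sup>+z. f (b, z) \<partial>K b \<partial>M)"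
proof -
  define F where "F f = (\<integral>\<^sup>+b. \<integral>\<^sup>+z. f (b, z) \<partial>K b \<partial>M)" for f :: "'b \<times> 'c \<Rightarrow> ennreal"
  define Q where "Q = measure_of (space (M \<Otimes>\<^sub>M S)) (sets (M \<Otimes>\<^sub>M S)) (\<lambda>A. F (indicator A))"
  have sQ: "sets Q = sets (M \<Otimes>\<^sub>M S)" by (simp add: Q_def sets.sets_measure_of_eq)
  have sec: "(\<lambda>z. f (b, z)) \<in> borel_measurable (K b)"
    if "b \<in> space M" "f \<in> borel_measurable (M \<Otimes>\<^sub>M S)" for b and f :: "'b \<times> 'c \<Rightarrow> ennreal"
    using measurable_Pair2[OF that(2,1)] measurable_cong_sets[OF sets_K[OF that(1)] refl] by auto
  have em: "emeasure Q A = F (indicator A)" if A: "A \<in> sets (M \<Otimes>\<^sub>M S)" for A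
    unfolding Q_def
  proof (rule emeasure_measure_of_sigma[OF sets.sigma_algebra_axioms _ _ A])
    show "countably_additive (sets (M \<Otimes>\<^sub>M S)) (\<lambda>A. F (indicator A))"
    proof (rule countably_additiveI)
      fix A :: "nat \<Rightarrow> _" assume A: "range A \<subseteq> sets (M \<Otimes>\<^sub>M S)" "disjoint_family A"
      have [measurable]: "A i \<in> sets (M \<Otimes>\<^sub>M S)" for i using A by auto
      have "F (indicator (\<Union>i. A i)) = (\<integral>\<^sup>+b. (\<Sum>i. \<integral>\<^sup>+z. indicator (A i) (b, z) \<partial>K b) \<partial>M)"
        unfolding F_def using suminf_indicator[OF A(2)] sec
        by (intro nn_integral_cong) (simp add: nn_integral_suminf[symmetric])
      also have "\<dots> = (\<Sum>i. F (indicator (A i)))"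
        unfolding F_def by (intro nn_integral_suminf int_K) measurable
      finally show "(\<Sum>i. F (indicator (A i))) = F (indicator (\<Union>i. A i))" ..
    qed
  qed (simp add: positive_def F_def)
  have "(\<integral>\<^sup>+w. f w \<partial>Q) = F f" if "f \<in> borel_measurable (M \<Otimes>\<^sub>M S)" for f
    using that
  proof induction
    case (cong f g)
    have "F f = F g" unfolding F_def
    proof (intro nn_integral_cong)
      fix b z assume b: "b \<in> space M" "z \<in> space (K b)"
      then have "z \<in> space S" using sets_eq_imp_space_eq[OF sets_K] by auto
      then show "f (b, z) = g (b, z)" using cong b by (auto simp: space_pair_measure)
    qed
    moreover have "(\<integral>\<^sup>+w. f w \<partial>Q) = (\<integral>\<^sup>+w. g w \<partial>Q)"
      using cong sets_eq_imp_space_eq[OF sQ] by (intro nn_integral_cong) auto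
    ultimately show ?case using cong by simp
  next
    case (set A)
    then show ?case using sQ by (simp add: em)
  next
    case (mult u c)
    then show ?case using sQ measurable_cong_sets[OF sQ refl, of borel] sec int_K
      by (simp add: nn_integral_cmult F_def cong: nn_integral_cong)
  next
    case (add u v)
    then show ?case using sQ measurable_cong_sets[OF sQ refl, of borel] sec int_K
      by (simp add: nn_integral_add F_def cong: nn_integral_cong)
  next
    case (seq U)
    have "F (SUP i. U i) = (\<integral>\<^sup>+b. (SUP i. \<integral>\<^sup>+z. U i (b, z) \<partial>K b) \<partial>M)"
      unfolding F_def using seq sec
      by (intro nn_integral_cong) (simp add: image_comp SUP_apply nn_integral_monotone_convergence_SUP[symmetric] incseq_def le_fun_def)
    also have "\<dots> = (SUP i. F (U i))" unfolding F_def using seq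
      by (intro nn_integral_monotone_convergence_SUP int_K)
         (auto simp: incseq_def le_fun_def intro!: nn_integral_mono)
    also have "\<dots> = (\<integral>\<^sup>+w. (SUP i. U i w) \<partial>Q)"
      using seq measurable_cong_sets[OF sQ refl, of borel]
      by (subst nn_integral_monotone_convergence_SUP) auto
    also have "\<dots> = (\<integral>\<^sup>+w. (SUP i. U i) w \<partial>Q)" by (simp add: image_comp SUP_apply)
    finally show ?case ..
  qed
  then show thesis using that[OF sQ] by (simp add: F_def)
qed

text \<open>The Poisson weights satisfy (n + 1) p(n + 1) = m p(n); this shifts the summation index
  by one.\<close>

lemma (in prob_space) poisson_shift:
  assumes pd: "poisson_distributed M W m" and m: "m < \<infinity>" and g[measurable]: "g \<in> borel_measurable borel"
  shows "(\<integral>\<^sup>+\<omega>. W \<omega> * g (W \<omega>) \<partial>M) = m * (\<integral>\<^sup>+\<omega>. g (W \<omega> + 1) \<partial>M)"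
proof -
  define r where "r = enn2real m"
  have r: "0 \<le> r" "m = ennreal r" using m by (auto simp: r_def)
  have W[measurable]: "W \<in> borel_measurable M" using pd by (simp add: poisson_distributed_def)
  define E where "E n = {\<omega> \<in> space M. W \<omega> = of_nat n}" for n
  have E[measurable]: "E n \<in> events" for n unfolding E_def by measurable
  define p where "p n = exp (- r) * r ^ n / fact n" for n
  have pE: "prob (E n) = p n" for n
    using pd m by (simp add: poisson_distributed_def E_def p_def r_def)
  have p_sums: "p sums 1"
  proof -
    have "(\<lambda>n. exp (-r) * (r ^ n /\<^sub>R fact n)) sums (exp (-r) * exp r)"
      by (intro sums_mult exp_converges)
    also have "(\<lambda>n. exp (-r) * (r ^ n /\<^sub>R fact n)) = p"
      by (auto simp: p_def field_simps)
    finally show ?thesis by (simp add: exp_minus)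
  qed
  have disj: "disjoint_family E" by (auto simp: disjoint_family_on_def E_def)
  have "(\<lambda>n. prob (E n)) sums prob (\<Union>n. E n)"
    using disj by (intro finite_measure_UNION) auto
  then have "prob (\<Union>n. E n) = 1" using p_sums by (simp add: pE sums_unique2)
  \<comment> \<open>Only the probabilities of natural numbers are given, but these already sum to 1,
    so \<open>W\<close> takes no other value with positive probability.\<close>
  then have AE: "AE \<omega> in M. \<omega> \<in> (\<Union>n. E n)" by (subst (asm) prob_eq_1) auto
  have int: "(\<integral>\<^sup>+\<omega>. h (W \<omega>) \<partial>M) = (\<Sum>n. h (of_nat n) * ennreal (p n))"
    if [measurable]: "h \<in> borel_measurable borel" for h :: "ennreal \<Rightarrow> ennreal"
  proof -
    have "(\<integral>\<^sup>+\<omega>. h (W \<omega>) \<partial>M) = (\<integral>\<^sup>+\<omega>. (\<Sum>n. h (of_nat n) * indicator (E n) \<omega>) \<partial>M)"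
    proof (rule nn_integral_cong_AE, use AE in eventually_elim)
      fix \<omega> assume "\<omega> \<in> (\<Union>n. E n)"
      then obtain k where k: "\<omega> \<in> E k" by auto
      have "(\<Sum>n. h (of_nat n) * indicator (E n) \<omega>) = (\<Sum>n\<in>{k}. h (of_nat n) * indicator (E n) \<omega>)"
        using k by (intro suminf_finite) (auto simp: E_def indicator_def)
      moreover have "W \<omega> = of_nat k" using k by (simp add: E_def)
      ultimately show "h (W \<omega>) = (\<Sum>n. h (of_nat n) * indicator (E n) \<omega>)" using k by simp
    qed
    also have "\<dots> = (\<Sum>n. h (of_nat n) * ennreal (p n))"
      by (subst nn_integral_suminf) (auto simp: nn_integral_cmult emeasure_eq_measure pE)
    finally show ?thesis .
  qed
  have step: "of_nat (Suc n) * ennreal (p (Suc n)) = m * ennreal (p n)" for n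
  proof -
    have "of_nat (Suc n) * ennreal (p (Suc n)) = ennreal (real (Suc n) * p (Suc n))"
      unfolding ennreal_of_nat_eq_real_of_nat by (subst ennreal_mult') auto
    also have "real (Suc n) * p (Suc n) = r * p n"
      by (simp add: p_def field_simps del: of_nat_Suc)
    also have "ennreal (r * p n) = m * ennreal (p n)" using r by (simp add: ennreal_mult')
    finally show ?thesis .
  qed
  have "(\<integral>\<^sup>+\<omega>. W \<omega> * g (W \<omega>) \<partial>M) = (\<Sum>n. of_nat n * g (of_nat n) * ennreal (p n))"
    by (rule int) measurable
  \<comment> \<open>The term n = 0 vanishes because of the factor n, so the series may start at
    \<open>Suc n\<close>.\<close>
  also have "\<dots> = (\<Sum>n. of_nat (Suc n) * g (of_nat (Suc n)) * ennreal (p (Suc n)))"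
    using sums_Suc[OF summable_sums[OF summableI], of "\<lambda>n. of_nat n * g (of_nat n) * ennreal (p n)"]
    by (simp add: sums_iff)
  also have "\<dots> = (\<Sum>n. m * (g (of_nat n + 1) * ennreal (p n)))"
  proof (rule arg_cong[where f=suminf], rule ext)
    fix n
    have "of_nat (Suc n) * g (of_nat (Suc n)) * ennreal (p (Suc n))
        = (of_nat (Suc n) * ennreal (p (Suc n))) * g (of_nat (Suc n))" by (simp only: ac_simps)
    also have "\<dots> = m * (g (of_nat n + 1) * ennreal (p n))"
      unfolding step by (simp add: ac_simps)
    finally show "of_nat (Suc n) * g (of_nat (Suc n)) * ennreal (p (Suc n)) = m * (g (of_nat n + 1) * ennreal (p n))" .
  qed
  also have "\<dots> = m * (\<integral>\<^sup>+\<omega>. g (W \<omega> + 1) \<partial>M)"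
    by (subst int[of "\<lambda>x. g (x + 1)"]) (auto simp: ennreal_suminf_cmult)
  finally show ?thesis .
qed

text \<open>By independence the joint law of the j-th count and the remaining counts is a product;
  with the remaining counts frozen, the one-dimensional shift applies to the j-th.\<close>

lemma (in prob_space) poisson_shift_indep:
  fixes V :: "nat \<Rightarrow> 'a \<Rightarrow> ennreal"
  assumes ind: "indep_vars (\<lambda>_. borel) V {..<n}" and j: "j < n"
    and pd: "poisson_distributed M (V j) m" and m: "m < \<infinity>"
    and \<psi>[measurable]: "\<psi> \<in> borel_measurable (PiM {..<n} (\<lambda>_. borel))"
  shows "(\<integral>\<^sup>+\<omega>. V j \<omega> * \<psi> (\<lambda>i\<in>{..<n}. V i \<omega>) \<partial>M)
    = m * (\<integral>\<^sup>+\<omega>. \<psi> (\<lambda>i\<in>{..<n}. if i = j then V i \<omega> + 1 else V i \<omega>) \<partial>M)"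
proof -
  have V[measurable]: "V i \<in> borel_measurable M" if "i < n" for i
    using ind that by (auto simp: indep_vars_def)
  let ?R = "PiM ({..<n} - {j}) (\<lambda>_. borel :: ennreal measure)" and ?J = "PiM {j} (\<lambda>_. borel :: ennreal measure)"
  define R where "R \<omega> = (\<lambda>i\<in>{..<n} - {j}. V i \<omega>)" for \<omega>
  define J where "J \<omega> = (\<lambda>i\<in>{j}. V i \<omega>)" for \<omega>
  have [measurable]: "R \<in> M \<rightarrow>\<^sub>M ?R" "J \<in> M \<rightarrow>\<^sub>M ?J"
    unfolding R_def J_def using j by (auto intro!: measurable_restrict V)
  have "indep_var ?J J ?R R"
    unfolding J_def R_def using j by (intro indep_var_restrict[OF ind]) auto
  then have eq: "distr M (?J \<Otimes>\<^sub>M ?R) (\<lambda>\<omega>. (J \<omega>, R \<omega>)) = distr M ?J J \<Otimes>\<^sub>M distr M ?R R"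
    by (simp add: indep_var_distribution_eq)
  interpret RR: prob_space "distr M ?R R" by (rule prob_space_distr) measurable
  interpret JJ: prob_space "distr M ?J J" by (rule prob_space_distr) measurable
  interpret pair_sigma_finite "distr M ?J J" "distr M ?R R" ..
  have fold: "(\<integral>\<^sup>+\<omega>. h (J \<omega>, R \<omega>) \<partial>M) = (\<integral>\<^sup>+\<omega>'. \<integral>\<^sup>+\<omega>. h (J \<omega>, R \<omega>') \<partial>M \<partial>M)"
    if [measurable]: "h \<in> borel_measurable (?J \<Otimes>\<^sub>M ?R)" for h :: "_ \<Rightarrow> ennreal"
  proof -
    have "(\<integral>\<^sup>+\<omega>. h (J \<omega>, R \<omega>) \<partial>M) = (\<integral>\<^sup>+w. h w \<partial>distr M (?J \<Otimes>\<^sub>M ?R) (\<lambda>\<omega>. (J \<omega>, R \<omega>)))"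
      by (subst nn_integral_distr) auto
    also have "\<dots> = (\<integral>\<^sup>+r. \<integral>\<^sup>+a. h (a, r) \<partial>distr M ?J J \<partial>distr M ?R R)"
      unfolding eq by (intro nn_integral_snd[symmetric]) measurable
    also have "\<dots> = (\<integral>\<^sup>+\<omega>'. \<integral>\<^sup>+a. h (a, R \<omega>') \<partial>distr M ?J J \<partial>M)"
      by (subst nn_integral_distr) measurable
    also have "\<dots> = (\<integral>\<^sup>+\<omega>'. \<integral>\<^sup>+\<omega>. h (J \<omega>, R \<omega>') \<partial>M \<partial>M)"
    proof (rule nn_integral_cong)
      fix \<omega>' assume "\<omega>' \<in> space M"
      then have [measurable]: "R \<omega>' \<in> space ?R" by (rule measurable_space[rotated]) measurable
      show "(\<integral>\<^sup>+a. h (a, R \<omega>') \<partial>distr M ?J J) = (\<integral>\<^sup>+\<omega>. h (J \<omega>, R \<omega>') \<partial>M)"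
        by (subst nn_integral_distr) measurable
    qed
    finally show ?thesis .
  qed
  define G where "G t r = \<psi> (\<lambda>i\<in>{..<n}. if i = j then t else r i)" for t r
  have G[measurable]: "(\<lambda>w. G (T w) (U w)) \<in> borel_measurable L"
    if [measurable]: "T \<in> borel_measurable L" "U \<in> L \<rightarrow>\<^sub>M ?R" for L :: "'z measure" and T U
    unfolding G_def
  proof (rule measurable_compose[OF _ \<psi>], rule measurable_restrict)
    fix i assume i: "i \<in> {..<n}"
    show "(\<lambda>w. if i = j then T w else U w i) \<in> borel_measurable L"
    proof (cases "i = j")
      case False
      then have "(\<lambda>r. r i) \<in> ?R \<rightarrow>\<^sub>M borel" using i by (intro measurable_component_singleton) auto
      from measurable_compose[OF that(2) this] show ?thesis using False by simp
    qed simp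
  qed
  have J_app[measurable]: "(\<lambda>a. a j) \<in> borel_measurable ?J" by (rule measurable_component_singleton) auto
  have "(\<integral>\<^sup>+\<omega>. V j \<omega> * \<psi> (\<lambda>i\<in>{..<n}. V i \<omega>) \<partial>M) = (\<integral>\<^sup>+\<omega>. J \<omega> j * G (J \<omega> j) (R \<omega>) \<partial>M)"
    by (intro nn_integral_cong arg_cong2[where f="(*)"]) (auto simp: J_def R_def G_def intro!: arg_cong[where f=\<psi>])
  also have "\<dots> = (\<integral>\<^sup>+\<omega>'. \<integral>\<^sup>+\<omega>. J \<omega> j * G (J \<omega> j) (R \<omega>') \<partial>M \<partial>M)"
    by (rule fold[of "\<lambda>(a, r). a j * G (a j) r", simplified]) measurable
  also have "\<dots> = (\<integral>\<^sup>+\<omega>'. m * (\<integral>\<^sup>+\<omega>. G (J \<omega> j + 1) (R \<omega>') \<partial>M) \<partial>M)"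
  proof (rule nn_integral_cong)
    fix \<omega>' assume \<omega>': "\<omega>' \<in> space M"
    then have [measurable]: "R \<omega>' \<in> space ?R" by (rule measurable_space[rotated]) measurable
    have [simp]: "J \<omega> j = V j \<omega>" for \<omega> by (simp add: J_def)
    have [measurable]: "(\<lambda>t. G t (R \<omega>')) \<in> borel_measurable borel"
      by (rule G) auto
    show "(\<integral>\<^sup>+\<omega>. J \<omega> j * G (J \<omega> j) (R \<omega>') \<partial>M) = m * (\<integral>\<^sup>+\<omega>. G (J \<omega> j + 1) (R \<omega>') \<partial>M)"
      using poisson_shift[OF pd m, of "\<lambda>t. G t (R \<omega>')"] by simp
  qed
  also have "\<dots> = m * (\<integral>\<^sup>+\<omega>'. \<integral>\<^sup>+\<omega>. G (J \<omega> j + 1) (R \<omega>') \<partial>M \<partial>M)"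
    by (rule nn_integral_cmult) measurable
  also have "(\<integral>\<^sup>+\<omega>'. \<integral>\<^sup>+\<omega>. G (J \<omega> j + 1) (R \<omega>') \<partial>M \<partial>M) = (\<integral>\<^sup>+\<omega>. G (J \<omega> j + 1) (R \<omega>) \<partial>M)"
    by (rule fold[of "\<lambda>(a, r). G (a j + 1) r", simplified, symmetric]) measurable
  also have "\<dots> = (\<integral>\<^sup>+\<omega>. \<psi> (\<lambda>i\<in>{..<n}. if i = j then V i \<omega> + 1 else V i \<omega>) \<partial>M)"
    by (intro nn_integral_cong) (auto simp: J_def R_def G_def intro!: arg_cong[where f=\<psi>])
  finally show ?thesis .
qed

section \<open>Finite-dimensional events and the Mecke formula for a single point\<close>

context localized_borel_space
begin

abbreviation add_point :: "'a measure \<Rightarrow> 'a \<Rightarrow> 'a measure" where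
  "add_point \<mu> x \<equiv> add_points \<mu> {0::nat} (\<lambda>_. x)"

lemma measurable_add_point[measurable (raw)]:
  "K \<in> M \<rightarrow>\<^sub>M N \<Longrightarrow> y \<in> M \<rightarrow>\<^sub>M X \<Longrightarrow> (\<lambda>w. add_point (K w) (y w)) \<in> M \<rightarrow>\<^sub>M N"
  by (rule measurable_add_points) auto

definition cylinder :: "'a set set \<Rightarrow> ('a set \<Rightarrow> ennreal set) \<Rightarrow> 'a measure set" where
  "cylinder I E = {\<mu>\<in>CM. \<forall>B\<in>I. emeasure \<mu> B \<in> E B}"

text \<open>Finite-dimensional events: an intersection-stable generator of \<open>N\<close> whose
  members involve finitely many counts each, so that independence of finitely many counts can be
  brought to bear.\<close>

definition cylinders :: "'a measure set set" where
  "cylinders = {cylinder I E |I E. finite I \<and> I \<subseteq> sets X \<and> (\<forall>B\<in>I. E B \<in> sets borel)}"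

lemma cylinders_Int:
  assumes "C \<in> cylinders" "D \<in> cylinders" shows "C \<inter> D \<in> cylinders"
proof -
  from assms obtain I E I' E' where 
    C: "C = cylinder I E" "finite I" "I \<subseteq> sets X" "\<forall>B\<in>I. E B \<in> sets borel" and
    D: "D = cylinder I' E'" "finite I'" "I' \<subseteq> sets X" "\<forall>B\<in>I'. E' B \<in> sets borel"
    unfolding cylinders_def by blast
  \<comment> \<open>A set constrained by only one of the two cylinders receives the trivial
    constraint \<open>UNIV\<close> from the other.\<close>
  have "C \<inter> D = cylinder (I \<union> I') (\<lambda>B. (if B \<in> I then E B else UNIV) \<inter> (if B \<in> I' then E' B else UNIV))"
    unfolding C D cylinder_def by auto
  then show ?thesis
    unfolding cylinders_def using C(2-) D(2-) 
    by (intro CollectI exI[of _ "I \<union> I'"] exI[of _ "\<lambda>B. (if B \<in> I then E B else UNIV) \<inter> (if B \<in> I' then E' B else UNIV)"]) auto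
qed

lemma sets_N: "sets N = sigma_sets CM cylinders"
proof -
  have "sets N = sigma_sets CM (\<Union>m\<in>(\<lambda>B. vimage_algebra CM (\<lambda>\<mu>. emeasure \<mu> B) borel) ` sets X. sets m)"
    unfolding counting_algebra_def by (rule sets_Sup_eq) auto
  also have "\<dots> = sigma_sets CM cylinders"
  proof (rule sigma_sets_eqI)
    fix a assume "a \<in> (\<Union>m\<in>(\<lambda>B. vimage_algebra CM (\<lambda>\<mu>. emeasure \<mu> B) borel) ` sets X. sets m)"
    then obtain B E where "B \<in> sets X" "E \<in> sets borel" "a = (\<lambda>\<mu>. emeasure \<mu> B) -` E \<inter> CM"
      by (auto simp: sets_vimage_algebra2)
    then have "a \<in> cylinders"
      unfolding cylinders_def cylinder_def by (intro CollectI exI[of _ "{B}"] exI[of _ "\<lambda>_. E"]) auto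
    then show "a \<in> sigma_sets CM cylinders" ..
  next
    fix a assume "a \<in> cylinders"
    then obtain I E where I: "a = cylinder I E" "finite I" "I \<subseteq> sets X" "\<forall>B\<in>I. E B \<in> sets borel"
      unfolding cylinders_def by blast
    have "{\<mu> \<in> space N. \<forall>B\<in>I. emeasure \<mu> B \<in> E B} \<in> sets N"
    proof (rule sets.sets_Collect_finite_All[OF _ I(2)])
      fix B assume "B \<in> I"
      then have "(\<lambda>\<mu>. emeasure \<mu> B) -` E B \<inter> space N \<in> sets N"
        using I by (intro measurable_sets[OF measurable_emeasure_N]) auto
      also have "(\<lambda>\<mu>. emeasure \<mu> B) -` E B \<inter> space N = {\<mu> \<in> space N. emeasure \<mu> B \<in> E B}" by auto
      finally show "{\<mu> \<in> space N. emeasure \<mu> B \<in> E B} \<in> sets N" .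
    qed
    then show "a \<in> sigma_sets CM (\<Union>m\<in>(\<lambda>B. vimage_algebra CM (\<lambda>\<mu>. emeasure \<mu> B) borel) ` sets X. sets m)"
      unfolding I(1) cylinder_def \<open>sets N = _\<close>[symmetric] space_N .
  qed
  finally show ?thesis .
qed

lemma sets_X_local: "sets X = sigma_sets (space X) (local_sets X Bn)"
proof
  show "sets X \<subseteq> sigma_sets (space X) (local_sets X Bn)"
  proof
    fix B assume B: "B \<in> sets X"
    have "B = (\<Union>n. B \<inter> Bn n)" using Bn_UN sets.sets_into_space[OF B] by auto
    moreover have "B \<inter> Bn n \<in> sigma_sets (space X) (local_sets X Bn)" for n
      using B by (intro sigma_sets.Basic) (auto simp: local_sets_def)
    ultimately show "B \<in> sigma_sets (space X) (local_sets X Bn)"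
      by (metis (no_types, lifting) sigma_sets.Union)
  qed
  show "sigma_sets (space X) (local_sets X Bn) \<subseteq> sets X"
    using local_sets_sets by (intro sets.sigma_sets_subset) auto
qed

text \<open>The first factor ranges over local sets so that the measures compared in the Mecke
  formula are finite on the generator.\<close>

lemma sets_X_N:
  "sets (X \<Otimes>\<^sub>M N) = sigma_sets (space X \<times> CM) {A \<times> D |A D. A \<in> local_sets X Bn \<and> D \<in> cylinders}"
proof -
  have CM: "CM \<in> cylinders"
    unfolding cylinders_def cylinder_def by (intro CollectI exI[of _ "{}"]) auto
  have local_Pow: "local_sets X Bn \<subseteq> Pow (space X)" using local_sets_sets sets.sets_into_space by blast
  have cyl_Pow: "cylinders \<subseteq> Pow CM" by (auto simp: cylinders_def cylinder_def)
  have "sets (X \<Otimes>\<^sub>M N) = sets (sigma (space X \<times> space N) {A \<times> D |A D. A \<in> local_sets X Bn \<and> D \<in> cylinders})"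
    using local_Pow cyl_Pow CM sets_N sets_X_local Bn_UN Bn_local
    by (intro sets_pair_eq[where Ca="range Bn" and Cb="{CM}"]) (auto simp: space_N)
  also have "\<dots> = sigma_sets (space X \<times> CM) {A \<times> D |A D. A \<in> local_sets X Bn \<and> D \<in> cylinders}"
    unfolding space_N 
    by (rule sets_measure_of) (use local_Pow cyl_Pow in fast)
  finally show ?thesis .
qed

text \<open>The finite algebra generated by \<open>I\<close> has as atoms the sets of points which lie in the same members of \<open>I\<close>.\<close>

lemma finite_atoms_algebra:
  assumes I: "finite I" "I \<subseteq> sets X"
  shows "\<exists>(n::nat) C J. (\<forall>i<n. C i \<in> sets X) \<and> disjoint_family_on C {..<n} \<and>
    (\<forall>B\<in>I. J B \<subseteq> {..<n} \<and> B = (\<Union>i\<in>J B. C i))"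
proof -
  obtain e where e: "bij_betw e {..<card (Pow I)} (Pow I)"
    using ex_bij_betw_nat_finite[of "Pow I"] I(1) by (auto simp: atLeast0LessThan)
  define C where "C i = {x\<in>space X. {B\<in>I. x \<in> B} = e i}" for i
  define J where "J B = {i\<in>{..<card (Pow I)}. B \<in> e i}" for B
  show ?thesis
  proof (intro exI conjI ballI allI impI)
    fix i assume i: "i < card (Pow I)"
    have "e i \<subseteq> I" using bij_betwE[OF e] i by auto
    then have "C i = {x\<in>space X. \<forall>B\<in>I. x \<in> B \<longleftrightarrow> B \<in> e i}" by (auto simp: C_def)
    also have "\<dots> \<in> sets X"
    proof (rule sets.sets_Collect_finite_All[OF _ I(1)])
      fix B assume "B \<in> I"
      then have [measurable]: "B \<in> sets X" using I by auto
      show "{x \<in> space X. (x \<in> B) = (B \<in> e i)} \<in> sets X" by measurable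
    qed
    finally show "C i \<in> sets X" .
  next
    show "disjoint_family_on C {..<card (Pow I)}"
      using bij_betw_imp_inj_on[OF e] by (auto simp: disjoint_family_on_def C_def inj_on_def)
  next
    fix B assume B: "B \<in> I"
    show "J B \<subseteq> {..<card (Pow I)}" by (auto simp: J_def)
    show "B = (\<Union>i\<in>J B. C i)"
    proof
      show "B \<subseteq> (\<Union>i\<in>J B. C i)"
      proof
        fix x assume x: "x \<in> B"
        have "{B\<in>I. x \<in> B} \<in> e ` {..<card (Pow I)}" using e by (auto simp: bij_betw_def)
        then obtain i where "i < card (Pow I)" "{B\<in>I. x \<in> B} = e i" by auto
        moreover have "x \<in> space X" using x B I sets.sets_into_space by auto
        ultimately show "x \<in> (\<Union>i\<in>J B. C i)" using x B by (auto simp: J_def C_def)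
      qed
    qed (auto simp: J_def C_def)
  qed
qed

text \<open>Both sides are measures, and on a rectangle over a cylinder event the claim reduces, through the
  atoms of the finitely many sets involved, to the shift identity for independent Poisson variables.\<close>

lemma poisson_mecke:
  assumes P: "prob_space P" and pp: "poisson_process X Bn L P \<eta>"
    and lf: "locally_finite_measure X Bn L"
    and f: "(\<lambda>(x, \<mu>). f x \<mu>) \<in> borel_measurable (X \<Otimes>\<^sub>M N)"
  shows "(\<integral>\<^sup>+\<omega>. \<integral>\<^sup>+x. f x (\<eta> \<omega>) \<partial>\<eta> \<omega> \<partial>P) = (\<integral>\<^sup>+\<omega>. \<integral>\<^sup>+x. f x (add_point (\<eta> \<omega>) x) \<partial>L \<partial>P)"
proof -
  interpret prob_space P by fact
  have \<eta>[measurable]: "\<eta> \<in> P \<rightarrow>\<^sub>M N" using pp by (simp add: poisson_process_def)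
  have \<eta>_CM: "\<eta> \<omega> \<in> CM" if "\<omega> \<in> space P" for \<omega>
    using measurable_space[OF \<eta> that] by (simp add: space_N)
  have sL: "sets L = sets X" and finL: "\<And>C. C \<in> local_sets X Bn \<Longrightarrow> emeasure L C < \<infinity>"
    using lf by (auto simp: locally_finite_measure_def)
  have spL: "space L = space X" using sets_eq_imp_space_eq[OF sL] .
  have \<eta>_int: "(\<lambda>\<omega>. \<integral>\<^sup>+x. g (\<omega>, x) \<partial>\<eta> \<omega>) \<in> borel_measurable P"
    if "g \<in> borel_measurable (P \<Otimes>\<^sub>M X)" for g :: "_ \<Rightarrow> ennreal"
    using that by (intro nn_integral_measurable_N) auto
  have L_int: "(\<lambda>\<omega>. \<integral>\<^sup>+x. g (\<omega>, x) \<partial>L) \<in> borel_measurable P"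
    if "g \<in> borel_measurable (P \<Otimes>\<^sub>M X)" for g :: "_ \<Rightarrow> ennreal"
    using that by (intro nn_integral_measurable_kernel[where S=X and C=Bn and K="\<lambda>_. L"])
      (use sL finL Bn_local Bn_UN incseq_Bn in auto)
  obtain Q1 where Q1: "sets Q1 = sets (P \<Otimes>\<^sub>M X)"
    "\<And>f. f \<in> borel_measurable (P \<Otimes>\<^sub>M X) \<Longrightarrow> (\<integral>\<^sup>+w. f w \<partial>Q1) = (\<integral>\<^sup>+\<omega>. \<integral>\<^sup>+x. f (\<omega>, x) \<partial>\<eta> \<omega> \<partial>P)"
    by (rule semidirect_measure[of P \<eta> X]) (use \<eta>_int \<eta>_CM CM_sets in auto)
  obtain Q2 where Q2: "sets Q2 = sets (P \<Otimes>\<^sub>M X)"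
    "\<And>f. f \<in> borel_measurable (P \<Otimes>\<^sub>M X) \<Longrightarrow> (\<integral>\<^sup>+w. f w \<partial>Q2) = (\<integral>\<^sup>+\<omega>. \<integral>\<^sup>+x. f (\<omega>, x) \<partial>L \<partial>P)"
    by (rule semidirect_measure[of P "\<lambda>_. L" X]) (use L_int sL in auto)
  define v1 :: "'b \<times> 'a \<Rightarrow> 'a \<times> 'a measure" where "v1 = (\<lambda>(\<omega>, x). (x, \<eta> \<omega>))"
  define v2 :: "'b \<times> 'a \<Rightarrow> 'a \<times> 'a measure" where "v2 = (\<lambda>(\<omega>, x). (x, add_point (\<eta> \<omega>) x))"
  have v[measurable]: "v1 \<in> P \<Otimes>\<^sub>M X \<rightarrow>\<^sub>M X \<Otimes>\<^sub>M N" "v2 \<in> P \<Otimes>\<^sub>M X \<rightarrow>\<^sub>M X \<Otimes>\<^sub>M N"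
    unfolding v1_def v2_def by measurable
  have v': "v1 \<in> Q1 \<rightarrow>\<^sub>M X \<Otimes>\<^sub>M N" "v2 \<in> Q2 \<rightarrow>\<^sub>M X \<Otimes>\<^sub>M N"
    unfolding measurable_cong_sets[OF Q1(1) refl] measurable_cong_sets[OF Q2(1) refl] by (fact v)+
  \<comment> \<open>\<open>M1\<close> is the Campbell measure of \<eta>; \<open>M2\<close> describes
    a point drawn from \<open>L\<close> together with \<eta> enlarged by that point.\<close>
  define M1 where "M1 = distr Q1 (X \<Otimes>\<^sub>M N) v1"
  define M2 where "M2 = distr Q2 (X \<Otimes>\<^sub>M N) v2"
  have int1: "(\<integral>\<^sup>+w. g w \<partial>M1) = (\<integral>\<^sup>+\<omega>. \<integral>\<^sup>+x. g (x, \<eta> \<omega>) \<partial>\<eta> \<omega> \<partial>P)"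
    if [measurable]: "g \<in> borel_measurable (X \<Otimes>\<^sub>M N)" for g :: "_ \<Rightarrow> ennreal"
    unfolding M1_def using v' by (subst nn_integral_distr) (auto simp: Q1(2) v1_def)
  have int2: "(\<integral>\<^sup>+w. g w \<partial>M2) = (\<integral>\<^sup>+\<omega>. \<integral>\<^sup>+x. g (x, add_point (\<eta> \<omega>) x) \<partial>L \<partial>P)"
    if [measurable]: "g \<in> borel_measurable (X \<Otimes>\<^sub>M N)" for g :: "_ \<Rightarrow> ennreal"
    unfolding M2_def using v' by (subst nn_integral_distr) (auto simp: Q2(2) v2_def)
  have eq: "emeasure M1 (A \<times> D) = emeasure M2 (A \<times> D)"
    and fin: "emeasure M1 (A \<times> D) \<noteq> \<infinity>"
    if A: "A \<in> local_sets X Bn" and D: "D \<in> cylinders" for A D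
  proof -
    have AX: "A \<in> sets X" using local_sets_sets[OF A] .
    obtain I E where I: "D = cylinder I E" "finite I" "I \<subseteq> sets X" "\<forall>B\<in>I. E B \<in> sets borel"
      using D unfolding cylinders_def by blast
    have DN: "D \<in> sets N" using D sets_N by auto
    have AD[measurable]: "A \<times> D \<in> sets (X \<Otimes>\<^sub>M N)" using AX DN by auto
    \<comment> \<open>Including \<open>A\<close> in the family makes it a disjoint union of atoms
      too, so that \<eta>(A) is a sum of independent counts.\<close>
    have "finite (insert A I)" "insert A I \<subseteq> sets X" using I AX by auto
    from finite_atoms_algebra[OF this] obtain n :: nat and C J where
      CJ: "\<forall>i<n. C i \<in> sets X" "disjoint_family_on C {..<n}"
        "\<forall>B\<in>insert A I. J B \<subseteq> {..<n} \<and> B = (\<Union>i\<in>J B. C i)" by (elim exE conjE)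
    have C: "\<And>i. i < n \<Longrightarrow> C i \<in> sets X" "disjoint_family_on C {..<n}" and
      J: "\<And>B. B \<in> insert A I \<Longrightarrow> J B \<subseteq> {..<n}" "\<And>B. B \<in> insert A I \<Longrightarrow> B = (\<Union>i\<in>J B. C i)"
      using CJ by blast+
    have finJ: "finite (J B)" if "B \<in> insert A I" for B
      using J(1)[OF that] finite_subset by blast
    have em_C: "emeasure \<mu> B = (\<Sum>i\<in>J B. emeasure \<mu> (C i))" if "B \<in> insert A I" "sets \<mu> = sets X" for \<mu> B
    proof -
      have "emeasure \<mu> (\<Union>i\<in>J B. C i) = (\<Sum>i\<in>J B. emeasure \<mu> (C i))"
        using J(1)[OF that(1)] C that(2) disjoint_family_on_mono[OF J(1)[OF that(1)] C(2)] finJ[OF that(1)]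
        by (intro sum_emeasure[symmetric]) auto
      then show ?thesis using J(2)[OF that(1)] by simp
    qed
    define V where "V i \<omega> = emeasure (\<eta> \<omega>) (C i)" for i \<omega>
    have ind: "indep_vars (\<lambda>_. borel) V {..<n}"
      using pp C unfolding poisson_process_def V_def by blast
    have pd: "poisson_distributed P (V i) (emeasure L (C i))" if "i < n" for i
      using pp C(1)[OF that] unfolding poisson_process_def V_def by blast
    \<comment> \<open>\<psi> expresses the cylinder event through the counts of the atoms.\<close>
    define \<psi> :: "(nat \<Rightarrow> ennreal) \<Rightarrow> ennreal" where "\<psi> r = (\<Prod>B\<in>I. indicator (E B) (\<Sum>i\<in>J B. r i))" for r
    have \<psi>[measurable]: "\<psi> \<in> borel_measurable (PiM {..<n} (\<lambda>_. borel))"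
      unfolding \<psi>_def
    proof (rule borel_measurable_prod_ennreal)
      fix B assume B: "B \<in> I"
      have "(\<lambda>r. \<Sum>i\<in>J B. r i) \<in> borel_measurable (PiM {..<n} (\<lambda>_. borel :: ennreal measure))"
        using J(1)[of B] B by (intro borel_measurable_sum measurable_component_singleton) auto
      then show "(\<lambda>r. indicator (E B) (\<Sum>i\<in>J B. r i) :: ennreal) \<in> borel_measurable (PiM {..<n} (\<lambda>_. borel))"
        using I(4) B by (intro measurable_compose[OF _ borel_measurable_indicator]) auto
    qed
    have ind_D: "indicator D \<mu> = \<psi> r" if "\<mu> \<in> CM" "\<And>i. i < n \<Longrightarrow> emeasure \<mu> (C i) = r i" for \<mu> r
    proof -
      have "emeasure \<mu> B = (\<Sum>i\<in>J B. r i)" if B: "B \<in> I" for B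
        using em_C[of B \<mu>] B CM_sets[OF \<open>\<mu> \<in> CM\<close>] that J(1)[of B] \<open>\<And>i. i < n \<Longrightarrow> emeasure \<mu> (C i) = r i\<close>
        by (auto intro!: sum.cong)
      then show ?thesis using that(1) I(2) unfolding I(1) \<psi>_def cylinder_def
        by (auto simp: indicator_def prod.If_cases Int_absorb2 intro: prod.neutral)
    qed
    have sub: "C i \<subseteq> A" if "i \<in> J A" for i using J(2)[of A] that by auto
    have Cloc: "C i \<in> local_sets X Bn" if "i \<in> J A" for i
      using local_sets_subset[OF A sub[OF that]] C(1) J(1)[of A] that by auto
    \<comment> \<open>A point added in the atom \<open>C j\<close> raises the count of that atom by
      one and changes no other, which is the effect of the Poisson shift on the arguments of
      \<psi>.\<close>
    have shift: "(\<integral>\<^sup>+\<omega>. V j \<omega> * indicator D (\<eta> \<omega>) \<partial>P) = (\<integral>\<^sup>+\<omega>. \<integral>\<^sup>+x. indicator (C j) x * indicator D (add_point (\<eta> \<omega>) x) \<partial>L \<partial>P)"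
      if j: "j \<in> J A" for j
    proof -
      have jn: "j < n" using j J(1)[of A] by auto
      have "(\<integral>\<^sup>+\<omega>. V j \<omega> * indicator D (\<eta> \<omega>) \<partial>P) = (\<integral>\<^sup>+\<omega>. V j \<omega> * \<psi> (\<lambda>i\<in>{..<n}. V i \<omega>) \<partial>P)"
        by (intro nn_integral_cong arg_cong2[where f="(*)"] refl ind_D \<eta>_CM) (auto simp: V_def)
      also have "\<dots> = emeasure L (C j) * (\<integral>\<^sup>+\<omega>. \<psi> (\<lambda>i\<in>{..<n}. if i = j then V i \<omega> + 1 else V i \<omega>) \<partial>P)"
        using finL[OF Cloc[OF j]] jn by (intro poisson_shift_indep[OF ind jn pd]) auto
      also have "\<dots> = (\<integral>\<^sup>+\<omega>. emeasure L (C j) * \<psi> (\<lambda>i\<in>{..<n}. if i = j then V i \<omega> + 1 else V i \<omega>) \<partial>P)"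
      proof (rule nn_integral_cmult[symmetric], rule measurable_compose[OF _ \<psi>], rule measurable_restrict)
        fix i assume i: "i \<in> {..<n}"
        then have [measurable]: "V i \<in> borel_measurable P" using pd by (simp add: poisson_distributed_def)
        show "(\<lambda>\<omega>. if i = j then V i \<omega> + 1 else V i \<omega>) \<in> borel_measurable P" by measurable
      qed
      also have "\<dots> = (\<integral>\<^sup>+\<omega>. \<integral>\<^sup>+x. indicator (C j) x * indicator D (add_point (\<eta> \<omega>) x) \<partial>L \<partial>P)"
      proof (rule nn_integral_cong)
        fix \<omega> assume \<omega>: "\<omega> \<in> space P"
        have "(\<integral>\<^sup>+x. indicator (C j) x * indicator D (add_point (\<eta> \<omega>) x) \<partial>L)
            = (\<integral>\<^sup>+x. indicator (C j) x * \<psi> (\<lambda>i\<in>{..<n}. if i = j then V i \<omega> + 1 else V i \<omega>) \<partial>L)"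
        proof (rule nn_integral_cong)
          fix x assume x: "x \<in> space L"
          show "indicator (C j) x * indicator D (add_point (\<eta> \<omega>) x) = indicator (C j) x * \<psi> (\<lambda>i\<in>{..<n}. if i = j then V i \<omega> + 1 else V i \<omega>)"
          proof (cases "x \<in> C j")
            case True
            have "indicator D (add_point (\<eta> \<omega>) x) = \<psi> (\<lambda>i\<in>{..<n}. if i = j then V i \<omega> + 1 else V i \<omega>)"
            proof (rule ind_D)
              show "add_point (\<eta> \<omega>) x \<in> CM" using x by (intro add_points_CM \<eta>_CM \<omega>) (auto simp: spL)
              fix i assume i: "i < n"
              have "indicator (C i) x = (if i = j then 1 else 0 :: ennreal)"
                using True C(2) i jn by (auto simp: disjoint_family_on_def indicator_def)
              then show "emeasure (add_point (\<eta> \<omega>) x) (C i) = (\<lambda>i\<in>{..<n}. if i = j then V i \<omega> + 1 else V i \<omega>) i"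
                using x i C(1) by (subst emeasure_add_points[OF \<eta>_CM[OF \<omega>]]) (auto simp: spL V_def)
            qed
            then show ?thesis by simp
          qed simp
        qed
        also have "\<dots> = emeasure L (C j) * \<psi> (\<lambda>i\<in>{..<n}. if i = j then V i \<omega> + 1 else V i \<omega>)"
          using C(1)[OF jn] sL by (subst nn_integral_multc) auto
        finally show "emeasure L (C j) * \<psi> (\<lambda>i\<in>{..<n}. if i = j then V i \<omega> + 1 else V i \<omega>) = 
          (\<integral>\<^sup>+x. indicator (C j) x * indicator D (add_point (\<eta> \<omega>) x) \<partial>L)" ..
      qed
      finally show ?thesis .
    qed
    have V_m[measurable]: "V j \<in> borel_measurable P" if "j \<in> J A" for j
      using pd[of j] J(1)[of A] that by (auto simp: poisson_distributed_def)
    have [measurable]: "D \<in> sets N" "A \<in> sets X" by fact+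
    have ind_A: "indicator A x = (\<Sum>j\<in>J A. indicator (C j) x :: ennreal)" for x
    proof -
      have "indicator A x = (indicator (\<Union>i\<in>J A. C i) x :: ennreal)"
        using J(2)[of A] by (intro arg_cong[where f="\<lambda>B. indicator B x"]) blast
      also have "\<dots> = (\<Sum>j\<in>J A. indicator (C j) x)"
        using J(1)[of A] finJ[of A] disjoint_family_on_mono[OF _ C(2), of "J A"]
        by (intro indicator_UN_disjoint) auto
      finally show ?thesis .
    qed
    have e1: "emeasure M1 (A \<times> D) = (\<integral>\<^sup>+\<omega>. emeasure (\<eta> \<omega>) A * indicator D (\<eta> \<omega>) \<partial>P)"
    proof -
      have "emeasure M1 (A \<times> D) = (\<integral>\<^sup>+w. indicator (A \<times> D) w \<partial>M1)"
        using AD by (simp add: M1_def)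
      also have "\<dots> = (\<integral>\<^sup>+\<omega>. \<integral>\<^sup>+x. indicator (A \<times> D) (x, \<eta> \<omega>) \<partial>\<eta> \<omega> \<partial>P)" by (rule int1) measurable
      also have "\<dots> = (\<integral>\<^sup>+\<omega>. emeasure (\<eta> \<omega>) A * indicator D (\<eta> \<omega>) \<partial>P)"
      proof (rule nn_integral_cong)
        fix \<omega> assume "\<omega> \<in> space P"
        then have "A \<in> sets (\<eta> \<omega>)" using \<eta>_CM CM_sets AX by blast
        then show "(\<integral>\<^sup>+x. indicator (A \<times> D) (x, \<eta> \<omega>) \<partial>\<eta> \<omega>) = emeasure (\<eta> \<omega>) A * indicator D (\<eta> \<omega>)"
          by (simp add: indicator_times nn_integral_multc)
      qed
      finally show ?thesis .
    qed
    also have "\<dots> = (\<integral>\<^sup>+\<omega>. (\<Sum>j\<in>J A. V j \<omega> * indicator D (\<eta> \<omega>)) \<partial>P)"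
      using \<eta>_CM CM_sets by (intro nn_integral_cong) (auto simp: em_C[of A] V_def sum_distrib_right)
    also have "\<dots> = (\<Sum>j\<in>J A. \<integral>\<^sup>+\<omega>. V j \<omega> * indicator D (\<eta> \<omega>) \<partial>P)"
      by (rule nn_integral_sum) measurable
    also have "\<dots> = (\<Sum>j\<in>J A. \<integral>\<^sup>+\<omega>. \<integral>\<^sup>+x. indicator (C j) x * indicator D (add_point (\<eta> \<omega>) x) \<partial>L \<partial>P)"
      by (intro sum.cong refl shift)
    also have "\<dots> = (\<integral>\<^sup>+\<omega>. (\<Sum>j\<in>J A. \<integral>\<^sup>+x. indicator (C j) x * indicator D (add_point (\<eta> \<omega>) x) \<partial>L) \<partial>P)"
    proof (rule nn_integral_sum[symmetric])
      fix j assume "j \<in> J A"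
      then have [measurable]: "C j \<in> sets X" using C(1) J(1)[of A] by auto
      show "(\<lambda>\<omega>. \<integral>\<^sup>+x. indicator (C j) x * indicator D (add_point (\<eta> \<omega>) x) \<partial>L) \<in> borel_measurable P"
        by (rule L_int[of "\<lambda>(\<omega>, x). indicator (C j) x * indicator D (add_point (\<eta> \<omega>) x)", simplified]) measurable
    qed
    also have "\<dots> = (\<integral>\<^sup>+\<omega>. \<integral>\<^sup>+x. indicator (A \<times> D) (x, add_point (\<eta> \<omega>) x) \<partial>L \<partial>P)"
    proof (rule nn_integral_cong)
      fix \<omega> assume \<omega>: "\<omega> \<in> space P"
      have [measurable]: "(\<lambda>x. add_point (\<eta> \<omega>) x) \<in> X \<rightarrow>\<^sub>M N" using \<eta>_CM[OF \<omega>]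
        by (intro measurable_add_points) (auto simp: space_N)
      have "(\<Sum>j\<in>J A. \<integral>\<^sup>+x. indicator (C j) x * indicator D (add_point (\<eta> \<omega>) x) \<partial>L) 
        = (\<integral>\<^sup>+x. (\<Sum>j\<in>J A. indicator (C j) x * indicator D (add_point (\<eta> \<omega>) x)) \<partial>L)"
      proof (rule nn_integral_sum[symmetric])
        fix j assume "j \<in> J A"
        then have [measurable]: "C j \<in> sets X" using C(1) J(1)[of A] by auto
        have "(\<lambda>x. indicator (C j) x * indicator D (add_point (\<eta> \<omega>) x) :: ennreal) \<in> borel_measurable X"
          by measurable
        then show "(\<lambda>x. indicator (C j) x * indicator D (add_point (\<eta> \<omega>) x) :: ennreal) \<in> borel_measurable L"
          unfolding measurable_cong_sets[OF sL refl] .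
      qed
      also have "\<dots> = (\<integral>\<^sup>+x. indicator (A \<times> D) (x, add_point (\<eta> \<omega>) x) \<partial>L)"
        by (intro nn_integral_cong) (simp add: sum_distrib_right[symmetric] ind_A[symmetric] indicator_times)
      finally show "(\<Sum>j\<in>J A. \<integral>\<^sup>+x. indicator (C j) x * indicator D (add_point (\<eta> \<omega>) x) \<partial>L) 
        = (\<integral>\<^sup>+x. indicator (A \<times> D) (x, add_point (\<eta> \<omega>) x) \<partial>L)" .
    qed
    also have "\<dots> = emeasure M2 (A \<times> D)"
    proof -
      have "emeasure M2 (A \<times> D) = (\<integral>\<^sup>+w. indicator (A \<times> D) w \<partial>M2)"
        using AD by (simp add: M2_def)
      also have "\<dots> = (\<integral>\<^sup>+\<omega>. \<integral>\<^sup>+x. indicator (A \<times> D) (x, add_point (\<eta> \<omega>) x) \<partial>L \<partial>P)" by (rule int2) measurable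
      finally show ?thesis by simp
    qed
    finally show "emeasure M1 (A \<times> D) = emeasure M2 (A \<times> D)" .
    have "emeasure M1 (A \<times> D) \<le> (\<integral>\<^sup>+\<omega>. emeasure (\<eta> \<omega>) A \<partial>P)"
      unfolding e1 by (intro nn_integral_mono) (auto simp: indicator_def)
    \<comment> \<open>The Poisson shift with the constant function 1 is the formula for the
      mean.\<close>
    also have "\<dots> = emeasure L A"
      using poisson_shift[of "\<lambda>\<omega>. emeasure (\<eta> \<omega>) A" "emeasure L A" "\<lambda>_. 1"] pp AX finL[OF A]
      by (simp add: poisson_process_def emeasure_space_1)
    also have "\<dots> < \<infinity>" using finL[OF A] .
    finally show "emeasure M1 (A \<times> D) \<noteq> \<infinity>" by simp
  qed
  have CM: "CM \<in> cylinders"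
    unfolding cylinders_def cylinder_def by (intro CollectI exI[of _ "{}"]) auto
  have "M1 = M2"
  proof (rule measure_eqI_generator_eq[where E="{A \<times> D |A D. A \<in> local_sets X Bn \<and> D \<in> cylinders}" 
      and \<Omega>="space X \<times> CM" and A="\<lambda>n. Bn n \<times> CM"])
    show "Int_stable {A \<times> D |A D. A \<in> local_sets X Bn \<and> D \<in> cylinders}"
    proof (rule Int_stableI)
      fix a b assume "a \<in> {A \<times> D |A D. A \<in> local_sets X Bn \<and> D \<in> cylinders}" "b \<in> {A \<times> D |A D. A \<in> local_sets X Bn \<and> D \<in> cylinders}"
      then obtain A D A' D' where *: "a = A \<times> D" "b = A' \<times> D'" "A \<in> local_sets X Bn" "D \<in> cylinders" 
        "A' \<in> local_sets X Bn" "D' \<in> cylinders" by auto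
      then have "A \<inter> A' \<in> local_sets X Bn" using local_sets_subset[OF *(3), of "A \<inter> A'"] local_sets_sets by auto
      then show "a \<inter> b \<in> {A \<times> D |A D. A \<in> local_sets X Bn \<and> D \<in> cylinders}"
        using * cylinders_Int by (auto simp: Times_Int_Times)
    qed
    show "{A \<times> D |A D. A \<in> local_sets X Bn \<and> D \<in> cylinders} \<subseteq> Pow (space X \<times> CM)"
      using local_sets_sets sets.sets_into_space by (fastforce simp: cylinders_def cylinder_def)
    show "sets M1 = sigma_sets (space X \<times> CM) {A \<times> D |A D. A \<in> local_sets X Bn \<and> D \<in> cylinders}"
      "sets M2 = sigma_sets (space X \<times> CM) {A \<times> D |A D. A \<in> local_sets X Bn \<and> D \<in> cylinders}"
      by (simp_all add: M1_def M2_def sets_X_N)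
    show "(\<Union>n. Bn n \<times> CM) = space X \<times> CM" using Bn_UN by auto
    show "range (\<lambda>n. Bn n \<times> CM) \<subseteq> {A \<times> D |A D. A \<in> local_sets X Bn \<and> D \<in> cylinders}"
      using CM Bn_local by blast
  qed (use eq fin CM Bn_local in auto)
  then show ?thesis using int1[OF f] int2[OF f] by simp
qed

end

section \<open>The Mecke formula for factorial measures\<close>

definition inj_tuples :: "nat \<Rightarrow> 'b set \<Rightarrow> (nat \<Rightarrow> 'b) set" where
  "inj_tuples m S = {p \<in> {..<m} \<rightarrow>\<^sub>E S. inj_on p {..<m}}"

section \<open>Tuples of pairwise distinct labels\<close>

lemma inj_tuples_0: "inj_tuples 0 S = {\<lambda>_. undefined}"
  by (auto simp: inj_tuples_def)

lemma bij_betw_inj_tuples_Suc: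
  "bij_betw (\<lambda>(p, q). p(m := q)) (SIGMA p:inj_tuples m S. S - p ` {..<m}) (inj_tuples (Suc m) S)"
proof (rule bij_betwI[where g="\<lambda>r. (restrict r {..<m}, r m)"])
  show "(\<lambda>(p, q). p(m := q)) \<in> (SIGMA p:inj_tuples m S. S - p ` {..<m}) \<rightarrow> inj_tuples (Suc m) S"
  proof (rule funcsetI, clarify)
    fix p q assume p: "p \<in> inj_tuples m S" and q: "q \<in> S" "q \<notin> p ` {..<m}"
    have "inj_on p (insert m {..<m} - {m})" using p by (simp add: inj_tuples_def)
    then have "inj_on (p(m := q)) (insert m {..<m})"
      using p q by (auto simp: inj_tuples_def inj_on_insert inj_on_fun_updI)
    then show "p(m := q) \<in> inj_tuples (Suc m) S"
      using p q by (auto simp: inj_tuples_def lessThan_Suc intro!: PiE_fun_upd)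
  qed
  show "(\<lambda>r. (restrict r {..<m}, r m)) \<in> inj_tuples (Suc m) S \<rightarrow> (SIGMA p:inj_tuples m S. S - p ` {..<m})"
  proof (rule funcsetI)
    fix r assume r: "r \<in> inj_tuples (Suc m) S"
    then have "inj_on r (insert m {..<m})" "r \<in> insert m {..<m} \<rightarrow>\<^sub>E S" 
      by (auto simp: inj_tuples_def lessThan_Suc)
    then show "(restrict r {..<m}, r m) \<in> (SIGMA p:inj_tuples m S. S - p ` {..<m})"
      unfolding inj_on_insert by (auto simp: inj_tuples_def PiE_iff)
  qed
  fix w assume w: "w \<in> (SIGMA p:inj_tuples m S. S - p ` {..<m})"
  then show "(restrict (case w of (p, q) \<Rightarrow> p(m := q)) {..<m}, (case w of (p, q) \<Rightarrow> p(m := q)) m) = w"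
    by (auto simp: inj_tuples_def PiE_iff extensional_def fun_eq_iff)
next
  fix r assume r: "r \<in> inj_tuples (Suc m) S"
  then show "(case (restrict r {..<m}, r m) of (p, q) \<Rightarrow> p(m := q)) = r"
    by (auto simp: inj_tuples_def PiE_iff extensional_def fun_eq_iff)
qed

lemma nn_integral_count_space_Sigma:
  "(\<integral>\<^sup>+w. h w \<partial>count_space (Sigma A B)) = (\<integral>\<^sup>+p. \<integral>\<^sup>+q. h (p, q) \<partial>count_space (B p) \<partial>count_space A)"
proof -
  have "(\<integral>\<^sup>+w. h w \<partial>count_space (Sigma A B)) = (\<integral>\<^sup>+w. h w * indicator (Sigma A B) w \<partial>count_space UNIV)"
    by (simp add: nn_integral_count_space_indicator)
  also have "\<dots> = (\<integral>\<^sup>+p. \<integral>\<^sup>+q. h (p, q) * indicator (Sigma A B) (p, q) \<partial>count_space UNIV \<partial>count_space UNIV)"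
    by (rule nn_integral_fst_count_space[symmetric])
  also have "\<dots> = (\<integral>\<^sup>+p. (\<integral>\<^sup>+q. h (p, q) * indicator (B p) q \<partial>count_space UNIV) * indicator A p \<partial>count_space UNIV)"
    by (intro nn_integral_cong) (auto simp: indicator_def intro!: nn_integral_cong)
  also have "\<dots> = (\<integral>\<^sup>+p. \<integral>\<^sup>+q. h (p, q) \<partial>count_space (B p) \<partial>count_space A)"
    by (simp add: nn_integral_count_space_indicator)
  finally show ?thesis .
qed

text \<open>Subtraction in \<open>ennreal\<close> inverts addition only for finite subtrahends,
  whence the finiteness of h on the removed set.\<close>

lemma nn_integral_count_space_Diff:
  fixes h :: "'b \<Rightarrow> ennreal"
  assumes F: "finite F" "F \<subseteq> S" and h: "\<And>q. q \<in> F \<Longrightarrow> h q < \<infinity>"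
  shows "(\<integral>\<^sup>+q. h q \<partial>count_space (S - F)) = (\<integral>\<^sup>+q. h q \<partial>count_space S) - (\<Sum>q\<in>F. h q)"
proof -
  have "(\<integral>\<^sup>+q. h q \<partial>count_space S) = (\<integral>\<^sup>+q. h q * indicator (S - F) q + h q * indicator F q \<partial>count_space UNIV)"
    using F by (subst nn_integral_count_space_indicator) (auto simp: indicator_def intro!: nn_integral_cong)
  also have "\<dots> = (\<integral>\<^sup>+q. h q \<partial>count_space (S - F)) + (\<integral>\<^sup>+q. h q \<partial>count_space F)"
    by (subst nn_integral_add) (auto simp: nn_integral_count_space_indicator)
  also have "(\<integral>\<^sup>+q. h q \<partial>count_space F) = (\<Sum>q\<in>F. h q)"
    using F by (simp add: nn_integral_count_space_finite)
  finally have *: "(\<integral>\<^sup>+q. h q \<partial>count_space S) = (\<integral>\<^sup>+q. h q \<partial>count_space (S - F)) + (\<Sum>q\<in>F. h q)" .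
  have "(\<Sum>q\<in>F. h q) \<noteq> \<top>" using h F(1) by (simp add: less_top)
  then show ?thesis unfolding * by (rule ennreal_add_diff_cancel_right[symmetric])
qed

lemma nn_integral_add_measure:
  assumes s: "sets \<psi> = sets \<mu>" and f: "f \<in> borel_measurable \<mu>"
  shows "(\<integral>\<^sup>+x. f x \<partial>add_measure \<mu> \<psi>) = (\<integral>\<^sup>+x. f x \<partial>\<mu>) + (\<integral>\<^sup>+x. f x \<partial>\<psi>)"
proof -
  have m: "borel_measurable \<psi> = (borel_measurable \<mu> :: (_ \<Rightarrow> ennreal) set)"
    "borel_measurable (add_measure \<mu> \<psi>) = (borel_measurable \<mu> :: (_ \<Rightarrow> ennreal) set)"
    by (rule measurable_cong_sets[OF s refl], rule measurable_cong_sets[OF sets_add_measure refl])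
  have sp: "space \<psi> = space \<mu>" using sets_eq_imp_space_eq[OF s] .
  show ?thesis using f
  proof induction
    case (cong f g)
    have "(\<integral>\<^sup>+x. f x \<partial>\<nu>) = (\<integral>\<^sup>+x. g x \<partial>\<nu>)" if "space \<nu> = space \<mu>" for \<nu>
      using cong that by (intro nn_integral_cong) auto
    from this[of \<mu>] this[of \<psi>] this[of "add_measure \<mu> \<psi>"] show ?case using cong(4) sp by simp
  next
    case (set A)
    then show ?case using s by (simp add: emeasure_add_measure)
  next
    case (mult u c)
    then show ?case by (simp add: nn_integral_cmult m distrib_left)
  next
    case (add u v)
    then show ?case by (simp add: nn_integral_add m ac_simps)
  next
    case (seq U)
    have mono: "(\<integral>\<^sup>+x. (SUP i. U i) x \<partial>\<nu>) = (SUP i. \<integral>\<^sup>+x. U i x \<partial>\<nu>)"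
      if "borel_measurable \<nu> = (borel_measurable \<mu> :: (_ \<Rightarrow> ennreal) set)" for \<nu>
    proof -
      have "U i \<in> borel_measurable \<nu>" for i unfolding that by (rule seq(1))
      then show ?thesis using nn_integral_monotone_convergence_SUP[OF seq(3), of \<nu>]
        by (simp add: image_comp SUP_apply)
    qed
    have inc: "incseq (\<lambda>i. \<integral>\<^sup>+x. U i x \<partial>\<nu>)" for \<nu>
      using seq(3) by (auto simp: incseq_def le_fun_def intro!: nn_integral_mono)
    show ?case unfolding mono[OF refl] mono[OF m(1)] mono[OF m(2)] seq(5)
      by (rule ennreal_SUP_add[OF inc inc])
  qed
qed

section \<open>Factorial measures of a counting measure as sums over tuples of labels\<close>

context localized_borel_space
begin

lemma nn_integral_add_points:
  assumes \<mu>: "\<mu> \<in> CM" and J: "finite J" "x ` J \<subseteq> space X" and h: "h \<in> borel_measurable X"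
  shows "(\<integral>\<^sup>+y. h y \<partial>add_points \<mu> J x) = (\<integral>\<^sup>+y. h y \<partial>\<mu>) + (\<Sum>j\<in>J. h (x j))"
proof -
  have "h \<in> borel_measurable \<mu>" using h unfolding measurable_cong_sets[OF CM_sets[OF \<mu>] refl] .
  moreover have "(\<integral>\<^sup>+y. h y \<partial>distr (count_space J) X x) = (\<Sum>j\<in>J. h (x j))"
    using J h by (subst nn_integral_distr) (auto simp: nn_integral_count_space_finite)
  ultimately show ?thesis
    unfolding add_points_def by (subst nn_integral_add_measure) (auto simp: CM_sets[OF \<mu>])
qed

abbreviation XP :: "nat \<Rightarrow> (nat \<Rightarrow> 'a) measure" where
  "XP m \<equiv> PiM {..<m} (\<lambda>_. X)"

lemma factorial_measure_sets: "\<mu> \<in> CM \<Longrightarrow> sets (factorial_measure m \<mu>) = sets (XP m)"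
  unfolding factorial_measure_def by (simp add: CM_sets cong: sets_PiM_cong)

lemma measurable_inj_tuples:
  "\<mu> \<in> CM \<Longrightarrow> (\<lambda>p. \<lambda>i\<in>{..<m}. fst (p i)) \<in> count_space (inj_tuples m (labelled_points \<mu>)) \<rightarrow>\<^sub>M XP m"
proof (rule measurable_count_space_eq1[THEN iffD2], rule funcsetI)
  fix p assume \<mu>: "\<mu> \<in> CM" and p: "p \<in> inj_tuples m (labelled_points \<mu>)"
  then have "fst (p i) \<in> space X" if "i < m" for i
    using that CM_space[OF \<mu>] by (auto simp: inj_tuples_def labelled_points_def PiE_def Pi_def split_beta)
  then show "(\<lambda>i\<in>{..<m}. fst (p i)) \<in> space (XP m)" by (simp add: space_PiM PiE_def Pi_def)
qed

lemma nn_integral_factorial_measure: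
  assumes \<mu>: "\<mu> \<in> CM" and f: "f \<in> borel_measurable (XP m)"
  shows "(\<integral>\<^sup>+x. f x \<partial>factorial_measure m \<mu>)
    = (\<integral>\<^sup>+p. f (\<lambda>i\<in>{..<m}. fst (p i)) \<partial>count_space (inj_tuples m (labelled_points \<mu>)))"
proof -
  have s: "sets (power_measure \<mu> m) = sets (XP m)" using CM_sets[OF \<mu>] by (intro sets_PiM_cong) auto
  have "(\<lambda>p. \<lambda>i\<in>{..<m}. fst (p i)) \<in> count_space (inj_tuples m (labelled_points \<mu>)) \<rightarrow>\<^sub>M power_measure \<mu> m"
    using measurable_inj_tuples[OF \<mu>] unfolding measurable_cong_sets[OF refl s] .
  moreover have "f \<in> borel_measurable (power_measure \<mu> m)"
    using f unfolding measurable_cong_sets[OF s refl] .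
  ultimately show ?thesis
    unfolding factorial_measure_def inj_tuples_def[symmetric] by (subst nn_integral_distr) auto
qed

lemma measurable_XP_upd:
  "f \<in> M \<rightarrow>\<^sub>M XP m \<Longrightarrow> g \<in> M \<rightarrow>\<^sub>M X \<Longrightarrow> (\<lambda>w. (f w)(m := g w)) \<in> M \<rightarrow>\<^sub>M XP (Suc m)"
  by (rule measurable_fun_upd) auto

lemma measurable_add_tuple[measurable (raw)]:
  "K \<in> M \<rightarrow>\<^sub>M N \<Longrightarrow> x \<in> M \<rightarrow>\<^sub>M XP m \<Longrightarrow> (\<lambda>w. add_points (K w) {..<m} (x w)) \<in> M \<rightarrow>\<^sub>M N"
  by (rule measurable_add_points) (auto intro: measurable_compose[OF _ measurable_component_singleton])

lemma nn_integral_factorial_measure_0: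
  assumes \<mu>: "\<mu> \<in> CM" and f: "f \<in> borel_measurable (XP 0)"
  shows "(\<integral>\<^sup>+x. f x \<partial>factorial_measure 0 \<mu>) = f (\<lambda>_. undefined)"
  using nn_integral_factorial_measure[OF \<mu> f] by (simp add: inj_tuples_0 nn_integral_count_space_finite)

text \<open>Given the first m labels, the last coordinate runs over \<mu> with these m labels
  deleted. Labels are deleted and not positions, so a point of multiplicity r loses one unit for
  each of its labels already used.\<close>

lemma nn_integral_factorial_measure_Suc:
  assumes \<mu>: "\<mu> \<in> CM" and g[measurable]: "g \<in> borel_measurable (XP (Suc m))" and fin: "\<And>x. g x < \<infinity>"
  shows "(\<integral>\<^sup>+x. g x \<partial>factorial_measure (Suc m) \<mu>)
    = (\<integral>\<^sup>+x. (\<integral>\<^sup>+y. g (x(m := y)) \<partial>\<mu>) - (\<Sum>i<m. g (x(m := x i))) \<partial>factorial_measure m \<mu>)"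
proof -
  let ?S = "labelled_points \<mu>"
  define x where "x p = (\<lambda>i\<in>{..<m}. fst (p i))" for p :: "nat \<Rightarrow> 'a \<times> nat"
  note measurable_XP_upd[measurable (raw)]
  have [measurable]: "(\<lambda>w. \<mu>) \<in> XP m \<rightarrow>\<^sub>M N" using \<mu> by (simp add: space_N)
  have "(\<integral>\<^sup>+x. g x \<partial>factorial_measure (Suc m) \<mu>)
    = (\<integral>\<^sup>+r. g (\<lambda>i\<in>{..<Suc m}. fst (r i)) \<partial>count_space (inj_tuples (Suc m) ?S))"
    by (rule nn_integral_factorial_measure[OF \<mu> g])
  also have "\<dots> = (\<integral>\<^sup>+w. g (\<lambda>i\<in>{..<Suc m}. fst ((case w of (p, q) \<Rightarrow> p(m := q)) i)) \<partial>count_space (SIGMA p:inj_tuples m ?S. ?S - p ` {..<m}))"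
    by (rule nn_integral_bij_count_space[OF bij_betw_inj_tuples_Suc, symmetric])
  also have "\<dots> = (\<integral>\<^sup>+p. \<integral>\<^sup>+q. g ((x p)(m := fst q)) \<partial>count_space (?S - p ` {..<m}) \<partial>count_space (inj_tuples m ?S))"
    unfolding nn_integral_count_space_Sigma
    by (intro nn_integral_cong arg_cong[where f=g]) (auto simp: x_def fun_eq_iff)
  also have "\<dots> = (\<integral>\<^sup>+p. (\<integral>\<^sup>+y. g ((x p)(m := y)) \<partial>\<mu>) - (\<Sum>i<m. g ((x p)(m := x p i))) \<partial>count_space (inj_tuples m ?S))"
  proof (rule nn_integral_cong)
    fix p assume "p \<in> space (count_space (inj_tuples m ?S))"
    then have p: "p \<in> inj_tuples m ?S" by simp
    have xp: "x p \<in> space (XP m)" using measurable_space[OF measurable_inj_tuples[OF \<mu>]] p by (auto simp: x_def)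
    have "(\<integral>\<^sup>+q. g ((x p)(m := fst q)) \<partial>count_space (?S - p ` {..<m}))
      = (\<integral>\<^sup>+q. g ((x p)(m := fst q)) \<partial>count_space ?S) - (\<Sum>q\<in>p ` {..<m}. g ((x p)(m := fst q)))"
      using p fin by (intro nn_integral_count_space_Diff) (auto simp: inj_tuples_def)
    also have "(\<Sum>q\<in>p ` {..<m}. g ((x p)(m := fst q))) = (\<Sum>i<m. g ((x p)(m := x p i)))"
      using p by (subst sum.reindex) (auto simp: inj_tuples_def x_def)
    also have "(\<integral>\<^sup>+q. g ((x p)(m := fst q)) \<partial>count_space ?S) = (\<integral>\<^sup>+y. g ((x p)(m := y)) \<partial>\<mu>)"
      using xp by (intro nn_integral_labelled_points[OF \<mu>, symmetric]) measurable
    finally show "(\<integral>\<^sup>+q. g ((x p)(m := fst q)) \<partial>count_space (?S - p ` {..<m}))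
      = (\<integral>\<^sup>+y. g ((x p)(m := y)) \<partial>\<mu>) - (\<Sum>i<m. g ((x p)(m := x p i)))" .
  qed
  also have "\<dots> = (\<integral>\<^sup>+x. (\<integral>\<^sup>+y. g (x(m := y)) \<partial>\<mu>) - (\<Sum>i<m. g (x(m := x i))) \<partial>factorial_measure m \<mu>)"
    unfolding x_def
  proof (rule nn_integral_factorial_measure[OF \<mu>, symmetric])
    have [measurable]: "(\<lambda>x. \<integral>\<^sup>+y. g (x(m := y)) \<partial>\<mu>) \<in> borel_measurable (XP m)"
      by (rule nn_integral_measurable_N) measurable
    show "(\<lambda>x. (\<integral>\<^sup>+y. g (x(m := y)) \<partial>\<mu>) - (\<Sum>i<m. g (x(m := x i)))) \<in> borel_measurable (XP m)"
      by measurable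
  qed
  finally show ?thesis .
qed

section \<open>Boxes and measurable dependence of factorial measures on the configuration\<close>

abbreviation box :: "nat \<Rightarrow> 'a set \<Rightarrow> (nat \<Rightarrow> 'a) set" where
  "box m B \<equiv> PiE {..<m} (\<lambda>_. B)"

lemma box_sets[measurable]: "B \<in> sets X \<Longrightarrow> box m B \<in> sets (XP m)"
  by (intro sets_PiM_I_finite) auto

lemma incseq_box: "incseq (\<lambda>n. box m (Bn n))"
  using Bn_mono by (auto simp: incseq_def PiE_iff)

lemma UN_box: "(\<Union>n. box m (Bn n)) = space (XP m)"
proof
  show "space (XP m) \<subseteq> (\<Union>n. box m (Bn n))"
  proof
    fix x assume x: "x \<in> space (XP m)"
    then have "\<forall>i\<in>{..<m}. \<exists>n. x i \<in> Bn n" using Bn_UN by (auto simp: space_PiM PiE_iff)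
    then obtain n where n: "\<And>i. i < m \<Longrightarrow> x i \<in> Bn (n i)" by (metis lessThan_iff)
    \<comment> \<open>The sum of the indices serves as a common upper bound for all of them.\<close>
    have "x i \<in> Bn (\<Sum>i<m. n i)" if "i < m" for i
      using Bn_mono[of "n i" "\<Sum>i<m. n i"] n[OF that] that by (auto intro: member_le_sum)
    then have "x \<in> box m (Bn (\<Sum>i<m. n i))" using x by (auto simp: space_PiM PiE_iff)
    then show "x \<in> (\<Union>n. box m (Bn n))" by blast
  qed
qed (use sets.sets_into_space[OF Bn_sets] in \<open>auto simp: space_PiM PiE_iff\<close>)

text \<open>Dropping the distinctness of the entries leaves all m-tuples from the finite set of
  labels over \<open>B\<close>.\<close>

lemma factorial_measure_box:
  assumes \<mu>: "\<mu> \<in> CM" and B: "B \<in> local_sets X Bn"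
  shows "emeasure (factorial_measure m \<mu>) (box m B) \<le> emeasure \<mu> B ^ m"
proof -
  define F where "F = {q \<in> labelled_points \<mu>. fst q \<in> B}"
  have F: "finite F" "emeasure \<mu> B = of_nat (card F)"
    using labelled_points_local[OF \<mu> B] by (auto simp: F_def)
  have BX: "box m B \<in> sets (XP m)" using local_sets_sets[OF B] by auto
  have "emeasure (factorial_measure m \<mu>) (box m B) = (\<integral>\<^sup>+x. indicator (box m B) x \<partial>factorial_measure m \<mu>)"
    using BX factorial_measure_sets[OF \<mu>] by simp
  also have "\<dots> = (\<integral>\<^sup>+p. indicator (box m B) (\<lambda>i\<in>{..<m}. fst (p i)) \<partial>count_space (inj_tuples m (labelled_points \<mu>)))"
    using BX by (intro nn_integral_factorial_measure[OF \<mu>]) auto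
  also have "\<dots> = (\<integral>\<^sup>+p. indicator (box m B) (\<lambda>i\<in>{..<m}. fst (p i)) * indicator (inj_tuples m (labelled_points \<mu>)) p \<partial>count_space UNIV)"
    by (rule nn_integral_count_space_indicator) simp
  also have "\<dots> \<le> (\<integral>\<^sup>+p. indicator (PiE {..<m} (\<lambda>_. F)) p \<partial>count_space UNIV)"
    by (intro nn_integral_mono) (auto simp: indicator_def inj_tuples_def F_def PiE_iff split: if_splits)
  also have "\<dots> = of_nat (card (PiE {..<m} (\<lambda>_. F)))"
    using F by (simp add: finite_PiE)
  also have "\<dots> = emeasure \<mu> B ^ m" using F by (simp add: card_PiE)
  finally show ?thesis .
qed

text \<open>Measurability of the masses in \<mu> enters as a hypothesis, so that the lemma for order
  m is available inside the induction step that proves this measurability for order m + 1.\<close>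

lemma measurable_factorial_kernel:
  assumes em: "\<And>E. E \<in> sets (XP m) \<Longrightarrow> (\<lambda>\<mu>. emeasure (factorial_measure m \<mu>) E) \<in> borel_measurable N"
    and K: "K \<in> M \<rightarrow>\<^sub>M N"
    and f: "(\<lambda>(b, x). f b x) \<in> borel_measurable (M \<Otimes>\<^sub>M XP m)"
  shows "(\<lambda>b. \<integral>\<^sup>+x. f b x \<partial>factorial_measure m (K b)) \<in> borel_measurable M"
proof (rule nn_integral_measurable_kernel[OF _ _ _ incseq_box UN_box _ f])
  have K': "K b \<in> CM" if "b \<in> space M" for b using measurable_space[OF K that] by (simp add: space_N)
  show "sets (factorial_measure m (K b)) = sets (XP m)" if "b \<in> space M" for b
    using K'[OF that] factorial_measure_sets by auto
  show "emeasure (factorial_measure m (K b)) (box m (Bn n)) < \<infinity>" if "b \<in> space M" for b n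
  proof -
    have "emeasure (K b) (Bn n) ^ m < \<infinity>"
      using CM_finite[OF K'[OF that] Bn_local] by (simp add: power_less_top_ennreal)
    then show ?thesis using factorial_measure_box[OF K'[OF that] Bn_local] by (rule le_less_trans[rotated])
  qed
  show "(\<lambda>b. emeasure (factorial_measure m (K b)) A) \<in> borel_measurable M" if "A \<in> sets (XP m)" for A
    using measurable_compose[OF K em[OF that]] .
qed auto

text \<open>Induction along the recursion that removes the last coordinate: the integrand left over
  is jointly measurable in \<mu> and the first m coordinates.\<close>

lemma measurable_emeasure_factorial:
  "E \<in> sets (XP m) \<Longrightarrow> (\<lambda>\<mu>. emeasure (factorial_measure m \<mu>) E) \<in> borel_measurable N"
proof (induction m arbitrary: E)
  case 0
  have "emeasure (factorial_measure 0 \<mu>) E = indicator E (\<lambda>_. undefined)" if "\<mu> \<in> space N" for \<mu>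
    using nn_integral_factorial_measure_0[of \<mu> "indicator E"] that 0 factorial_measure_sets[of \<mu> 0]
    by (simp add: space_N)
  then show ?case by (simp cong: measurable_cong)
next
  case (Suc m)
  note [measurable] = Suc.prems measurable_XP_upd[measurable (raw)]
  let ?g = "\<lambda>\<mu> x. (\<integral>\<^sup>+y. indicator E (x(m := y)) \<partial>\<mu>) - (\<Sum>i<m. indicator E (x(m := x i))) :: ennreal"
  have "emeasure (factorial_measure (Suc m) \<mu>) E = (\<integral>\<^sup>+x. ?g \<mu> x \<partial>factorial_measure m \<mu>)" if "\<mu> \<in> space N" for \<mu>
  proof -
    have "indicator E x < (\<infinity> :: ennreal)" for x by (simp add: indicator_def)
    then show ?thesis
      using nn_integral_factorial_measure_Suc[of \<mu> "indicator E" m] that Suc.prems factorial_measure_sets[of \<mu> "Suc m"]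
      by (simp add: space_N)
  qed
  moreover have "(\<lambda>\<mu>. \<integral>\<^sup>+x. ?g \<mu> x \<partial>factorial_measure m \<mu>) \<in> borel_measurable N"
  proof (rule measurable_factorial_kernel[OF Suc.IH, where K="\<lambda>\<mu>. \<mu>"])
    have [measurable]: "(\<lambda>w. \<integral>\<^sup>+y. indicator E ((snd w)(m := y)) \<partial>fst w) \<in> borel_measurable (N \<Otimes>\<^sub>M XP m)"
      by (rule nn_integral_measurable_N) measurable
    show "(\<lambda>(\<mu>, x). ?g \<mu> x) \<in> borel_measurable (N \<Otimes>\<^sub>M XP m)"
      unfolding split_beta' by measurable
  qed auto
  ultimately show ?case by (simp cong: measurable_cong)
qed

lemma measurable_factorial:
  assumes "K \<in> M \<rightarrow>\<^sub>M N" "(\<lambda>(b, x). f b x) \<in> borel_measurable (M \<Otimes>\<^sub>M XP m)"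
  shows "(\<lambda>b. \<integral>\<^sup>+x. f b x \<partial>factorial_measure m (K b)) \<in> borel_measurable M"
  by (rule measurable_factorial_kernel[OF measurable_emeasure_factorial assms])

end

text \<open>\<open>Q\<close> is the law of the process on the space of configurations, and what is
  kept of the Poisson property is the Mecke formula. Working with the law leaves the randomization
  aside: every set-valued map below is a function of the configuration alone.\<close>

locale poisson_law = localized_borel_space X Bn + prob_space Q
  for X :: "'a measure" and Bn and Q :: "'a measure measure" +
  fixes L :: "'a measure"
  assumes locally_finite: "locally_finite_measure X Bn L"
    and sets_Q[measurable_cong]: "sets Q = sets N"
    and mecke: "\<And>f. (\<lambda>(x, \<mu>). f x \<mu>) \<in> borel_measurable (X \<Otimes>\<^sub>M N) \<Longrightarrow>
      (\<integral>\<^sup>+\<mu>. \<integral>\<^sup>+x. f x \<mu> \<partial>\<mu> \<partial>Q) = (\<integral>\<^sup>+\<mu>. \<integral>\<^sup>+x. f x (add_point \<mu> x) \<partial>L \<partial>Q)"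
begin

lemma sets_L[measurable_cong]: "sets L = sets X"
  using locally_finite by (simp add: locally_finite_measure_def)

lemma L_finite: "C \<in> local_sets X Bn \<Longrightarrow> emeasure L C < \<infinity>"
  using locally_finite by (simp add: locally_finite_measure_def)

lemma space_L: "space L = space X" using sets_eq_imp_space_eq[OF sets_L] .

lemma space_Q: "space Q = CM" using sets_eq_imp_space_eq[OF sets_Q] by (simp add: space_N)

sublocale L: sigma_finite_measure L
proof
  show "\<exists>A. countable A \<and> A \<subseteq> sets L \<and> \<Union> A = space L \<and> (\<forall>a\<in>A. emeasure L a \<noteq> \<infinity>)"
    using L_finite[OF Bn_local] Bn_UN by (intro exI[of _ "range Bn"]) (auto simp: sets_L space_L less_top[symmetric])
qed

sublocale LP: product_sigma_finite "\<lambda>_ :: nat. L"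
  by unfold_locales

lemma sets_LP[measurable_cong]: "sets (PiM I (\<lambda>_. L)) = sets (PiM I (\<lambda>_. X))"
  by (intro sets_PiM_cong sets_L refl)

lemma space_LP: "space (PiM I (\<lambda>_. L)) = space (PiM I (\<lambda>_. X))"
  using sets_eq_imp_space_eq[OF sets_LP] .

lemma sigma_finite_LP: "finite I \<Longrightarrow> sigma_finite_measure (PiM I (\<lambda>_ :: nat. L))"
  by (rule LP.sigma_finite)

lemma add_points_Suc:
  assumes \<mu>: "\<mu> \<in> CM" and x: "x \<in> space (XP m)" and y: "y \<in> space X"
  shows "add_points (add_point \<mu> y) {..<m} x = add_points \<mu> {..<Suc m} (x(m := y))"
proof -
  have x': "x ` {..<m} \<subseteq> space X" using x by (auto simp: space_PiM PiE_iff)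
  have c: "add_point \<mu> y \<in> CM" using \<mu> y by (intro add_points_CM) auto
  have xy: "(x(m := y)) ` {..<Suc m} \<subseteq> space X" using x' y by (auto simp: less_Suc_eq)
  show ?thesis
  proof (rule CM_eqI)
    fix A assume A: "A \<in> sets X"
    have "(\<Sum>j<m. indicator A ((x(m := y)) j)) = (\<Sum>j<m. indicator A (x j) :: ennreal)"
      by (intro sum.cong) auto
    then show "emeasure (add_points (add_point \<mu> y) {..<m} x) A = emeasure (add_points \<mu> {..<Suc m} (x(m := y))) A"
      using x' y A by (simp add: emeasure_add_points[OF c _ x'] emeasure_add_points[OF \<mu> _ xy]
          emeasure_add_points[OF \<mu>] ac_simps)
  qed (use add_points_CM[OF c _ x'] add_points_CM[OF \<mu> _ xy] in auto)
qed

text \<open>The recursion isolates an integral of the last coordinate against \<mu>. The induction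
  hypothesis replaces the first m points by points added from \<open>L\<close>, and the one-point
  formula then treats the last one.\<close>

lemma mecke_factorial_Suc:
  assumes IH: "\<And>f. (\<lambda>(x, \<mu>). f x \<mu>) \<in> borel_measurable (XP m \<Otimes>\<^sub>M N) \<Longrightarrow>
      (\<integral>\<^sup>+\<mu>. \<integral>\<^sup>+x. f x \<mu> \<partial>factorial_measure m \<mu> \<partial>Q)
        = (\<integral>\<^sup>+\<mu>. \<integral>\<^sup>+x. f x (add_points \<mu> {..<m} x) \<partial>power_measure L m \<partial>Q)"
    and f[measurable]: "(\<lambda>(x, \<mu>). f x \<mu>) \<in> borel_measurable (XP (Suc m) \<Otimes>\<^sub>M N)"
    and fin: "\<And>x \<mu>. f x \<mu> < \<infinity>"
  shows "(\<integral>\<^sup>+\<mu>. \<integral>\<^sup>+x. f x \<mu> \<partial>factorial_measure (Suc m) \<mu> \<partial>Q)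
        = (\<integral>\<^sup>+\<mu>. \<integral>\<^sup>+x. f x (add_points \<mu> {..<Suc m} x) \<partial>power_measure L (Suc m) \<partial>Q)"
proof -
  note [measurable (raw)] = measurable_XP_upd
  interpret LPm: sigma_finite_measure "power_measure L m" by (rule sigma_finite_LP) simp
  interpret F: pair_sigma_finite Q "power_measure L m" ..
  have f1: "(\<lambda>w. f (g w) (h w)) \<in> borel_measurable M"
    if "g \<in> M \<rightarrow>\<^sub>M XP (Suc m)" "h \<in> M \<rightarrow>\<^sub>M N" for g h and M :: "'z measure"
    using measurable_compose[OF measurable_Pair[OF that] f] by simp
  have f2: "(\<lambda>w. f (g w) (h w)) \<in> borel_measurable M"
    if "g \<in> M \<rightarrow>\<^sub>M XP (Suc m)" "h \<in> M \<rightarrow>\<^sub>M N" for g h and M :: "(nat \<Rightarrow> 'a) measure"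
    using measurable_compose[OF measurable_Pair[OF that] f] by simp
  let ?g = "\<lambda>x \<mu>. (\<integral>\<^sup>+y. f (x(m := y)) \<mu> \<partial>\<mu>) - (\<Sum>i<m. f (x(m := x i)) \<mu>)"
  let ?h = "\<lambda>x \<mu>. (\<integral>\<^sup>+y. f (x(m := y)) (add_points \<mu> {..<m} x) \<partial>\<mu>)"
  let ?h' = "\<lambda>x \<mu>. (\<integral>\<^sup>+y. f (x(m := y)) (add_points \<mu> {..<Suc m} (x(m := y))) \<partial>L)"
  have "(\<integral>\<^sup>+\<mu>. \<integral>\<^sup>+x. f x \<mu> \<partial>factorial_measure (Suc m) \<mu> \<partial>Q) = (\<integral>\<^sup>+\<mu>. \<integral>\<^sup>+x. ?g x \<mu> \<partial>factorial_measure m \<mu> \<partial>Q)"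
  proof (rule nn_integral_cong)
    fix \<mu> assume "\<mu> \<in> space Q"
    then have \<mu>: "\<mu> \<in> CM" by (simp add: space_Q)
    then have "(\<lambda>x. f x \<mu>) \<in> borel_measurable (XP (Suc m))" by (intro f2) (auto simp: space_N)
    from nn_integral_factorial_measure_Suc[OF \<mu> this fin]
    show "(\<integral>\<^sup>+x. f x \<mu> \<partial>factorial_measure (Suc m) \<mu>) = (\<integral>\<^sup>+x. ?g x \<mu> \<partial>factorial_measure m \<mu>)" .
  qed
  also have "\<dots> = (\<integral>\<^sup>+\<mu>. \<integral>\<^sup>+x. ?g x (add_points \<mu> {..<m} x) \<partial>power_measure L m \<partial>Q)"
  proof (rule IH)
    have [measurable]: "(\<lambda>w. \<integral>\<^sup>+y. f ((fst w)(m := y)) (snd w) \<partial>snd w) \<in> borel_measurable (XP m \<Otimes>\<^sub>M N)"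
      by (rule nn_integral_measurable_N) measurable
    show "(\<lambda>(x, \<mu>). ?g x \<mu>) \<in> borel_measurable (XP m \<Otimes>\<^sub>M N)"
      unfolding split_beta' by measurable
  qed
  \<comment> \<open>The integral against the enlarged measure contains one term for each of the m
    added points, and these are exactly the terms that the recursion subtracts. An integral against
    \<mu> alone remains.\<close>
  also have "\<dots> = (\<integral>\<^sup>+\<mu>. \<integral>\<^sup>+x. ?h x \<mu> \<partial>power_measure L m \<partial>Q)"
  proof (intro nn_integral_cong)
    fix \<mu> x assume "\<mu> \<in> space Q" and "x \<in> space (power_measure L m)"
    then have \<mu>: "\<mu> \<in> CM" and x: "x \<in> space (XP m)" by (simp_all add: space_Q space_LP)
    then have x': "x ` {..<m} \<subseteq> space X" by (auto simp: space_PiM PiE_iff)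
    have [measurable]: "add_points \<mu> {..<m} x \<in> space N" using \<mu> x' by (simp add: add_points_CM space_N)
    have [measurable]: "(\<lambda>y. f (x(m := y)) (add_points \<mu> {..<m} x)) \<in> borel_measurable X"
      using x by measurable
    show "?g x (add_points \<mu> {..<m} x) = ?h x \<mu>"
      using fin by (subst nn_integral_add_points[OF \<mu> _ x']) 
        (auto simp: ennreal_add_diff_cancel_right less_top[symmetric] ennreal_sum_less_top)
  qed
  \<comment> \<open>The order is exchanged so that the one-point formula acts with the tuple x
    frozen.\<close>
  also have "\<dots> = (\<integral>\<^sup>+x. \<integral>\<^sup>+\<mu>. ?h x \<mu> \<partial>Q \<partial>power_measure L m)"
  proof (rule F.Fubini'[symmetric])
    have "(\<lambda>w. \<integral>\<^sup>+y. f ((snd w)(m := y)) (add_points (fst w) {..<m} (snd w)) \<partial>fst w) \<in> borel_measurable (N \<Otimes>\<^sub>M XP m)"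
      by (rule nn_integral_measurable_N) measurable
    then show "(\<lambda>(\<mu>, x). ?h x \<mu>) \<in> borel_measurable (Q \<Otimes>\<^sub>M power_measure L m)"
      unfolding split_beta' by measurable
  qed
  also have "\<dots> = (\<integral>\<^sup>+x. \<integral>\<^sup>+\<mu>. ?h' x \<mu> \<partial>Q \<partial>power_measure L m)"
  proof (rule nn_integral_cong)
    fix x assume "x \<in> space (power_measure L m)"
    then have x[measurable]: "x \<in> space (XP m)" by (simp add: space_LP)
    have "(\<integral>\<^sup>+\<mu>. ?h x \<mu> \<partial>Q) = (\<integral>\<^sup>+\<mu>. \<integral>\<^sup>+y. f (x(m := y)) (add_points (add_point \<mu> y) {..<m} x) \<partial>L \<partial>Q)"
      by (rule mecke) measurable
    also have "\<dots> = (\<integral>\<^sup>+\<mu>. ?h' x \<mu> \<partial>Q)"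
      using x by (intro nn_integral_cong) (auto simp: space_Q space_L add_points_Suc)
    finally show "(\<integral>\<^sup>+\<mu>. ?h x \<mu> \<partial>Q) = (\<integral>\<^sup>+\<mu>. ?h' x \<mu> \<partial>Q)" .
  qed
  also have "\<dots> = (\<integral>\<^sup>+\<mu>. \<integral>\<^sup>+x. ?h' x \<mu> \<partial>power_measure L m \<partial>Q)"
    by (rule F.Fubini') measurable
  also have "\<dots> = (\<integral>\<^sup>+\<mu>. \<integral>\<^sup>+x. f x (add_points \<mu> {..<Suc m} x) \<partial>power_measure L (Suc m) \<partial>Q)"
  proof (rule nn_integral_cong)
    fix \<mu> assume "\<mu> \<in> space Q"
    then have [measurable]: "\<mu> \<in> space N" by (simp add: space_Q space_N)
    have "(\<lambda>x. f x (add_points \<mu> {..<Suc m} x)) \<in> borel_measurable (XP (Suc m))"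
      by measurable
    then show "(\<integral>\<^sup>+x. ?h' x \<mu> \<partial>power_measure L m) = (\<integral>\<^sup>+x. f x (add_points \<mu> {..<Suc m} x) \<partial>power_measure L (Suc m))"
      unfolding lessThan_Suc
      by (intro LP.product_nn_integral_insert[symmetric])
        (auto simp: measurable_cong_sets[OF sets_LP refl])
  qed
  finally show ?thesis .
qed

text \<open>The subtraction in the recursion needs finite integrands, so f is first capped at n;
  monotone convergence on both sides removes the cap.\<close>

theorem mecke_factorial:
  assumes "(\<lambda>(x, \<mu>). f x \<mu>) \<in> borel_measurable (XP m \<Otimes>\<^sub>M N)"
  shows "(\<integral>\<^sup>+\<mu>. \<integral>\<^sup>+x. f x \<mu> \<partial>factorial_measure m \<mu> \<partial>Q)
    = (\<integral>\<^sup>+\<mu>. \<integral>\<^sup>+x. f x (add_points \<mu> {..<m} x) \<partial>power_measure L m \<partial>Q)"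
  using assms
proof (induction m arbitrary: f)
  case 0
  show ?case
  proof (rule nn_integral_cong)
    fix \<mu> assume "\<mu> \<in> space Q"
    then have \<mu>: "\<mu> \<in> CM" by (simp add: space_Q)
    have [measurable]: "(\<lambda>x. f x \<mu>) \<in> borel_measurable (XP 0)"
      using measurable_Pair1[OF 0] \<mu> by (simp add: space_N)
    have "add_points \<mu> {} x = \<mu>" for x :: "nat \<Rightarrow> 'a" using \<mu> by (intro CM_eqI add_points_CM) (auto simp: emeasure_add_points)
    then show "(\<integral>\<^sup>+x. f x \<mu> \<partial>factorial_measure 0 \<mu>) = (\<integral>\<^sup>+x. f x (add_points \<mu> {..<0} x) \<partial>power_measure L 0)"
      by (subst nn_integral_factorial_measure_0[OF \<mu>]) (auto simp: PiM_empty nn_integral_count_space_finite)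
  qed
next
  case (Suc m)
  let ?f = "\<lambda>n x \<mu>. min (f x \<mu>) (of_nat n)"
  note Suc.prems[measurable]
  have f_n[measurable]: "(\<lambda>(x, \<mu>). ?f n x \<mu>) \<in> borel_measurable (XP (Suc m) \<Otimes>\<^sub>M N)" for n
    unfolding split_beta' using Suc.prems by (intro borel_measurable_min) (auto simp: split_beta')
  have step: "(\<integral>\<^sup>+\<mu>. \<integral>\<^sup>+x. ?f n x \<mu> \<partial>factorial_measure (Suc m) \<mu> \<partial>Q)
    = (\<integral>\<^sup>+\<mu>. \<integral>\<^sup>+x. ?f n x (add_points \<mu> {..<Suc m} x) \<partial>power_measure L (Suc m) \<partial>Q)" for n
    by (rule mecke_factorial_Suc[OF Suc.IH f_n]) (auto simp: min_less_iff_disj of_nat_less_top)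
  have SUP_f: "(SUP n. ?f n x \<mu>) = f x \<mu>" for x \<mu>
  proof (rule antisym)
    show "f x \<mu> \<le> (SUP n. ?f n x \<mu>)"
    proof (cases "f x \<mu> = \<top>")
      case True
      have "min \<top> (of_nat n) = (of_nat n :: ennreal)" for n by (rule min_absorb2) simp
      then show ?thesis by (simp only: True ennreal_SUP_of_nat_eq_top order_refl)
    next
      case False
      then obtain n where "f x \<mu> \<le> of_nat n" using ennreal_Ex_less_of_nat[of "f x \<mu>"] by (auto simp: less_top intro: less_imp_le)
      then show ?thesis by (intro SUP_upper2[of n]) auto
    qed
  qed (auto intro: SUP_least)
  have mono: "incseq (\<lambda>n. min c (of_nat n :: ennreal))" for c by (auto simp: incseq_def intro: min.coboundedI2)
  have lhs: "(\<integral>\<^sup>+\<mu>. \<integral>\<^sup>+x. f x \<mu> \<partial>factorial_measure (Suc m) \<mu> \<partial>Q) = (SUP n. \<integral>\<^sup>+\<mu>. \<integral>\<^sup>+x. ?f n x \<mu> \<partial>factorial_measure (Suc m) \<mu> \<partial>Q)"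
  proof (subst nn_integral_monotone_convergence_SUP[symmetric])
    show "(\<lambda>\<mu>. \<integral>\<^sup>+x. ?f n x \<mu> \<partial>factorial_measure (Suc m) \<mu>) \<in> borel_measurable Q" for n
      unfolding measurable_cong_sets[OF sets_Q refl]
      using measurable_compose[OF _ f_n[of n], of "\<lambda>w. (snd w, fst w)" "N \<Otimes>\<^sub>M XP (Suc m)"]
      by (intro measurable_factorial) (simp_all add: split_beta')
    show "(\<integral>\<^sup>+\<mu>. \<integral>\<^sup>+x. f x \<mu> \<partial>factorial_measure (Suc m) \<mu> \<partial>Q) = (\<integral>\<^sup>+\<mu>. (SUP n. \<integral>\<^sup>+x. ?f n x \<mu> \<partial>factorial_measure (Suc m) \<mu>) \<partial>Q)"
    proof (rule nn_integral_cong)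
      fix \<mu> assume "\<mu> \<in> space Q"
      then have \<mu>: "\<mu> \<in> CM" by (simp add: space_Q)
      have m: "(\<lambda>x. ?f n x \<mu>) \<in> borel_measurable (XP (Suc m))" for n
        using measurable_Pair1[OF f_n] \<mu> by (simp add: space_N)
      have "(SUP n. \<integral>\<^sup>+x. ?f n x \<mu> \<partial>factorial_measure (Suc m) \<mu>) = (\<integral>\<^sup>+x. (SUP n. ?f n x \<mu>) \<partial>factorial_measure (Suc m) \<mu>)"
        using m mono by (intro nn_integral_monotone_convergence_SUP[symmetric])
          (auto simp: measurable_cong_sets[OF factorial_measure_sets[OF \<mu>] refl] incseq_def le_fun_def)
      then show "(\<integral>\<^sup>+x. f x \<mu> \<partial>factorial_measure (Suc m) \<mu>) = (SUP n. \<integral>\<^sup>+x. ?f n x \<mu> \<partial>factorial_measure (Suc m) \<mu>)"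
        by (simp only: SUP_f)
    qed
  qed (use mono in \<open>auto simp: incseq_def le_fun_def intro!: nn_integral_mono\<close>)
  have [measurable]: "(\<lambda>(\<mu>, x). ?f n x (add_points \<mu> {..<Suc m} x)) \<in> borel_measurable (N \<Otimes>\<^sub>M XP (Suc m))" for n
    using measurable_compose[OF _ f_n[of n], of "\<lambda>w. (snd w, add_points (fst w) {..<Suc m} (snd w))" "N \<Otimes>\<^sub>M XP (Suc m)"]
    by (simp add: split_beta')
  interpret LPm: sigma_finite_measure "power_measure L (Suc m)" by (rule sigma_finite_LP) simp
  have rhs: "(\<integral>\<^sup>+\<mu>. \<integral>\<^sup>+x. f x (add_points \<mu> {..<Suc m} x) \<partial>power_measure L (Suc m) \<partial>Q)
    = (SUP n. \<integral>\<^sup>+\<mu>. \<integral>\<^sup>+x. ?f n x (add_points \<mu> {..<Suc m} x) \<partial>power_measure L (Suc m) \<partial>Q)"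
  proof (subst nn_integral_monotone_convergence_SUP[symmetric])
    show "(\<lambda>\<mu>. \<integral>\<^sup>+x. ?f n x (add_points \<mu> {..<Suc m} x) \<partial>power_measure L (Suc m)) \<in> borel_measurable Q" for n
      by measurable
    show "(\<integral>\<^sup>+\<mu>. \<integral>\<^sup>+x. f x (add_points \<mu> {..<Suc m} x) \<partial>power_measure L (Suc m) \<partial>Q)
      = (\<integral>\<^sup>+\<mu>. (SUP n. \<integral>\<^sup>+x. ?f n x (add_points \<mu> {..<Suc m} x) \<partial>power_measure L (Suc m)) \<partial>Q)"
    proof (rule nn_integral_cong)
      fix \<mu> assume "\<mu> \<in> space Q"
      then have [measurable]: "\<mu> \<in> space N" by (simp add: space_Q space_N)
      have "(SUP n. \<integral>\<^sup>+x. ?f n x (add_points \<mu> {..<Suc m} x) \<partial>power_measure L (Suc m)) 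
        = (\<integral>\<^sup>+x. (SUP n. ?f n x (add_points \<mu> {..<Suc m} x)) \<partial>power_measure L (Suc m))"
      proof (rule nn_integral_monotone_convergence_SUP[symmetric])
        show "(\<lambda>x. ?f n x (add_points \<mu> {..<Suc m} x)) \<in> borel_measurable (power_measure L (Suc m))" for n
          by measurable
      qed (use mono in \<open>auto simp: incseq_def le_fun_def\<close>)
      then show "(\<integral>\<^sup>+x. f x (add_points \<mu> {..<Suc m} x) \<partial>power_measure L (Suc m)) 
        = (SUP n. \<integral>\<^sup>+x. ?f n x (add_points \<mu> {..<Suc m} x) \<partial>power_measure L (Suc m))"
        by (simp only: SUP_f)
    qed
  qed (use mono in \<open>auto simp: incseq_def le_fun_def intro!: nn_integral_mono\<close>)
  show ?case unfolding lhs rhs step ..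
qed

end

section \<open>Differences of multiple integrals\<close>

text \<open>Expand the product over i in \<open>K\<close> of 1 + c i, with c i = 0 on
  \<open>N\<close> and c i = -1 elsewhere: the set \<open>J\<close> collects the factors that
  contribute 1. The product is 0 as soon as some i lies outside \<open>N\<close>.\<close>

lemma sum_supersets_alternating:
  assumes K: "finite K" and N: "N \<subseteq> K"
  shows "(\<Sum>J\<in>Pow K. if N \<subseteq> J then (-1) ^ (card K - card J) else 0 :: real) = (if N = K then 1 else 0)"
proof -
  have "(\<Sum>J\<in>Pow K. if N \<subseteq> J then (-1) ^ (card K - card J) else 0 :: real)
    = (\<Sum>J\<in>Pow K. (\<Prod>i\<in>J. 1) * (\<Prod>i\<in>K - J. if i \<in> N then 0 else -1))"
  proof (rule sum.cong[OF refl])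
    fix J assume J: "J \<in> Pow K"
    have fin: "finite (K - J)" using K by auto
    show "(if N \<subseteq> J then (-1) ^ (card K - card J) else 0 :: real) = (\<Prod>i\<in>J. 1) * (\<Prod>i\<in>K - J. if i \<in> N then 0 else -1)"
    proof (cases "N \<subseteq> J")
      case True
      then have "(\<Prod>i\<in>K - J. if i \<in> N then 0 else -1 :: real) = (\<Prod>i\<in>K - J. -1)"
        by (intro prod.cong) auto
      also have "\<dots> = (-1) ^ (card K - card J)"
        using J K by (simp add: card_Diff_subset finite_subset)
      finally show ?thesis using True by simp
    next
      case False
      then have "\<exists>i\<in>K - J. (if i \<in> N then 0 else -1 :: real) = 0" using N by auto
      then have "(\<Prod>i\<in>K - J. if i \<in> N then 0 else -1 :: real) = 0" using fin by (auto simp: prod_zero_iff)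
      then show ?thesis using False by simp
    qed
  qed
  also have "\<dots> = (\<Prod>i\<in>K. 1 + (if i \<in> N then 0 else -1))"
    using prod_add[OF K, of "\<lambda>_. 1 :: real" "\<lambda>i. if i \<in> N then 0 else -1"] by simp
  also have "\<dots> = (if N = K then 1 else 0)"
  proof (cases "N = K")
    case False
    then obtain i where "i \<in> K" "i \<notin> N" using N by auto
    then show ?thesis using False K by (auto simp: prod_zero_iff)
  qed (simp add: prod.neutral)
  finally show ?thesis .
qed

lemma finite_inj_tuples: "finite S \<Longrightarrow> finite (inj_tuples i S)"
  unfolding inj_tuples_def by (rule finite_subset[of _ "{..<i} \<rightarrow>\<^sub>E S"]) (auto intro: finite_PiE)

text \<open>Bijections between fibres of equal size are glued. It serves to match labels sitting at
  the same position when no canonical matching exists.\<close>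

lemma fibre_bijection:
  assumes A: "finite A" and B: "finite B"
    and card: "\<And>c. card {a\<in>A. f a = c} = card {b\<in>B. g b = c}"
  shows "\<exists>h. bij_betw h A B \<and> (\<forall>a\<in>A. g (h a) = f a)"
proof -
  have "\<exists>h. bij_betw h {a\<in>A. f a = c} {b\<in>B. g b = c}" for c
    using A B card by (intro finite_same_card_bij) auto
  then obtain h where h: "\<And>c. bij_betw (h c) {a\<in>A. f a = c} {b\<in>B. g b = c}" by metis
  have hB: "h (f a) a \<in> B \<and> g (h (f a) a) = f a" if "a \<in> A" for a
    using bij_betwE[OF h[of "f a"]] that by auto
  have "bij_betw (\<lambda>a. h (f a) a) A B"
  proof (rule bij_betw_imageI)
    show "inj_on (\<lambda>a. h (f a) a) A"
    proof (rule inj_onI)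
      fix a a' assume aa: "a \<in> A" "a' \<in> A" "h (f a) a = h (f a') a'"
      then have "f a = f a'" using hB by metis
      then show "a = a'" using aa bij_betw_imp_inj_on[OF h[of "f a"]] by (auto dest: inj_onD)
    qed
    show "(\<lambda>a. h (f a) a) ` A = B"
    proof
      show "B \<subseteq> (\<lambda>a. h (f a) a) ` A"
      proof
        fix b assume b: "b \<in> B"
        then have "b \<in> h (g b) ` {a\<in>A. f a = g b}" using bij_betw_imp_surj_on[OF h[of "g b"]] by auto
        then obtain a where "a \<in> A" "f a = g b" "b = h (g b) a" by auto
        then show "b \<in> (\<lambda>a. h (f a) a) ` A" by (intro image_eqI[of _ _ a]) auto
      qed
    qed (use hB in auto)
  qed
  then show ?thesis using hB by (intro exI[of _ "\<lambda>a. h (f a) a"]) auto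
qed

lemma bij_betw_inj_tuples:
  assumes h: "bij_betw h A B"
  shows "bij_betw (\<lambda>p. \<lambda>j\<in>{..<i}. h (p j)) (inj_tuples i A) (inj_tuples i B)"
proof -
  have into: "(\<lambda>j\<in>{..<i}. h (p j)) \<in> inj_tuples i B" if "bij_betw h A B" "p \<in> inj_tuples i A" for h p and A :: "'x set" and B :: "'y set"
  proof -
    have p: "p \<in> {..<i} \<rightarrow>\<^sub>E A" "inj_on p {..<i}" using that(2) by (auto simp: inj_tuples_def)
    have "inj_on (\<lambda>j. h (p j)) {..<i}"
      using p bij_betw_imp_inj_on[OF that(1)] by (auto simp: inj_on_def PiE_def Pi_def)
    then have "inj_on (\<lambda>j\<in>{..<i}. h (p j)) {..<i}" by (simp add: inj_on_restrict_eq)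
    moreover have "(\<lambda>j\<in>{..<i}. h (p j)) \<in> {..<i} \<rightarrow>\<^sub>E B"
      using p bij_betwE[OF that(1)] by (auto simp: PiE_def Pi_def)
    ultimately show ?thesis by (simp add: inj_tuples_def)
  qed
  define g where "g = inv_into A h"
  have g: "bij_betw g B A" unfolding g_def by (rule bij_betw_inv_into[OF h])
  have gh: "g (h a) = a" if "a \<in> A" for a unfolding g_def using bij_betw_inv_into_left[OF h that] .
  have hg: "h (g b) = b" if "b \<in> B" for b unfolding g_def using bij_betw_inv_into_right[OF h that] .
  have ext: "(\<lambda>j\<in>{..<i}. p j) = p" "\<And>j. j < i \<Longrightarrow> p j \<in> A" if "p \<in> inj_tuples i A" for p and A :: "'x set"
    using that by (auto simp: inj_tuples_def PiE_def extensional_restrict)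
  show ?thesis
  proof (rule bij_betwI[where g="\<lambda>p. \<lambda>j\<in>{..<i}. g (p j)"])
    fix p assume p: "p \<in> inj_tuples i A"
    show "(\<lambda>j\<in>{..<i}. g ((\<lambda>j\<in>{..<i}. h (p j)) j)) = p"
      using ext[OF p] gh by (auto simp: fun_eq_iff restrict_def split: if_splits)
  next
    fix p assume p: "p \<in> inj_tuples i B"
    show "(\<lambda>j\<in>{..<i}. h ((\<lambda>j\<in>{..<i}. g (p j)) j)) = p"
      using ext[OF p] hg by (auto simp: fun_eq_iff restrict_def split: if_splits)
  qed (use into[OF h] into[OF g] in auto)
qed

text \<open>A tuple of k distinct entries which contains all k labels \<open>Inr j\<close> has no
  room for any other entry, so it is a permutation of them.\<close>

lemma inj_tuples_onto:
  "{p \<in> inj_tuples k (Inl ` F \<union> Inr ` {..<k}). {j\<in>{..<k}. Inr j \<in> p ` {..<k}} = {..<k}}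
    = (\<lambda>\<pi>. \<lambda>j\<in>{..<k}. Inr (\<pi> j)) ` {\<pi>. \<pi> permutes {..<k}}" (is "?T = ?R")
proof
  show "?R \<subseteq> ?T"
  proof
    fix p assume "p \<in> ?R"
    then obtain \<pi> where \<pi>: "\<pi> permutes {..<k}" and p: "p = (\<lambda>j\<in>{..<k}. Inr (\<pi> j))" by auto
    have "p ` {..<k} = Inr ` \<pi> ` {..<k}" unfolding p by (auto simp: image_image)
    also have "\<dots> = Inr ` {..<k}" using permutes_image[OF \<pi>] by simp
    finally have im: "p ` {..<k} = Inr ` {..<k}" .
    have "inj_on p {..<k}" using permutes_inj[OF \<pi>] unfolding p by (auto simp: inj_on_def inj_def)
    moreover have "p \<in> {..<k} \<rightarrow>\<^sub>E Inl ` F \<union> Inr ` {..<k}" using im unfolding p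
      by (auto simp: PiE_def Pi_def)
    ultimately show "p \<in> ?T" using im by (auto simp: inj_tuples_def)
  qed
  show "?T \<subseteq> ?R"
  proof
    fix p assume p: "p \<in> ?T"
    then have p1: "p \<in> {..<k} \<rightarrow>\<^sub>E Inl ` F \<union> Inr ` {..<k}" "inj_on p {..<k}"
      and sub: "Inr ` {..<k} \<subseteq> p ` {..<k}" by (auto simp: inj_tuples_def)
    have "card (p ` {..<k}) = card (Inr ` {..<k} :: ('a + nat) set)"
      using p1(2) by (simp add: card_image)
    then have im: "p ` {..<k} = Inr ` {..<k}" using sub card_subset_eq[OF _ sub] by simp
    define \<pi> where "\<pi> j = (if j < k then projr (p j) else j)" for j
    have pj: "p j = Inr (\<pi> j)" "\<pi> j < k" if "j < k" for j
    proof -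
      have "p j \<in> Inr ` {..<k}" using im that by blast
      then show "p j = Inr (\<pi> j)" "\<pi> j < k" using that by (auto simp: \<pi>_def)
    qed
    have "inj_on \<pi> {..<k}"
      using p1(2) pj by (auto simp: inj_on_def)
    moreover have "\<pi> ` {..<k} \<subseteq> {..<k}" using pj by auto
    ultimately have "bij_betw \<pi> {..<k} {..<k}"
      by (simp add: bij_betw_def endo_inj_surj)
    then have "\<pi> permutes {..<k}" by (intro bij_imp_permutes) (auto simp: \<pi>_def)
    moreover have "p = (\<lambda>j\<in>{..<k}. Inr (\<pi> j))"
      using p1(1) pj by (auto simp: fun_eq_iff PiE_def extensional_def)
    ultimately show "p \<in> ?R" by auto
  qed
qed

text \<open>Summing with alternating signs over the sets \<open>J\<close> of admitted labels \<open>Inr j\<close> singles out the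
  tuples which use all of them.\<close>

lemma alternating_sum_inj_tuples:
  fixes A :: "nat \<Rightarrow> (nat \<Rightarrow> 'b + nat) \<Rightarrow> real" and c :: "nat \<Rightarrow> real"
  assumes F: "finite F"
  shows "(\<Sum>J\<in>Pow {..<k}. (-1) ^ (k - card J) * (\<Sum>i\<le>k. c i * (\<Sum>p\<in>inj_tuples i (Inl ` F \<union> Inr ` J). A i p)))
    = c k * (\<Sum>\<pi> | \<pi> permutes {..<k}. A k (\<lambda>j\<in>{..<k}. Inr (\<pi> j)))"
proof -
  define T where "T i = inj_tuples i (Inl ` F \<union> Inr ` {..<k})" for i
  \<comment> \<open>The set of new labels occurring in p: exchanging the sums leaves, for each p, an
    alternating sum over the supersets \<open>J\<close> of this set.\<close>
  define N where "N i p = {j\<in>{..<k}. Inr j \<in> p ` {..<i}}" for i and p :: "nat \<Rightarrow> 'b + nat"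
  have finT: "finite (T i)" for i unfolding T_def using F by (intro finite_inj_tuples) auto
  have TJ: "inj_tuples i (Inl ` F \<union> Inr ` J) = {p\<in>T i. N i p \<subseteq> J}" if J: "J \<in> Pow {..<k}" for i J
  proof (intro set_eqI iffI)
    fix p assume "p \<in> inj_tuples i (Inl ` F \<union> Inr ` J)"
    then have p: "inj_on p {..<i}" "p \<in> extensional {..<i}" "\<And>j. j < i \<Longrightarrow> p j \<in> Inl ` F \<union> Inr ` J"
      by (auto simp: inj_tuples_def PiE_def)
    have "Inl ` F \<union> Inr ` J \<subseteq> Inl ` F \<union> Inr ` {..<k}" using J by blast
    then have "p j \<in> Inl ` F \<union> Inr ` {..<k}" if "j < i" for j using p(3)[OF that] by blast
    then have "p \<in> T i" using p(1,2) by (simp add: inj_tuples_def PiE_def Pi_def T_def)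
    moreover have "N i p \<subseteq> J"
    proof
      fix j assume "j \<in> N i p"
      then obtain l where l: "l < i" "Inr j = p l" by (auto simp: N_def)
      then show "j \<in> J" using p(3)[OF l(1)] by auto
    qed
    ultimately show "p \<in> {p\<in>T i. N i p \<subseteq> J}" by simp
  next
    fix p assume "p \<in> {p\<in>T i. N i p \<subseteq> J}"
    then have p: "inj_on p {..<i}" "p \<in> extensional {..<i}" "\<And>j. j < i \<Longrightarrow> p j \<in> Inl ` F \<union> Inr ` {..<k}" "N i p \<subseteq> J"
      by (auto simp: inj_tuples_def PiE_def T_def)
    have "p j \<in> Inl ` F \<union> Inr ` J" if j: "j < i" for j
    proof (cases "p j")
      case (Inr l)
      then have "l < k" using p(3)[OF j] by auto
      moreover have "Inr l \<in> p ` {..<i}" using Inr j by (metis imageI lessThan_iff)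
      ultimately have "l \<in> N i p" by (simp add: N_def)
      then show ?thesis using p(4) Inr by auto
    qed (use p(3)[OF j] in auto)
    then show "p \<in> inj_tuples i (Inl ` F \<union> Inr ` J)" using p by (auto simp: inj_tuples_def PiE_def)
  qed
  have "(\<Sum>J\<in>Pow {..<k}. (-1) ^ (k - card J) * (\<Sum>i\<le>k. c i * (\<Sum>p\<in>inj_tuples i (Inl ` F \<union> Inr ` J). A i p)))
    = (\<Sum>J\<in>Pow {..<k}. \<Sum>i\<le>k. \<Sum>p\<in>T i. c i * A i p * (if N i p \<subseteq> J then (-1) ^ (k - card J) else 0))"
  proof (rule sum.cong[OF refl])
    fix J assume J: "J \<in> Pow {..<k}"
    have "(\<Sum>p\<in>inj_tuples i (Inl ` F \<union> Inr ` J). A i p) = (\<Sum>p\<in>T i. if N i p \<subseteq> J then A i p else 0)" for i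
      unfolding TJ[OF J] using finT by (simp add: sum.inter_filter)
    then show "(-1) ^ (k - card J) * (\<Sum>i\<le>k. c i * (\<Sum>p\<in>inj_tuples i (Inl ` F \<union> Inr ` J). A i p))
      = (\<Sum>i\<le>k. \<Sum>p\<in>T i. c i * A i p * (if N i p \<subseteq> J then (-1) ^ (k - card J) else 0))"
      by (auto simp: sum_distrib_left intro!: sum.cong)
  qed
  also have "\<dots> = (\<Sum>i\<le>k. \<Sum>p\<in>T i. c i * A i p * (\<Sum>J\<in>Pow {..<k}. if N i p \<subseteq> J then (-1) ^ (k - card J) else 0))"
    by (subst sum.swap, intro sum.cong[OF refl], subst sum.swap) (simp add: sum_distrib_left)
  also have "\<dots> = (\<Sum>i\<le>k. \<Sum>p\<in>T i. c i * A i p * (if N i p = {..<k} then 1 else 0))"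
  proof (intro sum.cong[OF refl])
    fix i p
    have "N i p \<subseteq> {..<k}" by (auto simp: N_def)
    from sum_supersets_alternating[OF finite_lessThan this]
    have "(\<Sum>J\<in>Pow {..<k}. if N i p \<subseteq> J then (-1) ^ (k - card J) else 0 :: real) = (if N i p = {..<k} then 1 else 0)"
      by (simp only: card_lessThan)
    then show "c i * A i p * (\<Sum>J\<in>Pow {..<k}. if N i p \<subseteq> J then (-1) ^ (k - card J) else 0)
      = c i * A i p * (if N i p = {..<k} then 1 else 0)" by (simp only:)
  qed
  \<comment> \<open>A tuple with fewer than k entries cannot contain k distinct labels, so only the
    order i = k survives.\<close>
  also have "\<dots> = (\<Sum>i\<in>{k}. \<Sum>p\<in>T i. c i * A i p * (if N i p = {..<k} then 1 else 0))"
  proof (rule sum.mono_neutral_right)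
    show "\<forall>i\<in>{..k} - {k}. (\<Sum>p\<in>T i. c i * A i p * (if N i p = {..<k} then 1 else 0)) = 0"
    proof
      fix i assume i: "i \<in> {..k} - {k}"
      have "N i p \<noteq> {..<k}" for p
      proof
        assume "N i p = {..<k}"
        then have "Inr ` {..<k} \<subseteq> p ` {..<i}" by (auto simp: N_def)
        then have "card (Inr ` {..<k} :: ('b + nat) set) \<le> card (p ` {..<i})" by (intro card_mono) auto
        also have "\<dots> \<le> i" using card_image_le[of "{..<i}" p] by simp
        finally show False using i by (simp add: card_image)
      qed
      then show "(\<Sum>p\<in>T i. c i * A i p * (if N i p = {..<k} then 1 else 0)) = 0" by simp
    qed
  qed auto
  also have "\<dots> = c k * (\<Sum>p\<in>{p\<in>T k. N k p = {..<k}}. A k p)"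
    using finT by (simp add: sum.inter_filter sum_distrib_left if_distrib cong: if_cong)
  also have "{p\<in>T k. N k p = {..<k}} = (\<lambda>\<pi>. \<lambda>j\<in>{..<k}. Inr (\<pi> j)) ` {\<pi>. \<pi> permutes {..<k}}"
    unfolding T_def N_def by (rule inj_tuples_onto)
  also have "(\<Sum>p\<in>(\<lambda>\<pi>. \<lambda>j\<in>{..<k}. Inr (\<pi> j)) ` {\<pi>. \<pi> permutes {..<k}}. A k p)
    = (\<Sum>\<pi> | \<pi> permutes {..<k}. A k (\<lambda>j\<in>{..<k}. Inr (\<pi> j)))"
  proof (subst sum.reindex)
    show "inj_on (\<lambda>\<pi>. \<lambda>j\<in>{..<k}. Inr (\<pi> j) :: 'b + nat) {\<pi>. \<pi> permutes {..<k}}"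
    proof (rule inj_onI)
      fix \<pi> \<sigma> assume *: "\<pi> \<in> {\<pi>. \<pi> permutes {..<k}}" "\<sigma> \<in> {\<pi>. \<pi> permutes {..<k}}"
        and eq: "(\<lambda>j\<in>{..<k}. Inr (\<pi> j) :: 'b + nat) = (\<lambda>j\<in>{..<k}. Inr (\<sigma> j))"
      show "\<pi> = \<sigma>"
      proof
        fix j show "\<pi> j = \<sigma> j"
        proof (cases "j < k")
          case True
          then show ?thesis using fun_cong[OF eq, of j] by simp
        next
          case False
          then have "\<pi> j = j" "\<sigma> j = j" using * by (auto intro: permutes_not_in)
          then show ?thesis by simp
        qed
      qed
    qed
  qed simp
  finally show ?thesis .
qed

text \<open>The integral is the difference of the integrals of the two parts where the integrand is
  integrable and has the default value 0 elsewhere; the case distinction is itself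
  measurable.\<close>

lemma measurable_integral_kernel:
  fixes f :: "'b \<Rightarrow> 'c \<Rightarrow> real"
  assumes K: "\<And>f. (\<lambda>(b, z). f b z) \<in> borel_measurable (M \<Otimes>\<^sub>M S) \<Longrightarrow>
      (\<lambda>b. \<integral>\<^sup>+z. f b z \<partial>K b :: ennreal) \<in> borel_measurable M"
    and sets_K: "\<And>b. b \<in> space M \<Longrightarrow> sets (K b) = sets S"
    and f[measurable]: "(\<lambda>(b, z). f b z) \<in> borel_measurable (M \<Otimes>\<^sub>M S)"
  shows "(\<lambda>b. \<integral>z. f b z \<partial>K b) \<in> borel_measurable M"
proof -
  have [measurable]: "(\<lambda>b. \<integral>\<^sup>+z. ennreal (f b z) \<partial>K b) \<in> borel_measurable M"
    "(\<lambda>b. \<integral>\<^sup>+z. ennreal (- f b z) \<partial>K b) \<in> borel_measurable M"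
    "(\<lambda>b. \<integral>\<^sup>+z. ennreal \<bar>f b z\<bar> \<partial>K b) \<in> borel_measurable M"
    by (rule K; measurable)+
  have "(\<integral>z. f b z \<partial>K b) = (if (\<integral>\<^sup>+z. ennreal \<bar>f b z\<bar> \<partial>K b) < \<infinity>
      then enn2real (\<integral>\<^sup>+z. ennreal (f b z) \<partial>K b) - enn2real (\<integral>\<^sup>+z. ennreal (- f b z) \<partial>K b) else 0)"
    if b: "b \<in> space M" for b
  proof -
    have m: "f b \<in> borel_measurable (K b)"
      using measurable_Pair2[OF f b] unfolding measurable_cong_sets[OF sets_K[OF b] refl] by simp
    show ?thesis
    proof (cases "(\<integral>\<^sup>+z. ennreal \<bar>f b z\<bar> \<partial>K b) < \<infinity>")
      case True
      then have "integrable (K b) (f b)" using m by (simp add: integrable_iff_bounded)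
      then show ?thesis using True by (simp add: real_lebesgue_integral_def)
    next
      case False
      then have "\<not> integrable (K b) (f b)" by (simp add: integrable_iff_bounded)
      then show ?thesis using False by (simp add: not_integrable_integral_eq)
    qed
  qed
  then show ?thesis by (simp cong: measurable_cong)
qed

section \<open>Mixtures of factorial and intensity measures, and pathwise integrals\<close>

context poisson_law
begin

text \<open>The i-th factorial measure of \<mu> times \<open>L\<close> to the power k - i, carried
  over to functions on \<open>{..<k}\<close>. All terms of the pathwise formula thus become
  integrals of one kernel over one space.\<close>

definition mixed_measure :: "nat \<Rightarrow> nat \<Rightarrow> 'a measure \<Rightarrow> (nat \<Rightarrow> 'a) measure" where
  "mixed_measure k i \<mu> = distr (factorial_measure i \<mu> \<Otimes>\<^sub>M PiM {i..<k} (\<lambda>_. L)) (XP k) (merge {..<i} {i..<k})"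

lemma sets_mixed_measure[simp]: "sets (mixed_measure k i \<mu>) = sets (XP k)"
  by (simp add: mixed_measure_def)

lemma space_mixed_measure[simp]: "space (mixed_measure k i \<mu>) = space (XP k)"
  by (simp add: mixed_measure_def)

lemma measurable_merge_XP:
  assumes "i \<le> k" shows "merge {..<i} {i..<k} \<in> XP i \<Otimes>\<^sub>M PiM {i..<k} (\<lambda>_. L) \<rightarrow>\<^sub>M XP k"
proof -
  have "merge {..<i} {i..<k} \<in> XP i \<Otimes>\<^sub>M PiM {i..<k} (\<lambda>_. X) \<rightarrow>\<^sub>M PiM ({..<i} \<union> {i..<k}) (\<lambda>_. X)"
    by (rule measurable_merge)
  moreover have "{..<i} \<union> {i..<k} = {..<k}" using assms by auto
  ultimately have "merge {..<i} {i..<k} \<in> XP i \<Otimes>\<^sub>M PiM {i..<k} (\<lambda>_. X) \<rightarrow>\<^sub>M XP k" by simp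
  then show ?thesis
    unfolding measurable_cong_sets[OF sets_pair_measure_cong[OF refl sets_LP] refl] .
qed

lemma measurable_merge_factorial:
  assumes "i \<le> k" "\<mu> \<in> CM"
  shows "merge {..<i} {i..<k} \<in> factorial_measure i \<mu> \<Otimes>\<^sub>M PiM {i..<k} (\<lambda>_. L) \<rightarrow>\<^sub>M XP k"
  using measurable_merge_XP[OF assms(1)]
  unfolding measurable_cong_sets[OF sets_pair_measure_cong[OF factorial_measure_sets[OF assms(2)] refl] refl] .

lemma nn_integral_mixed_measure:
  assumes i: "i \<le> k" and \<mu>: "\<mu> \<in> CM" and f[measurable]: "f \<in> borel_measurable (XP k)"
  shows "(\<integral>\<^sup>+x. f x \<partial>mixed_measure k i \<mu>)
    = (\<integral>\<^sup>+x. \<integral>\<^sup>+y. f (merge {..<i} {i..<k} (x, y)) \<partial>PiM {i..<k} (\<lambda>_. L) \<partial>factorial_measure i \<mu>)"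
proof -
  interpret S: sigma_finite_measure "PiM {i..<k} (\<lambda>_. L)" by (rule sigma_finite_LP) simp
  note m = measurable_merge_factorial[OF i \<mu>]
  have f': "f \<in> borel_measurable (distr (factorial_measure i \<mu> \<Otimes>\<^sub>M PiM {i..<k} (\<lambda>_. L)) (XP k) (merge {..<i} {i..<k}))"
    using f by simp
  show ?thesis unfolding mixed_measure_def nn_integral_distr[OF m f']
    by (rule S.nn_integral_fst[symmetric]) (rule measurable_compose[OF m f])
qed

lemma pathwise_integral_mixed:
  assumes \<mu>: "\<mu> \<in> CM" and u: "u \<in> borel_measurable (XP k)"
  shows "pathwise_integral L k u \<mu> = (\<Sum>i\<le>k. (-1) ^ (k - i) * real (k choose i) * (\<integral>x. u x \<partial>mixed_measure k i \<mu>))"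
  unfolding pathwise_integral_def
proof (rule sum.cong[OF refl])
  fix i assume "i \<in> {..k}"
  then have i: "i \<le> k" by simp
  have "(\<integral>x. u x \<partial>mixed_measure k i \<mu>)
    = (\<integral>(x, y). u (merge {..<i} {i..<k} (x, y)) \<partial>(factorial_measure i \<mu> \<Otimes>\<^sub>M PiM {i..<k} (\<lambda>_. L)))"
    unfolding mixed_measure_def using measurable_merge_factorial[OF i \<mu>] u
    by (subst integral_distr) (auto simp: split_beta')
  then show "(-1) ^ (k - i) * real (k choose i) * (\<integral>(x, y). u (merge {..<i} {i..<k} (x, y))
      \<partial>(factorial_measure i \<mu> \<Otimes>\<^sub>M PiM {i..<k} (\<lambda>_. L)))
    = (-1) ^ (k - i) * real (k choose i) * (\<integral>x. u x \<partial>mixed_measure k i \<mu>)" by simp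
qed

lemma measurable_nn_integral_mixed:
  fixes f :: "'b \<Rightarrow> (nat \<Rightarrow> 'a) \<Rightarrow> ennreal"
  assumes i: "i \<le> k" and K: "K \<in> M \<rightarrow>\<^sub>M N" and f[measurable]: "(\<lambda>(b, x). f b x) \<in> borel_measurable (M \<Otimes>\<^sub>M XP k)"
  shows "(\<lambda>b. \<integral>\<^sup>+x. f b x \<partial>mixed_measure k i (K b)) \<in> borel_measurable M"
proof -
  interpret S: sigma_finite_measure "PiM {i..<k} (\<lambda>_. L)" by (rule sigma_finite_LP) simp
  let ?M = "(M \<Otimes>\<^sub>M XP i) \<Otimes>\<^sub>M PiM {i..<k} (\<lambda>_. L)"
  have "(\<lambda>w. merge {..<i} {i..<k} (snd (fst w), snd w)) \<in> ?M \<rightarrow>\<^sub>M XP k"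
    by (rule measurable_compose[OF _ measurable_merge_XP[OF i]]) measurable
  moreover have "(\<lambda>w. fst (fst w)) \<in> ?M \<rightarrow>\<^sub>M M" by measurable
  ultimately have "(\<lambda>w. (fst (fst w), merge {..<i} {i..<k} (snd (fst w), snd w))) \<in> ?M \<rightarrow>\<^sub>M M \<Otimes>\<^sub>M XP k"
    by (rule measurable_Pair[rotated])
  from measurable_compose[OF this f]
  have "(\<lambda>w. \<integral>\<^sup>+y. f (fst w) (merge {..<i} {i..<k} (snd w, y)) \<partial>PiM {i..<k} (\<lambda>_. L)) \<in> borel_measurable (M \<Otimes>\<^sub>M XP i)"
    by (intro S.borel_measurable_nn_integral) (simp add: split_beta')
  then have "(\<lambda>b. \<integral>\<^sup>+x. \<integral>\<^sup>+y. f b (merge {..<i} {i..<k} (x, y)) \<partial>PiM {i..<k} (\<lambda>_. L) \<partial>factorial_measure i (K b)) \<in> borel_measurable M"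
    by (intro measurable_factorial[OF K]) (simp add: split_beta')
  moreover have "(\<integral>\<^sup>+x. f b x \<partial>mixed_measure k i (K b))
      = (\<integral>\<^sup>+x. \<integral>\<^sup>+y. f b (merge {..<i} {i..<k} (x, y)) \<partial>PiM {i..<k} (\<lambda>_. L) \<partial>factorial_measure i (K b))"
    if "b \<in> space M" for b
    using measurable_Pair2[OF f that] measurable_space[OF K that]
    by (intro nn_integral_mixed_measure i) (simp_all add: space_N)
  ultimately show ?thesis by (subst measurable_cong)
qed

lemma measurable_pathwise_integral:
  assumes K[measurable]: "K \<in> M \<rightarrow>\<^sub>M N" and f[measurable]: "(\<lambda>(b, x). f b x) \<in> borel_measurable (M \<Otimes>\<^sub>M XP k)"
  shows "(\<lambda>b. pathwise_integral L k (f b) (K b)) \<in> borel_measurable M"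
proof -
  have [measurable]: "(\<lambda>b. \<integral>x. f b x \<partial>mixed_measure k i (K b)) \<in> borel_measurable M" if "i \<in> {..k}" for i
    using that by (intro measurable_integral_kernel[OF measurable_nn_integral_mixed[OF _ K]] f) auto
  have "(\<lambda>b. \<Sum>i\<le>k. (-1) ^ (k - i) * real (k choose i) * (\<integral>x. f b x \<partial>mixed_measure k i (K b))) \<in> borel_measurable M"
    by measurable
  moreover have "pathwise_integral L k (f b) (K b)
      = (\<Sum>i\<le>k. (-1) ^ (k - i) * real (k choose i) * (\<integral>x. f b x \<partial>mixed_measure k i (K b)))"
    if "b \<in> space M" for b
    using measurable_Pair2[OF f that] measurable_space[OF K that]
    by (intro pathwise_integral_mixed) (simp_all add: space_N)
  ultimately show ?thesis by (subst measurable_cong)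
qed

lemma add_points_cong:
  assumes \<mu>: "\<mu> \<in> CM" and J: "finite J" "x ` J \<subseteq> space X" and eq: "\<And>j. j \<in> J \<Longrightarrow> x j = y j"
  shows "add_points \<mu> J x = add_points \<mu> J y"
proof -
  have J': "y ` J \<subseteq> space X" using J eq by auto
  show ?thesis
    using add_points_CM[OF \<mu> J] add_points_CM[OF \<mu> J(1) J'] eq
    by (intro CM_eqI) (auto simp: emeasure_add_points[OF \<mu> J] emeasure_add_points[OF \<mu> J(1) J'])
qed

text \<open>The first i coordinates come from the process and reappear as added points; the other
  coordinates already follow \<open>L\<close> and add nothing. Both kinds together run through the
  full power of \<open>L\<close>.\<close>

theorem mecke_mixed:
  assumes i: "i \<le> k" and f[measurable]: "(\<lambda>(x, \<mu>). f x \<mu>) \<in> borel_measurable (XP k \<Otimes>\<^sub>M N)"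
  shows "(\<integral>\<^sup>+\<mu>. \<integral>\<^sup>+x. f x \<mu> \<partial>mixed_measure k i \<mu> \<partial>Q)
    = (\<integral>\<^sup>+\<mu>. \<integral>\<^sup>+x. f x (add_points \<mu> {..<i} x) \<partial>power_measure L k \<partial>Q)"
proof -
  interpret S: sigma_finite_measure "PiM {i..<k} (\<lambda>_. L)" by (rule sigma_finite_LP) simp
  have un: "{..<i} \<union> {i..<k} = {..<k}" and dj: "{..<i} \<inter> {i..<k} = {}" using i by auto
  have "(\<integral>\<^sup>+\<mu>. \<integral>\<^sup>+x. f x \<mu> \<partial>mixed_measure k i \<mu> \<partial>Q)
    = (\<integral>\<^sup>+\<mu>. \<integral>\<^sup>+x. \<integral>\<^sup>+y. f (merge {..<i} {i..<k} (x, y)) \<mu> \<partial>PiM {i..<k} (\<lambda>_. L) \<partial>factorial_measure i \<mu> \<partial>Q)"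
  proof (intro nn_integral_cong nn_integral_mixed_measure i)
    fix \<mu> assume "\<mu> \<in> space Q"
    then show "\<mu> \<in> CM" "(\<lambda>x. f x \<mu>) \<in> borel_measurable (XP k)"
      using measurable_Pair1[OF f, of \<mu>] by (simp_all add: space_Q space_N)
  qed
  also have "\<dots> = (\<integral>\<^sup>+\<mu>. \<integral>\<^sup>+x. \<integral>\<^sup>+y. f (merge {..<i} {i..<k} (x, y)) (add_points \<mu> {..<i} x) \<partial>PiM {i..<k} (\<lambda>_. L) \<partial>power_measure L i \<partial>Q)"
  proof (rule mecke_factorial)
    let ?M = "(XP i \<Otimes>\<^sub>M N) \<Otimes>\<^sub>M PiM {i..<k} (\<lambda>_. L)"
    have "(\<lambda>w. merge {..<i} {i..<k} (fst (fst w), snd w)) \<in> ?M \<rightarrow>\<^sub>M XP k"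
      by (rule measurable_compose[OF _ measurable_merge_XP[OF i]]) measurable
    moreover have "(\<lambda>w. snd (fst w)) \<in> ?M \<rightarrow>\<^sub>M N" by measurable
    ultimately have "(\<lambda>w. (merge {..<i} {i..<k} (fst (fst w), snd w), snd (fst w))) \<in> ?M \<rightarrow>\<^sub>M XP k \<Otimes>\<^sub>M N"
      by (rule measurable_Pair)
    from measurable_compose[OF this f]
    have "(\<lambda>w. \<integral>\<^sup>+y. f (merge {..<i} {i..<k} (fst w, y)) (snd w) \<partial>PiM {i..<k} (\<lambda>_. L)) \<in> borel_measurable (XP i \<Otimes>\<^sub>M N)"
      by (intro S.borel_measurable_nn_integral) (simp add: split_beta')
    then show "(\<lambda>(x, \<mu>). \<integral>\<^sup>+y. f (merge {..<i} {i..<k} (x, y)) \<mu> \<partial>PiM {i..<k} (\<lambda>_. L)) \<in> borel_measurable (XP i \<Otimes>\<^sub>M N)"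
      by (simp add: split_beta')
  qed
  also have "\<dots> = (\<integral>\<^sup>+\<mu>. \<integral>\<^sup>+x. f x (add_points \<mu> {..<i} x) \<partial>power_measure L k \<partial>Q)"
  proof (rule nn_integral_cong)
    fix \<mu> assume "\<mu> \<in> space Q"
    then have \<mu>: "\<mu> \<in> CM" by (simp add: space_Q)
    let ?g = "\<lambda>x. f x (add_points \<mu> {..<i} x)"
    have m: "(\<lambda>x. add_points \<mu> {..<i} x) \<in> XP k \<rightarrow>\<^sub>M N"
      using \<mu> i by (intro measurable_add_points measurable_component_singleton) (auto simp: space_N)
    have g: "?g \<in> borel_measurable (XP k)"
      using measurable_compose[OF measurable_Pair[OF measurable_ident m] f] by simp
    have "(\<integral>\<^sup>+x. ?g x \<partial>power_measure L k)
      = (\<integral>\<^sup>+x. \<integral>\<^sup>+y. ?g (merge {..<i} {i..<k} (x, y)) \<partial>PiM {i..<k} (\<lambda>_. L) \<partial>power_measure L i)"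
      using LP.product_nn_integral_fold[of "{..<i}" "{i..<k}" ?g] g dj
      unfolding un measurable_cong_sets[OF sets_LP refl] by auto
    also have "\<dots> = (\<integral>\<^sup>+x. \<integral>\<^sup>+y. f (merge {..<i} {i..<k} (x, y)) (add_points \<mu> {..<i} x) \<partial>PiM {i..<k} (\<lambda>_. L) \<partial>power_measure L i)"
    proof (intro nn_integral_cong)
      fix x y assume "x \<in> space (power_measure L i)"
      then have x: "x ` {..<i} \<subseteq> space X" unfolding space_LP by (auto simp: space_PiM PiE_iff)
      have "add_points \<mu> {..<i} x = add_points \<mu> {..<i} (merge {..<i} {i..<k} (x, y))"
        by (rule add_points_cong[OF \<mu> _ x]) (auto simp: merge_def)
      then show "?g (merge {..<i} {i..<k} (x, y)) = f (merge {..<i} {i..<k} (x, y)) (add_points \<mu> {..<i} x)" by simp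
    qed
    finally show "(\<integral>\<^sup>+x. \<integral>\<^sup>+y. f (merge {..<i} {i..<k} (x, y)) (add_points \<mu> {..<i} x) \<partial>PiM {i..<k} (\<lambda>_. L) \<partial>power_measure L i)
      = (\<integral>\<^sup>+x. ?g x \<partial>power_measure L k)" ..
  qed
  finally show ?thesis .
qed

lemma mixed_measure_box:
  assumes i: "i \<le> k" and \<mu>: "\<mu> \<in> CM" and B: "B \<in> local_sets X Bn"
  shows "emeasure (mixed_measure k i \<mu>) (box k B) \<le> emeasure \<mu> B ^ i * emeasure L B ^ (k - i)"
proof -
  have BX: "B \<in> sets X" using local_sets_sets[OF B] .
  let ?C = "PiE {i..<k} (\<lambda>_. B)"
  have C: "?C \<in> sets (PiM {i..<k} (\<lambda>_. L))" using BX by (intro sets_PiM_I_finite) (auto simp: sets_L)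
  have "emeasure (mixed_measure k i \<mu>) (box k B) = (\<integral>\<^sup>+x. indicator (box k B) x \<partial>mixed_measure k i \<mu>)"
    using BX by simp
  also have "\<dots> = (\<integral>\<^sup>+x. \<integral>\<^sup>+y. indicator (box k B) (merge {..<i} {i..<k} (x, y)) \<partial>PiM {i..<k} (\<lambda>_. L) \<partial>factorial_measure i \<mu>)"
    using BX by (intro nn_integral_mixed_measure i \<mu>) auto
  also have "\<dots> \<le> (\<integral>\<^sup>+x. \<integral>\<^sup>+y. indicator (box i B) x * indicator ?C y \<partial>PiM {i..<k} (\<lambda>_. L) \<partial>factorial_measure i \<mu>)"
  proof (intro nn_integral_mono)
    fix x y assume "x \<in> space (factorial_measure i \<mu>)" "y \<in> space (PiM {i..<k} (\<lambda>_. L))"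
    then have xy: "x \<in> extensional {..<i}" "y \<in> extensional {i..<k}"
      using sets_eq_imp_space_eq[OF factorial_measure_sets[OF \<mu>, of i]] by (auto simp: space_PiM PiE_def)
    show "indicator (box k B) (merge {..<i} {i..<k} (x, y)) \<le> (indicator (box i B) x * indicator ?C y :: ennreal)"
    proof (cases "merge {..<i} {i..<k} (x, y) \<in> box k B")
      case True
      then have *: "merge {..<i} {i..<k} (x, y) j \<in> B" if "j < k" for j using that by auto
      have "x j \<in> B" if "j < i" for j using *[of j] that i by (auto simp: merge_def)
      moreover have "y j \<in> B" if "i \<le> j" "j < k" for j using *[of j] that by (auto simp: merge_def)
      ultimately show ?thesis using xy by (auto simp: indicator_def PiE_def)
    qed simp
  qed
  also have "\<dots> = (\<integral>\<^sup>+x. indicator (box i B) x * emeasure (PiM {i..<k} (\<lambda>_. L)) ?C \<partial>factorial_measure i \<mu>)"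
    using C by (intro nn_integral_cong) (simp add: nn_integral_cmult)
  also have "\<dots> = emeasure (factorial_measure i \<mu>) (box i B) * emeasure (PiM {i..<k} (\<lambda>_. L)) ?C"
  proof (subst nn_integral_multc)
    have b: "box i B \<in> sets (factorial_measure i \<mu>)" using BX factorial_measure_sets[OF \<mu>] by simp
    then show "indicator (box i B) \<in> borel_measurable (factorial_measure i \<mu>)" by simp
    show "(\<integral>\<^sup>+x. indicator (box i B) x \<partial>factorial_measure i \<mu>) * emeasure (PiM {i..<k} (\<lambda>_. L)) ?C
      = emeasure (factorial_measure i \<mu>) (box i B) * emeasure (PiM {i..<k} (\<lambda>_. L)) ?C"
      using b by simp
  qed
  also have "emeasure (PiM {i..<k} (\<lambda>_. L)) ?C = emeasure L B ^ (k - i)"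
    using BX by (subst LP.emeasure_PiM) (auto simp: sets_L)
  also have "emeasure (factorial_measure i \<mu>) (box i B) * emeasure L B ^ (k - i) \<le> emeasure \<mu> B ^ i * emeasure L B ^ (k - i)"
    by (intro mult_right_mono factorial_measure_box \<mu> B) auto
  finally show ?thesis .
qed

text \<open>The bound and the support are required at every x and not merely almost everywhere: for
  a fixed configuration the factorial measures may charge sets that are null for the power of
  \<open>L\<close>.\<close>

definition bounded_kernel :: "nat \<Rightarrow> 'a set \<Rightarrow> real \<Rightarrow> ((nat \<Rightarrow> 'a) \<Rightarrow> real) \<Rightarrow> bool" where
  "bounded_kernel k B c v \<longleftrightarrow> B \<in> local_sets X Bn \<and> 0 \<le> c \<and> v \<in> borel_measurable (XP k) \<and>
    (\<forall>x. \<bar>v x\<bar> \<le> c * indicator (box k B) x)"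

lemma bounded_kernelD:
  assumes "bounded_kernel k B c v"
  shows "B \<in> local_sets X Bn" "B \<in> sets X" "0 \<le> c" "v \<in> borel_measurable (XP k)"
    "\<bar>v x\<bar> \<le> c * indicator (box k B) x" "x \<notin> box k B \<Longrightarrow> v x = 0" "\<bar>v x\<bar> \<le> c"
proof -
  show B: "B \<in> local_sets X Bn" "B \<in> sets X" "0 \<le> c" "v \<in> borel_measurable (XP k)"
    and *: "\<bar>v x\<bar> \<le> c * indicator (box k B) x" for x
    using assms local_sets_sets by (auto simp: bounded_kernel_def)
  show "x \<notin> box k B \<Longrightarrow> v x = 0" using *[of x] by simp
  show "\<bar>v x\<bar> \<le> c" using *[of x] B(3) by (cases "x \<in> box k B") auto
qed

section \<open>Bounds and finite sums for pathwise integrals of bounded kernels\<close>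

lemma mixed_box_finite:
  assumes "i \<le> k" "\<mu> \<in> CM" "B \<in> local_sets X Bn"
  shows "emeasure (mixed_measure k i \<mu>) (box k B) < \<infinity>"
    "measure (mixed_measure k i \<mu>) (box k B) \<le> measure \<mu> B ^ i * measure L B ^ (k - i)"
proof -
  have "emeasure \<mu> B ^ i * emeasure L B ^ (k - i) = ennreal (measure \<mu> B ^ i * measure L B ^ (k - i))"
    using CM_finite[OF assms(2,3)] L_finite[OF assms(3)]
    by (simp add: emeasure_eq_ennreal_measure ennreal_mult ennreal_power)
  with mixed_measure_box[OF assms]
  have le: "emeasure (mixed_measure k i \<mu>) (box k B) \<le> ennreal (measure \<mu> B ^ i * measure L B ^ (k - i))" by simp
  then show "emeasure (mixed_measure k i \<mu>) (box k B) < \<infinity>" by (auto intro: le_less_trans)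
  show "measure (mixed_measure k i \<mu>) (box k B) \<le> measure \<mu> B ^ i * measure L B ^ (k - i)"
    unfolding measure_def[of "mixed_measure k i \<mu>"] using enn2real_mono[OF le] by simp
qed

lemma integrable_mixed:
  assumes v: "bounded_kernel k B c v" and i: "i \<le> k" and \<mu>: "\<mu> \<in> CM"
  shows "integrable (mixed_measure k i \<mu>) v"
proof (rule Bochner_Integration.integrable_bound)
  note D = bounded_kernelD[OF v]
  show "integrable (mixed_measure k i \<mu>) (\<lambda>x. c * indicator (box k B) x)"
    using D(2) mixed_box_finite(1)[OF i \<mu> D(1)] by (intro integrable_mult_right integrable_real_indicator) auto
  show "v \<in> borel_measurable (mixed_measure k i \<mu>)"
    using D(4) unfolding measurable_cong_sets[OF sets_mixed_measure refl] .
  show "AE x in mixed_measure k i \<mu>. norm (v x) \<le> norm (c * indicator (box k B) x)"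
    using D(3,5) by (intro AE_I2) (simp add: abs_mult)
qed

lemma integral_mixed_bound:
  assumes v: "bounded_kernel k B c v" and i: "i \<le> k" and \<mu>: "\<mu> \<in> CM"
  shows "\<bar>\<integral>x. v x \<partial>mixed_measure k i \<mu>\<bar> \<le> c * (measure \<mu> B ^ i * measure L B ^ (k - i))"
proof -
  note D = bounded_kernelD[OF v]
  have int: "integrable (mixed_measure k i \<mu>) (\<lambda>x. c * indicator (box k B) x)"
    using D(2) mixed_box_finite(1)[OF i \<mu> D(1)] by (intro integrable_mult_right integrable_real_indicator) auto
  have "\<bar>\<integral>x. v x \<partial>mixed_measure k i \<mu>\<bar> \<le> (\<integral>x. c * indicator (box k B) x \<partial>mixed_measure k i \<mu>)"
    using integral_abs_bound[of "mixed_measure k i \<mu>" v] integral_mono[OF integrable_abs[OF integrable_mixed[OF v i \<mu>]] int D(5)]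
    by linarith
  also have "\<dots> = c * measure (mixed_measure k i \<mu>) (box k B)"
    using D(2) box_sets[OF D(2), of k] sets.sets_into_space[of "box k B" "XP k"] by (simp add: Int_absorb1)
  also have "\<dots> \<le> c * (measure \<mu> B ^ i * measure L B ^ (k - i))"
    using D mixed_box_finite(2)[OF i \<mu> D(1)] by (intro mult_left_mono) auto
  finally show ?thesis .
qed

text \<open>Powers with exponents i and k - i are enlarged to the k-th powers of 1 + mass, which
  makes the bound uniform in i; the binomial coefficients then add up to 2^k.\<close>

lemma pathwise_integral_bound:
  assumes v: "bounded_kernel k B c v" and \<mu>: "\<mu> \<in> CM"
  shows "\<bar>pathwise_integral L k v \<mu>\<bar> \<le> (2 ^ k * c * (1 + measure L B) ^ k) * (1 + measure \<mu> B) ^ k"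
proof -
  note D = bounded_kernelD[OF v]
  have "\<bar>pathwise_integral L k v \<mu>\<bar> \<le> (\<Sum>i\<le>k. \<bar>(-1) ^ (k - i) * real (k choose i) * (\<integral>x. v x \<partial>mixed_measure k i \<mu>)\<bar>)"
    unfolding pathwise_integral_mixed[OF \<mu> D(4)] by (rule sum_abs)
  also have "\<dots> \<le> (\<Sum>i\<le>k. real (k choose i) * (c * ((1 + measure \<mu> B) ^ k * (1 + measure L B) ^ k)))"
  proof (rule sum_mono)
    fix i assume "i \<in> {..k}"
    then have i: "i \<le> k" by simp
    have "measure \<mu> B ^ i \<le> (1 + measure \<mu> B) ^ i" by (intro power_mono) auto
    also have "\<dots> \<le> (1 + measure \<mu> B) ^ k" using i by (intro power_increasing) auto
    finally have 1: "measure \<mu> B ^ i \<le> (1 + measure \<mu> B) ^ k" .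
    have "measure L B ^ (k - i) \<le> (1 + measure L B) ^ (k - i)" by (intro power_mono) auto
    also have "\<dots> \<le> (1 + measure L B) ^ k" using i by (intro power_increasing) auto
    finally have 2: "measure L B ^ (k - i) \<le> (1 + measure L B) ^ k" .
    have "\<bar>\<integral>x. v x \<partial>mixed_measure k i \<mu>\<bar> \<le> c * ((1 + measure \<mu> B) ^ k * (1 + measure L B) ^ k)"
      using integral_mixed_bound[OF v i \<mu>] mult_mono[OF 1 2] D(3)
      by (auto intro: order_trans mult_left_mono)
    then show "\<bar>(-1) ^ (k - i) * real (k choose i) * (\<integral>x. v x \<partial>mixed_measure k i \<mu>)\<bar>
      \<le> real (k choose i) * (c * ((1 + measure \<mu> B) ^ k * (1 + measure L B) ^ k))"
      by (simp add: abs_mult power_abs mult_left_mono)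
  qed
  also have "\<dots> = real (\<Sum>i\<le>k. k choose i) * (c * ((1 + measure \<mu> B) ^ k * (1 + measure L B) ^ k))"
    by (simp add: sum_distrib_right)
  also have "(\<Sum>i\<le>k. k choose i) = 2 ^ k" by (rule choose_row_sum)
  finally show ?thesis by (simp add: ac_simps)
qed

lemma sigma_finite_factorial_measure:
  assumes \<mu>: "\<mu> \<in> CM" shows "sigma_finite_measure (factorial_measure i \<mu>)"
proof
  have "emeasure (factorial_measure i \<mu>) (box i (Bn n)) \<noteq> \<infinity>" for n
  proof -
    have "emeasure \<mu> (Bn n) ^ i < \<infinity>"
      using CM_finite[OF \<mu> Bn_local] by (simp add: power_less_top_ennreal)
    then show ?thesis using factorial_measure_box[OF \<mu> Bn_local, of i n] by (auto dest: le_less_trans)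
  qed
  then show "\<exists>A. countable A \<and> A \<subseteq> sets (factorial_measure i \<mu>) \<and> \<Union> A = space (factorial_measure i \<mu>) \<and>
      (\<forall>a\<in>A. emeasure (factorial_measure i \<mu>) a \<noteq> \<infinity>)"
    using UN_box[of i] sets_eq_imp_space_eq[OF factorial_measure_sets[OF \<mu>, of i]]
    by (intro exI[of _ "range (\<lambda>n. box i (Bn n))"]) (auto simp: factorial_measure_sets[OF \<mu>])
qed

definition section_integral :: "nat \<Rightarrow> ((nat \<Rightarrow> 'a) \<Rightarrow> real) \<Rightarrow> nat \<Rightarrow> (nat \<Rightarrow> 'a) \<Rightarrow> real" where
  "section_integral k v i z = (\<integral>y. v (merge {..<i} {i..<k} (z, y)) \<partial>PiM {i..<k} (\<lambda>_. L))"

text \<open>A tuple with a label outside \<open>B\<close> contributes 0, since every completion of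
  it leaves the box. What remains is a finite sum, accessible to combinatorics.\<close>

lemma integral_mixed_sum:
  assumes v: "bounded_kernel k B c v" and i: "i \<le> k" and \<mu>: "\<mu> \<in> CM"
  shows "(\<integral>x. v x \<partial>mixed_measure k i \<mu>)
    = (\<Sum>p\<in>inj_tuples i {q \<in> labelled_points \<mu>. fst q \<in> B}. section_integral k v i (\<lambda>j\<in>{..<i}. fst (p j)))"
proof -
  note D = bounded_kernelD[OF v]
  interpret FM: sigma_finite_measure "factorial_measure i \<mu>" by (rule sigma_finite_factorial_measure[OF \<mu>])
  interpret S: sigma_finite_measure "PiM {i..<k} (\<lambda>_. L)" by (rule sigma_finite_LP) simp
  interpret pair_sigma_finite "factorial_measure i \<mu>" "PiM {i..<k} (\<lambda>_. L)" ..
  note m = measurable_merge_factorial[OF i \<mu>]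
  let ?F = "{q \<in> labelled_points \<mu>. fst q \<in> B}" and ?lab = "labelled_points \<mu>"
  let ?a = "section_integral k v i"
  have s: "sets (power_measure \<mu> i) = sets (XP i)" using CM_sets[OF \<mu>] by (intro sets_PiM_cong) auto
  have "integrable (factorial_measure i \<mu> \<Otimes>\<^sub>M PiM {i..<k} (\<lambda>_. L)) (\<lambda>w. v (merge {..<i} {i..<k} w))"
    using integrable_mixed[OF v i \<mu>] D(4) unfolding mixed_measure_def by (subst (asm) integrable_distr_eq[OF m])
  from integral_fst'[OF this]
  have "(\<integral>x. v x \<partial>mixed_measure k i \<mu>) = (\<integral>x. ?a x \<partial>factorial_measure i \<mu>)"
    unfolding mixed_measure_def section_integral_def by (simp add: integral_distr[OF m D(4)])
  also have "\<dots> = (\<integral>p. ?a (\<lambda>j\<in>{..<i}. fst (p j)) \<partial>count_space (inj_tuples i ?lab))"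
  proof -
    have t: "(\<lambda>p. \<lambda>j\<in>{..<i}. fst (p j)) \<in> count_space (inj_tuples i ?lab) \<rightarrow>\<^sub>M power_measure \<mu> i"
      using measurable_inj_tuples[OF \<mu>] unfolding measurable_cong_sets[OF refl s] .
    have "(\<lambda>w. v (merge {..<i} {i..<k} w)) \<in> borel_measurable (power_measure \<mu> i \<Otimes>\<^sub>M PiM {i..<k} (\<lambda>_. L))"
      using measurable_compose[OF measurable_merge_XP[OF i] D(4)]
      unfolding measurable_cong_sets[OF sets_pair_measure_cong[OF s refl] refl] .
    then have "?a \<in> borel_measurable (power_measure \<mu> i)"
      unfolding section_integral_def by (intro S.borel_measurable_lebesgue_integral) (simp add: split_beta')
    then show ?thesis
      unfolding factorial_measure_def inj_tuples_def[symmetric] by (rule integral_distr[OF t])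
  qed
  also have "\<dots> = (\<Sum>p\<in>inj_tuples i ?F. ?a (\<lambda>j\<in>{..<i}. fst (p j)))"
  proof -
    have fin: "finite (inj_tuples i ?F)"
      using labelled_points_local[OF \<mu> D(1)] by (intro finite_inj_tuples) auto
    have sub: "inj_tuples i ?F \<subseteq> inj_tuples i ?lab"
      by (auto simp: inj_tuples_def PiE_def Pi_def)
    have zero: "?a (\<lambda>j\<in>{..<i}. fst (p j)) = 0" if p: "p \<in> inj_tuples i ?lab" "p \<notin> inj_tuples i ?F" for p
    proof -
      have "\<exists>j<i. fst (p j) \<notin> B"
      proof (rule ccontr)
        assume "\<not> (\<exists>j<i. fst (p j) \<notin> B)"
        then have "p j \<in> ?F" if "j < i" for j using p(1) that by (auto simp: inj_tuples_def)
        then have "p \<in> inj_tuples i ?F" using p(1) unfolding inj_tuples_def PiE_def Pi_def by simp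
        then show False using p(2) by contradiction
      qed
      then obtain j where j: "j < i" "fst (p j) \<notin> B" by blast
      have "merge {..<i} {i..<k} (\<lambda>j\<in>{..<i}. fst (p j), y) \<notin> box k B" for y
      proof
        assume "merge {..<i} {i..<k} (\<lambda>j\<in>{..<i}. fst (p j), y) \<in> box k B"
        from PiE_mem[OF this, of j]
        have "merge {..<i} {i..<k} (\<lambda>j\<in>{..<i}. fst (p j), y) j \<in> B" using j i by simp
        then show False using j by (simp add: merge_def)
      qed
      then show ?thesis unfolding section_integral_def by (simp add: D(6))
    qed
    have sub2: "{p \<in> inj_tuples i ?lab. ?a (\<lambda>j\<in>{..<i}. fst (p j)) \<noteq> 0} \<subseteq> inj_tuples i ?F"
      using zero by blast
    have "(\<integral>p. ?a (\<lambda>j\<in>{..<i}. fst (p j)) \<partial>count_space (inj_tuples i ?lab))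
      = (\<Sum>p | p \<in> inj_tuples i ?lab \<and> ?a (\<lambda>j\<in>{..<i}. fst (p j)) \<noteq> 0. ?a (\<lambda>j\<in>{..<i}. fst (p j)))"
      using finite_subset[OF sub2 fin] by (intro lebesgue_integral_count_space_finite_support)
    also have "\<dots> = (\<Sum>p\<in>inj_tuples i ?F. ?a (\<lambda>j\<in>{..<i}. fst (p j)))"
      using sub2 sub fin by (intro sum.mono_neutral_left) auto
    finally show ?thesis .
  qed
  finally show ?thesis .
qed

text \<open>Over a position c the enlarged measure has as many labels as \<mu> has at c plus the
  number of j with \<open>x j\<close> = c. Equal fibres give a bijection that respects positions,
  even when new points fall on old ones or on each other.\<close>

lemma labelled_points_add_points:
  fixes J :: "nat set"
  assumes \<mu>: "\<mu> \<in> CM" and B: "B \<in> local_sets X Bn" and J: "finite J" "\<And>j. j \<in> J \<Longrightarrow> x j \<in> B"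
  shows "\<exists>h. bij_betw h (Inl ` {q \<in> labelled_points \<mu>. fst q \<in> B} \<union> Inr ` J)
      {q \<in> labelled_points (add_points \<mu> J x). fst q \<in> B} \<and>
    (\<forall>s\<in>Inl ` {q \<in> labelled_points \<mu>. fst q \<in> B} \<union> Inr ` J. fst (h s) = case_sum fst x s)"
proof (rule fibre_bijection)
  let ?\<nu> = "add_points \<mu> J x" and ?F = "{q \<in> labelled_points \<mu>. fst q \<in> B}"
  let ?F' = "{q \<in> labelled_points ?\<nu>. fst q \<in> B}"
  have BX: "B \<subseteq> space X" using sets.sets_into_space[OF local_sets_sets[OF B]] .
  have Jx: "x ` J \<subseteq> space X" using J BX by auto
  have \<nu>: "?\<nu> \<in> CM" using add_points_CM[OF \<mu> J(1) Jx] .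
  show fin: "finite (Inl ` ?F \<union> Inr ` J)" using labelled_points_local[OF \<mu> B] J by auto
  show fin': "finite ?F'" using labelled_points_local[OF \<nu> B] by auto
  have finF: "finite ?F" using labelled_points_local[OF \<mu> B] by auto
  fix c
  show "card {s \<in> Inl ` ?F \<union> Inr ` J. case_sum fst x s = c} = card {q \<in> ?F'. fst q = c}"
  proof (cases "c \<in> B")
    case False
    then have "{s \<in> Inl ` ?F \<union> Inr ` J. case_sum fst x s = c} = {}" "{q \<in> ?F'. fst q = c} = {}" using J by auto
    then show ?thesis by (simp only: card.empty)
  next
    case True
    have cX: "c \<in> space X" using True BX by auto
    have "{s \<in> Inl ` ?F \<union> Inr ` J. case_sum fst x s = c} = Inl ` {q\<in>?F. fst q = c} \<union> Inr ` {j\<in>J. x j = c}" by auto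
    then have "card {s \<in> Inl ` ?F \<union> Inr ` J. case_sum fst x s = c} = card (Inl ` {q\<in>?F. fst q = c} \<union> Inr ` {j\<in>J. x j = c} :: (('a \<times> nat) + nat) set)"
      by (simp only:)
    also have "\<dots> = card {q\<in>?F. fst q = c} + card {j\<in>J. x j = c}"
    proof (subst card_Un_disjoint)
      have "finite {q\<in>?F. fst q = c}" using finF by (rule rev_finite_subset) auto
      then show "finite (Inl ` {q\<in>?F. fst q = c})" by (rule finite_imageI)
    qed (use J(1) in \<open>auto simp: card_image\<close>)
    finally have 1: "card {s \<in> Inl ` ?F \<union> Inr ` J. case_sum fst x s = c} = card {q\<in>?F. fst q = c} + card {j\<in>J. x j = c}" .
    have 2: "{q\<in>?F. fst q = c} = {q \<in> labelled_points \<mu>. fst q \<in> {c}}" using True by auto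
    have 3: "{q \<in> ?F'. fst q = c} = {q \<in> labelled_points ?\<nu>. fst q \<in> {c}}" using True by auto
    have "(of_nat (card {q \<in> ?F'. fst q = c}) :: ennreal) = emeasure ?\<nu> {c}"
      unfolding 3 by (rule labelled_points_local(2)[OF \<nu> singleton_local[OF cX], symmetric])
    also have "\<dots> = emeasure \<mu> {c} + (\<Sum>j\<in>J. indicator {c} (x j))"
      by (rule emeasure_add_points[OF \<mu> J(1) Jx singleton_sets[OF cX]])
    also have "\<dots> = of_nat (card {q\<in>?F. fst q = c} + card {j\<in>J. x j = c})"
      unfolding 2 using labelled_points_local(2)[OF \<mu> singleton_local[OF cX]] J(1) by (simp add: sum_indicator_nat)
    finally have "card {q \<in> ?F'. fst q = c} = card {q\<in>?F. fst q = c} + card {j\<in>J. x j = c}"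
      by (simp only: of_nat_eq_iff)
    with 1 show ?thesis by simp
  qed
qed

text \<open>The left side is the k-fold difference operator. Adding the points indexed by
  \<open>J\<close> adds the labels \<open>Inr j\<close> with j in \<open>J\<close>; the alternating
  sum retains the tuples that use every new label, and those leave no entry for an old point and no
  coordinate to integrate over \<open>L\<close>.\<close>

theorem pathwise_integral_difference:
  assumes v: "bounded_kernel k B c v" and \<mu>: "\<mu> \<in> CM" and x: "x \<in> box k B"
  shows "(\<Sum>J\<in>Pow {..<k}. (-1) ^ (k - card J) * pathwise_integral L k v (add_points \<mu> J x))
    = (\<Sum>\<pi> | \<pi> permutes {..<k}. v (x \<circ> \<pi>))"
proof -
  note D = bounded_kernelD[OF v]
  define F where "F = {q \<in> labelled_points \<mu>. fst q \<in> B}"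
  have F: "finite F" using labelled_points_local[OF \<mu> D(1)] by (simp add: F_def)
  define A where "A i p = section_integral k v i (\<lambda>j\<in>{..<i}. case_sum fst x (p j))" for i and p :: "nat \<Rightarrow> ('a \<times> nat) + nat"
  have xB: "x j \<in> B" if "j < k" for j using x that by auto
  have BX: "B \<subseteq> space X" using sets.sets_into_space[OF D(2)] .
  have mix: "(\<integral>z. v z \<partial>mixed_measure k i (add_points \<mu> J x)) = (\<Sum>p\<in>inj_tuples i (Inl ` F \<union> Inr ` J). A i p)"
    if J: "J \<in> Pow {..<k}" and i: "i \<le> k" for J i
  proof -
    let ?\<nu> = "add_points \<mu> J x" and ?S = "Inl ` F \<union> Inr ` J :: (('a \<times> nat) + nat) set"
    have fJ: "finite J" using J finite_subset by auto
    have \<nu>: "?\<nu> \<in> CM" using J xB BX by (intro add_points_CM[OF \<mu> fJ]) auto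
    obtain h where h: "bij_betw h ?S {q \<in> labelled_points ?\<nu>. fst q \<in> B}" "\<And>s. s \<in> ?S \<Longrightarrow> fst (h s) = case_sum fst x s"
      using labelled_points_add_points[OF \<mu> D(1) fJ, of x] J xB unfolding F_def by blast
    have "(\<integral>z. v z \<partial>mixed_measure k i ?\<nu>)
      = (\<Sum>p\<in>inj_tuples i {q \<in> labelled_points ?\<nu>. fst q \<in> B}. section_integral k v i (\<lambda>j\<in>{..<i}. fst (p j)))"
      by (rule integral_mixed_sum[OF v i \<nu>])
    also have "\<dots> = (\<Sum>p\<in>inj_tuples i ?S. section_integral k v i (\<lambda>j\<in>{..<i}. fst ((\<lambda>j\<in>{..<i}. h (p j)) j)))"
      by (rule sum.reindex_bij_betw[OF bij_betw_inj_tuples[OF h(1)], symmetric])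
    also have "\<dots> = (\<Sum>p\<in>inj_tuples i ?S. A i p)"
    proof (rule sum.cong[OF refl])
      fix p assume "p \<in> inj_tuples i ?S"
      then have "p j \<in> ?S" if "j < i" for j using that by (auto simp: inj_tuples_def PiE_def Pi_def)
      then have "(\<lambda>j\<in>{..<i}. fst ((\<lambda>j\<in>{..<i}. h (p j)) j)) = (\<lambda>j\<in>{..<i}. case_sum fst x (p j))"
        using h(2) by (intro restrict_ext) auto
      then show "section_integral k v i (\<lambda>j\<in>{..<i}. fst ((\<lambda>j\<in>{..<i}. h (p j)) j)) = A i p" by (simp add: A_def)
    qed
    finally show ?thesis .
  qed
  have "(\<Sum>J\<in>Pow {..<k}. (-1) ^ (k - card J) * pathwise_integral L k v (add_points \<mu> J x))
    = (\<Sum>J\<in>Pow {..<k}. (-1) ^ (k - card J) * (\<Sum>i\<le>k. ((-1) ^ (k - i) * real (k choose i)) *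
        (\<Sum>p\<in>inj_tuples i (Inl ` F \<union> Inr ` J). A i p)))"
  proof (rule sum.cong[OF refl])
    fix J assume J: "J \<in> Pow {..<k}"
    have fJ: "finite J" using J finite_subset by auto
    have \<nu>: "add_points \<mu> J x \<in> CM" using J xB BX by (intro add_points_CM[OF \<mu> fJ]) auto
    show "(-1) ^ (k - card J) * pathwise_integral L k v (add_points \<mu> J x)
      = (-1) ^ (k - card J) * (\<Sum>i\<le>k. ((-1) ^ (k - i) * real (k choose i)) * (\<Sum>p\<in>inj_tuples i (Inl ` F \<union> Inr ` J). A i p))"
      unfolding pathwise_integral_mixed[OF \<nu> D(4)] using mix[OF J] by simp
  qed
  \<comment> \<open>Only the term of order k is left, and its coefficient is 1.\<close>
  also have "\<dots> = (-1) ^ (k - k) * real (k choose k) * (\<Sum>\<pi> | \<pi> permutes {..<k}. A k (\<lambda>j\<in>{..<k}. Inr (\<pi> j)))"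
    by (rule alternating_sum_inj_tuples[OF F])
  also have "\<dots> = (\<Sum>\<pi> | \<pi> permutes {..<k}. v (x \<circ> \<pi>))"
  proof -
    have "A k (\<lambda>j\<in>{..<k}. Inr (\<pi> j)) = v (x \<circ> \<pi>)" if \<pi>: "\<pi> permutes {..<k}" for \<pi>
    proof -
      have e: "(\<lambda>j\<in>{..<k}. case_sum fst x ((\<lambda>j\<in>{..<k}. Inr (\<pi> j)) j)) = x \<circ> \<pi>"
      proof
        fix j show "(\<lambda>j\<in>{..<k}. case_sum fst x ((\<lambda>j\<in>{..<k}. Inr (\<pi> j)) j)) j = (x \<circ> \<pi>) j"
        proof (cases "j < k")
          case False
          then have "\<pi> j = j" using \<pi> by (auto intro: permutes_not_in)
          then show ?thesis using False x by (auto simp: PiE_def extensional_def)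
        qed simp
      qed
      have "(x \<circ> \<pi>) j = undefined" if "\<not> j < k" for j using fun_cong[OF e, of j] that by simp
      then have "merge {..<k} {} (x \<circ> \<pi>, y) = x \<circ> \<pi>" for y
        by (simp add: merge_def fun_eq_iff)
      then show ?thesis unfolding A_def e section_integral_def
        by (simp add: PiM_empty lebesgue_integral_count_space_finite)
    qed
    then show ?thesis by simp
  qed
  finally show ?thesis .
qed

text \<open>The indicator that no coordinate lies in \<open>C\<close>, written as a product over
  coordinates so that joint measurability follows from that of the one-point indicator.\<close>

definition avoiding :: "nat \<Rightarrow> 'a set \<Rightarrow> (nat \<Rightarrow> 'a) \<Rightarrow> real" where
  "avoiding k C x = (\<Prod>j<k. 1 - indicator C (x j))"

lemma avoiding_eq: "avoiding k C x = (if \<forall>j<k. x j \<notin> C then 1 else 0)"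
proof (cases "\<forall>j<k. x j \<notin> C")
  case True
  then have "avoiding k C x = (\<Prod>j<k. 1)" unfolding avoiding_def by (intro prod.cong) auto
  then show ?thesis using True by simp
next
  case False
  then obtain j where "j \<in> {..<k}" "1 - indicator C (x j) = (0 :: real)" by auto
  then have "avoiding k C x = 0" unfolding avoiding_def by (intro prod_zero) auto
  then show ?thesis using False by simp
qed

lemma measurable_avoiding:
  assumes "(\<lambda>(w, x). indicator (Z w) x :: real) \<in> borel_measurable (M \<Otimes>\<^sub>M X)"
  shows "(\<lambda>(w, x). avoiding k (Z w) x) \<in> borel_measurable (M \<Otimes>\<^sub>M XP k)"
proof -
  have "(\<lambda>w. indicator (Z (fst w)) (snd w j) :: real) \<in> borel_measurable (M \<Otimes>\<^sub>M XP k)" if "j < k" for j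
  proof -
    have "(\<lambda>x. x j) \<in> XP k \<rightarrow>\<^sub>M X" using that by (intro measurable_component_singleton) simp
    from measurable_Pair[OF measurable_fst measurable_compose[OF measurable_snd this], of M]
    have "(\<lambda>w. (fst w, snd w j)) \<in> M \<Otimes>\<^sub>M XP k \<rightarrow>\<^sub>M M \<Otimes>\<^sub>M X" by simp
    from measurable_compose[OF this assms] show ?thesis by simp
  qed
  then show ?thesis unfolding avoiding_def split_beta'
    by (intro borel_measurable_prod borel_measurable_diff borel_measurable_const) auto
qed

section \<open>Locality: adding points that avoid a stopping set\<close>

lemma emeasure_glue:
  assumes "\<alpha> \<in> CM" "\<beta> \<in> CM" "C \<in> sets X" "A \<in> sets X"
  shows "emeasure (add_measure (restr_measure \<alpha> C) (restr_measure \<beta> (space X - C))) A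
    = emeasure \<alpha> (A \<inter> C) + emeasure \<beta> (A \<inter> (space X - C))"
proof -
  have "space X - C \<in> sets X" using assms(3) by auto
  then show ?thesis
    using assms by (simp add: emeasure_add_measure emeasure_restr_measure CM_sets)
qed

lemma emeasure_split:
  assumes \<mu>: "\<mu> \<in> CM" and A: "A \<in> sets X" and C: "C \<in> sets X"
  shows "emeasure \<mu> (A \<inter> C) + emeasure \<mu> (A \<inter> (space X - C)) = emeasure \<mu> A"
proof -
  have "(A \<inter> C) \<union> (A \<inter> (space X - C)) = A" using sets.sets_into_space[OF A] by auto
  then show ?thesis
    using A C CM_sets[OF \<mu>] by (subst plus_emeasure) auto
qed

text \<open>Both claims come from the defining identity of stopping sets. For the first, \<mu> is
  kept on its stopping set and replaced by the enlarged measure outside; for the second the two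
  measures exchange their roles.\<close>

lemma stopping_set_add_points:
  assumes Z: "stopping_set X Bn Z" and \<mu>: "\<mu> \<in> CM" and J: "finite J" "x ` J \<subseteq> space X"
  shows "(\<forall>j\<in>J. x j \<notin> Z \<mu>) \<Longrightarrow> Z (add_points \<mu> J x) = Z \<mu>"
    and "(\<forall>j\<in>J. x j \<notin> Z (add_points \<mu> J x)) \<Longrightarrow> Z (add_points \<mu> J x) = Z \<mu>"
proof -
  let ?\<nu> = "add_points \<mu> J x"
  have st: "Z \<alpha> = Z (add_measure (restr_measure \<alpha> (Z \<alpha>)) (restr_measure \<psi> (space X - Z \<alpha>)))"
    and ZX: "Z \<alpha> \<in> sets X" if "\<alpha> \<in> CM" "\<psi> \<in> CM" for \<alpha> \<psi>
    using Z that unfolding stopping_set_def by blast+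
  have \<nu>: "?\<nu> \<in> CM" by (rule add_points_CM[OF \<mu> J])
  have em: "emeasure ?\<nu> A = emeasure \<mu> A + (\<Sum>j\<in>J. indicator A (x j))" if "A \<in> sets X" for A
    by (rule emeasure_add_points[OF \<mu> J that])
  {
    assume out: "\<forall>j\<in>J. x j \<notin> Z \<mu>"
    note ZX = ZX[OF \<mu> \<mu>]
    have "add_measure (restr_measure \<mu> (Z \<mu>)) (restr_measure ?\<nu> (space X - Z \<mu>)) = ?\<nu>"
    proof (rule measure_eqI)
      fix A assume "A \<in> sets (add_measure (restr_measure \<mu> (Z \<mu>)) (restr_measure ?\<nu> (space X - Z \<mu>)))"
      then have A: "A \<in> sets X" by (simp add: CM_sets[OF \<mu>])
      have AZ: "A \<inter> (space X - Z \<mu>) \<in> sets X" using A ZX by auto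
      have "(\<Sum>j\<in>J. indicator (A \<inter> (space X - Z \<mu>)) (x j)) = (\<Sum>j\<in>J. indicator A (x j) :: ennreal)"
        using out J by (intro sum.cong) (auto simp: indicator_def)
      then show "emeasure (add_measure (restr_measure \<mu> (Z \<mu>)) (restr_measure ?\<nu> (space X - Z \<mu>))) A = emeasure ?\<nu> A"
        unfolding emeasure_glue[OF \<mu> \<nu> ZX A] em[OF A] em[OF AZ] emeasure_split[OF \<mu> A ZX, symmetric]
        by (simp add: add.assoc)
    qed (simp add: CM_sets[OF \<mu>])
    then show "Z ?\<nu> = Z \<mu>" using st[OF \<mu> \<nu>] by simp
  }
  {
    assume out: "\<forall>j\<in>J. x j \<notin> Z ?\<nu>"
    note ZX = ZX[OF \<nu> \<nu>]
    \<comment> \<open>No added point lies in the stopping set of the enlarged measure, so the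
      enlarged measure agrees with \<mu> there and the glued measure is \<mu>.\<close>
    have "add_measure (restr_measure ?\<nu> (Z ?\<nu>)) (restr_measure \<mu> (space X - Z ?\<nu>)) = \<mu>"
    proof (rule measure_eqI)
      fix A assume "A \<in> sets (add_measure (restr_measure ?\<nu> (Z ?\<nu>)) (restr_measure \<mu> (space X - Z ?\<nu>)))"
      then have A: "A \<in> sets X" by (simp add: CM_sets[OF \<mu>])
      have AZ: "A \<inter> Z ?\<nu> \<in> sets X" using A ZX by auto
      have "(\<Sum>j\<in>J. indicator (A \<inter> Z ?\<nu>) (x j)) = (0 :: ennreal)"
        using out by (intro sum.neutral) (auto simp: indicator_def)
      then show "emeasure (add_measure (restr_measure ?\<nu> (Z ?\<nu>)) (restr_measure \<mu> (space X - Z ?\<nu>))) A = emeasure \<mu> A"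
        unfolding emeasure_glue[OF \<nu> \<mu> ZX A] em[OF AZ] emeasure_split[OF \<mu> A ZX, symmetric] by simp
    qed (simp add: CM_sets[OF \<mu>])
    then show "Z ?\<nu> = Z \<mu>" using st[OF \<nu> \<mu>] by simp
  }
qed

text \<open>If the indicator is 1 for either of the two configurations, one of the two directions of
  locality makes the stopping sets equal; otherwise both indicators are 0. A single direction would
  give only an inequality.\<close>

lemma avoiding_add_points:
  assumes Z: "stopping_set X Bn Z" and \<mu>: "\<mu> \<in> CM" and J: "J \<subseteq> {..<k}" and x: "x \<in> space (XP k)"
  shows "avoiding k (Z (add_points \<mu> J x)) x = avoiding k (Z \<mu>) x"
    and "avoiding k (Z \<mu>) x \<noteq> 0 \<Longrightarrow> Z (add_points \<mu> J x) = Z \<mu>"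
proof -
  have J': "finite J" using J finite_subset by blast
  have xX: "x ` J \<subseteq> space X" using J x by (auto simp: space_PiM PiE_iff)
  note st = stopping_set_add_points[OF Z \<mu> J' xX]
  have sub: "\<forall>j\<in>J. x j \<notin> C" if "\<forall>j<k. x j \<notin> C" for C using J that by blast
  show "avoiding k (Z (add_points \<mu> J x)) x = avoiding k (Z \<mu>) x"
  proof (cases "(\<forall>j<k. x j \<notin> Z \<mu>) \<or> (\<forall>j<k. x j \<notin> Z (add_points \<mu> J x))")
    case True
    then have "Z (add_points \<mu> J x) = Z \<mu>" using st sub by blast
    then show ?thesis by simp
  next
    case False
    then show ?thesis unfolding avoiding_eq by argo
  qed
  show "avoiding k (Z \<mu>) x \<noteq> 0 \<Longrightarrow> Z (add_points \<mu> J x) = Z \<mu>"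
    using st(1) sub unfolding avoiding_eq by presburger
qed

lemma restr_add_points:
  assumes \<mu>: "\<mu> \<in> CM" and C: "C \<in> sets X" and J: "finite J" "x ` J \<subseteq> space X" "\<And>j. j \<in> J \<Longrightarrow> x j \<notin> C"
  shows "restr_measure (add_points \<mu> J x) C = restr_measure \<mu> C"
proof (rule measure_eqI)
  fix A assume "A \<in> sets (restr_measure (add_points \<mu> J x) C)"
  then have A: "A \<in> sets X" by (simp add: CM_sets[OF \<mu>])
  have "(\<Sum>j\<in>J. indicator (A \<inter> C) (x j)) = (0 :: ennreal)"
    using J(3) by (intro sum.neutral) (auto simp: indicator_def)
  then show "emeasure (restr_measure (add_points \<mu> J x) C) A = emeasure (restr_measure \<mu> C) A"
    using A C J(1,2) \<mu> by (simp add: emeasure_restr_measure CM_sets emeasure_add_points)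
qed simp

end

section \<open>Duality for integrals over tuples avoiding a stopping set\<close>

text \<open>The mixed Mecke formula adds an initial segment of the coordinates; this permutation
  lets symmetry carry the result over to an arbitrary set \<open>J\<close> of the same size.\<close>

lemma permutes_image_lessThan:
  assumes J: "J \<subseteq> {..<k}"
  shows "\<exists>\<pi>. \<pi> permutes {..<k} \<and> bij_betw \<pi> {..<card J} J"
proof -
  have fJ: "finite J" using J finite_subset by blast
  have le: "card J \<le> k" using card_mono[OF finite_lessThan J] by simp
  obtain f where f: "bij_betw f {..<card J} J"
    using finite_same_card_bij[OF finite_lessThan fJ] by auto
  have "card ({..<k} - {..<card J}) = card ({..<k} - J)"
    using J le fJ by (simp add: card_Diff_subset)
  then obtain g where g: "bij_betw g ({..<k} - {..<card J}) ({..<k} - J)"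
    using finite_same_card_bij[of "{..<k} - {..<card J}" "{..<k} - J"] by auto
  define \<pi> where "\<pi> j = (if j \<in> {..<card J} then f j else if j < k then g j else j)" for j
  have "bij_betw (\<lambda>j. if j \<in> {..<card J} then f j else g j) ({..<card J} \<union> ({..<k} - {..<card J})) (J \<union> ({..<k} - J))"
    by (rule bij_betw_disjoint_Un[OF f g]) auto
  moreover have "{..<card J} \<union> ({..<k} - {..<card J}) = {..<k}" "J \<union> ({..<k} - J) = {..<k}"
    using J le by auto
  ultimately have "bij_betw (\<lambda>j. if j \<in> {..<card J} then f j else g j) {..<k} {..<k}" by simp
  then have "bij_betw \<pi> {..<k} {..<k}"
    by (rule bij_betw_cong[THEN iffD1, rotated]) (auto simp: \<pi>_def)
  then have "\<pi> permutes {..<k}"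
    using le by (intro bij_imp_permutes) (auto simp: \<pi>_def)
  moreover have "bij_betw \<pi> {..<card J} J"
    using f by (rule bij_betw_cong[THEN iffD1, rotated]) (auto simp: \<pi>_def)
  ultimately show ?thesis by blast
qed

context poisson_law
begin

section \<open>Moments of counts and the Mecke formula for signed integrands\<close>

lemma measure_add_point:
  assumes \<mu>: "\<mu> \<in> CM" and x: "x \<in> space X" and B: "B \<in> sets X"
  shows "emeasure (add_point \<mu> x) B = emeasure \<mu> B + indicator B x"
  using emeasure_add_points[OF \<mu> _ _ B, of "{0::nat}" "\<lambda>_. x"] x by simp

text \<open>Induction on m. The Mecke formula trades the extra factor \<mu>(B) for an integral over
  \<open>B\<close> with one point added, and one point at most doubles 1 + \<mu>(B).\<close>

lemma moment_finite:
  assumes B: "B \<in> local_sets X Bn"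
  shows "(\<integral>\<^sup>+\<mu>. (1 + emeasure \<mu> B) ^ m \<partial>Q) < \<infinity>"
proof (induction m)
  case 0
  then show ?case by (simp add: emeasure_space_1)
next
  case (Suc m)
  have BX[measurable]: "B \<in> sets X" using local_sets_sets[OF B] .
  let ?I = "\<integral>\<^sup>+\<mu>. (1 + emeasure \<mu> B) ^ m \<partial>Q"
  have "(\<integral>\<^sup>+\<mu>. (1 + emeasure \<mu> B) ^ Suc m \<partial>Q)
    = (\<integral>\<^sup>+\<mu>. (1 + emeasure \<mu> B) ^ m + emeasure \<mu> B * (1 + emeasure \<mu> B) ^ m \<partial>Q)"
    by (simp add: distrib_right)
  also have "\<dots> = ?I + (\<integral>\<^sup>+\<mu>. emeasure \<mu> B * (1 + emeasure \<mu> B) ^ m \<partial>Q)"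
    by (rule nn_integral_add) measurable
  also have "(\<integral>\<^sup>+\<mu>. emeasure \<mu> B * (1 + emeasure \<mu> B) ^ m \<partial>Q)
    = (\<integral>\<^sup>+\<mu>. \<integral>\<^sup>+x. indicator B x * (1 + emeasure \<mu> B) ^ m \<partial>\<mu> \<partial>Q)"
  proof (rule nn_integral_cong)
    fix \<mu> assume "\<mu> \<in> space Q"
    then have "B \<in> sets \<mu>" using BX by (simp add: space_Q CM_sets)
    then show "emeasure \<mu> B * (1 + emeasure \<mu> B) ^ m = (\<integral>\<^sup>+x. indicator B x * (1 + emeasure \<mu> B) ^ m \<partial>\<mu>)"
      by (simp add: nn_integral_multc)
  qed
  also have "\<dots> = (\<integral>\<^sup>+\<mu>. \<integral>\<^sup>+x. indicator B x * (1 + emeasure (add_point \<mu> x) B) ^ m \<partial>L \<partial>Q)"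
    by (rule mecke) measurable
  also have "\<dots> \<le> (\<integral>\<^sup>+\<mu>. \<integral>\<^sup>+x. indicator B x * (2 ^ m * (1 + emeasure \<mu> B) ^ m) \<partial>L \<partial>Q)"
  proof (intro nn_integral_mono mult_left_mono)
    fix \<mu> x assume "\<mu> \<in> space Q" "x \<in> space L"
    then have \<mu>: "\<mu> \<in> CM" and x: "x \<in> space X" by (simp_all add: space_Q space_L)
    have "1 + emeasure (add_point \<mu> x) B \<le> 2 * (1 + emeasure \<mu> B)"
    proof -
      have "1 + emeasure (add_point \<mu> x) B \<le> 1 + (emeasure \<mu> B + 1)"
        unfolding measure_add_point[OF \<mu> x BX] by (intro add_left_mono) (auto simp: indicator_def)
      also have "\<dots> \<le> 1 + (emeasure \<mu> B + 1) + emeasure \<mu> B" by simp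
      also have "\<dots> = 2 * (1 + emeasure \<mu> B)" by (simp add: mult_2 ac_simps)
      finally show ?thesis .
    qed
    then show "(1 + emeasure (add_point \<mu> x) B) ^ m \<le> 2 ^ m * (1 + emeasure \<mu> B) ^ m"
      unfolding power_mult_distrib[symmetric] by (rule power_mono) simp
  qed simp
  also have "\<dots> = (\<integral>\<^sup>+\<mu>. (emeasure L B * 2 ^ m) * (1 + emeasure \<mu> B) ^ m \<partial>Q)"
    using BX by (intro nn_integral_cong) (simp add: nn_integral_multc sets_L mult.assoc)
  also have "\<dots> = (emeasure L B * 2 ^ m) * ?I"
    by (rule nn_integral_cmult) measurable
  finally have "(\<integral>\<^sup>+\<mu>. (1 + emeasure \<mu> B) ^ Suc m \<partial>Q) \<le> ?I + (emeasure L B * 2 ^ m) * ?I"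
    by (simp add: add_left_mono)
  also have "\<dots> < \<infinity>" using Suc L_finite[OF B] by (simp add: ennreal_mult_less_top power_less_top_ennreal)
  finally show ?case .
qed

abbreviation QL :: "nat \<Rightarrow> ('a measure \<times> (nat \<Rightarrow> 'a)) measure" where
  "QL k \<equiv> Q \<Otimes>\<^sub>M power_measure L k"

lemma sets_QL: "sets (QL k) = sets (N \<Otimes>\<^sub>M XP k)"
  by (rule sets_pair_measure_cong[OF sets_Q sets_LP])

lemma space_QL: "w \<in> space (QL k) \<longleftrightarrow> fst w \<in> CM \<and> snd w \<in> space (XP k)"
  by (cases w) (simp add: space_pair_measure space_Q space_LP)

lemma pair_sigma_finite_QL: "pair_sigma_finite Q (power_measure L k)"
proof -
  interpret LPm: sigma_finite_measure "power_measure L k" by (rule sigma_finite_LP) simp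
  show ?thesis ..
qed

lemma measurable_add_points_QL:
  assumes "J \<subseteq> {..<k}"
  shows "(\<lambda>w. add_points (fst w) J (snd w)) \<in> N \<Otimes>\<^sub>M XP k \<rightarrow>\<^sub>M N"
proof (rule measurable_add_points)
  show "finite J" using assms finite_subset by blast
  fix j assume "j \<in> J"
  then have "(\<lambda>x. x j) \<in> XP k \<rightarrow>\<^sub>M X" using assms by (intro measurable_component_singleton) auto
  from measurable_compose[OF measurable_snd this] show "(\<lambda>w. snd w j) \<in> N \<Otimes>\<^sub>M XP k \<rightarrow>\<^sub>M X" .
qed measurable

text \<open>The nonnegative formula is applied to the positive and negative parts; the hypothesis on
  the absolute value excludes \<infinity> - \<infinity>.\<close>

theorem mecke_mixed_real:
  fixes f :: "(nat \<Rightarrow> 'a) \<Rightarrow> 'a measure \<Rightarrow> real"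
  assumes i: "i \<le> k" and f: "(\<lambda>(x, \<mu>). f x \<mu>) \<in> borel_measurable (XP k \<Otimes>\<^sub>M N)"
    and fin: "(\<integral>\<^sup>+\<mu>. \<integral>\<^sup>+x. ennreal \<bar>f x \<mu>\<bar> \<partial>mixed_measure k i \<mu> \<partial>Q) < \<infinity>"
  shows "integrable (QL k) (\<lambda>w. f (snd w) (add_points (fst w) {..<i} (snd w)))"
    and "integrable Q (\<lambda>\<mu>. \<integral>x. f x \<mu> \<partial>mixed_measure k i \<mu>)"
    and "(\<integral>\<mu>. \<integral>x. f x \<mu> \<partial>mixed_measure k i \<mu> \<partial>Q)
      = (\<integral>w. f (snd w) (add_points (fst w) {..<i} (snd w)) \<partial>QL k)"
proof -
  interpret LPm: sigma_finite_measure "power_measure L k" by (rule sigma_finite_LP) simp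
  let ?g = "\<lambda>w. f (snd w) (add_points (fst w) {..<i} (snd w))"
  have "(\<lambda>w. add_points (fst w) {..<i} (snd w)) \<in> N \<Otimes>\<^sub>M XP k \<rightarrow>\<^sub>M N"
    using i by (intro measurable_add_points_QL) auto
  from measurable_compose[OF measurable_Pair[OF measurable_snd this] f]
  have g: "?g \<in> borel_measurable (QL k)" unfolding measurable_cong_sets[OF sets_QL refl] by simp
  have int: "(\<integral>\<^sup>+w. h (?g w) \<partial>QL k) = (\<integral>\<^sup>+\<mu>. \<integral>\<^sup>+x. h (f x \<mu>) \<partial>mixed_measure k i \<mu> \<partial>Q)"
    and meas: "(\<lambda>\<mu>. \<integral>\<^sup>+x. h (f x \<mu>) \<partial>mixed_measure k i \<mu>) \<in> borel_measurable Q"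
    if h: "h \<in> borel_measurable borel" for h :: "real \<Rightarrow> ennreal"
  proof -
    have hf: "(\<lambda>(x, \<mu>). h (f x \<mu>)) \<in> borel_measurable (XP k \<Otimes>\<^sub>M N)"
      using measurable_compose[OF f h] by (simp add: split_beta')
    have "(\<integral>\<^sup>+w. h (?g w) \<partial>QL k) = (\<integral>\<^sup>+\<mu>. \<integral>\<^sup>+x. h (f x (add_points \<mu> {..<i} x)) \<partial>power_measure L k \<partial>Q)"
      using LPm.nn_integral_fst[OF measurable_compose[OF g h]] by simp
    also have "\<dots> = (\<integral>\<^sup>+\<mu>. \<integral>\<^sup>+x. h (f x \<mu>) \<partial>mixed_measure k i \<mu> \<partial>Q)"
      by (rule mecke_mixed[OF i hf, symmetric])
    finally show "(\<integral>\<^sup>+w. h (?g w) \<partial>QL k) = (\<integral>\<^sup>+\<mu>. \<integral>\<^sup>+x. h (f x \<mu>) \<partial>mixed_measure k i \<mu> \<partial>Q)" .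
    have "(\<lambda>w. (snd w, fst w)) \<in> N \<Otimes>\<^sub>M XP k \<rightarrow>\<^sub>M XP k \<Otimes>\<^sub>M N" by measurable
    from measurable_compose[OF this hf]
    have "(\<lambda>(\<mu>, x). h (f x \<mu>)) \<in> borel_measurable (N \<Otimes>\<^sub>M XP k)" by (simp add: split_beta')
    from measurable_nn_integral_mixed[OF i measurable_ident_sets[OF refl] this]
    show "(\<lambda>\<mu>. \<integral>\<^sup>+x. h (f x \<mu>) \<partial>mixed_measure k i \<mu>) \<in> borel_measurable Q"
      unfolding measurable_cong_sets[OF sets_Q refl] .
  qed
  show integrable_g: "integrable (QL k) ?g"
    using g fin int[of "\<lambda>t. ennreal \<bar>t\<bar>"] by (simp add: integrable_iff_bounded)
  define Ap where "Ap \<mu> = (\<integral>\<^sup>+x. ennreal (f x \<mu>) \<partial>mixed_measure k i \<mu>)" for \<mu>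
  define An where "An \<mu> = (\<integral>\<^sup>+x. ennreal (- f x \<mu>) \<partial>mixed_measure k i \<mu>)" for \<mu>
  define A where "A \<mu> = (\<integral>\<^sup>+x. ennreal \<bar>f x \<mu>\<bar> \<partial>mixed_measure k i \<mu>)" for \<mu>
  have m: "Ap \<in> borel_measurable Q" "An \<in> borel_measurable Q" "A \<in> borel_measurable Q"
    unfolding Ap_def An_def A_def by (rule meas; measurable)+
  have le: "Ap \<mu> \<le> A \<mu>" "An \<mu> \<le> A \<mu>" for \<mu>
    unfolding Ap_def An_def A_def by (intro nn_integral_mono ennreal_leI; simp)+
  \<comment> \<open>Integrability of the inner integrand is available only for almost every \<mu>;
    elsewhere the inner integral has its default value, so the identities below hold almost
    everywhere.\<close>
  have finA: "AE \<mu> in Q. A \<mu> \<noteq> \<infinity>"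
  proof (rule nn_integral_noteq_infinite[OF m(3)])
    show "(\<integral>\<^sup>+\<mu>. A \<mu> \<partial>Q) \<noteq> \<infinity>" using fin by (simp add: A_def)
  qed
  have part: "integrable Q (\<lambda>\<mu>. enn2real (B \<mu>)) \<and> (\<integral>\<mu>. enn2real (B \<mu>) \<partial>Q) = enn2real (\<integral>\<^sup>+\<mu>. B \<mu> \<partial>Q)"
    if B: "B \<in> borel_measurable Q" "\<And>\<mu>. B \<mu> \<le> A \<mu>" for B
  proof -
    have eq: "(\<integral>\<^sup>+\<mu>. ennreal (enn2real (B \<mu>)) \<partial>Q) = (\<integral>\<^sup>+\<mu>. B \<mu> \<partial>Q)"
    proof (rule nn_integral_cong_AE, use finA in eventually_elim)
      fix \<mu> assume "A \<mu> \<noteq> \<infinity>"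
      then have "B \<mu> < \<top>" using B(2)[of \<mu>] by (metis infinity_ennreal_def less_top order_le_less_trans)
      then show "ennreal (enn2real (B \<mu>)) = B \<mu>" by simp
    qed
    have "(\<integral>\<^sup>+\<mu>. B \<mu> \<partial>Q) \<le> (\<integral>\<^sup>+\<mu>. A \<mu> \<partial>Q)" using B(2) by (intro nn_integral_mono)
    also have "\<dots> < \<infinity>" using fin by (simp add: A_def)
    finally have "integrable Q (\<lambda>\<mu>. enn2real (B \<mu>))"
      using B(1) eq by (intro integrableI_nonneg) auto
    moreover have "(\<integral>\<mu>. enn2real (B \<mu>) \<partial>Q) = enn2real (\<integral>\<^sup>+\<mu>. B \<mu> \<partial>Q)"
      using B(1) by (subst integral_eq_nn_integral) (auto simp: eq)
    ultimately show ?thesis ..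
  qed
  have AE_eq: "AE \<mu> in Q. (\<integral>x. f x \<mu> \<partial>mixed_measure k i \<mu>) = enn2real (Ap \<mu>) - enn2real (An \<mu>)"
  proof -
    have "AE \<mu> in Q. \<mu> \<in> space Q" by simp
    with finA show ?thesis
    proof eventually_elim
      fix \<mu> assume \<mu>: "A \<mu> \<noteq> \<infinity>" "\<mu> \<in> space Q"
      then have "(\<lambda>x. f x \<mu>) \<in> borel_measurable (mixed_measure k i \<mu>)"
        using measurable_Pair1[OF f, of \<mu>] unfolding measurable_cong_sets[OF sets_mixed_measure refl]
        by (simp add: space_N space_Q)
      then have "integrable (mixed_measure k i \<mu>) (\<lambda>x. f x \<mu>)"
        using \<mu>(1) by (simp add: integrable_iff_bounded A_def less_top)
      then show "(\<integral>x. f x \<mu> \<partial>mixed_measure k i \<mu>) = enn2real (Ap \<mu>) - enn2real (An \<mu>)"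
        unfolding Ap_def An_def by (rule real_lebesgue_integral_def)
    qed
  qed
  have "(\<lambda>w. (snd w, fst w)) \<in> N \<Otimes>\<^sub>M XP k \<rightarrow>\<^sub>M XP k \<Otimes>\<^sub>M N" by measurable
  from measurable_compose[OF this f]
  have f': "(\<lambda>(\<mu>, x). f x \<mu>) \<in> borel_measurable (N \<Otimes>\<^sub>M XP k)" by (simp add: split_beta')
  have mI: "(\<lambda>\<mu>. \<integral>x. f x \<mu> \<partial>mixed_measure k i \<mu>) \<in> borel_measurable Q"
    unfolding measurable_cong_sets[OF sets_Q refl]
    by (rule measurable_integral_kernel[OF measurable_nn_integral_mixed[OF i measurable_ident_sets[OF refl]] sets_mixed_measure f'])
  have intd: "integrable Q (\<lambda>\<mu>. enn2real (Ap \<mu>) - enn2real (An \<mu>))"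
    using part[OF m(1) le(1)] part[OF m(2) le(2)] by simp
  show "integrable Q (\<lambda>\<mu>. \<integral>x. f x \<mu> \<partial>mixed_measure k i \<mu>)"
    using integrable_cong_AE[OF mI borel_measurable_integrable[OF intd] AE_eq] intd by simp
  have "(\<integral>\<mu>. \<integral>x. f x \<mu> \<partial>mixed_measure k i \<mu> \<partial>Q) = (\<integral>\<mu>. enn2real (Ap \<mu>) - enn2real (An \<mu>) \<partial>Q)"
    by (rule integral_cong_AE[OF mI borel_measurable_integrable[OF intd] AE_eq])
  also have "\<dots> = enn2real (\<integral>\<^sup>+\<mu>. Ap \<mu> \<partial>Q) - enn2real (\<integral>\<^sup>+\<mu>. An \<mu> \<partial>Q)"
    using part[OF m(1) le(1)] part[OF m(2) le(2)] by simp
  also have "\<dots> = (\<integral>w. ?g w \<partial>QL k)"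
    using int[of "\<lambda>t. ennreal t"] int[of "\<lambda>t. ennreal (- t)"]
    by (simp add: real_lebesgue_integral_def[OF integrable_g] Ap_def An_def)
  finally show "(\<integral>\<mu>. \<integral>x. f x \<mu> \<partial>mixed_measure k i \<mu> \<partial>Q) = (\<integral>w. ?g w \<partial>QL k)" .
qed

section \<open>Permutations of coordinates and symmetric kernels\<close>

lemma measurable_permute:
  assumes \<pi>: "\<pi> permutes {..<k}"
  shows "(\<lambda>x. x \<circ> \<pi>) \<in> XP k \<rightarrow>\<^sub>M XP k"
proof -
  have "(\<lambda>x. \<lambda>j\<in>{..<k}. x (\<pi> j)) \<in> XP k \<rightarrow>\<^sub>M XP k"
    using permutes_in_image[OF \<pi>] by (intro measurable_restrict measurable_component_singleton) auto
  moreover have "(\<lambda>j\<in>{..<k}. x (\<pi> j)) = x \<circ> \<pi>" if "x \<in> space (XP k)" for x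
  proof
    fix j show "(\<lambda>j\<in>{..<k}. x (\<pi> j)) j = (x \<circ> \<pi>) j"
      using that permutes_not_in[OF \<pi>, of j] by (auto simp: space_PiM PiE_def extensional_def)
  qed
  ultimately show ?thesis by (simp cong: measurable_cong)
qed

text \<open>The preimage of a rectangle is the rectangle whose sides are permuted by the inverse,
  and the product of the masses of the sides does not depend on their order.\<close>

lemma distr_permute:
  assumes \<pi>: "\<pi> permutes {..<k}"
  shows "distr (power_measure L k) (power_measure L k) (\<lambda>x. x \<circ> \<pi>) = power_measure L k"
proof (rule LP.PiM_eqI)
  fix A assume A: "\<And>i. i \<in> {..<k} \<Longrightarrow> A i \<in> sets L"
  let ?\<sigma> = "inv \<pi>"
  have \<sigma>: "?\<sigma> permutes {..<k}" by (rule permutes_inv[OF \<pi>])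
  have m: "(\<lambda>x. x \<circ> \<pi>) \<in> power_measure L k \<rightarrow>\<^sub>M power_measure L k"
    using measurable_permute[OF \<pi>] unfolding measurable_cong_sets[OF sets_LP sets_LP] .
  have A\<sigma>: "A (?\<sigma> i) \<in> sets L" if "i \<in> {..<k}" for i
    using A permutes_in_image[OF \<sigma>, of i] that by auto
  have "(\<lambda>x. x \<circ> \<pi>) -` Pi\<^sub>E {..<k} A \<inter> space (power_measure L k) = Pi\<^sub>E {..<k} (\<lambda>i. A (?\<sigma> i))"
  proof (intro set_eqI iffI)
    fix x assume x: "x \<in> (\<lambda>x. x \<circ> \<pi>) -` Pi\<^sub>E {..<k} A \<inter> space (power_measure L k)"
    have "x i \<in> A (?\<sigma> i)" if "i \<in> {..<k}" for i
    proof -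
      have "?\<sigma> i \<in> {..<k}" using permutes_in_image[OF \<sigma>, of i] that by auto
      then have "(x \<circ> \<pi>) (?\<sigma> i) \<in> A (?\<sigma> i)" using x by (auto simp: PiE_def Pi_def)
      then show ?thesis by (simp add: permutes_inverses[OF \<pi>])
    qed
    then show "x \<in> Pi\<^sub>E {..<k} (\<lambda>i. A (?\<sigma> i))" using x by (auto simp: space_PiM PiE_def)
  next
    fix x assume x: "x \<in> Pi\<^sub>E {..<k} (\<lambda>i. A (?\<sigma> i))"
    have "(x \<circ> \<pi>) i \<in> A i" if "i \<in> {..<k}" for i
    proof -
      have "\<pi> i \<in> {..<k}" using permutes_in_image[OF \<pi>, of i] that by auto
      then have "x (\<pi> i) \<in> A (?\<sigma> (\<pi> i))" using x by (auto simp: PiE_def Pi_def)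
      then show ?thesis by (simp add: permutes_inverses[OF \<pi>])
    qed
    moreover have "(x \<circ> \<pi>) i = undefined" if "i \<notin> {..<k}" for i
      using x that permutes_not_in[OF \<pi> that] by (auto simp: PiE_def extensional_def)
    moreover have "x \<in> space (power_measure L k)"
      using x A\<sigma>[THEN sets.sets_into_space] by (auto simp: space_PiM PiE_def Pi_def)
    ultimately show "x \<in> (\<lambda>x. x \<circ> \<pi>) -` Pi\<^sub>E {..<k} A \<inter> space (power_measure L k)"
      by (auto simp: PiE_def Pi_def extensional_def)
  qed
  then have "emeasure (distr (power_measure L k) (power_measure L k) (\<lambda>x. x \<circ> \<pi>)) (Pi\<^sub>E {..<k} A)
    = emeasure (power_measure L k) (Pi\<^sub>E {..<k} (\<lambda>i. A (?\<sigma> i)))"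
    using A m by (subst emeasure_distr) (auto intro!: sets_PiM_I_finite)
  also have "\<dots> = (\<Prod>i<k. emeasure L (A (?\<sigma> i)))"
    using A\<sigma> by (intro LP.emeasure_PiM) auto
  also have "\<dots> = (\<Prod>i<k. emeasure L (A i))"
    using prod.permute[OF \<sigma>, of "\<lambda>i. emeasure L (A i)"] by (simp add: comp_def)
  finally show "emeasure (distr (power_measure L k) (power_measure L k) (\<lambda>x. x \<circ> \<pi>)) (Pi\<^sub>E {..<k} A)
    = (\<Prod>i\<in>{..<k}. emeasure L (A i))" .
qed auto

lemma distr_permute_QL:
  assumes \<pi>: "\<pi> permutes {..<k}"
  shows "distr (QL k) (QL k) (\<lambda>w. (fst w, snd w \<circ> \<pi>)) = QL k"
proof -
  interpret LPm: sigma_finite_measure "power_measure L k" by (rule sigma_finite_LP) simp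
  have m: "(\<lambda>x. x \<circ> \<pi>) \<in> power_measure L k \<rightarrow>\<^sub>M power_measure L k"
    using measurable_permute[OF \<pi>] unfolding measurable_cong_sets[OF sets_LP sets_LP] .
  have "sigma_finite_measure (distr (power_measure L k) (power_measure L k) (\<lambda>x. x \<circ> \<pi>))"
    unfolding distr_permute[OF \<pi>] ..
  from pair_measure_distr[OF measurable_ident[of Q] m this]
  show ?thesis unfolding distr_permute[OF \<pi>] id_def distr_id by (simp add: split_beta')
qed

lemma stopping_set_sets: "stopping_set X Bn Z \<Longrightarrow> \<mu> \<in> CM \<Longrightarrow> Z \<mu> \<in> sets X"
  by (auto simp: stopping_set_def)

lemma measurable_avoiding_stopping:
  assumes Z: "stopping_set X Bn Z"
  shows "(\<lambda>(\<mu>, x). avoiding k (Z \<mu>) x) \<in> borel_measurable (N \<Otimes>\<^sub>M XP k)"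
proof (rule measurable_avoiding)
  have "(\<lambda>w. (snd w, fst w)) \<in> N \<Otimes>\<^sub>M X \<rightarrow>\<^sub>M X \<Otimes>\<^sub>M N" by measurable
  moreover have "(\<lambda>(x, \<mu>). indicator (Z \<mu>) x :: real) \<in> borel_measurable (X \<Otimes>\<^sub>M N)"
    using Z by (simp add: stopping_set_def)
  ultimately show "(\<lambda>(\<mu>, x). indicator (Z \<mu>) x :: real) \<in> borel_measurable (N \<Otimes>\<^sub>M X)"
    using measurable_compose[of "\<lambda>w. (snd w, fst w)" "N \<Otimes>\<^sub>M X" "X \<Otimes>\<^sub>M N" "\<lambda>(x, \<mu>). indicator (Z \<mu>) x :: real" borel]
    by (simp add: split_beta')
qed

lemma avoiding_le: "0 \<le> avoiding k C x" "avoiding k C x \<le> 1" "avoiding k C x * avoiding k C x = avoiding k C x"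
  by (auto simp: avoiding_eq)

lemma bounded_kernel_avoiding:
  assumes v: "bounded_kernel k B c v" and Z: "stopping_set X Bn Z" and \<mu>: "\<mu> \<in> CM"
  shows "bounded_kernel k B c (\<lambda>x. v x * avoiding k (Z \<mu>) x)"
proof -
  note D = bounded_kernelD[OF v]
  have "(\<lambda>x. avoiding k (Z \<mu>) x) \<in> borel_measurable (XP k)"
    using measurable_Pair2[OF measurable_avoiding_stopping[OF Z], of \<mu>] \<mu> by (simp add: space_N)
  moreover have "\<bar>v x * avoiding k (Z \<mu>) x\<bar> \<le> c * indicator (box k B) x" for x
    using D(5)[of x] by (auto simp: avoiding_eq)
  ultimately show ?thesis using D by (simp add: bounded_kernel_def)
qed

lemma avoiding_permute:
  assumes \<pi>: "\<pi> permutes {..<k}" shows "avoiding k C (x \<circ> \<pi>) = avoiding k C x"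
proof -
  have "avoiding k C (x \<circ> \<pi>) = (\<Prod>j\<in>{..<k}. 1 - indicator C (x (\<pi> j)))" by (simp add: avoiding_def)
  also have "\<dots> = avoiding k C x"
    using prod.permute[OF \<pi>, of "\<lambda>j. 1 - indicator C (x j) :: real"] by (simp add: avoiding_def comp_def)
  finally show ?thesis .
qed

lemma add_points_permute:
  assumes \<mu>: "\<mu> \<in> CM" and \<pi>: "\<pi> permutes {..<k}" and J: "J \<subseteq> {..<k}" "bij_betw \<pi> {..<i} J" "i \<le> k"
    and x: "x \<in> space (XP k)"
  shows "add_points \<mu> {..<i} (x \<circ> \<pi>) = add_points \<mu> J x"
proof -
  have fJ: "finite J" using J finite_subset by blast
  have x1: "x ` J \<subseteq> space X" using x J by (auto simp: space_PiM PiE_iff)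
  have "(x \<circ> \<pi>) ` {..<i} = x ` (\<pi> ` {..<i})" by auto
  then have x2: "(x \<circ> \<pi>) ` {..<i} \<subseteq> space X" using x1 bij_betw_imp_surj_on[OF J(2)] by simp
  show ?thesis
  proof (rule CM_eqI[OF add_points_CM[OF \<mu> _ x2] add_points_CM[OF \<mu> fJ x1]])
    fix A assume A: "A \<in> sets X"
    have "(\<Sum>j<i. indicator A ((x \<circ> \<pi>) j)) = (\<Sum>j\<in>J. indicator A (x j) :: ennreal)"
      using sum.reindex_bij_betw[OF J(2), of "\<lambda>j. indicator A (x j)"] by simp
    then show "emeasure (add_points \<mu> {..<i} (x \<circ> \<pi>)) A = emeasure (add_points \<mu> J x) A"
      unfolding emeasure_add_points[OF \<mu> finite_lessThan x2 A] emeasure_add_points[OF \<mu> fJ x1 A] by simp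
  qed simp
qed

text \<open>Symmetry almost everywhere for the power of \<open>L\<close> says nothing about a fixed
  realization, so it is invoked only after the Mecke formula has replaced the points of the process
  by points from \<open>L\<close>.\<close>

definition symmetric_kernel :: "nat \<Rightarrow> ((nat \<Rightarrow> 'a) \<Rightarrow> real) \<Rightarrow> bool" where
  "symmetric_kernel k v \<longleftrightarrow> (\<forall>\<pi>. \<pi> permutes {..<k} \<longrightarrow> (AE x in power_measure L k. v (x \<circ> \<pi>) = v x))"

lemma symmetric_kernel_QL:
  assumes v: "v \<in> borel_measurable (XP k)" and sym: "symmetric_kernel k v" and \<pi>: "\<pi> permutes {..<k}"
  shows "AE w in QL k. v (snd w \<circ> \<pi>) = v (snd w)"
proof -
  interpret LPm: sigma_finite_measure "power_measure L k" by (rule sigma_finite_LP) simp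
  interpret pair_sigma_finite Q "power_measure L k" by (rule pair_sigma_finite_QL)
  have p: "(\<lambda>w. v (snd w \<circ> \<pi>)) \<in> borel_measurable (N \<Otimes>\<^sub>M XP k)"
    using measurable_compose[OF measurable_compose[OF measurable_snd measurable_permute[OF \<pi>]] v, of N] by simp
  have q: "(\<lambda>w. v (snd w)) \<in> borel_measurable (N \<Otimes>\<^sub>M XP k)"
    by (rule measurable_compose[OF measurable_snd v])
  show ?thesis
  proof (rule AE_pair_measure)
    show "{w \<in> space (QL k). v (snd w \<circ> \<pi>) = v (snd w)} \<in> sets (QL k)"
      using p q unfolding sets_QL sets_eq_imp_space_eq[OF sets_QL] by (intro borel_measurable_eq) auto
    show "AE \<mu> in Q. AE x in power_measure L k. v (snd (\<mu>, x) \<circ> \<pi>) = v (snd (\<mu>, x))"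
      using sym \<pi> by (simp add: symmetric_kernel_def)
  qed
qed

text \<open>The random variable H for a deterministic stopping set, as a function of the
  configuration. Its kernel varies with \<mu>, so it is not the multiple integral of a fixed
  kernel.\<close>

definition outer_integral :: "nat \<Rightarrow> ((nat \<Rightarrow> 'a) \<Rightarrow> real) \<Rightarrow> ('a measure \<Rightarrow> 'a set) \<Rightarrow> 'a measure \<Rightarrow> real" where
  "outer_integral k v Z \<mu> = pathwise_integral L k (\<lambda>x. v x * avoiding k (Z \<mu>) x) \<mu>"

lemma outer_integral_bound:
  assumes v: "bounded_kernel k B c v" and Z: "stopping_set X Bn Z" and \<mu>: "\<mu> \<in> CM"
  shows "\<bar>outer_integral k v Z \<mu>\<bar> \<le> (2 ^ k * c * (1 + measure L B) ^ k) * (1 + measure \<mu> B) ^ k"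
  unfolding outer_integral_def by (rule pathwise_integral_bound[OF bounded_kernel_avoiding[OF v Z \<mu>] \<mu>])

lemma measurable_outer_integral:
  assumes v: "v \<in> borel_measurable (XP k)" and Z: "stopping_set X Bn Z"
  shows "outer_integral k v Z \<in> borel_measurable N"
  unfolding outer_integral_def
proof (rule measurable_pathwise_integral[OF measurable_ident_sets[OF refl]])
  show "(\<lambda>(\<mu>, x). v x * avoiding k (Z \<mu>) x) \<in> borel_measurable (N \<Otimes>\<^sub>M XP k)"
    using measurable_avoiding_stopping[OF Z] measurable_compose[OF measurable_snd v, of N] unfolding split_beta'
    by (intro borel_measurable_times) auto
qed

text \<open>All moments of the count of a local set are finite, so polynomial growth in that count
  is a sufficient and easily checked criterion.\<close>

lemma polynomial_integrable:
  assumes B: "B \<in> local_sets X Bn" and G: "G \<in> borel_measurable N"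
    and b: "\<And>\<mu>. \<mu> \<in> CM \<Longrightarrow> \<bar>G \<mu>\<bar> \<le> b * (1 + measure \<mu> B) ^ m"
  shows "integrable Q G"
proof -
  have BX: "B \<in> sets X" using local_sets_sets[OF B] .
  have eq: "ennreal ((1 + measure \<mu> B) ^ m) = (1 + emeasure \<mu> B) ^ m" if "\<mu> \<in> CM" for \<mu>
  proof -
    have "1 + emeasure \<mu> B = ennreal (1 + measure \<mu> B)"
      using CM_finite[OF that B] by (simp add: emeasure_eq_ennreal_measure ennreal_plus[OF zero_le_one measure_nonneg])
    then show ?thesis by (simp only:) (rule ennreal_power[symmetric], simp)
  qed
  have "(\<integral>\<^sup>+\<mu>. ennreal \<bar>G \<mu>\<bar> \<partial>Q) \<le> (\<integral>\<^sup>+\<mu>. ennreal \<bar>b\<bar> * (1 + emeasure \<mu> B) ^ m \<partial>Q)"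
  proof (rule nn_integral_mono)
    fix \<mu> assume "\<mu> \<in> space Q"
    then have \<mu>: "\<mu> \<in> CM" by (simp add: space_Q)
    have "\<bar>G \<mu>\<bar> \<le> \<bar>b\<bar> * (1 + measure \<mu> B) ^ m"
      using b[OF \<mu>] by (rule order_trans) (intro mult_right_mono; simp)
    then have "ennreal \<bar>G \<mu>\<bar> \<le> ennreal (\<bar>b\<bar> * (1 + measure \<mu> B) ^ m)" by (rule ennreal_leI)
    also have "\<dots> = ennreal \<bar>b\<bar> * (1 + emeasure \<mu> B) ^ m" by (simp add: ennreal_mult eq[OF \<mu>])
    finally show "ennreal \<bar>G \<mu>\<bar> \<le> ennreal \<bar>b\<bar> * (1 + emeasure \<mu> B) ^ m" .
  qed
  also have "\<dots> = ennreal \<bar>b\<bar> * (\<integral>\<^sup>+\<mu>. (1 + emeasure \<mu> B) ^ m \<partial>Q)"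
  proof (rule nn_integral_cmult)
    have "(\<lambda>\<mu>. (1 + emeasure \<mu> B) ^ m) \<in> borel_measurable N" using BX by measurable
    then show "(\<lambda>\<mu>. (1 + emeasure \<mu> B) ^ m) \<in> borel_measurable Q"
      unfolding measurable_cong_sets[OF sets_Q refl] .
  qed
  also have "\<dots> < \<infinity>" using moment_finite[OF B, of m] by (simp add: ennreal_mult_less_top)
  finally show ?thesis
    using G unfolding integrable_iff_bounded measurable_cong_sets[OF sets_Q refl] by simp
qed

lemma outer_integral_mixed:
  assumes v: "bounded_kernel k B c v" and Z: "stopping_set X Bn Z" and \<mu>: "\<mu> \<in> CM"
  shows "outer_integral k v Z \<mu> * g
    = (\<Sum>i\<le>k. (-1) ^ (k - i) * real (k choose i) * (\<integral>x. v x * avoiding k (Z \<mu>) x * g \<partial>mixed_measure k i \<mu>))"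
  unfolding outer_integral_def pathwise_integral_mixed[OF \<mu> bounded_kernelD(4)[OF bounded_kernel_avoiding[OF v Z \<mu>]]]
  by (simp only: sum_distrib_right mult.assoc integral_mult_left_zero[symmetric])

text \<open>The i-th term of the pathwise integral becomes, by the mixed Mecke formula, an integral
  in which \<open>G\<close> is shifted by the first i coordinates. Symmetry spreads it evenly over
  all sets \<open>J\<close> of size i, whose number is the binomial coefficient of that term, and
  the signs assemble the difference operator applied to \<open>G\<close>.\<close>

theorem outer_integral_duality:
  assumes v: "bounded_kernel k B c v" and sym: "symmetric_kernel k v" and Z: "stopping_set X Bn Z"
    and G: "G \<in> borel_measurable N" and b: "\<And>\<mu>. \<mu> \<in> CM \<Longrightarrow> \<bar>G \<mu>\<bar> \<le> b * (1 + measure \<mu> B) ^ d"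
  shows "(\<integral>\<mu>. outer_integral k v Z \<mu> * G \<mu> \<partial>Q)
    = (\<integral>w. v (snd w) * avoiding k (Z (fst w)) (snd w) *
        (\<Sum>J\<in>Pow {..<k}. (-1) ^ (k - card J) * G (add_points (fst w) J (snd w))) \<partial>QL k)"
proof -
  note D = bounded_kernelD[OF v]
  define f where "f x \<mu> = v x * avoiding k (Z \<mu>) x * G \<mu>" for x \<mu>
  define g where "g J w = v (snd w) * avoiding k (Z (fst w)) (snd w) * G (add_points (fst w) J (snd w))" for J w
  have av: "(\<lambda>w. avoiding k (Z (fst w)) (snd w)) \<in> borel_measurable (N \<Otimes>\<^sub>M XP k)"
    using measurable_avoiding_stopping[OF Z] by (simp add: split_beta')
  have vm: "(\<lambda>w. v (snd w)) \<in> borel_measurable (N \<Otimes>\<^sub>M XP k)"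
    by (rule measurable_compose[OF measurable_snd D(4)])
  have f: "(\<lambda>(x, \<mu>). f x \<mu>) \<in> borel_measurable (XP k \<Otimes>\<^sub>M N)"
  proof -
    have "(\<lambda>w. f (snd w) (fst w)) \<in> borel_measurable (N \<Otimes>\<^sub>M XP k)"
      unfolding f_def using av vm measurable_compose[OF measurable_fst G] by (intro borel_measurable_times)
    moreover have "(\<lambda>w. (snd w, fst w)) \<in> XP k \<Otimes>\<^sub>M N \<rightarrow>\<^sub>M N \<Otimes>\<^sub>M XP k" by measurable
    ultimately have "(\<lambda>w. f (snd (snd w, fst w)) (fst (snd w, fst w))) \<in> borel_measurable (XP k \<Otimes>\<^sub>M N)"
      by (rule measurable_compose[rotated])
    then show ?thesis by (simp add: split_beta')
  qed
  have gm: "g J \<in> borel_measurable (QL k)" if J: "J \<subseteq> {..<k}" for J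
    unfolding g_def measurable_cong_sets[OF sets_QL refl]
    using av vm measurable_compose[OF measurable_add_points_QL[OF J] G] by (intro borel_measurable_times)
  have fin: "(\<integral>\<^sup>+\<mu>. \<integral>\<^sup>+x. ennreal \<bar>f x \<mu>\<bar> \<partial>mixed_measure k i \<mu> \<partial>Q) < \<infinity>" if i: "i \<le> k" for i
  proof -
    \<comment> \<open>The integrand is at most c |G| on the box. The degree d comes from
      \<open>G\<close> and the degree k from the mass of the box; all factors free of \<mu> are
      collected in a.\<close>
    define a where "a = c * \<bar>b\<bar> * (1 + measure L B) ^ k"
    have a: "0 \<le> a" using D(3) by (simp add: a_def)
    have "(\<integral>\<^sup>+\<mu>. \<integral>\<^sup>+x. ennreal \<bar>f x \<mu>\<bar> \<partial>mixed_measure k i \<mu> \<partial>Q)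
      \<le> (\<integral>\<^sup>+\<mu>. ennreal (a * (1 + measure \<mu> B) ^ (d + k)) \<partial>Q)"
    proof (rule nn_integral_mono)
      fix \<mu> assume "\<mu> \<in> space Q"
      then have \<mu>: "\<mu> \<in> CM" by (simp add: space_Q)
      have "(\<integral>\<^sup>+x. ennreal \<bar>f x \<mu>\<bar> \<partial>mixed_measure k i \<mu>)
        \<le> (\<integral>\<^sup>+x. ennreal (c * \<bar>G \<mu>\<bar>) * indicator (box k B) x \<partial>mixed_measure k i \<mu>)"
      proof (rule nn_integral_mono)
        fix x
        have "\<bar>f x \<mu>\<bar> \<le> c * indicator (box k B) x * \<bar>G \<mu>\<bar>"
          using D(5)[of x] unfolding f_def abs_mult by (intro mult_right_mono) (auto simp: avoiding_eq)
        then have "ennreal \<bar>f x \<mu>\<bar> \<le> ennreal (c * indicator (box k B) x * \<bar>G \<mu>\<bar>)" by (rule ennreal_leI)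
        also have "\<dots> = ennreal (c * \<bar>G \<mu>\<bar>) * indicator (box k B) x" by (auto simp: indicator_def)
        finally show "ennreal \<bar>f x \<mu>\<bar> \<le> ennreal (c * \<bar>G \<mu>\<bar>) * indicator (box k B) x" .
      qed
      also have "\<dots> = ennreal (c * \<bar>G \<mu>\<bar>) * emeasure (mixed_measure k i \<mu>) (box k B)"
        using box_sets[OF D(2), of k] by (simp add: nn_integral_cmult_indicator)
      also have "\<dots> = ennreal (c * \<bar>G \<mu>\<bar> * measure (mixed_measure k i \<mu>) (box k B))"
        using mixed_box_finite(1)[OF i \<mu> D(1)] D(3) by (simp add: emeasure_eq_ennreal_measure ennreal_mult)
      also have "\<dots> \<le> ennreal (a * (1 + measure \<mu> B) ^ (d + k))"
      proof (rule ennreal_leI)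
        have G': "\<bar>G \<mu>\<bar> \<le> \<bar>b\<bar> * (1 + measure \<mu> B) ^ d"
          using b[OF \<mu>] by (rule order_trans) (intro mult_right_mono; simp)
        have "measure \<mu> B ^ i \<le> (1 + measure \<mu> B) ^ i" by (intro power_mono) auto
        also have "\<dots> \<le> (1 + measure \<mu> B) ^ k" using i by (intro power_increasing) auto
        finally have 1: "measure \<mu> B ^ i \<le> (1 + measure \<mu> B) ^ k" .
        have "measure L B ^ (k - i) \<le> (1 + measure L B) ^ (k - i)" by (intro power_mono) auto
        also have "\<dots> \<le> (1 + measure L B) ^ k" using i by (intro power_increasing) auto
        finally have 2: "measure L B ^ (k - i) \<le> (1 + measure L B) ^ k" .
        have "measure (mixed_measure k i \<mu>) (box k B) \<le> (1 + measure \<mu> B) ^ k * (1 + measure L B) ^ k"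
          using mixed_box_finite(2)[OF i \<mu> D(1)] mult_mono[OF 1 2] by (rule order_trans) auto
        then have "c * \<bar>G \<mu>\<bar> * measure (mixed_measure k i \<mu>) (box k B)
          \<le> c * (\<bar>b\<bar> * (1 + measure \<mu> B) ^ d) * ((1 + measure \<mu> B) ^ k * (1 + measure L B) ^ k)"
          using G' D(3) by (intro mult_mono) auto
        then show "c * \<bar>G \<mu>\<bar> * measure (mixed_measure k i \<mu>) (box k B) \<le> a * (1 + measure \<mu> B) ^ (d + k)"
          by (simp add: a_def power_add ac_simps)
      qed
      finally show "(\<integral>\<^sup>+x. ennreal \<bar>f x \<mu>\<bar> \<partial>mixed_measure k i \<mu>) \<le> ennreal (a * (1 + measure \<mu> B) ^ (d + k))" .
    qed
    also have "\<dots> < \<infinity>"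
    proof -
      have "(\<lambda>\<mu>. a * (1 + measure \<mu> B) ^ (d + k)) \<in> borel_measurable N"
        using measurable_emeasure_N[OF D(2)] unfolding measure_def by measurable
      then have "integrable Q (\<lambda>\<mu>. a * (1 + measure \<mu> B) ^ (d + k))"
        using a by (intro polynomial_integrable[OF D(1), where b=a and m="d + k"]) auto
      then have "(\<integral>\<^sup>+\<mu>. ennreal (norm (a * (1 + measure \<mu> B) ^ (d + k))) \<partial>Q) < \<infinity>"
        unfolding integrable_iff_bounded by (rule conjunct2)
      moreover have "norm (a * (1 + measure \<mu> B) ^ (d + k)) = a * (1 + measure \<mu> B) ^ (d + k)" for \<mu>
        using a by simp
      ultimately show ?thesis by (simp only:)
    qed
    finally show ?thesis .
  qed
  \<comment> \<open>The avoidance indicator at x takes the same value for the enlarged and the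
    original configuration, so the shift acts on \<open>G\<close> alone.\<close>
  have gi: "f (snd w) (add_points (fst w) {..<i} (snd w)) = g {..<i} w" if "i \<le> k" "w \<in> space (QL k)" for i w
    using avoiding_add_points(1)[OF Z, of "fst w" "{..<i}" k "snd w"] that
    by (simp add: f_def g_def space_QL)
  have int_i: "integrable (QL k) (g {..<i})" if "i \<le> k" for i
    using mecke_mixed_real(1)[OF that f fin[OF that]]
    by (rule Bochner_Integration.integrable_cong[THEN iffD1, OF refl, rotated]) (rule gi[OF that])
  have eq_i: "(\<integral>\<mu>. \<integral>x. f x \<mu> \<partial>mixed_measure k i \<mu> \<partial>Q) = (\<integral>w. g {..<i} w \<partial>QL k)" if "i \<le> k" for i
    unfolding mecke_mixed_real(3)[OF that f fin[OF that]]
    by (rule Bochner_Integration.integral_cong[OF refl]) (rule gi[OF that])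
  \<comment> \<open>A permutation of coordinates carries the initial segment to \<open>J\<close>; it
    preserves the law, the avoidance indicator, and almost everywhere the kernel.\<close>
  have J_eq: "integrable (QL k) (g J) \<and> (\<integral>w. g J w \<partial>QL k) = (\<integral>w. g {..<card J} w \<partial>QL k)" if J: "J \<subseteq> {..<k}" for J
  proof -
    have le: "card J \<le> k" using card_mono[OF finite_lessThan J] by simp
    obtain \<pi> where \<pi>: "\<pi> permutes {..<k}" "bij_betw \<pi> {..<card J} J"
      using permutes_image_lessThan[OF J] by blast
    let ?T = "\<lambda>w. (fst w, snd w \<circ> \<pi>)"
    have T: "?T \<in> QL k \<rightarrow>\<^sub>M QL k"
      unfolding measurable_cong_sets[OF sets_QL sets_QL]
      by (intro measurable_Pair measurable_fst measurable_compose[OF measurable_snd measurable_permute[OF \<pi>(1)]])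
    have ae: "AE w in QL k. g {..<card J} (?T w) = g J w"
    proof -
      have "AE w in QL k. w \<in> space (QL k)" by simp
      with symmetric_kernel_QL[OF D(4) sym \<pi>(1)] show ?thesis
      proof eventually_elim
        fix w assume w: "v (snd w \<circ> \<pi>) = v (snd w)" "w \<in> space (QL k)"
        then have "add_points (fst w) {..<card J} (snd w \<circ> \<pi>) = add_points (fst w) J (snd w)"
          by (intro add_points_permute[OF _ \<pi>(1) J \<pi>(2) le]) (simp_all add: space_QL)
        then show "g {..<card J} (?T w) = g J w"
          using w by (simp add: g_def avoiding_permute[OF \<pi>(1)])
      qed
    qed
    have gc: "g {..<card J} \<in> borel_measurable (QL k)" using le by (intro gm) auto
    have "integrable (distr (QL k) (QL k) ?T) (g {..<card J})"
      unfolding distr_permute_QL[OF \<pi>(1)] by (rule int_i[OF le])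
    then have i1: "integrable (QL k) (\<lambda>w. g {..<card J} (?T w))"
      using gc by (subst (asm) integrable_distr_eq[OF T])
    have m1: "(\<lambda>w. g {..<card J} (?T w)) \<in> borel_measurable (QL k)" by (rule measurable_compose[OF T gc])
    have "integrable (QL k) (g J)" using integrable_cong_AE[OF m1 gm[OF J] ae] i1 by simp
    moreover have "(\<integral>w. g J w \<partial>QL k) = (\<integral>w. g {..<card J} (?T w) \<partial>QL k)"
      by (rule integral_cong_AE[OF m1 gm[OF J] ae, symmetric])
    moreover have "\<dots> = (\<integral>w. g {..<card J} w \<partial>distr (QL k) (QL k) ?T)"
      by (rule integral_distr[OF T gc, symmetric])
    ultimately show ?thesis unfolding distr_permute_QL[OF \<pi>(1)] by simp
  qed
  have "(\<integral>\<mu>. outer_integral k v Z \<mu> * G \<mu> \<partial>Q)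
    = (\<integral>\<mu>. (\<Sum>i\<le>k. (-1) ^ (k - i) * real (k choose i) * (\<integral>x. f x \<mu> \<partial>mixed_measure k i \<mu>)) \<partial>Q)"
    unfolding f_def by (intro Bochner_Integration.integral_cong refl outer_integral_mixed[OF v Z]) (simp add: space_Q)
  also have "\<dots> = (\<Sum>i\<le>k. (-1) ^ (k - i) * real (k choose i) * (\<integral>\<mu>. \<integral>x. f x \<mu> \<partial>mixed_measure k i \<mu> \<partial>Q))"
    using mecke_mixed_real(2)[OF _ f fin] by (subst Bochner_Integration.integral_sum) auto
  also have "\<dots> = (\<Sum>i\<le>k. (-1) ^ (k - i) * real (k choose i) * (\<integral>w. g {..<i} w \<partial>QL k))"
    by (intro sum.cong refl) (simp add: eq_i)
  \<comment> \<open>The factor (k choose i) is spent on replacing one integral by the equal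
    integrals for all sets \<open>J\<close> of size i.\<close>
  also have "\<dots> = (\<Sum>i\<le>k. \<Sum>J | J \<in> Pow {..<k} \<and> card J = i. (-1) ^ (k - card J) * (\<integral>w. g J w \<partial>QL k))"
  proof (rule sum.cong[OF refl])
    fix i assume "i \<in> {..k}"
    have "(\<Sum>J | J \<in> Pow {..<k} \<and> card J = i. (-1) ^ (k - card J) * (\<integral>w. g J w \<partial>QL k))
      = (\<Sum>J | J \<in> Pow {..<k} \<and> card J = i. (-1) ^ (k - i) * (\<integral>w. g {..<i} w \<partial>QL k))"
      using J_eq by (intro sum.cong refl) auto
    also have "\<dots> = real (k choose i) * ((-1) ^ (k - i) * (\<integral>w. g {..<i} w \<partial>QL k))"
      using n_subsets[of "{..<k}" i] by simp
    finally show "(-1) ^ (k - i) * real (k choose i) * (\<integral>w. g {..<i} w \<partial>QL k)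
      = (\<Sum>J | J \<in> Pow {..<k} \<and> card J = i. (-1) ^ (k - card J) * (\<integral>w. g J w \<partial>QL k))" by simp
  qed
  also have "\<dots> = (\<Sum>J\<in>Pow {..<k}. (-1) ^ (k - card J) * (\<integral>w. g J w \<partial>QL k))"
    using card_mono[OF finite_lessThan, of _ k] by (intro sum.group) auto
  also have "\<dots> = (\<integral>w. (\<Sum>J\<in>Pow {..<k}. (-1) ^ (k - card J) * g J w) \<partial>QL k)"
    using J_eq by (subst Bochner_Integration.integral_sum) auto
  also have "\<dots> = (\<integral>w. v (snd w) * avoiding k (Z (fst w)) (snd w) *
        (\<Sum>J\<in>Pow {..<k}. (-1) ^ (k - card J) * G (add_points (fst w) J (snd w))) \<partial>QL k)"
    by (intro Bochner_Integration.integral_cong refl) (simp add: g_def sum_distrib_left ac_simps)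
  finally show ?thesis .
qed

lemma integral_outer_integral_stopped:
  assumes v: "bounded_kernel k B c v" and sym: "symmetric_kernel k v" and Z: "stopping_set X Bn Z" and k: "1 \<le> k"
    and G: "(\<lambda>\<mu>. g (restr_measure \<mu> (Z \<mu>))) \<in> borel_measurable N" and b: "\<And>\<mu>. \<bar>g \<mu>\<bar> \<le> 1"
  shows "(\<integral>\<mu>. outer_integral k v Z \<mu> * g (restr_measure \<mu> (Z \<mu>)) \<partial>Q) = 0"
proof -
  let ?G = "\<lambda>\<mu>. g (restr_measure \<mu> (Z \<mu>))"
  have "(\<integral>\<mu>. outer_integral k v Z \<mu> * ?G \<mu> \<partial>Q)
    = (\<integral>w. v (snd w) * avoiding k (Z (fst w)) (snd w) *
        (\<Sum>J\<in>Pow {..<k}. (-1) ^ (k - card J) * ?G (add_points (fst w) J (snd w))) \<partial>QL k)"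
    using b by (intro outer_integral_duality[OF v sym Z G, where b=1 and d=0]) auto
  also have "\<dots> = (\<integral>w. 0 \<partial>QL k)"
  proof (rule Bochner_Integration.integral_cong[OF refl])
    fix w assume "w \<in> space (QL k)"
    then have w: "fst w \<in> CM" "snd w \<in> space (XP k)" by (simp_all add: space_QL)
    show "v (snd w) * avoiding k (Z (fst w)) (snd w) *
        (\<Sum>J\<in>Pow {..<k}. (-1) ^ (k - card J) * ?G (add_points (fst w) J (snd w))) = 0"
    proof (cases "avoiding k (Z (fst w)) (snd w) = 0")
      case False
      \<comment> \<open>The added points change neither the stopping set nor the restriction of the
        configuration to it.\<close>
      have "?G (add_points (fst w) J (snd w)) = ?G (fst w)" if J: "J \<in> Pow {..<k}" for J
      proof -
        have "Z (add_points (fst w) J (snd w)) = Z (fst w)"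
          using avoiding_add_points(2)[OF Z w(1) _ w(2) False, of J] J by simp
        moreover have "restr_measure (add_points (fst w) J (snd w)) (Z (fst w)) = restr_measure (fst w) (Z (fst w))"
        proof (rule restr_add_points[OF w(1) stopping_set_sets[OF Z w(1)]])
          show "finite J" using J finite_subset by auto
          show "snd w ` J \<subseteq> space X" using J w(2) by (auto simp: space_PiM PiE_iff)
          show "snd w j \<notin> Z (fst w)" if "j \<in> J" for j
            using False J that by (auto simp: avoiding_eq split: if_splits)
        qed
        ultimately show ?thesis by simp
      qed
      then have "(\<Sum>J\<in>Pow {..<k}. (-1) ^ (k - card J) * ?G (add_points (fst w) J (snd w)))
        = (\<Sum>J\<in>Pow {..<k}. (-1) ^ (k - card J)) * ?G (fst w)"
        by (simp add: sum_distrib_right)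
      \<comment> \<open>The signs cancel because k is at least 1; over an empty index set the sum
        would be 1.\<close>
      also have "(\<Sum>J\<in>Pow {..<k}. (-1) ^ (k - card J)) = (0 :: real)"
        proof -
          have "0 \<in> {..<k}" using k by simp
          then have "{} \<noteq> {..<k}" by blast
          then show ?thesis using sum_supersets_alternating[of "{..<k}" "{}"] by simp
        qed
      finally show ?thesis by simp
    qed simp
  qed
  finally show ?thesis by simp
qed

text \<open>For the empty stopping set every tuple avoids it, and the outer integral is the pathwise
  integral itself. This lets F and H share the same moment formulas.\<close>

lemma stopping_set_empty: "stopping_set X Bn (\<lambda>_. {})"
  by (simp add: stopping_set_def split_beta')

text \<open>One identity yields all three moments of F and H: take both sets empty for the square of
  F, \<open>Z\<close> and the empty set for the product, and \<open>Z\<close> twice for the square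
  of H. The factor k! is the number of permutations produced by the difference operator.\<close>

lemma integral_outer_integral_mult:
  assumes v: "bounded_kernel k B c v" and sym: "symmetric_kernel k v"
    and Z: "stopping_set X Bn Z" and Z': "stopping_set X Bn Z'" and sub: "\<And>\<mu>. \<mu> \<in> CM \<Longrightarrow> Z' \<mu> \<subseteq> Z \<mu>"
  shows "(\<integral>\<mu>. outer_integral k v Z \<mu> * outer_integral k v Z' \<mu> \<partial>Q)
    = fact k * (\<integral>w. (v (snd w))\<^sup>2 * avoiding k (Z (fst w)) (snd w) \<partial>QL k)"
proof -
  note D = bounded_kernelD[OF v]
  have "(\<integral>\<mu>. outer_integral k v Z \<mu> * outer_integral k v Z' \<mu> \<partial>Q)
    = (\<integral>w. v (snd w) * avoiding k (Z (fst w)) (snd w) *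
        (\<Sum>J\<in>Pow {..<k}. (-1) ^ (k - card J) * outer_integral k v Z' (add_points (fst w) J (snd w))) \<partial>QL k)"
    by (rule outer_integral_duality[OF v sym Z measurable_outer_integral[OF D(4) Z'] outer_integral_bound[OF v Z']])
  also have "\<dots> = (\<integral>w. v (snd w) * avoiding k (Z (fst w)) (snd w) * (\<Sum>\<pi> | \<pi> permutes {..<k}. v (snd w \<circ> \<pi>)) \<partial>QL k)"
  proof (rule Bochner_Integration.integral_cong[OF refl])
    fix w assume "w \<in> space (QL k)"
    then have w: "fst w \<in> CM" "snd w \<in> space (XP k)" by (simp_all add: space_QL)
    show "v (snd w) * avoiding k (Z (fst w)) (snd w) *
        (\<Sum>J\<in>Pow {..<k}. (-1) ^ (k - card J) * outer_integral k v Z' (add_points (fst w) J (snd w)))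
      = v (snd w) * avoiding k (Z (fst w)) (snd w) * (\<Sum>\<pi> | \<pi> permutes {..<k}. v (snd w \<circ> \<pi>))"
    proof (cases "avoiding k (Z (fst w)) (snd w) = 0 \<or> snd w \<notin> box k B")
      case True
      then show ?thesis using D(6) by auto
    next
      case False
      \<comment> \<open>A tuple avoiding \<open>Z\<close> avoids the smaller set too, so this set is
        unchanged by all the shifts and the kernel of the second factor may be treated as fixed
        under the difference operator.\<close>
      have av: "avoiding k (Z' (fst w)) (snd w) = 1"
        using False sub[OF w(1)] by (auto simp: avoiding_eq split: if_splits)
      let ?v = "\<lambda>x. v x * avoiding k (Z' (fst w)) x"
      have "outer_integral k v Z' (add_points (fst w) J (snd w)) = pathwise_integral L k ?v (add_points (fst w) J (snd w))"
        if J: "J \<in> Pow {..<k}" for J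
        using avoiding_add_points(2)[OF Z' w(1) _ w(2), of J] J av by (simp add: outer_integral_def)
      then have "(\<Sum>J\<in>Pow {..<k}. (-1) ^ (k - card J) * outer_integral k v Z' (add_points (fst w) J (snd w)))
        = (\<Sum>J\<in>Pow {..<k}. (-1) ^ (k - card J) * pathwise_integral L k ?v (add_points (fst w) J (snd w)))"
        by (intro sum.cong refl) simp
      also have "\<dots> = (\<Sum>\<pi> | \<pi> permutes {..<k}. ?v (snd w \<circ> \<pi>))"
        using False by (intro pathwise_integral_difference[OF bounded_kernel_avoiding[OF v Z' w(1)] w(1)]) auto
      also have "\<dots> = (\<Sum>\<pi> | \<pi> permutes {..<k}. v (snd w \<circ> \<pi>))"
        using av by (intro sum.cong refl) (simp add: avoiding_permute)
      finally show ?thesis by simp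
    qed
  qed
  also have "\<dots> = (\<integral>w. fact k * ((v (snd w))\<^sup>2 * avoiding k (Z (fst w)) (snd w)) \<partial>QL k)"
  proof (rule integral_cong_AE)
    have vm: "(\<lambda>w. v (snd w)) \<in> borel_measurable (N \<Otimes>\<^sub>M XP k)"
      by (rule measurable_compose[OF measurable_snd D(4)])
    have am: "(\<lambda>w. avoiding k (Z (fst w)) (snd w)) \<in> borel_measurable (N \<Otimes>\<^sub>M XP k)"
      using measurable_avoiding_stopping[OF Z] by (simp add: split_beta')
    have pm: "(\<lambda>w. v (snd w \<circ> \<pi>)) \<in> borel_measurable (N \<Otimes>\<^sub>M XP k)" if "\<pi> permutes {..<k}" for \<pi>
      using measurable_compose[OF measurable_compose[OF measurable_snd measurable_permute[OF that]] D(4), of N] by simp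
    show "(\<lambda>w. v (snd w) * avoiding k (Z (fst w)) (snd w) * (\<Sum>\<pi> | \<pi> permutes {..<k}. v (snd w \<circ> \<pi>))) \<in> borel_measurable (QL k)"
      unfolding measurable_cong_sets[OF sets_QL refl]
      by (intro borel_measurable_times borel_measurable_sum vm am pm) simp
    show "(\<lambda>w. fact k * ((v (snd w))\<^sup>2 * avoiding k (Z (fst w)) (snd w))) \<in> borel_measurable (QL k)"
      unfolding measurable_cong_sets[OF sets_QL refl]
      by (intro borel_measurable_times borel_measurable_power vm am borel_measurable_const)
    have "AE w in QL k. \<forall>\<pi>\<in>{\<pi>. \<pi> permutes {..<k}}. v (snd w \<circ> \<pi>) = v (snd w)"
      using finite_permutations[of "{..<k}"] symmetric_kernel_QL[OF D(4) sym]
      by (intro AE_finite_allI) auto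
    then show "AE w in QL k. v (snd w) * avoiding k (Z (fst w)) (snd w) * (\<Sum>\<pi> | \<pi> permutes {..<k}. v (snd w \<circ> \<pi>))
      = fact k * ((v (snd w))\<^sup>2 * avoiding k (Z (fst w)) (snd w))"
    proof eventually_elim
      fix w :: "'a measure \<times> (nat \<Rightarrow> 'a)"
      assume "\<forall>\<pi>\<in>{\<pi>. \<pi> permutes {..<k}}. v (snd w \<circ> \<pi>) = v (snd w)"
      then have "(\<Sum>\<pi> | \<pi> permutes {..<k}. v (snd w \<circ> \<pi>)) = real (card {\<pi>. \<pi> permutes {..<k}}) * v (snd w)" by simp
      also have "card {\<pi>. \<pi> permutes {..<k}} = fact k" by (rule card_permutations) auto
      finally show "v (snd w) * avoiding k (Z (fst w)) (snd w) * (\<Sum>\<pi> | \<pi> permutes {..<k}. v (snd w \<circ> \<pi>))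
        = fact k * ((v (snd w))\<^sup>2 * avoiding k (Z (fst w)) (snd w))" by (simp only: power2_eq_square of_nat_fact ac_simps)
    qed
  qed
  finally show ?thesis by simp
qed

lemma outer_integral_empty: "outer_integral k v (\<lambda>_. {}) \<mu> = pathwise_integral L k v \<mu>"
  by (simp add: outer_integral_def avoiding_eq)

lemma integrable_square_box:
  assumes v: "bounded_kernel k B c v" and a: "a \<in> borel_measurable (N \<Otimes>\<^sub>M XP k)" "\<And>w. \<bar>a w\<bar> \<le> (1::real)"
  shows "integrable (QL k) (\<lambda>w. (v (snd w))\<^sup>2 * a w)"
proof (rule Bochner_Integration.integrable_bound)
  note D = bounded_kernelD[OF v]
  interpret LPm: sigma_finite_measure "power_measure L k" by (rule sigma_finite_LP) simp
  have bx: "box k B \<in> sets (power_measure L k)" using box_sets[OF D(2), of k] by (simp add: sets_LP)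
  have "emeasure (QL k) (CM \<times> box k B) = emeasure Q CM * emeasure (power_measure L k) (box k B)"
    using bx sets.top[of Q] by (intro LPm.emeasure_pair_measure_Times) (auto simp: space_Q)
  also have "\<dots> < \<infinity>"
    using L_finite[OF D(1)] D(2) emeasure_space_1
    by (simp add: space_Q[symmetric] LP.emeasure_PiM sets_L power_less_top_ennreal)
  finally have fin: "emeasure (QL k) (CM \<times> box k B) < \<infinity>" .
  have s: "CM \<times> box k B \<in> sets (QL k)" using bx sets.top[of Q] by (auto simp: space_Q)
  show "integrable (QL k) (\<lambda>w. c\<^sup>2 * indicator (CM \<times> box k B) w)"
    using fin s by (intro integrable_mult_right integrable_real_indicator)
  show "(\<lambda>w. (v (snd w))\<^sup>2 * a w) \<in> borel_measurable (QL k)"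
    unfolding measurable_cong_sets[OF sets_QL refl]
    by (intro borel_measurable_times borel_measurable_power a measurable_compose[OF measurable_snd D(4)])
  show "AE w in QL k. norm ((v (snd w))\<^sup>2 * a w) \<le> norm (c\<^sup>2 * indicator (CM \<times> box k B) w)"
  proof (rule AE_I2)
    fix w assume "w \<in> space (QL k)"
    then have w: "fst w \<in> CM" by (simp add: space_QL)
    show "norm ((v (snd w))\<^sup>2 * a w) \<le> norm (c\<^sup>2 * indicator (CM \<times> box k B) w)"
    proof (cases "snd w \<in> box k B")
      case True
      have "(v (snd w))\<^sup>2 * \<bar>a w\<bar> \<le> c\<^sup>2 * 1"
        using D(7)[of "snd w"] D(3) a(2)[of w] by (intro mult_mono) (auto simp: abs_le_square_iff[symmetric])
      then show ?thesis using True w by (cases w) (simp add: abs_mult)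
    next
      case False
      then show ?thesis using D(6) by simp
    qed
  qed
qed

theorem second_moment_difference:
  assumes v: "bounded_kernel k B c v" and sym: "symmetric_kernel k v" and Z: "stopping_set X Bn Z"
  shows "integrable Q (\<lambda>\<mu>. (pathwise_integral L k v \<mu> - outer_integral k v Z \<mu>)\<^sup>2)"
    and "(\<integral>\<mu>. (pathwise_integral L k v \<mu> - outer_integral k v Z \<mu>)\<^sup>2 \<partial>Q)
    = fact k * (\<integral>w. (v (snd w))\<^sup>2 * (1 - avoiding k (Z (fst w)) (snd w)) \<partial>QL k)"
proof -
  note D = bounded_kernelD[OF v]
  let ?E = "\<lambda>_ :: 'a measure. {} :: 'a set"
  let ?F = "outer_integral k v ?E" and ?H = "outer_integral k v Z"
  note E = stopping_set_empty
  have int: "integrable Q (\<lambda>\<mu>. outer_integral k v Z1 \<mu> * outer_integral k v Z2 \<mu>)"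
    if Z12: "stopping_set X Bn Z1" "stopping_set X Bn Z2" for Z1 Z2
  proof (rule polynomial_integrable[OF D(1)])
    let ?b = "2 ^ k * c * (1 + measure L B) ^ k"
    show "(\<lambda>\<mu>. outer_integral k v Z1 \<mu> * outer_integral k v Z2 \<mu>) \<in> borel_measurable N"
      using Z12 by (intro borel_measurable_times measurable_outer_integral D(4))
    fix \<mu> assume \<mu>: "\<mu> \<in> CM"
    have "\<bar>outer_integral k v Z1 \<mu> * outer_integral k v Z2 \<mu>\<bar>
      \<le> (?b * (1 + measure \<mu> B) ^ k) * (?b * (1 + measure \<mu> B) ^ k)"
      unfolding abs_mult using D(3)
      by (intro mult_mono outer_integral_bound[OF v Z12(1) \<mu>] outer_integral_bound[OF v Z12(2) \<mu>]) auto
    then show "\<bar>outer_integral k v Z1 \<mu> * outer_integral k v Z2 \<mu>\<bar> \<le> (?b * ?b) * (1 + measure \<mu> B) ^ (k + k)"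
      by (simp add: power_add ac_simps)
  qed
  have sq: "(pathwise_integral L k v \<mu> - ?H \<mu>)\<^sup>2 = ?F \<mu> * ?F \<mu> - 2 * (?H \<mu> * ?F \<mu>) + ?H \<mu> * ?H \<mu>" for \<mu>
    unfolding outer_integral_empty by (simp add: power2_eq_square algebra_simps)
  show "integrable Q (\<lambda>\<mu>. (pathwise_integral L k v \<mu> - ?H \<mu>)\<^sup>2)"
    unfolding sq using int[OF E E] int[OF Z E] int[OF Z Z]
    by (intro Bochner_Integration.integrable_add Bochner_Integration.integrable_diff integrable_mult_right)
  have "(\<integral>\<mu>. (pathwise_integral L k v \<mu> - ?H \<mu>)\<^sup>2 \<partial>Q)
    = (\<integral>\<mu>. ?F \<mu> * ?F \<mu> \<partial>Q) - 2 * (\<integral>\<mu>. ?H \<mu> * ?F \<mu> \<partial>Q) + (\<integral>\<mu>. ?H \<mu> * ?H \<mu> \<partial>Q)"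
    unfolding sq using int[OF E E] int[OF Z E] int[OF Z Z] by simp
  \<comment> \<open>The product of F and H and the square of H have the same mean, so the
    coefficients -2 and 1 combine to -1.\<close>
  also have "\<dots> = fact k * (\<integral>w. (v (snd w))\<^sup>2 * avoiding k {} (snd w) \<partial>QL k)
    - fact k * (\<integral>w. (v (snd w))\<^sup>2 * avoiding k (Z (fst w)) (snd w) \<partial>QL k)"
    using integral_outer_integral_mult[OF v sym E E] integral_outer_integral_mult[OF v sym Z E]
      integral_outer_integral_mult[OF v sym Z Z] by simp
  also have "\<dots> = fact k * ((\<integral>w. (v (snd w))\<^sup>2 * 1 \<partial>QL k)
    - (\<integral>w. (v (snd w))\<^sup>2 * avoiding k (Z (fst w)) (snd w) \<partial>QL k))"
    by (simp add: avoiding_eq right_diff_distrib)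
  also have "(\<integral>w. (v (snd w))\<^sup>2 * 1 \<partial>QL k) - (\<integral>w. (v (snd w))\<^sup>2 * avoiding k (Z (fst w)) (snd w) \<partial>QL k)
    = (\<integral>w. (v (snd w))\<^sup>2 * 1 - (v (snd w))\<^sup>2 * avoiding k (Z (fst w)) (snd w) \<partial>QL k)"
  proof (rule Bochner_Integration.integral_diff[symmetric])
    show "integrable (QL k) (\<lambda>w. (v (snd w))\<^sup>2 * 1)"
      by (rule integrable_square_box[OF v]) auto
    show "integrable (QL k) (\<lambda>w. (v (snd w))\<^sup>2 * avoiding k (Z (fst w)) (snd w))"
    proof (rule integrable_square_box[OF v])
      show "(\<lambda>w. avoiding k (Z (fst w)) (snd w)) \<in> borel_measurable (N \<Otimes>\<^sub>M XP k)"
        using measurable_avoiding_stopping[OF Z] by (simp add: split_beta')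
    qed (simp add: avoiding_eq)
  qed
  finally show "(\<integral>\<mu>. (pathwise_integral L k v \<mu> - ?H \<mu>)\<^sup>2 \<partial>Q)
    = fact k * (\<integral>w. (v (snd w))\<^sup>2 * (1 - avoiding k (Z (fst w)) (snd w)) \<partial>QL k)"
    by (simp add: right_diff_distrib)
qed

section \<open>Approximation by bounded kernels\<close>

text \<open>The moment formula with both stopping sets empty, where the avoidance indicator is
  identically 1.\<close>

lemma nn_integral_isometry:
  assumes v: "bounded_kernel k B c v" and sym: "symmetric_kernel k v"
  shows "(\<integral>\<^sup>+\<mu>. ennreal ((pathwise_integral L k v \<mu>)\<^sup>2) \<partial>Q)
    = ennreal (fact k) * (\<integral>\<^sup>+x. ennreal ((v x)\<^sup>2) \<partial>power_measure L k)"
proof -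
  note D = bounded_kernelD[OF v]
  interpret LPm: sigma_finite_measure "power_measure L k" by (rule sigma_finite_LP) simp
  have pm: "pathwise_integral L k v \<in> borel_measurable N"
    using measurable_outer_integral[OF D(4) stopping_set_empty] unfolding outer_integral_empty[abs_def] .
  have "integrable Q (\<lambda>\<mu>. (pathwise_integral L k v \<mu>)\<^sup>2)"
  proof (rule polynomial_integrable[OF D(1)])
    let ?b = "2 ^ k * c * (1 + measure L B) ^ k"
    show "(\<lambda>\<mu>. (pathwise_integral L k v \<mu>)\<^sup>2) \<in> borel_measurable N" using pm by measurable
    fix \<mu> assume \<mu>: "\<mu> \<in> CM"
    have "\<bar>pathwise_integral L k v \<mu>\<bar>\<^sup>2 \<le> (?b * (1 + measure \<mu> B) ^ k)\<^sup>2"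
      using pathwise_integral_bound[OF v \<mu>] by (intro power_mono) auto
    then show "\<bar>(pathwise_integral L k v \<mu>)\<^sup>2\<bar> \<le> ?b\<^sup>2 * (1 + measure \<mu> B) ^ (k * 2)"
      by (simp add: power_mult_distrib power_mult)
  qed
  then have "(\<integral>\<^sup>+\<mu>. ennreal ((pathwise_integral L k v \<mu>)\<^sup>2) \<partial>Q) = ennreal (\<integral>\<mu>. (pathwise_integral L k v \<mu>)\<^sup>2 \<partial>Q)"
    by (intro nn_integral_eq_integral) auto
  also have "(\<integral>\<mu>. (pathwise_integral L k v \<mu>)\<^sup>2 \<partial>Q) = fact k * (\<integral>w. (v (snd w))\<^sup>2 * 1 \<partial>QL k)"
    using integral_outer_integral_mult[OF v sym stopping_set_empty stopping_set_empty]
    by (simp add: outer_integral_empty power2_eq_square avoiding_eq)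
  also have "ennreal \<dots> = ennreal (fact k) * ennreal (\<integral>w. (v (snd w))\<^sup>2 * 1 \<partial>QL k)"
    by (intro ennreal_mult) auto
  also have "ennreal (\<integral>w. (v (snd w))\<^sup>2 * 1 \<partial>QL k) = (\<integral>\<^sup>+w. ennreal ((v (snd w))\<^sup>2 * 1) \<partial>QL k)"
  proof (rule nn_integral_eq_integral[symmetric])
    show "integrable (QL k) (\<lambda>w. (v (snd w))\<^sup>2 * 1)" by (rule integrable_square_box[OF v]) auto
  qed simp
  also have "\<dots> = (\<integral>\<^sup>+\<mu>. \<integral>\<^sup>+x. ennreal ((v x)\<^sup>2) \<partial>power_measure L k \<partial>Q)"
  proof -
    have "(\<lambda>w. ennreal ((v (snd w))\<^sup>2 * 1)) \<in> borel_measurable (QL k)"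
      unfolding measurable_cong_sets[OF sets_QL refl]
      using measurable_compose[OF measurable_snd D(4), of N] by measurable
    from LPm.nn_integral_fst[OF this] show ?thesis by simp
  qed
  also have "\<dots> = (\<integral>\<^sup>+x. ennreal ((v x)\<^sup>2) \<partial>power_measure L k)" by (simp add: emeasure_space_1)
  finally show ?thesis .
qed

text \<open>For an integrand that does not depend on \<mu> the mixed Mecke formula says that the
  mean of the mixed integral is the integral over the power of \<open>L\<close>. A finite mean
  forces almost sure finiteness.\<close>

lemma AE_integrable_mixed:
  fixes v :: "(nat \<Rightarrow> 'a) \<Rightarrow> real"
  assumes v: "integrable (power_measure L k) v"
  shows "AE \<mu> in Q. \<forall>i\<in>{..k}. integrable (mixed_measure k i \<mu>) v"
proof (rule AE_finite_allI[OF finite_atMost])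
  fix i assume "i \<in> {..k}"
  then have i: "i \<le> k" by simp
  have vm: "v \<in> borel_measurable (XP k)"
    using borel_measurable_integrable[OF v] unfolding measurable_cong_sets[OF sets_LP refl] .
  have "(\<lambda>w. ennreal \<bar>v (fst w)\<bar>) \<in> borel_measurable (XP k \<Otimes>\<^sub>M N)"
    using measurable_compose[OF measurable_fst vm, of N] by measurable
  then have m1: "(\<lambda>(x, \<mu>). ennreal \<bar>v x\<bar>) \<in> borel_measurable (XP k \<Otimes>\<^sub>M N)" by (simp add: split_beta')
  have "(\<lambda>w. ennreal \<bar>v (snd w)\<bar>) \<in> borel_measurable (N \<Otimes>\<^sub>M XP k)"
    using measurable_compose[OF measurable_snd vm, of N] by measurable
  then have m2: "(\<lambda>(\<mu>, x). ennreal \<bar>v x\<bar>) \<in> borel_measurable (N \<Otimes>\<^sub>M XP k)" by (simp add: split_beta')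
  have "(\<integral>\<^sup>+\<mu>. \<integral>\<^sup>+x. ennreal \<bar>v x\<bar> \<partial>mixed_measure k i \<mu> \<partial>Q) = (\<integral>\<^sup>+\<mu>. \<integral>\<^sup>+x. ennreal \<bar>v x\<bar> \<partial>power_measure L k \<partial>Q)"
    by (rule mecke_mixed[OF i m1])
  also have "\<dots> = (\<integral>\<^sup>+x. ennreal \<bar>v x\<bar> \<partial>power_measure L k)" by (simp add: emeasure_space_1)
  also have "\<dots> < \<infinity>" using v by (simp add: integrable_iff_bounded)
  finally have fin: "(\<integral>\<^sup>+\<mu>. \<integral>\<^sup>+x. ennreal \<bar>v x\<bar> \<partial>mixed_measure k i \<mu> \<partial>Q) \<noteq> \<infinity>" by simp
  have "(\<lambda>\<mu>. \<integral>\<^sup>+x. ennreal \<bar>v x\<bar> \<partial>mixed_measure k i \<mu>) \<in> borel_measurable Q"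
    unfolding measurable_cong_sets[OF sets_Q refl]
    by (rule measurable_nn_integral_mixed[OF i measurable_ident_sets[OF refl] m2])
  from nn_integral_noteq_infinite[OF this fin]
  show "AE \<mu> in Q. integrable (mixed_measure k i \<mu>) v"
  proof eventually_elim
    fix \<mu> assume "(\<integral>\<^sup>+x. ennreal \<bar>v x\<bar> \<partial>mixed_measure k i \<mu>) \<noteq> \<infinity>"
    then show "integrable (mixed_measure k i \<mu>) v"
      using vm unfolding integrable_iff_bounded measurable_cong_sets[OF sets_mixed_measure refl]
      by (simp add: less_top)
  qed
qed

text \<open>Values above the level are replaced by 0 rather than clipped, so each truncation equals
  v or 0 at every point.\<close>

definition truncate_kernel :: "nat \<Rightarrow> ((nat \<Rightarrow> 'a) \<Rightarrow> real) \<Rightarrow> nat \<Rightarrow> (nat \<Rightarrow> 'a) \<Rightarrow> real" where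
  "truncate_kernel k v m x = (if x \<in> box k (Bn m) \<and> \<bar>v x\<bar> \<le> real m then v x else 0)"

section \<open>Truncations and their convergence\<close>

lemma measurable_truncate_kernel:
  assumes "v \<in> borel_measurable (XP k)"
  shows "truncate_kernel k v m \<in> borel_measurable (XP k)"
proof -
  note [measurable] = assms box_sets[OF Bn_sets, of k m]
  show ?thesis unfolding truncate_kernel_def[abs_def] by measurable
qed

lemma bounded_truncate_kernel:
  assumes v: "v \<in> borel_measurable (XP k)"
  shows "bounded_kernel k (Bn m) (real m) (truncate_kernel k v m)"
  using measurable_truncate_kernel[OF v] Bn_local by (auto simp: bounded_kernel_def truncate_kernel_def)

lemma permute_box:
  assumes \<pi>: "\<pi> permutes {..<k}" and x: "x \<in> space (XP k)"
  shows "x \<circ> \<pi> \<in> box k B \<longleftrightarrow> x \<in> box k B"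
proof -
  have "x \<circ> \<pi> \<in> extensional {..<k}" "x \<in> extensional {..<k}"
    using measurable_space[OF measurable_permute[OF \<pi>] x] x by (auto simp: space_PiM PiE_def)
  moreover have "(\<forall>i\<in>{..<k}. (x \<circ> \<pi>) i \<in> B) \<longleftrightarrow> (\<forall>i\<in>\<pi> ` {..<k}. x i \<in> B)" by simp
  ultimately show ?thesis unfolding permutes_image[OF \<pi>] PiE_iff by blast
qed

lemma symmetric_truncate_kernel:
  assumes sym: "symmetric_kernel k v"
  shows "symmetric_kernel k (truncate_kernel k v m)"
  unfolding symmetric_kernel_def
proof (intro allI impI)
  fix \<pi> assume \<pi>: "\<pi> permutes {..<k}"
  have "AE x in power_measure L k. v (x \<circ> \<pi>) = v x" using sym \<pi> by (simp add: symmetric_kernel_def)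
  moreover have "AE x in power_measure L k. x \<in> space (XP k)" by (rule AE_I2) (simp add: space_LP)
  ultimately show "AE x in power_measure L k. truncate_kernel k v m (x \<circ> \<pi>) = truncate_kernel k v m x"
    by eventually_elim (simp add: truncate_kernel_def permute_box[OF \<pi>])
qed

lemma truncate_kernel_le: "\<bar>truncate_kernel k v m x\<bar> \<le> \<bar>v x\<bar>"
  by (simp add: truncate_kernel_def)

text \<open>A point kept at level m is kept at every later level, and a point discarded at level m
  contributes v or 0. This makes the distance between two truncations uniform in the later
  one.\<close>

lemma truncate_kernel_diff_le:
  assumes "m \<le> n"
  shows "\<bar>truncate_kernel k v m x - truncate_kernel k v n x\<bar> \<le> \<bar>truncate_kernel k v m x - v x\<bar>"
proof -
  have "x \<in> box k (Bn n)" if "x \<in> box k (Bn m)" using that Bn_mono[OF assms] by (auto simp: PiE_def Pi_def)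
  then show ?thesis using assms by (auto simp: truncate_kernel_def)
qed

lemma truncate_kernel_eventually:
  assumes "x \<in> space (XP k)"
  shows "eventually (\<lambda>m. truncate_kernel k v m x = v x) sequentially"
proof -
  obtain n where n: "x \<in> box k (Bn n)" using assms UN_box[of k] by blast
  obtain l where l: "\<bar>v x\<bar> \<le> real l" using real_arch_simple by blast
  show ?thesis
  proof (rule eventually_sequentiallyI[of "max n l"])
    fix m assume "max n l \<le> m"
    then have "x \<in> box k (Bn m)" "\<bar>v x\<bar> \<le> real m"
      using n l incseqD[OF incseq_box[of k], of n m] by auto
    then show "truncate_kernel k v m x = v x" by (simp add: truncate_kernel_def)
  qed
qed

lemma truncate_kernel_tendsto: "x \<in> space (XP k) \<Longrightarrow> (\<lambda>m. truncate_kernel k v m x) \<longlonglongrightarrow> v x"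
  by (rule tendsto_eventually[OF truncate_kernel_eventually])

lemma bounded_kernel_diff:
  assumes v: "v \<in> borel_measurable (XP k)" and mn: "m \<le> n"
  shows "bounded_kernel k (Bn n) (real m + real n) (\<lambda>x. truncate_kernel k v m x - truncate_kernel k v n x)"
proof -
  have sub: "x \<in> box k (Bn n)" if "x \<in> box k (Bn m)" for x using that Bn_mono[OF mn] by (auto simp: PiE_def Pi_def)
  have "\<bar>truncate_kernel k v m x - truncate_kernel k v n x\<bar> \<le> (real m + real n) * indicator (box k (Bn n)) x" for x
  proof (cases "x \<in> box k (Bn n)")
    case True
    have "\<bar>truncate_kernel k v m x\<bar> \<le> real m" "\<bar>truncate_kernel k v n x\<bar> \<le> real n"
      by (auto simp: truncate_kernel_def)
    then show ?thesis using True by simp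
  next
    case False
    then show ?thesis using sub[of x] by (auto simp: truncate_kernel_def)
  qed
  then show ?thesis
    using measurable_truncate_kernel[OF v] Bn_local by (simp add: bounded_kernel_def)
qed

lemma pathwise_integral_truncate_tendsto:
  assumes v: "v \<in> borel_measurable (XP k)" and \<mu>: "\<mu> \<in> CM"
    and int: "\<forall>i\<in>{..k}. integrable (mixed_measure k i \<mu>) v"
  shows "(\<lambda>m. pathwise_integral L k (truncate_kernel k v m) \<mu>) \<longlonglongrightarrow> pathwise_integral L k v \<mu>"
  unfolding pathwise_integral_mixed[OF \<mu> v] pathwise_integral_mixed[OF \<mu> measurable_truncate_kernel[OF v]]
proof (intro tendsto_sum tendsto_mult tendsto_const)
  fix i assume i: "i \<in> {..k}"
  show "(\<lambda>m. \<integral>x. truncate_kernel k v m x \<partial>mixed_measure k i \<mu>) \<longlonglongrightarrow> (\<integral>x. v x \<partial>mixed_measure k i \<mu>)"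
  proof (rule integral_dominated_convergence[where w="\<lambda>x. \<bar>v x\<bar>"])
    show "v \<in> borel_measurable (mixed_measure k i \<mu>)" "truncate_kernel k v m \<in> borel_measurable (mixed_measure k i \<mu>)" for m
      unfolding measurable_cong_sets[OF sets_mixed_measure refl] using v measurable_truncate_kernel[OF v] by auto
    show "integrable (mixed_measure k i \<mu>) (\<lambda>x. \<bar>v x\<bar>)" using int i by auto
    show "AE x in mixed_measure k i \<mu>. (\<lambda>m. truncate_kernel k v m x) \<longlonglongrightarrow> v x"
      by (rule AE_I2) (simp add: truncate_kernel_tendsto)
    show "AE x in mixed_measure k i \<mu>. norm (truncate_kernel k v m x) \<le> \<bar>v x\<bar>" for m
      using truncate_kernel_le by simp
  qed
qed

lemma pathwise_integral_diff:
  assumes v: "bounded_kernel k B c v" and w: "bounded_kernel k C d w" and \<mu>: "\<mu> \<in> CM"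
  shows "pathwise_integral L k (\<lambda>x. v x - w x) \<mu> = pathwise_integral L k v \<mu> - pathwise_integral L k w \<mu>"
proof -
  note vm = bounded_kernelD(4)[OF v] and wm = bounded_kernelD(4)[OF w]
  have "(\<lambda>x. v x - w x) \<in> borel_measurable (XP k)" using vm wm by measurable
  from pathwise_integral_mixed[OF \<mu> this] show ?thesis
    unfolding pathwise_integral_mixed[OF \<mu> vm] pathwise_integral_mixed[OF \<mu> wm]
    using integrable_mixed[OF v _ \<mu>] integrable_mixed[OF w _ \<mu>]
    by (simp add: sum_subtractf[symmetric] right_diff_distrib)
qed

lemma measurable_pathwise:
  assumes "v \<in> borel_measurable (XP k)" shows "pathwise_integral L k v \<in> borel_measurable N"
  using measurable_outer_integral[OF assms stopping_set_empty] unfolding outer_integral_empty[abs_def] .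

text \<open>The isometry passes from the truncations to \<open>v\<close> by Fatou's lemma.\<close>

lemma pathwise_integral_truncate_error:
  assumes v: "integrable (power_measure L k) v" and sym: "symmetric_kernel k v"
  shows "(\<integral>\<^sup>+\<mu>. ennreal ((pathwise_integral L k (truncate_kernel k v m) \<mu> - pathwise_integral L k v \<mu>)\<^sup>2) \<partial>Q)
    \<le> ennreal (fact k) * (\<integral>\<^sup>+x. ennreal ((truncate_kernel k v m x - v x)\<^sup>2) \<partial>power_measure L k)"
proof -
  have vm: "v \<in> borel_measurable (XP k)"
    using borel_measurable_integrable[OF v] unfolding measurable_cong_sets[OF sets_LP refl] .
  let ?T = "truncate_kernel k v" and ?F = "\<lambda>u. pathwise_integral L k u"
  let ?R = "ennreal (fact k) * (\<integral>\<^sup>+x. ennreal ((?T m x - v x)\<^sup>2) \<partial>power_measure L k)"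
  note Tm = bounded_truncate_kernel[OF vm]
  \<comment> \<open>The difference of two truncations is again a bounded symmetric kernel, so the
    isometry applies to it and bounds the distance independently of n.\<close>
  have bd: "(\<integral>\<^sup>+\<mu>. ennreal ((?F (?T m) \<mu> - ?F (?T n) \<mu>)\<^sup>2) \<partial>Q) \<le> ?R" if mn: "m \<le> n" for n
  proof -
    let ?d = "\<lambda>x. ?T m x - ?T n x"
    have symd: "symmetric_kernel k ?d"
      unfolding symmetric_kernel_def
    proof (intro allI impI)
      fix \<pi> assume \<pi>: "\<pi> permutes {..<k}"
      have "AE x in power_measure L k. ?T m (x \<circ> \<pi>) = ?T m x" "AE x in power_measure L k. ?T n (x \<circ> \<pi>) = ?T n x"
        using symmetric_truncate_kernel[OF sym] \<pi> by (auto simp: symmetric_kernel_def)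
      then show "AE x in power_measure L k. ?d (x \<circ> \<pi>) = ?d x" by eventually_elim simp
    qed
    have "(\<integral>\<^sup>+\<mu>. ennreal ((?F (?T m) \<mu> - ?F (?T n) \<mu>)\<^sup>2) \<partial>Q) = (\<integral>\<^sup>+\<mu>. ennreal ((?F ?d \<mu>)\<^sup>2) \<partial>Q)"
      by (intro nn_integral_cong) (simp add: space_Q pathwise_integral_diff[OF Tm Tm])
    also have "\<dots> = ennreal (fact k) * (\<integral>\<^sup>+x. ennreal ((?d x)\<^sup>2) \<partial>power_measure L k)"
      by (rule nn_integral_isometry[OF bounded_kernel_diff[OF vm mn] symd])
    also have "\<dots> \<le> ?R"
      using truncate_kernel_diff_le[OF mn]
      by (intro mult_left_mono nn_integral_mono ennreal_leI) (auto simp: abs_le_square_iff[symmetric])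
    finally show ?thesis .
  qed
  have "(\<integral>\<^sup>+\<mu>. ennreal ((?F (?T m) \<mu> - ?F v \<mu>)\<^sup>2) \<partial>Q)
    \<le> (\<integral>\<^sup>+\<mu>. liminf (\<lambda>n. ennreal ((?F (?T m) \<mu> - ?F (?T n) \<mu>)\<^sup>2)) \<partial>Q)"
  proof (rule nn_integral_mono_AE)
    have "AE \<mu> in Q. \<mu> \<in> space Q" by simp
    with AE_integrable_mixed[OF v]
    show "AE \<mu> in Q. ennreal ((?F (?T m) \<mu> - ?F v \<mu>)\<^sup>2) \<le> liminf (\<lambda>n. ennreal ((?F (?T m) \<mu> - ?F (?T n) \<mu>)\<^sup>2))"
    proof eventually_elim
      fix \<mu> assume *: "\<forall>i\<in>{..k}. integrable (mixed_measure k i \<mu>) v" "\<mu> \<in> space Q"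
      then have \<mu>: "\<mu> \<in> CM" by (simp add: space_Q)
      have "(\<lambda>n. ennreal ((?F (?T m) \<mu> - ?F (?T n) \<mu>)\<^sup>2)) \<longlonglongrightarrow> ennreal ((?F (?T m) \<mu> - ?F v \<mu>)\<^sup>2)"
        by (intro tendsto_ennrealI tendsto_power tendsto_diff tendsto_const
            pathwise_integral_truncate_tendsto[OF vm \<mu> *(1)])
      then have "liminf (\<lambda>n. ennreal ((?F (?T m) \<mu> - ?F (?T n) \<mu>)\<^sup>2)) = ennreal ((?F (?T m) \<mu> - ?F v \<mu>)\<^sup>2)"
        by (intro lim_imp_Liminf) auto
      then show "ennreal ((?F (?T m) \<mu> - ?F v \<mu>)\<^sup>2) \<le> liminf (\<lambda>n. ennreal ((?F (?T m) \<mu> - ?F (?T n) \<mu>)\<^sup>2))" by simp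
    qed
  qed
  also have "\<dots> \<le> liminf (\<lambda>n. \<integral>\<^sup>+\<mu>. ennreal ((?F (?T m) \<mu> - ?F (?T n) \<mu>)\<^sup>2) \<partial>Q)"
  proof (rule nn_integral_liminf)
    fix n
    have [measurable]: "?F (?T m) \<in> borel_measurable Q" "?F (?T n) \<in> borel_measurable Q"
      unfolding measurable_cong_sets[OF sets_Q refl]
      by (rule measurable_pathwise[OF measurable_truncate_kernel[OF vm]])+
    show "(\<lambda>\<mu>. ennreal ((?F (?T m) \<mu> - ?F (?T n) \<mu>)\<^sup>2)) \<in> borel_measurable Q" by measurable
  qed
  \<comment> \<open>The bound holds only from n = m on, which suffices for an upper limit.\<close>
  also have "\<dots> \<le> limsup (\<lambda>n. \<integral>\<^sup>+\<mu>. ennreal ((?F (?T m) \<mu> - ?F (?T n) \<mu>)\<^sup>2) \<partial>Q)"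
    by (rule Liminf_le_Limsup) simp
  also have "\<dots> \<le> ?R"
    by (rule Limsup_bounded) (use bd in \<open>auto intro: eventually_sequentiallyI[of m]\<close>)
  finally show ?thesis .
qed

lemma truncate_kernel_L2:
  assumes v: "v \<in> borel_measurable (XP k)" and sq: "integrable (power_measure L k) (\<lambda>x. (v x)\<^sup>2)"
  shows "(\<lambda>m. \<integral>\<^sup>+x. ennreal ((truncate_kernel k v m x - v x)\<^sup>2) \<partial>power_measure L k) \<longlonglongrightarrow> 0"
proof -
  have "(\<lambda>m. \<integral>\<^sup>+x. ennreal ((truncate_kernel k v m x - v x)\<^sup>2) \<partial>power_measure L k) \<longlonglongrightarrow> (\<integral>\<^sup>+x. 0 \<partial>power_measure L k)"
  proof (rule nn_integral_dominated_convergence[where w="\<lambda>x. ennreal ((v x)\<^sup>2)"])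
    note [measurable] = v measurable_truncate_kernel[OF v]
    show "(\<lambda>x. ennreal ((truncate_kernel k v m x - v x)\<^sup>2)) \<in> borel_measurable (power_measure L k)" for m
      by measurable
    show "(\<lambda>x. ennreal ((v x)\<^sup>2)) \<in> borel_measurable (power_measure L k)" by measurable
    show "AE x in power_measure L k. ennreal ((truncate_kernel k v m x - v x)\<^sup>2) \<le> ennreal ((v x)\<^sup>2)" for m
      by (intro AE_I2 ennreal_leI) (simp add: truncate_kernel_def)
    show "(\<integral>\<^sup>+x. ennreal ((v x)\<^sup>2) \<partial>power_measure L k) < \<infinity>" using sq by (simp add: integrable_iff_bounded)
    show "AE x in power_measure L k. (\<lambda>m. ennreal ((truncate_kernel k v m x - v x)\<^sup>2)) \<longlonglongrightarrow> 0"
    proof (rule AE_I2)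
      fix x assume "x \<in> space (power_measure L k)"
      then have "eventually (\<lambda>m. truncate_kernel k v m x = v x) sequentially"
        by (intro truncate_kernel_eventually) (simp add: space_LP)
      then have "eventually (\<lambda>m. ennreal ((truncate_kernel k v m x - v x)\<^sup>2) = 0) sequentially"
        by eventually_elim simp
      then show "(\<lambda>m. ennreal ((truncate_kernel k v m x - v x)\<^sup>2)) \<longlonglongrightarrow> 0" by (rule tendsto_eventually)
    qed
  qed simp
  then show ?thesis by simp
qed

theorem bounded_kernel_approximation:
  assumes v: "symmetric_L2 L k v" "integrable (power_measure L k) v" and e: "0 < (e :: real)"
  shows "\<exists>B c w. bounded_kernel k B c w \<and> symmetric_kernel k w \<and>
    (\<integral>\<^sup>+x. ennreal ((w x - v x)\<^sup>2) \<partial>power_measure L k) \<le> ennreal e \<and>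
    (\<integral>\<^sup>+\<mu>. ennreal ((pathwise_integral L k w \<mu> - pathwise_integral L k v \<mu>)\<^sup>2) \<partial>Q) \<le> ennreal e"
proof -
  let ?D = "\<lambda>m. \<integral>\<^sup>+x. ennreal ((truncate_kernel k v m x - v x)\<^sup>2) \<partial>power_measure L k"
  have vm: "v \<in> borel_measurable (XP k)" and sq: "integrable (power_measure L k) (\<lambda>x. (v x)\<^sup>2)"
    and sym: "symmetric_kernel k v"
    using v by (auto simp: symmetric_L2_def symmetric_kernel_def measurable_cong_sets[OF sets_LP refl])
  \<comment> \<open>Dividing by k! compensates the factor in the isometry; as k! is at least 1, the
    same m also serves for the kernels.\<close>
  have "eventually (\<lambda>m. ?D m < ennreal (e / fact k)) sequentially"
    using truncate_kernel_L2[OF vm sq] e by (intro order_tendstoD(2)) auto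
  then obtain m where m: "?D m < ennreal (e / fact k)" by (auto simp: eventually_sequentially)
  have 1: "ennreal (fact k) * ?D m \<le> ennreal e"
  proof -
    have "ennreal (fact k) * ?D m \<le> ennreal (fact k) * ennreal (e / fact k)"
      using m by (intro mult_left_mono) auto
    also have "\<dots> = ennreal e" using e by (simp add: ennreal_mult[symmetric])
    finally show ?thesis .
  qed
  have "e / fact k \<le> e / 1" using e fact_ge_1[of k] by (intro divide_left_mono) auto
  then have 2: "?D m \<le> ennreal e" using m by (auto intro: order_trans[OF less_imp_le] ennreal_leI)
  show ?thesis
    using bounded_truncate_kernel[OF vm, of m] symmetric_truncate_kernel[OF sym, of m] 2
      order_trans[OF pathwise_integral_truncate_error[OF v(2) sym, of m] 1] by blast
qed

end

section \<open>Conditioning on the stopped process\<close>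

text \<open>Independence of the generated sigma-fields factorizes the joint law on rectangles, which
  determine it because both marginals are finite.\<close>

lemma (in prob_space) distr_independent_elements:
  assumes "independent_elements M A V B W"
  shows "distr M (A \<Otimes>\<^sub>M B) (\<lambda>\<omega>. (V \<omega>, W \<omega>)) = distr M A V \<Otimes>\<^sub>M distr M B W"
proof -
  have V: "V \<in> M \<rightarrow>\<^sub>M A" and W: "W \<in> M \<rightarrow>\<^sub>M B"
    and ind: "indep_set (sets (vimage_algebra (space M) V A)) (sets (vimage_algebra (space M) W B))"
    using assms by (auto simp: independent_elements_def)
  interpret DV: prob_space "distr M A V" by (rule prob_space_distr[OF V])
  interpret DW: prob_space "distr M B W" by (rule prob_space_distr[OF W])
  have VW: "(\<lambda>\<omega>. (V \<omega>, W \<omega>)) \<in> M \<rightarrow>\<^sub>M A \<Otimes>\<^sub>M B" using V W by (rule measurable_Pair)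
  show ?thesis
  proof (rule pair_measure_eqI[symmetric])
    show "sets (distr M A V \<Otimes>\<^sub>M distr M B W) = sets (distr M (A \<Otimes>\<^sub>M B) (\<lambda>\<omega>. (V \<omega>, W \<omega>)))"
      by (simp cong: sets_pair_measure_cong)
    fix S T assume "S \<in> sets (distr M A V)" "T \<in> sets (distr M B W)"
    then have S: "S \<in> sets A" and T: "T \<in> sets B" by simp_all
    have "emeasure (distr M (A \<Otimes>\<^sub>M B) (\<lambda>\<omega>. (V \<omega>, W \<omega>))) (S \<times> T)
      = emeasure M ((V -` S \<inter> space M) \<inter> (W -` T \<inter> space M))"
      using VW S T by (subst emeasure_distr) (auto intro!: arg_cong[where f="emeasure M"])
    also have "\<dots> = emeasure M (V -` S \<inter> space M) * emeasure M (W -` T \<inter> space M)"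
      using indep_setD[OF ind in_vimage_algebra[OF S] in_vimage_algebra[OF T]]
      by (simp add: emeasure_eq_measure ennreal_mult'')
    also have "\<dots> = emeasure (distr M A V) S * emeasure (distr M B W) T"
      using V W S T by (simp add: emeasure_distr)
    finally show "emeasure (distr M A V) S * emeasure (distr M B W) T
      = emeasure (distr M (A \<Otimes>\<^sub>M B) (\<lambda>\<omega>. (V \<omega>, W \<omega>))) (S \<times> T)" ..
  qed (rule DV.sigma_finite_measure_axioms, rule DW.sigma_finite_measure_axioms)
qed

text \<open>Orthogonality to the indicators of \<open>F\<close> says that H has conditional
  expectation 0, so J and J - H have the same conditional expectation; Jensen's inequality for the
  square does the rest.\<close>

lemma (in prob_space) cond_exp_square_le:
  assumes F: "subalgebra M F" and J: "integrable M J" and H: "integrable M H"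
    and sq: "integrable M (\<lambda>\<omega>. (J \<omega> - H \<omega>)\<^sup>2)"
    and orth: "\<And>A. A \<in> sets F \<Longrightarrow> (\<integral>\<omega>. H \<omega> * indicator A \<omega> \<partial>M) = 0"
  shows "(\<integral>\<^sup>+\<omega>. ennreal ((real_cond_exp M F J \<omega>)\<^sup>2) \<partial>M) \<le> (\<integral>\<^sup>+\<omega>. ennreal ((J \<omega> - H \<omega>)\<^sup>2) \<partial>M)"
proof -
  interpret finite_measure_subalgebra M F by unfold_locales (rule F)
  let ?K = "\<lambda>\<omega>. J \<omega> - H \<omega>"
  have K: "integrable M ?K" using J H by simp
  have "AE \<omega> in M. real_cond_exp M F H \<omega> = 0"
  proof (rule real_cond_exp_charact)
    fix A assume "A \<in> sets F"
    from orth[OF this] show "(\<integral>\<omega>\<in>A. H \<omega> \<partial>M) = (\<integral>\<omega>\<in>A. 0 \<partial>M)"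
      by (simp add: set_lebesgue_integral_def mult.commute)
  qed (use H in auto)
  then have eq: "AE \<omega> in M. real_cond_exp M F J \<omega> = real_cond_exp M F ?K \<omega>"
    using real_cond_exp_diff[OF J H] by eventually_elim simp
  have jensen: "AE \<omega> in M. (real_cond_exp M F ?K \<omega>)\<^sup>2 \<le> real_cond_exp M F (\<lambda>\<omega>. (?K \<omega>)\<^sup>2) \<omega>"
    by (rule real_cond_exp_jensens_inequality(2)[where I=UNIV and q="\<lambda>x. x\<^sup>2"])
       (use K sq convex_power2 in auto)
  have i: "integrable M (real_cond_exp M F (\<lambda>\<omega>. (?K \<omega>)\<^sup>2))" by (rule real_cond_exp_int(1)[OF sq])
  have nn: "AE \<omega> in M. 0 \<le> real_cond_exp M F (\<lambda>\<omega>. (?K \<omega>)\<^sup>2) \<omega>"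
    using jensen by eventually_elim (rule order_trans[OF zero_le_power2])
  have "(\<integral>\<^sup>+\<omega>. ennreal ((real_cond_exp M F J \<omega>)\<^sup>2) \<partial>M)
    \<le> (\<integral>\<^sup>+\<omega>. ennreal (real_cond_exp M F (\<lambda>\<omega>. (?K \<omega>)\<^sup>2) \<omega>) \<partial>M)"
    by (rule nn_integral_mono_AE, use eq jensen in eventually_elim) (simp add: ennreal_leI)
  also have "\<dots> = ennreal (\<integral>\<omega>. real_cond_exp M F (\<lambda>\<omega>. (?K \<omega>)\<^sup>2) \<omega> \<partial>M)"
    by (rule nn_integral_eq_integral[OF i nn])
  also have "\<dots> = ennreal (\<integral>\<omega>. (?K \<omega>)\<^sup>2 \<partial>M)" by (simp add: real_cond_exp_int(2)[OF sq])
  also have "\<dots> = (\<integral>\<^sup>+\<omega>. ennreal ((?K \<omega>)\<^sup>2) \<partial>M)"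
    by (rule nn_integral_eq_integral[OF sq, symmetric]) simp
  finally show ?thesis .
qed

text \<open>The gap between the two sides is (p - a q)^2 / a. For small a the weight of q is close
  to 1, at the price of a large weight on p, which is reserved for the approximation error.\<close>

lemma square_add_le:
  fixes p q a :: real
  assumes "0 < a" shows "(p + q)\<^sup>2 \<le> (1 + 1 / a) * p\<^sup>2 + (1 + a) * q\<^sup>2"
proof -
  have "0 \<le> (p - a * q)\<^sup>2 / a" using assms by simp
  also have "\<dots> = (1 / a) * p\<^sup>2 + a * q\<^sup>2 - 2 * p * q" using assms by (simp add: power2_eq_square field_simps)
  finally show ?thesis by (simp add: power2_eq_square algebra_simps)
qed

text \<open>The weight w is 1 for comparisons of random variables and kernels, and the hitting
  probability for comparisons of kernels in the final bound.\<close>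

lemma nn_integral_square_triangle:
  fixes f g h :: "'b \<Rightarrow> real"
  assumes a: "0 < a" and fgh: "f \<in> borel_measurable M" "g \<in> borel_measurable M" "h \<in> borel_measurable M"
    and w: "w \<in> borel_measurable M"
  shows "(\<integral>\<^sup>+x. ennreal ((f x - h x)\<^sup>2) * w x \<partial>M)
    \<le> ennreal (1 + 1 / a) * (\<integral>\<^sup>+x. ennreal ((f x - g x)\<^sup>2) * w x \<partial>M) + ennreal (1 + a) * (\<integral>\<^sup>+x. ennreal ((g x - h x)\<^sup>2) * w x \<partial>M)"
proof -
  note [measurable] = fgh w
  have "(\<integral>\<^sup>+x. ennreal ((f x - h x)\<^sup>2) * w x \<partial>M)
    \<le> (\<integral>\<^sup>+x. ennreal (1 + 1 / a) * (ennreal ((f x - g x)\<^sup>2) * w x) + ennreal (1 + a) * (ennreal ((g x - h x)\<^sup>2) * w x) \<partial>M)"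
  proof (rule nn_integral_mono)
    fix x
    have "(f x - h x)\<^sup>2 \<le> (1 + 1 / a) * (f x - g x)\<^sup>2 + (1 + a) * (g x - h x)\<^sup>2"
      using square_add_le[OF a, of "f x - g x" "g x - h x"] by simp
    then have "ennreal ((f x - h x)\<^sup>2) \<le> ennreal ((1 + 1 / a) * (f x - g x)\<^sup>2 + (1 + a) * (g x - h x)\<^sup>2)" by (rule ennreal_leI)
    also have "\<dots> = ennreal (1 + 1 / a) * ennreal ((f x - g x)\<^sup>2) + ennreal (1 + a) * ennreal ((g x - h x)\<^sup>2)"
      using a by (simp add: ennreal_plus ennreal_mult del: ennreal_plus_if)
    finally have "ennreal ((f x - h x)\<^sup>2) * w x
      \<le> (ennreal (1 + 1 / a) * ennreal ((f x - g x)\<^sup>2) + ennreal (1 + a) * ennreal ((g x - h x)\<^sup>2)) * w x"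
      by (rule mult_right_mono) simp
    then show "ennreal ((f x - h x)\<^sup>2) * w x
      \<le> ennreal (1 + 1 / a) * (ennreal ((f x - g x)\<^sup>2) * w x) + ennreal (1 + a) * (ennreal ((g x - h x)\<^sup>2) * w x)"
      by (simp only: distrib_right mult.assoc)
  qed
  also have "\<dots> = ennreal (1 + 1 / a) * (\<integral>\<^sup>+x. ennreal ((f x - g x)\<^sup>2) * w x \<partial>M) + ennreal (1 + a) * (\<integral>\<^sup>+x. ennreal ((g x - h x)\<^sup>2) * w x \<partial>M)"
    by (simp add: nn_integral_add nn_integral_cmult)
  finally show ?thesis .
qed

locale stopped_poisson = localized_borel_space X Bn + P: prob_space P
  for X :: "'a measure" and Bn and P :: "'w measure" +
  fixes L :: "'a measure" and \<eta> :: "'w \<Rightarrow> 'a measure"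
    and YY :: "'y measure" and Y :: "'w \<Rightarrow> 'y" and Z :: "'y \<Rightarrow> 'a measure \<Rightarrow> 'a set"
  assumes L_locally_finite: "locally_finite_measure X Bn L"
    and poisson: "poisson_process X Bn L P \<eta>"
    and independent: "independent_elements P (counting_algebra X Bn) \<eta> YY Y"
    and stopping: "randomized_stopping_set X Bn (distr P YY Y) Z"
begin

section \<open>The law of the process, and the randomization\<close>

lemma \<eta>: "\<eta> \<in> P \<rightarrow>\<^sub>M N" and Y: "Y \<in> P \<rightarrow>\<^sub>M YY"
  using independent by (auto simp: independent_elements_def)

lemma \<eta>_CM: "\<omega> \<in> space P \<Longrightarrow> \<eta> \<omega> \<in> CM"
  using measurable_space[OF \<eta>] by (simp add: space_N)

text \<open>Under the law of \<eta> the configuration itself is the random element, so for a fixed y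
  with \<open>Z y\<close> a stopping set the results for deterministic stopping sets apply
  verbatim.\<close>

sublocale poisson_law X Bn "distr P N \<eta>" L
proof (intro poisson_law.intro poisson_law_axioms.intro)
  show "localized_borel_space X Bn" by (rule localized_borel_space_axioms)
  show "prob_space (distr P N \<eta>)" by (rule P.prob_space_distr[OF \<eta>])
  show "locally_finite_measure X Bn L" by (rule L_locally_finite)
  show "sets (distr P N \<eta>) = sets N" by simp
  fix f :: "'a \<Rightarrow> 'a measure \<Rightarrow> ennreal"
  assume f: "(\<lambda>(x, \<mu>). f x \<mu>) \<in> borel_measurable (X \<Otimes>\<^sub>M N)"
  have sL: "sets L = sets X" and finL: "\<And>C. C \<in> local_sets X Bn \<Longrightarrow> emeasure L C < \<infinity>"
    using L_locally_finite by (auto simp: locally_finite_measure_def)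
  have "(\<lambda>w. (snd w, fst w)) \<in> N \<Otimes>\<^sub>M X \<rightarrow>\<^sub>M X \<Otimes>\<^sub>M N" by measurable
  from measurable_compose[OF this f]
  have "(\<lambda>(\<mu>, x). f x \<mu>) \<in> borel_measurable (N \<Otimes>\<^sub>M X)" by (simp add: split_beta')
  then have 1: "(\<lambda>\<mu>. \<integral>\<^sup>+x. f x \<mu> \<partial>\<mu>) \<in> borel_measurable N"
    by (rule nn_integral_measurable_N[OF measurable_ident_sets[OF refl]])
  have "(\<lambda>w. (snd w, add_point (fst w) (snd w))) \<in> N \<Otimes>\<^sub>M X \<rightarrow>\<^sub>M X \<Otimes>\<^sub>M N" by measurable
  from measurable_compose[OF this f]
  have m2: "(\<lambda>(\<mu>, x). f x (add_point \<mu> x)) \<in> borel_measurable (N \<Otimes>\<^sub>M X)" by (simp add: split_beta')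
  have 2: "(\<lambda>\<mu>. \<integral>\<^sup>+x. f x (add_point \<mu> x) \<partial>L) \<in> borel_measurable N"
    by (rule nn_integral_measurable_kernel[OF _ _ _ incseq_Bn Bn_UN _ m2])
       (use sL finL Bn_local in auto)
  show "(\<integral>\<^sup>+\<mu>. \<integral>\<^sup>+x. f x \<mu> \<partial>\<mu> \<partial>distr P N \<eta>) = (\<integral>\<^sup>+\<mu>. \<integral>\<^sup>+x. f x (add_point \<mu> x) \<partial>L \<partial>distr P N \<eta>)"
    using poisson_mecke[OF P.prob_space_axioms poisson L_locally_finite f] 1 2
    by (simp add: nn_integral_distr[OF \<eta>])
qed

abbreviation "Q \<equiv> distr P N \<eta>"
abbreviation "R \<equiv> distr P YY Y"

lemma R_prob: "prob_space R" by (rule P.prob_space_distr[OF Y])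

lemma Z_sets: "y \<in> space YY \<Longrightarrow> \<mu> \<in> CM \<Longrightarrow> Z y \<mu> \<in> sets X"
  using stopping by (simp add: randomized_stopping_set_def)

lemma AE_stopping: "AE y in R. stopping_set X Bn (Z y)"
  using stopping by (simp add: randomized_stopping_set_def)

lemma AE_stopping_P: "AE \<omega> in P. stopping_set X Bn (Z (Y \<omega>))"
  using AE_distrD[OF Y AE_stopping] .

lemma pair_measurable: "(\<lambda>\<omega>. (\<eta> \<omega>, Y \<omega>)) \<in> P \<rightarrow>\<^sub>M N \<Otimes>\<^sub>M YY"
  by (rule measurable_Pair[OF \<eta> Y])

text \<open>By independence the randomization can be integrated last, so the inner integral sees a
  fixed y.\<close>

lemma nn_integral_pair:
  assumes h: "h \<in> borel_measurable (N \<Otimes>\<^sub>M YY)"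
  shows "(\<integral>\<^sup>+\<omega>. h (\<eta> \<omega>, Y \<omega>) \<partial>P) = (\<integral>\<^sup>+y. \<integral>\<^sup>+\<mu>. h (\<mu>, y) \<partial>Q \<partial>R)"
proof -
  interpret R: prob_space R by (rule R_prob)
  interpret QR: pair_sigma_finite Q R ..
  have h': "h \<in> borel_measurable (Q \<Otimes>\<^sub>M R)"
    using h by (simp cong: measurable_cong_sets sets_pair_measure_cong)
  have "(\<integral>\<^sup>+\<omega>. h (\<eta> \<omega>, Y \<omega>) \<partial>P) = (\<integral>\<^sup>+w. h w \<partial>(Q \<Otimes>\<^sub>M R))"
    unfolding P.distr_independent_elements[OF independent, symmetric]
    using h by (subst nn_integral_distr[OF pair_measurable]) auto
  also have "\<dots> = (\<integral>\<^sup>+y. \<integral>\<^sup>+\<mu>. h (\<mu>, y) \<partial>Q \<partial>R)"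
    by (rule QR.nn_integral_snd[OF h', symmetric])
  finally show ?thesis .
qed

lemma measurable_Z: "(\<lambda>(b, x). indicator (Z (snd b) (fst b)) x :: real) \<in> borel_measurable ((N \<Otimes>\<^sub>M YY) \<Otimes>\<^sub>M X)"
proof -
  have "(\<lambda>(\<mu>, x, y). indicator (Z y \<mu>) x :: real) \<in> borel_measurable (N \<Otimes>\<^sub>M X \<Otimes>\<^sub>M R)"
    using stopping by (simp add: randomized_stopping_set_def)
  moreover have "sets (N \<Otimes>\<^sub>M X \<Otimes>\<^sub>M R) = sets (N \<Otimes>\<^sub>M X \<Otimes>\<^sub>M YY)"
    by (intro sets_pair_measure_cong) auto
  ultimately have Zm: "(\<lambda>(\<mu>, x, y). indicator (Z y \<mu>) x :: real) \<in> borel_measurable (N \<Otimes>\<^sub>M X \<Otimes>\<^sub>M YY)"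
    using measurable_cong_sets[of "N \<Otimes>\<^sub>M X \<Otimes>\<^sub>M R" "N \<Otimes>\<^sub>M X \<Otimes>\<^sub>M YY" borel borel] by auto
  have "(\<lambda>w. (fst (fst w), snd w, snd (fst w))) \<in> (N \<Otimes>\<^sub>M YY) \<Otimes>\<^sub>M X \<rightarrow>\<^sub>M N \<Otimes>\<^sub>M X \<Otimes>\<^sub>M YY" by measurable
  from measurable_compose[OF this Zm] show ?thesis by (simp add: split_beta')
qed

lemmas measurable_avoiding_Z = measurable_avoiding[OF measurable_Z]

lemma measurable_outer:
  assumes v: "v \<in> borel_measurable (XP k)"
  shows "(\<lambda>b. outer_integral k v (Z (snd b)) (fst b)) \<in> borel_measurable (N \<Otimes>\<^sub>M YY)"
  unfolding outer_integral_def
proof (rule measurable_pathwise_integral[OF measurable_fst])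
  show "(\<lambda>(b, x). v x * avoiding k (Z (snd b) (fst b)) x) \<in> borel_measurable ((N \<Otimes>\<^sub>M YY) \<Otimes>\<^sub>M XP k)"
    using measurable_avoiding_Z[of k] measurable_compose[OF measurable_snd v, of "N \<Otimes>\<^sub>M YY"]
    unfolding split_beta' by (intro borel_measurable_times) auto
qed

lemma measurable_restr: "(\<lambda>b. restr_measure (fst b) (Z (snd b) (fst b))) \<in> N \<Otimes>\<^sub>M YY \<rightarrow>\<^sub>M N"
proof (rule measurable_N)
  fix b assume "b \<in> space (N \<Otimes>\<^sub>M YY)"
  then show "restr_measure (fst b) (Z (snd b) (fst b)) \<in> CM"
    by (intro restr_measure_CM Z_sets) (auto simp: space_pair_measure space_N)
next
  fix B assume B: "B \<in> sets X"
  have "(\<lambda>w. ennreal (indicator (Z (snd (fst w)) (fst (fst w))) (snd w))) \<in> borel_measurable ((N \<Otimes>\<^sub>M YY) \<Otimes>\<^sub>M X)"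
    using measurable_Z by (intro measurable_compose[OF _ measurable_ennreal]) (simp add: split_beta')
  moreover have "(\<lambda>w. indicator B (snd w) :: ennreal) \<in> borel_measurable ((N \<Otimes>\<^sub>M YY) \<Otimes>\<^sub>M X)"
    using B by (intro measurable_compose[OF measurable_snd borel_measurable_indicator])
  ultimately have "(\<lambda>w. indicator B (snd w) * ennreal (indicator (Z (snd (fst w)) (fst (fst w))) (snd w))) \<in> borel_measurable ((N \<Otimes>\<^sub>M YY) \<Otimes>\<^sub>M X)"
    by (intro borel_measurable_times_ennreal)
  then have "(\<lambda>b. \<integral>\<^sup>+x. indicator B x * ennreal (indicator (Z (snd b) (fst b)) x) \<partial>fst b) \<in> borel_measurable (N \<Otimes>\<^sub>M YY)"
    by (intro nn_integral_measurable_N[OF measurable_fst]) (simp add: split_beta')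
  moreover have "emeasure (restr_measure (fst b) (Z (snd b) (fst b))) B = (\<integral>\<^sup>+x. indicator B x * ennreal (indicator (Z (snd b) (fst b)) x) \<partial>fst b)"
    if "b \<in> space (N \<Otimes>\<^sub>M YY)" for b
  proof -
    have \<mu>: "fst b \<in> CM" and y: "snd b \<in> space YY" using that by (auto simp: space_pair_measure space_N)
    have ZX: "Z (snd b) (fst b) \<in> sets X" by (rule Z_sets[OF y \<mu>])
    have "(\<integral>\<^sup>+x. indicator B x * ennreal (indicator (Z (snd b) (fst b)) x) \<partial>fst b) = (\<integral>\<^sup>+x. indicator (B \<inter> Z (snd b) (fst b)) x \<partial>fst b)"
      by (intro nn_integral_cong) (auto simp: indicator_def)
    also have "\<dots> = emeasure (fst b) (B \<inter> Z (snd b) (fst b))"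
      using B ZX CM_sets[OF \<mu>] by (intro nn_integral_indicator) auto
    finally show ?thesis using B ZX CM_sets[OF \<mu>] by (simp add: emeasure_restr_measure)
  qed
  ultimately show "(\<lambda>b. emeasure (restr_measure (fst b) (Z (snd b) (fst b))) B) \<in> borel_measurable (N \<Otimes>\<^sub>M YY)"
    by (subst measurable_cong)
qed

lemma measurable_stopped: "stopped_process \<eta> Y Z \<in> P \<rightarrow>\<^sub>M N"
  using measurable_compose[OF pair_measurable measurable_restr] by (simp add: stopped_process_def[abs_def])

abbreviation "G \<equiv> stopped_sigma X Bn P \<eta> Y Z"

lemma subalgebra_stopped: "subalgebra P G"
  unfolding subalgebra_def stopped_sigma_def
  using sets_image_in_sets[OF refl measurable_stopped] by simp

text \<open>The indicator of an event of the conditioning sigma-field is thus a function of the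
  stopped process, the form of test function for which orthogonality is known.\<close>

lemma sets_stopped: "A \<in> sets G \<longleftrightarrow> (\<exists>D\<in>sets N. A = stopped_process \<eta> Y Z -` D \<inter> space P)"
proof -
  have "stopped_process \<eta> Y Z \<in> space P \<rightarrow> space N" using measurable_space[OF measurable_stopped] by auto
  from sets_vimage_algebra2[OF this] show ?thesis by (auto simp: stopped_sigma_def)
qed

lemma polynomial_integrable_P:
  assumes B: "B \<in> local_sets X Bn" and H: "H \<in> borel_measurable P"
    and b: "AE \<omega> in P. \<bar>H \<omega>\<bar> \<le> b * (1 + measure (\<eta> \<omega>) B) ^ m"
  shows "integrable P H"
proof (rule Bochner_Integration.integrable_bound)
  have BX[measurable]: "B \<in> sets X" using local_sets_sets[OF B] .
  have m: "(\<lambda>\<mu>. \<bar>b\<bar> * (1 + measure \<mu> B) ^ m) \<in> borel_measurable N"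
    unfolding measure_def by measurable
  have "integrable Q (\<lambda>\<mu>. \<bar>b\<bar> * (1 + measure \<mu> B) ^ m)"
    by (rule polynomial_integrable[OF B m, where b="\<bar>b\<bar>" and m=m]) (simp add: abs_mult)
  then show "integrable P (\<lambda>\<omega>. \<bar>b\<bar> * (1 + measure (\<eta> \<omega>) B) ^ m)"
    using m by (subst (asm) integrable_distr_eq[OF \<eta>])
  show "AE \<omega> in P. norm (H \<omega>) \<le> norm (\<bar>b\<bar> * (1 + measure (\<eta> \<omega>) B) ^ m)"
    using b
  proof eventually_elim
    fix \<omega> assume "\<bar>H \<omega>\<bar> \<le> b * (1 + measure (\<eta> \<omega>) B) ^ m"
    also have "\<dots> \<le> \<bar>b\<bar> * (1 + measure (\<eta> \<omega>) B) ^ m" by (intro mult_right_mono) auto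
    finally show "norm (H \<omega>) \<le> norm (\<bar>b\<bar> * (1 + measure (\<eta> \<omega>) B) ^ m)" by (simp add: abs_mult)
  qed
qed (rule H)

definition outer :: "nat \<Rightarrow> ((nat \<Rightarrow> 'a) \<Rightarrow> real) \<Rightarrow> 'w \<Rightarrow> real" where
  "outer k v \<omega> = outer_integral k v (Z (Y \<omega>)) (\<eta> \<omega>)"

lemma measurable_outer_P: "v \<in> borel_measurable (XP k) \<Longrightarrow> outer k v \<in> borel_measurable P"
  using measurable_compose[OF pair_measurable measurable_outer] by (simp add: outer_def[abs_def])

text \<open>The bound holds almost surely because \<open>Z y\<close> is known to be a stopping set
  only for almost every y.\<close>

lemma outer_bound:
  assumes v: "bounded_kernel k B c v"
  shows "AE \<omega> in P. \<bar>outer k v \<omega>\<bar> \<le> (2 ^ k * c * (1 + measure L B) ^ k) * (1 + measure (\<eta> \<omega>) B) ^ k"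
proof -
  have "AE \<omega> in P. \<omega> \<in> space P" by simp
  with AE_stopping_P show ?thesis
    unfolding outer_def by eventually_elim (intro outer_integral_bound[OF v] \<eta>_CM)
qed

lemma integrable_outer:
  assumes v: "bounded_kernel k B c v"
  shows "integrable P (outer k v)"
  by (rule polynomial_integrable_P[OF bounded_kernelD(1)[OF v] measurable_outer_P[OF bounded_kernelD(4)[OF v]] outer_bound[OF v]])

text \<open>The indicator of \<open>A\<close> is a function of the restricted configuration.
  Integrating over the configuration first, with y fixed, gives 0 for almost every y by the
  deterministic case.\<close>

lemma outer_orthogonal:
  assumes v: "bounded_kernel k B c v" and sym: "symmetric_kernel k v" and k: "1 \<le> k" and A: "A \<in> sets G"
  shows "(\<integral>\<omega>. outer k v \<omega> * indicator A \<omega> \<partial>P) = 0"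
proof -
  note D = bounded_kernelD[OF v]
  interpret R: prob_space R by (rule R_prob)
  interpret QR: pair_sigma_finite Q R ..
  obtain E where E: "E \<in> sets N" "A = stopped_process \<eta> Y Z -` E \<inter> space P" using A sets_stopped by blast
  define h where "h b = outer_integral k v (Z (snd b)) (fst b) * indicator E (restr_measure (fst b) (Z (snd b) (fst b)))" for b
  have gm: "(\<lambda>b. indicator E (restr_measure (fst b) (Z (snd b) (fst b))) :: real) \<in> borel_measurable (N \<Otimes>\<^sub>M YY)"
    using measurable_compose[OF measurable_restr borel_measurable_indicator[OF E(1)]] .
  have hm: "h \<in> borel_measurable (N \<Otimes>\<^sub>M YY)"
    unfolding h_def using measurable_outer[OF D(4)] gm by (rule borel_measurable_times)
  have A': "A \<in> sets P" using A subalgebra_stopped by (auto simp: subalgebra_def)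
  have h_eq: "outer k v \<omega> * indicator A \<omega> = h (\<eta> \<omega>, Y \<omega>)" if "\<omega> \<in> space P" for \<omega>
    using that by (simp add: outer_def h_def E(2) stopped_process_def indicator_def)
  have "integrable P (\<lambda>\<omega>. outer k v \<omega> * indicator A \<omega>)"
    using integrable_mult_indicator[OF A' integrable_outer[OF v]] by (simp add: mult.commute)
  moreover have "integrable P (\<lambda>\<omega>. outer k v \<omega> * indicator A \<omega>) = integrable P (\<lambda>\<omega>. h (\<eta> \<omega>, Y \<omega>))"
    by (rule Bochner_Integration.integrable_cong[OF refl]) (rule h_eq)
  \<comment> \<open>Integrability is carried over to the product law of \<eta> and \<open>Y\<close>,
    where Fubini's theorem needs it.\<close>
  ultimately have hi: "integrable P (\<lambda>\<omega>. h (\<eta> \<omega>, Y \<omega>))" by (rule iffD1[rotated])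
  then have "integrable (Q \<Otimes>\<^sub>M R) h"
    unfolding P.distr_independent_elements[OF independent, symmetric]
    using hm by (subst integrable_distr_eq[OF pair_measurable])
  then have hi2: "integrable (Q \<Otimes>\<^sub>M R) (\<lambda>(\<mu>, y). h (\<mu>, y))" by simp
  have "(\<integral>\<omega>. outer k v \<omega> * indicator A \<omega> \<partial>P) = (\<integral>\<omega>. h (\<eta> \<omega>, Y \<omega>) \<partial>P)"
    by (rule Bochner_Integration.integral_cong[OF refl h_eq])
  also have "\<dots> = (\<integral>b. h b \<partial>(Q \<Otimes>\<^sub>M R))"
    unfolding P.distr_independent_elements[OF independent, symmetric]
    by (rule integral_distr[OF pair_measurable hm, symmetric])
  also have "\<dots> = (\<integral>y. \<integral>\<mu>. h (\<mu>, y) \<partial>Q \<partial>R)"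
    using QR.integral_snd[OF hi2] by simp
  also have "\<dots> = 0"
  proof (rule integral_eq_zero_AE)
    have "AE y in R. y \<in> space R" by (rule AE_space)
    with AE_stopping show "AE y in R. (\<integral>\<mu>. h (\<mu>, y) \<partial>Q) = 0"
    proof eventually_elim
      fix y assume st: "stopping_set X Bn (Z y)" and y: "y \<in> space R"
      have "(\<lambda>\<mu>. indicator E (restr_measure \<mu> (Z y \<mu>)) :: real) \<in> borel_measurable N"
        using measurable_compose[OF measurable_Pair2'[of y YY N] gm] y by simp
      from integral_outer_integral_stopped[OF v sym st k this]
      show "(\<integral>\<mu>. h (\<mu>, y) \<partial>Q) = 0" by (simp add: h_def indicator_def)
    qed
  qed
  finally show ?thesis .
qed

lemma nn_second_moment_difference:
  assumes v: "bounded_kernel k B c v" and sym: "symmetric_kernel k v" and Z': "stopping_set X Bn Z'"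
  shows "(\<integral>\<^sup>+\<mu>. ennreal ((pathwise_integral L k v \<mu> - outer_integral k v Z' \<mu>)\<^sup>2) \<partial>Q)
    = ennreal (fact k) * (\<integral>\<^sup>+\<mu>. \<integral>\<^sup>+x. ennreal ((v x)\<^sup>2 * (1 - avoiding k (Z' \<mu>) x)) \<partial>power_measure L k \<partial>Q)"
proof -
  note D = bounded_kernelD[OF v]
  interpret LPm: sigma_finite_measure "power_measure L k" by (rule sigma_finite_LP) simp
  let ?a = "\<lambda>w. 1 - avoiding k (Z' (fst w)) (snd w)"
  have am: "?a \<in> borel_measurable (N \<Otimes>\<^sub>M XP k)"
    using measurable_avoiding_stopping[OF Z', of k] by (simp add: split_beta')
  have i: "integrable (QL k) (\<lambda>w. (v (snd w))\<^sup>2 * ?a w)"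
    by (rule integrable_square_box[OF v am]) (simp add: avoiding_eq)
  have nn: "0 \<le> (v (snd w))\<^sup>2 * ?a w" for w by (simp add: avoiding_eq)
  have "(\<integral>\<^sup>+\<mu>. ennreal ((pathwise_integral L k v \<mu> - outer_integral k v Z' \<mu>)\<^sup>2) \<partial>Q)
    = ennreal (\<integral>\<mu>. (pathwise_integral L k v \<mu> - outer_integral k v Z' \<mu>)\<^sup>2 \<partial>Q)"
    by (rule nn_integral_eq_integral[OF second_moment_difference(1)[OF v sym Z']]) simp
  also have "\<dots> = ennreal (fact k * (\<integral>w. (v (snd w))\<^sup>2 * ?a w \<partial>QL k))"
    by (simp only: second_moment_difference(2)[OF v sym Z'])
  also have "\<dots> = ennreal (fact k) * ennreal (\<integral>w. (v (snd w))\<^sup>2 * ?a w \<partial>QL k)"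
    using nn by (intro ennreal_mult Bochner_Integration.integral_nonneg) auto
  also have "ennreal (\<integral>w. (v (snd w))\<^sup>2 * ?a w \<partial>QL k) = (\<integral>\<^sup>+w. ennreal ((v (snd w))\<^sup>2 * ?a w) \<partial>QL k)"
    by (rule nn_integral_eq_integral[OF i, symmetric]) (simp add: nn)
  also have "\<dots> = (\<integral>\<^sup>+\<mu>. \<integral>\<^sup>+x. ennreal ((v x)\<^sup>2 * (1 - avoiding k (Z' \<mu>) x)) \<partial>power_measure L k \<partial>Q)"
    using LPm.nn_integral_fst[of "\<lambda>w. ennreal ((v (snd w))\<^sup>2 * ?a w)" Q] borel_measurable_integrable[OF i] by simp
  finally show ?thesis .
qed

definition hit :: "nat \<Rightarrow> (nat \<Rightarrow> 'a) \<Rightarrow> ennreal" where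
  "hit k x = emeasure P {\<omega> \<in> space P. x ` {..<k} \<inter> Z (Y \<omega>) (\<eta> \<omega>) \<noteq> {}}"

lemma measurable_hit_indicator:
  "(\<lambda>(x, \<omega>). ennreal (1 - avoiding k (Z (Y \<omega>) (\<eta> \<omega>)) x)) \<in> borel_measurable (XP k \<Otimes>\<^sub>M P)"
proof -
  have "(\<lambda>w. ((\<eta> (snd w), Y (snd w)), fst w)) \<in> XP k \<Otimes>\<^sub>M P \<rightarrow>\<^sub>M (N \<Otimes>\<^sub>M YY) \<Otimes>\<^sub>M XP k"
    by (intro measurable_Pair measurable_compose[OF measurable_snd \<eta>] measurable_compose[OF measurable_snd Y] measurable_fst)
  from measurable_compose[OF this measurable_avoiding_Z[of k]]
  have [measurable]: "(\<lambda>w. avoiding k (Z (Y (snd w)) (\<eta> (snd w))) (fst w)) \<in> borel_measurable (XP k \<Otimes>\<^sub>M P)"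
    by (simp add: split_beta')
  show ?thesis unfolding split_beta' by measurable
qed

text \<open>Written as an expectation, the hitting probability is measurable in x and ready for an
  exchange of the order of integration.\<close>

lemma hit_eq:
  assumes x: "x \<in> space (XP k)"
  shows "hit k x = (\<integral>\<^sup>+\<omega>. ennreal (1 - avoiding k (Z (Y \<omega>) (\<eta> \<omega>)) x) \<partial>P)"
proof -
  let ?A = "{\<omega> \<in> space P. x ` {..<k} \<inter> Z (Y \<omega>) (\<eta> \<omega>) \<noteq> {}}"
  have ind: "ennreal (1 - avoiding k (Z (Y \<omega>) (\<eta> \<omega>)) x) = indicator ?A \<omega>" if "\<omega> \<in> space P" for \<omega>
    using that by (auto simp: avoiding_eq indicator_def)
  have m: "(\<lambda>\<omega>. ennreal (1 - avoiding k (Z (Y \<omega>) (\<eta> \<omega>)) x)) \<in> borel_measurable P"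
    using measurable_Pair2[OF measurable_hit_indicator x] by simp
  have "?A = {\<omega> \<in> space P. indicator ?A \<omega> = (1 :: ennreal)}" by (auto simp: indicator_def)
  also have "\<dots> = {\<omega> \<in> space P. ennreal (1 - avoiding k (Z (Y \<omega>) (\<eta> \<omega>)) x) = 1}"
    by (rule Collect_cong, rule conj_cong[OF refl], simp only: ind)
  also have "\<dots> \<in> sets P" using m by measurable
  finally have "?A \<in> sets P" .
  then have "hit k x = (\<integral>\<^sup>+\<omega>. indicator ?A \<omega> \<partial>P)" unfolding hit_def by simp
  also have "\<dots> = (\<integral>\<^sup>+\<omega>. ennreal (1 - avoiding k (Z (Y \<omega>) (\<eta> \<omega>)) x) \<partial>P)"
    by (intro nn_integral_cong) (simp add: ind)
  finally show ?thesis .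
qed

lemma hit_le: "hit k x \<le> 1"
  unfolding hit_def by (rule P.emeasure_le_1)

lemma measurable_hit: "hit k \<in> borel_measurable (power_measure L k)"
proof -
  have "(\<lambda>x. \<integral>\<^sup>+\<omega>. ennreal (1 - avoiding k (Z (Y \<omega>) (\<eta> \<omega>)) x) \<partial>P) \<in> borel_measurable (XP k)"
    by (rule P.borel_measurable_nn_integral[OF measurable_hit_indicator])
  then have "hit k \<in> borel_measurable (XP k)" using hit_eq by (simp cong: measurable_cong)
  then show ?thesis unfolding measurable_cong_sets[OF sets_LP refl] .
qed

text \<open>The randomization is frozen, the second moment for a fixed stopping set is inserted, and
  the two laws are joined again; exchanging expectation and integration over x then turns the
  indicator of hitting into its probability.\<close>

theorem outer_second_moment:
  assumes v: "bounded_kernel k B c v" and sym: "symmetric_kernel k v"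
  shows "(\<integral>\<^sup>+\<omega>. ennreal ((pathwise_integral L k v (\<eta> \<omega>) - outer k v \<omega>)\<^sup>2) \<partial>P)
    = ennreal (fact k) * (\<integral>\<^sup>+x. ennreal ((v x)\<^sup>2) * hit k x \<partial>power_measure L k)"
proof -
  note D = bounded_kernelD[OF v]
  interpret LPm: sigma_finite_measure "power_measure L k" by (rule sigma_finite_LP) simp
  interpret LPP: pair_sigma_finite "power_measure L k" P ..
  have pm: "(\<lambda>b. pathwise_integral L k v (fst b)) \<in> borel_measurable (N \<Otimes>\<^sub>M YY)"
    by (rule measurable_compose[OF measurable_fst measurable_pathwise[OF D(4)]])
  define h where "h b = ennreal ((pathwise_integral L k v (fst b) - outer_integral k v (Z (snd b)) (fst b))\<^sup>2)" for b
  define h2 where "h2 b = (\<integral>\<^sup>+x. ennreal ((v x)\<^sup>2 * (1 - avoiding k (Z (snd b) (fst b)) x)) \<partial>power_measure L k)" for b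
  have hm: "h \<in> borel_measurable (N \<Otimes>\<^sub>M YY)"
    unfolding h_def using pm measurable_outer[OF D(4)] by measurable
  have h2m: "h2 \<in> borel_measurable (N \<Otimes>\<^sub>M YY)"
    unfolding h2_def
  proof (rule LPm.borel_measurable_nn_integral)
    have [measurable]: "(\<lambda>w. avoiding k (Z (snd (fst w)) (fst (fst w))) (snd w)) \<in> borel_measurable ((N \<Otimes>\<^sub>M YY) \<Otimes>\<^sub>M XP k)"
      using measurable_avoiding_Z[of k] by (simp add: split_beta')
    have [measurable]: "(\<lambda>w. v (snd w)) \<in> borel_measurable ((N \<Otimes>\<^sub>M YY) \<Otimes>\<^sub>M XP k)"
      by (rule measurable_compose[OF measurable_snd D(4)])
    have "(\<lambda>(b, x). ennreal ((v x)\<^sup>2 * (1 - avoiding k (Z (snd b) (fst b)) x))) \<in> borel_measurable ((N \<Otimes>\<^sub>M YY) \<Otimes>\<^sub>M XP k)"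
      unfolding split_beta' by measurable
    then show "(\<lambda>(b, x). ennreal ((v x)\<^sup>2 * (1 - avoiding k (Z (snd b) (fst b)) x))) \<in> borel_measurable ((N \<Otimes>\<^sub>M YY) \<Otimes>\<^sub>M power_measure L k)"
      unfolding measurable_cong_sets[OF sets_pair_measure_cong[OF refl sets_LP] refl] .
  qed
  have "(\<integral>\<^sup>+\<omega>. ennreal ((pathwise_integral L k v (\<eta> \<omega>) - outer k v \<omega>)\<^sup>2) \<partial>P) = (\<integral>\<^sup>+\<omega>. h (\<eta> \<omega>, Y \<omega>) \<partial>P)"
    by (simp add: h_def outer_def)
  also have "\<dots> = (\<integral>\<^sup>+y. \<integral>\<^sup>+\<mu>. h (\<mu>, y) \<partial>Q \<partial>R)" by (rule nn_integral_pair[OF hm])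
  also have "\<dots> = (\<integral>\<^sup>+y. ennreal (fact k) * (\<integral>\<^sup>+\<mu>. h2 (\<mu>, y) \<partial>Q) \<partial>R)"
    by (rule nn_integral_cong_AE, use AE_stopping in eventually_elim)
       (simp add: h_def h2_def nn_second_moment_difference[OF v sym])
  also have "\<dots> = ennreal (fact k) * (\<integral>\<^sup>+y. \<integral>\<^sup>+\<mu>. h2 (\<mu>, y) \<partial>Q \<partial>R)"
  proof (rule nn_integral_cmult)
    have "(\<lambda>w. (snd w, fst w)) \<in> YY \<Otimes>\<^sub>M N \<rightarrow>\<^sub>M N \<Otimes>\<^sub>M YY" by measurable
    from measurable_compose[OF this h2m]
    have "(\<lambda>(y, \<mu>). h2 (\<mu>, y)) \<in> borel_measurable (YY \<Otimes>\<^sub>M Q)" 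
      by (simp add: split_beta' measurable_cong_sets[OF sets_pair_measure_cong[OF refl sets_Q] refl])
    then have "(\<lambda>y. \<integral>\<^sup>+\<mu>. h2 (\<mu>, y) \<partial>Q) \<in> borel_measurable YY" by (rule borel_measurable_nn_integral)
    then show "(\<lambda>y. \<integral>\<^sup>+\<mu>. h2 (\<mu>, y) \<partial>Q) \<in> borel_measurable R" by simp
  qed
  also have "(\<integral>\<^sup>+y. \<integral>\<^sup>+\<mu>. h2 (\<mu>, y) \<partial>Q \<partial>R) = (\<integral>\<^sup>+\<omega>. h2 (\<eta> \<omega>, Y \<omega>) \<partial>P)"
    by (rule nn_integral_pair[OF h2m, symmetric])
  also have "\<dots> = (\<integral>\<^sup>+\<omega>. \<integral>\<^sup>+x. ennreal ((v x)\<^sup>2) * ennreal (1 - avoiding k (Z (Y \<omega>) (\<eta> \<omega>)) x) \<partial>power_measure L k \<partial>P)"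
    by (simp add: h2_def ennreal_mult avoiding_le)
  also have "\<dots> = (\<integral>\<^sup>+x. \<integral>\<^sup>+\<omega>. ennreal ((v x)\<^sup>2) * ennreal (1 - avoiding k (Z (Y \<omega>) (\<eta> \<omega>)) x) \<partial>P \<partial>power_measure L k)"
  proof (rule LPP.Fubini')
    have [measurable]: "(\<lambda>w. v (fst w)) \<in> borel_measurable (XP k \<Otimes>\<^sub>M P)"
      by (rule measurable_compose[OF measurable_fst D(4)])
    have [measurable]: "(\<lambda>w. ennreal (1 - avoiding k (Z (Y (snd w)) (\<eta> (snd w))) (fst w))) \<in> borel_measurable (XP k \<Otimes>\<^sub>M P)"
      using measurable_hit_indicator[of k] by (simp add: split_beta')
    have "(\<lambda>(x, \<omega>). ennreal ((v x)\<^sup>2) * ennreal (1 - avoiding k (Z (Y \<omega>) (\<eta> \<omega>)) x)) \<in> borel_measurable (XP k \<Otimes>\<^sub>M P)"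
      unfolding split_beta' by measurable
    then show "(\<lambda>(x, \<omega>). ennreal ((v x)\<^sup>2) * ennreal (1 - avoiding k (Z (Y \<omega>) (\<eta> \<omega>)) x)) \<in> borel_measurable (power_measure L k \<Otimes>\<^sub>M P)"
      unfolding measurable_cong_sets[OF sets_pair_measure_cong[OF sets_LP refl] refl] .
  qed
  also have "\<dots> = (\<integral>\<^sup>+x. ennreal ((v x)\<^sup>2) * hit k x \<partial>power_measure L k)"
  proof (rule nn_integral_cong)
    fix x assume "x \<in> space (power_measure L k)"
    then have x: "x \<in> space (XP k)" by (simp add: space_LP)
    have "(\<lambda>\<omega>. ennreal (1 - avoiding k (Z (Y \<omega>) (\<eta> \<omega>)) x)) \<in> borel_measurable P"
      using measurable_Pair2[OF measurable_hit_indicator x] by simp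
    then show "(\<integral>\<^sup>+\<omega>. ennreal ((v x)\<^sup>2) * ennreal (1 - avoiding k (Z (Y \<omega>) (\<eta> \<omega>)) x) \<partial>P) = ennreal ((v x)\<^sup>2) * hit k x"
      by (simp add: nn_integral_cmult hit_eq[OF x])
  qed
  finally show ?thesis .
qed

text \<open>Two approximations are combined: the integrable kernels provided by
  \<open>wiener_ito\<close>, and a truncation of one of them. Both control the kernel and the
  integral at once.\<close>

lemma wiener_ito_approximation:
  assumes J: "wiener_ito L P \<eta> k u J" and u: "symmetric_L2 L k u" and e: "0 < (e :: real)"
  shows "\<exists>B c w. bounded_kernel k B c w \<and> symmetric_kernel k w \<and>
    (\<integral>\<^sup>+x. ennreal ((w x - u x)\<^sup>2) \<partial>power_measure L k) \<le> ennreal e \<and>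
    (\<integral>\<^sup>+\<omega>. ennreal ((J \<omega> - pathwise_integral L k w (\<eta> \<omega>))\<^sup>2) \<partial>P) \<le> ennreal e"
proof -
  obtain v where v: "\<And>n. symmetric_L2 L k (v n)" "\<And>n. integrable (power_measure L k) (v n)"
    and lim1: "(\<lambda>n. \<integral>\<^sup>+x. ennreal ((v n x - u x)\<^sup>2) \<partial>power_measure L k) \<longlonglongrightarrow> 0"
    and lim2: "(\<lambda>n. \<integral>\<^sup>+\<omega>. ennreal ((pathwise_integral L k (v n) (\<eta> \<omega>) - J \<omega>)\<^sup>2) \<partial>P) \<longlonglongrightarrow> 0"
    and Jm: "J \<in> borel_measurable P"
    using J unfolding wiener_ito_def by blast
  have "eventually (\<lambda>n. (\<integral>\<^sup>+x. ennreal ((v n x - u x)\<^sup>2) \<partial>power_measure L k) < ennreal (e / 4)) sequentially"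
    "eventually (\<lambda>n. (\<integral>\<^sup>+\<omega>. ennreal ((pathwise_integral L k (v n) (\<eta> \<omega>) - J \<omega>)\<^sup>2) \<partial>P) < ennreal (e / 4)) sequentially"
    using order_tendstoD(2)[OF lim1, of "ennreal (e / 4)"] order_tendstoD(2)[OF lim2, of "ennreal (e / 4)"] e by auto
  then have "eventually (\<lambda>n. (\<integral>\<^sup>+x. ennreal ((v n x - u x)\<^sup>2) \<partial>power_measure L k) < ennreal (e / 4) \<and>
      (\<integral>\<^sup>+\<omega>. ennreal ((pathwise_integral L k (v n) (\<eta> \<omega>) - J \<omega>)\<^sup>2) \<partial>P) < ennreal (e / 4)) sequentially"
    by (rule eventually_conj)
  then obtain n where n: "(\<integral>\<^sup>+x. ennreal ((v n x - u x)\<^sup>2) \<partial>power_measure L k) < ennreal (e / 4)"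
    "(\<integral>\<^sup>+\<omega>. ennreal ((pathwise_integral L k (v n) (\<eta> \<omega>) - J \<omega>)\<^sup>2) \<partial>P) < ennreal (e / 4)"
    by (auto simp: eventually_sequentially)
  obtain B c w where w: "bounded_kernel k B c w" "symmetric_kernel k w"
    "(\<integral>\<^sup>+x. ennreal ((w x - v n x)\<^sup>2) \<partial>power_measure L k) \<le> ennreal (e / 4)"
    "(\<integral>\<^sup>+\<mu>. ennreal ((pathwise_integral L k w \<mu> - pathwise_integral L k (v n) \<mu>)\<^sup>2) \<partial>Q) \<le> ennreal (e / 4)"
    using bounded_kernel_approximation[OF v(1)[of n] v(2)[of n], of "e / 4"] e by auto
  note wm = bounded_kernelD(4)[OF w(1)]
  have um: "u \<in> borel_measurable (power_measure L k)" and vm: "v n \<in> borel_measurable (power_measure L k)"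
    using u v(1)[of n] by (auto simp: symmetric_L2_def)
  have vm': "v n \<in> borel_measurable (XP k)" using vm unfolding measurable_cong_sets[OF sets_LP refl] .
  have wm': "w \<in> borel_measurable (power_measure L k)" using wm unfolding measurable_cong_sets[OF sets_LP refl] .
  have pm: "pathwise_integral L k w \<in> borel_measurable N" "pathwise_integral L k (v n) \<in> borel_measurable N"
    by (rule measurable_pathwise[OF wm], rule measurable_pathwise[OF vm'])
  \<comment> \<open>The triangle inequality with a = 1 doubles each squared error, so a budget of e
    / 4 for each of the two leaves e in total.\<close>
  have four: "ennreal (1 + 1 / 1) * ennreal (e / 4) + ennreal (1 + 1) * ennreal (e / 4) = ennreal e"
  proof -
    have "ennreal 2 * ennreal (e / 4) = ennreal (e / 2)"
      using e by (subst ennreal_mult[symmetric]) auto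
    moreover have "ennreal (e / 2) + ennreal (e / 2) = ennreal e"
      using e by (subst ennreal_plus[symmetric]) auto
    ultimately show ?thesis by simp
  qed
  have "(\<integral>\<^sup>+x. ennreal ((w x - u x)\<^sup>2) * 1 \<partial>power_measure L k)
    \<le> ennreal (1 + 1 / 1) * (\<integral>\<^sup>+x. ennreal ((w x - v n x)\<^sup>2) * 1 \<partial>power_measure L k)
      + ennreal (1 + 1) * (\<integral>\<^sup>+x. ennreal ((v n x - u x)\<^sup>2) * 1 \<partial>power_measure L k)"
    by (rule nn_integral_square_triangle[OF zero_less_one wm' vm um]) simp
  also have "\<dots> \<le> ennreal (1 + 1 / 1) * ennreal (e / 4) + ennreal (1 + 1) * ennreal (e / 4)"
    using w(3) n(1) by (intro add_mono mult_left_mono) auto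
  finally have 1: "(\<integral>\<^sup>+x. ennreal ((w x - u x)\<^sup>2) \<partial>power_measure L k) \<le> ennreal e"
    unfolding four by simp
  have pmP: "(\<lambda>\<omega>. pathwise_integral L k w (\<eta> \<omega>)) \<in> borel_measurable P" "(\<lambda>\<omega>. pathwise_integral L k (v n) (\<eta> \<omega>)) \<in> borel_measurable P"
    using measurable_compose[OF \<eta> pm(1)] measurable_compose[OF \<eta> pm(2)] by simp_all
  have "(\<integral>\<^sup>+\<omega>. ennreal ((J \<omega> - pathwise_integral L k w (\<eta> \<omega>))\<^sup>2) * 1 \<partial>P)
    \<le> ennreal (1 + 1 / 1) * (\<integral>\<^sup>+\<omega>. ennreal ((J \<omega> - pathwise_integral L k (v n) (\<eta> \<omega>))\<^sup>2) * 1 \<partial>P)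
      + ennreal (1 + 1) * (\<integral>\<^sup>+\<omega>. ennreal ((pathwise_integral L k (v n) (\<eta> \<omega>) - pathwise_integral L k w (\<eta> \<omega>))\<^sup>2) * 1 \<partial>P)"
    by (rule nn_integral_square_triangle[OF zero_less_one Jm pmP(2,1)]) simp
  also have "(\<integral>\<^sup>+\<omega>. ennreal ((pathwise_integral L k (v n) (\<eta> \<omega>) - pathwise_integral L k w (\<eta> \<omega>))\<^sup>2) * 1 \<partial>P)
    = (\<integral>\<^sup>+\<mu>. ennreal ((pathwise_integral L k w \<mu> - pathwise_integral L k (v n) \<mu>)\<^sup>2) \<partial>Q)"
    using pm by (subst nn_integral_distr[OF \<eta>]) (auto simp: power2_commute)
  also have "(\<integral>\<^sup>+\<omega>. ennreal ((J \<omega> - pathwise_integral L k (v n) (\<eta> \<omega>))\<^sup>2) * 1 \<partial>P)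
    = (\<integral>\<^sup>+\<omega>. ennreal ((pathwise_integral L k (v n) (\<eta> \<omega>) - J \<omega>)\<^sup>2) \<partial>P)"
    by (simp add: power2_commute)
  also have "ennreal (1 + 1 / 1) * (\<integral>\<^sup>+\<omega>. ennreal ((pathwise_integral L k (v n) (\<eta> \<omega>) - J \<omega>)\<^sup>2) \<partial>P)
      + ennreal (1 + 1) * (\<integral>\<^sup>+\<mu>. ennreal ((pathwise_integral L k w \<mu> - pathwise_integral L k (v n) \<mu>)\<^sup>2) \<partial>Q)
    \<le> ennreal (1 + 1 / 1) * ennreal (e / 4) + ennreal (1 + 1) * ennreal (e / 4)"
    using w(4) n(2) by (intro add_mono mult_left_mono) auto
  finally have 2: "(\<integral>\<^sup>+\<omega>. ennreal ((J \<omega> - pathwise_integral L k w (\<eta> \<omega>))\<^sup>2) \<partial>P) \<le> ennreal e"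
    unfolding four by simp
  show ?thesis using w(1,2) 1 2 by blast
qed

lemma square_integrable_integrable:
  fixes f :: "'w \<Rightarrow> real"
  assumes "f \<in> borel_measurable P" "integrable P (\<lambda>\<omega>. (f \<omega>)\<^sup>2)"
  shows "integrable P f"
proof (rule Bochner_Integration.integrable_bound)
  show "integrable P (\<lambda>\<omega>. 1 + (f \<omega>)\<^sup>2)" using assms(2) by simp
  show "AE \<omega> in P. norm (f \<omega>) \<le> norm (1 + (f \<omega>)\<^sup>2)"
  proof (rule AE_I2)
    fix \<omega>
    have "0 \<le> (\<bar>f \<omega>\<bar> - 1)\<^sup>2" by simp
    then have "2 * \<bar>f \<omega>\<bar> \<le> 1 + (f \<omega>)\<^sup>2" by (simp add: power2_diff)
    then show "norm (f \<omega>) \<le> norm (1 + (f \<omega>)\<^sup>2)" by simp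
  qed
qed (rule assms(1))

text \<open>The weighted triangle inequality is used twice: from J through the pathwise integral of
  w to H, and from w through u to 0 under the hitting weight. Errors of size a^2 are small enough
  for the large weight 1 + 1/a.\<close>

lemma cond_exp_bound:
  assumes J: "wiener_ito L P \<eta> k u J" and u: "symmetric_L2 L k u" and k: "1 \<le> k" and a: "0 < a"
  shows "(\<integral>\<^sup>+\<omega>. ennreal ((real_cond_exp P G J \<omega>)\<^sup>2) \<partial>P)
    \<le> ennreal (1 + 1 / a) * ennreal (a\<^sup>2) + ennreal (1 + a) * (ennreal (fact k) *
        (ennreal (1 + 1 / a) * ennreal (a\<^sup>2) + ennreal (1 + a) * (\<integral>\<^sup>+x. ennreal ((u x)\<^sup>2) * hit k x \<partial>power_measure L k)))"
proof -
  obtain B c w where w: "bounded_kernel k B c w" "symmetric_kernel k w"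
    and wu: "(\<integral>\<^sup>+x. ennreal ((w x - u x)\<^sup>2) \<partial>power_measure L k) \<le> ennreal (a\<^sup>2)"
    and wJ: "(\<integral>\<^sup>+\<omega>. ennreal ((J \<omega> - pathwise_integral L k w (\<eta> \<omega>))\<^sup>2) \<partial>P) \<le> ennreal (a\<^sup>2)"
    using wiener_ito_approximation[OF J u, of "a\<^sup>2"] a by auto
  note D = bounded_kernelD[OF w(1)]
  let ?F = "\<lambda>\<omega>. pathwise_integral L k w (\<eta> \<omega>)" and ?H = "outer k w"
  have Jm: "J \<in> borel_measurable P" using J by (simp add: wiener_ito_def)
  have Fm: "?F \<in> borel_measurable P" using measurable_compose[OF \<eta> measurable_pathwise[OF D(4)]] .
  have Hm: "?H \<in> borel_measurable P" by (rule measurable_outer_P[OF D(4)])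
  have um: "u \<in> borel_measurable (power_measure L k)" using u by (simp add: symmetric_L2_def)
  have wm: "w \<in> borel_measurable (power_measure L k)" using D(4) unfolding measurable_cong_sets[OF sets_LP refl] .
  \<comment> \<open>Comparison with the zero function turns the triangle inequality into a bound for
    the weighted norm of w by that of u.\<close>
  have "(\<integral>\<^sup>+x. ennreal ((w x - 0)\<^sup>2) * hit k x \<partial>power_measure L k)
    \<le> ennreal (1 + 1 / a) * (\<integral>\<^sup>+x. ennreal ((w x - u x)\<^sup>2) * hit k x \<partial>power_measure L k)
      + ennreal (1 + a) * (\<integral>\<^sup>+x. ennreal ((u x - 0)\<^sup>2) * hit k x \<partial>power_measure L k)"
    by (rule nn_integral_square_triangle[OF a wm um _ measurable_hit]) simp
  also have "(\<integral>\<^sup>+x. ennreal ((w x - u x)\<^sup>2) * hit k x \<partial>power_measure L k) \<le> ennreal (a\<^sup>2)"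
  proof -
    have "(\<integral>\<^sup>+x. ennreal ((w x - u x)\<^sup>2) * hit k x \<partial>power_measure L k) \<le> (\<integral>\<^sup>+x. ennreal ((w x - u x)\<^sup>2) * 1 \<partial>power_measure L k)"
      by (intro nn_integral_mono mult_left_mono hit_le) simp
    then show ?thesis using wu by simp
  qed
  finally have hit_w: "(\<integral>\<^sup>+x. ennreal ((w x)\<^sup>2) * hit k x \<partial>power_measure L k)
    \<le> ennreal (1 + 1 / a) * ennreal (a\<^sup>2) + ennreal (1 + a) * (\<integral>\<^sup>+x. ennreal ((u x)\<^sup>2) * hit k x \<partial>power_measure L k)"
    by (simp add: mult_left_mono add_mono)
  have "(\<integral>\<^sup>+\<omega>. ennreal ((J \<omega> - ?H \<omega>)\<^sup>2) * 1 \<partial>P)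
    \<le> ennreal (1 + 1 / a) * (\<integral>\<^sup>+\<omega>. ennreal ((J \<omega> - ?F \<omega>)\<^sup>2) * 1 \<partial>P)
      + ennreal (1 + a) * (\<integral>\<^sup>+\<omega>. ennreal ((?F \<omega> - ?H \<omega>)\<^sup>2) * 1 \<partial>P)"
    by (rule nn_integral_square_triangle[OF a Jm Fm Hm]) simp
  also have "\<dots> \<le> ennreal (1 + 1 / a) * ennreal (a\<^sup>2) + ennreal (1 + a) * (ennreal (fact k) *
        (\<integral>\<^sup>+x. ennreal ((w x)\<^sup>2) * hit k x \<partial>power_measure L k))"
    using wJ outer_second_moment[OF w] by (intro add_mono mult_left_mono) auto
  also have "\<dots> \<le> ennreal (1 + 1 / a) * ennreal (a\<^sup>2) + ennreal (1 + a) * (ennreal (fact k) *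
        (ennreal (1 + 1 / a) * ennreal (a\<^sup>2) + ennreal (1 + a) * (\<integral>\<^sup>+x. ennreal ((u x)\<^sup>2) * hit k x \<partial>power_measure L k)))"
    using hit_w by (intro add_left_mono mult_left_mono) auto
  finally have JH: "(\<integral>\<^sup>+\<omega>. ennreal ((J \<omega> - ?H \<omega>)\<^sup>2) \<partial>P) \<le> ennreal (1 + 1 / a) * ennreal (a\<^sup>2) + ennreal (1 + a) * (ennreal (fact k) *
        (ennreal (1 + 1 / a) * ennreal (a\<^sup>2) + ennreal (1 + a) * (\<integral>\<^sup>+x. ennreal ((u x)\<^sup>2) * hit k x \<partial>power_measure L k)))"
    by simp
  have "(\<integral>\<^sup>+x. ennreal ((u x)\<^sup>2) * hit k x \<partial>power_measure L k) \<le> (\<integral>\<^sup>+x. ennreal ((u x)\<^sup>2) * 1 \<partial>power_measure L k)"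
    by (intro nn_integral_mono mult_left_mono hit_le) simp
  also have "\<dots> < \<infinity>" using u by (simp add: symmetric_L2_def integrable_iff_bounded)
  finally have "(\<integral>\<^sup>+x. ennreal ((u x)\<^sup>2) * hit k x \<partial>power_measure L k) < \<infinity>" .
  then have "(\<integral>\<^sup>+\<omega>. ennreal ((J \<omega> - ?H \<omega>)\<^sup>2) \<partial>P) < \<infinity>"
    using JH by (intro le_less_trans[OF JH]) (simp add: ennreal_mult_less_top)
  then have sq: "integrable P (\<lambda>\<omega>. (J \<omega> - ?H \<omega>)\<^sup>2)"
    using Jm Hm by (intro integrableI_nonneg) auto
  \<comment> \<open>Integrability of \<open>J\<close> is derived here: its distance to the outer
    integral is square integrable, hence integrable on a probability space, and the outer integral
    is integrable.\<close>
  have "integrable P (\<lambda>\<omega>. J \<omega> - ?H \<omega>)"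
    by (rule square_integrable_integrable[OF borel_measurable_diff[OF Jm Hm] sq])
  from Bochner_Integration.integrable_add[OF this integrable_outer[OF w(1)]]
  have Ji: "integrable P J" by simp
  have "(\<integral>\<^sup>+\<omega>. ennreal ((real_cond_exp P G J \<omega>)\<^sup>2) \<partial>P) \<le> (\<integral>\<^sup>+\<omega>. ennreal ((J \<omega> - ?H \<omega>)\<^sup>2) \<partial>P)"
    by (rule P.cond_exp_square_le[OF subalgebra_stopped Ji integrable_outer[OF w(1)] sq outer_orthogonal[OF w k]])
  with JH show ?thesis by (rule order_trans[rotated])
qed

text \<open>The bound holds for every positive a; along a = 1/(n + 1) the error terms vanish and the
  factors 1 + a tend to 1, which leaves the constant k!.\<close>

theorem cond_exp_wiener_ito_le:
  assumes J: "wiener_ito L P \<eta> k u J" and u: "symmetric_L2 L k u" and k: "1 \<le> k"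
  shows "(\<integral>\<^sup>+\<omega>. ennreal ((real_cond_exp P G J \<omega>)\<^sup>2) \<partial>P)
    \<le> ennreal (fact k) * (\<integral>\<^sup>+x. ennreal ((u x)\<^sup>2) * hit k x \<partial>power_measure L k)"
proof -
  let ?R = "\<integral>\<^sup>+x. ennreal ((u x)\<^sup>2) * hit k x \<partial>power_measure L k"
  let ?lhs = "\<integral>\<^sup>+\<omega>. ennreal ((real_cond_exp P G J \<omega>)\<^sup>2) \<partial>P"
  have "?R \<le> (\<integral>\<^sup>+x. ennreal ((u x)\<^sup>2) * 1 \<partial>power_measure L k)"
    by (intro nn_integral_mono mult_left_mono hit_le) simp
  also have "\<dots> < \<infinity>" using u by (simp add: symmetric_L2_def integrable_iff_bounded)
  \<comment> \<open>The hitting probability is at most 1 and u is square integrable, so the right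
    side is a real number and the limit can be taken among reals.\<close>
  finally obtain r where r: "?R = ennreal r" "0 \<le> r" by (cases "?R") auto
  define E where "E a = (1 + 1 / a) * a\<^sup>2 + (1 + a) * (fact k * ((1 + 1 / a) * a\<^sup>2 + (1 + a) * r))" for a :: real
  have "?lhs \<le> ennreal (E a)" if a: "0 < a" for a
  proof -
    have *: "ennreal p * ennreal s + ennreal q * (ennreal c * (ennreal p * ennreal s + ennreal q * ennreal r))
      = ennreal (p * s + q * (c * (p * s + q * r)))" if "0 \<le> p" "0 \<le> q" "0 \<le> s" "0 \<le> c" for p q s c
      using that r(2) by (simp add: ennreal_mult ennreal_plus)
    have "?lhs \<le> ennreal (1 + 1 / a) * ennreal (a\<^sup>2) + ennreal (1 + a) * (ennreal (fact k) *
        (ennreal (1 + 1 / a) * ennreal (a\<^sup>2) + ennreal (1 + a) * ?R))"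
      by (rule cond_exp_bound[OF J u k a])
    also have "\<dots> = ennreal (E a)"
      unfolding r(1) E_def using a by (intro *) auto
    finally show ?thesis .
  qed
  then have "?lhs \<le> ennreal (E (inverse (real (Suc n))))" for n
    by simp
  moreover have "(\<lambda>n. ennreal (E (inverse (real (Suc n))))) \<longlonglongrightarrow> ennreal (fact k * r)"
  proof (rule tendsto_ennrealI)
    have "(\<lambda>n. (inverse (real (Suc n)) ^ 2 + inverse (real (Suc n))) + (1 + inverse (real (Suc n))) *
        (fact k * ((inverse (real (Suc n)) ^ 2 + inverse (real (Suc n))) + (1 + inverse (real (Suc n))) * r)))
      \<longlonglongrightarrow> (0 ^ 2 + 0) + (1 + 0) * (fact k * ((0 ^ 2 + 0) + (1 + 0) * r))"
      by (intro tendsto_intros LIMSEQ_inverse_real_of_nat)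
    \<comment> \<open>The product (1 + 1/a) a^2 = a^2 + a has no singularity at 0, which makes the
      limit visible.\<close>
    moreover have "E a = (a ^ 2 + a) + (1 + a) * (fact k * ((a ^ 2 + a) + (1 + a) * r))" if "a \<noteq> 0" for a
    proof -
      have "(1 + 1 / a) * a\<^sup>2 = a\<^sup>2 + a"
        using that by (simp add: power2_eq_square field_simps)
      then show ?thesis unfolding E_def by (simp only:)
    qed
    then have "(\<lambda>n. E (inverse (real (Suc n)))) = (\<lambda>n. (inverse (real (Suc n)) ^ 2 + inverse (real (Suc n)))
      + (1 + inverse (real (Suc n))) * (fact k * ((inverse (real (Suc n)) ^ 2 + inverse (real (Suc n)))
        + (1 + inverse (real (Suc n))) * r)))"
      by (intro ext) simp
    moreover have "(0 ^ 2 + 0) + (1 + 0) * (fact k * ((0 ^ 2 + 0) + (1 + 0) * r)) = fact k * r" by simp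
    ultimately show "(\<lambda>n. E (inverse (real (Suc n)))) \<longlonglongrightarrow> fact k * r" by (simp only:)
  qed
  ultimately have "?lhs \<le> ennreal (fact k * r)"
    by (intro LIMSEQ_le_const[where X="\<lambda>n. ennreal (E (inverse (real (Suc n))))"]) auto
  also have "\<dots> = ennreal (fact k) * ?R" unfolding r(1) using r(2) by (simp add: ennreal_mult)
  finally show ?thesis .
qed

end

text \<open>\<open>Iku\<close> is an arbitrary version of the multiple integral. Both sides are
  nonnegative integrals and the right one is finite, since u is square integrable and probabilities
  are at most 1; the conclusion thus includes square integrability of the conditional
  expectation.\<close>

theorem theorem5p1:
  fixes X L :: "'a measure" and Bn :: "nat \<Rightarrow> 'a set"
    and P :: "'w measure" and \<eta> :: "'w \<Rightarrow> 'a measure"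
    and YY :: "'y measure" and Y :: "'w \<Rightarrow> 'y"
    and Z :: "'y \<Rightarrow> 'a measure \<Rightarrow> 'a set" and Zs :: "nat \<Rightarrow> 'y \<Rightarrow> 'a measure \<Rightarrow> 'a set"
    and k :: nat and u :: "(nat \<Rightarrow> 'a) \<Rightarrow> real" and Iku :: "'w \<Rightarrow> real"
  assumes "borel_isomorphic_space X"
    and "localizing_sequence X Bn"
    and "locally_finite_measure X Bn L"
    and "prob_space P"
    and "poisson_process X Bn L P \<eta>"
    and "independent_elements P (counting_algebra X Bn) \<eta> YY Y"
    and "randomized_stopping_set X Bn (distr P YY Y) Z"
    and "\<And>j. randomized_stopping_set X Bn (distr P YY Y) (Zs j)"
    and "AE y in distr P YY Y. \<forall>\<mu>\<in>counting_measures X Bn.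
           (\<forall>j. Zs j y \<mu> \<subseteq> Zs (Suc j) y \<mu>) \<and> Z y \<mu> = (\<Union>j. Zs j y \<mu>)"
    and "\<And>j. AE \<omega> in P. emeasure (\<eta> \<omega>) (Zs j (Y \<omega>) (\<eta> \<omega>)) < \<infinity>"
    and "k \<ge> 1"
    and "symmetric_L2 L k u"
    and "wiener_ito L P \<eta> k u Iku"
  shows "(\<integral>\<^sup>+\<omega>. ennreal ((real_cond_exp P (stopped_sigma X Bn P \<eta> Y Z) Iku \<omega>)\<^sup>2) \<partial>P)
    \<le> ennreal (fact k) *
        (\<integral>\<^sup>+x. ennreal ((u x)\<^sup>2) *
            emeasure P {\<omega> \<in> space P. x ` {..<k} \<inter> Z (Y \<omega>) (\<eta> \<omega>) \<noteq> {}}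
          \<partial>power_measure L k)"
proof -
  interpret stopped_poisson X Bn P L \<eta> YY Y Z
    unfolding stopped_poisson_def stopped_poisson_axioms_def localized_borel_space_def
    using assms(1-7) by simp
  show ?thesis
    using cond_exp_wiener_ito_le[OF assms(13,12,11)] unfolding hit_def .
qed

end
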